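(* Let $D_0>0$. For any integer $h\ge 1$, the problem $$\min\{\lambda_h(\Omega)\ :\ \Omega\subset\mathbb R^N,\ D(\Omega)\le D_0\}$$ has a solution. The solution (that is, any minimizer) is convex and is a body of constant width. For $h=1$, the solution is the ball (of diameter $D_0$), and it is the only solution.
   Context: The competitors $\Omega$ are open sets of $\mathbb R^N$, and $D(\Omega)$ denotes the diameter of $\Omega$. $0<\lambda_1(\Omega)\le\lambda_2(\Omega)\le\dots$ is the sequence of eigenvalues of the Dirichlet-Laplacian on $\Omega$ ($-\Delta u=\lambda u$ in $\Omega$, $u=0$ on $\partial\Omega$), repeated with multiplicity. A convex set is a body of constant width if its width in the direction $\xi$ (the distance between the two parallel supporting hyperplanes orthogonal to $\xi$) is the same for every unit direction $\xi$; here this width is $D_0$.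
   Formalization: The ball minus a point is also a minimizer for h=1 (N≥2), so the claims hold up to small sets: any minimizer's closure is convex of constant width D_0 and differs from it by a null set, its interior is a minimizer; for h=1 the ball is unique up to a set of zero capacity. *)

theory Defs
  imports "HOL-Analysis.Analysis"
begin

text \<open>
  Functions on an open set \<open>\<Omega>\<close> are total functions, considered only up to equality almost
  everywhere with respect to \<open>lebesgue_on \<Omega>\<close>.
\<close>

subsection \<open>The space \<open>H\<^sup>1\<^sub>0\<close>\<close>

primrec Ck :: "nat \<Rightarrow> ('a::euclidean_space \<Rightarrow> real) \<Rightarrow> bool" where
  "Ck 0 f \<longleftrightarrow> continuous_on UNIV f"
| "Ck (Suc k) f \<longleftrightarrow>
     (\<forall>x. f differentiable (at x)) \<and>
     (\<forall>i\<in>Basis. Ck k (\<lambda>x. frechet_derivative f (at x) i))"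

definition test_functions :: "'a::euclidean_space set \<Rightarrow> ('a \<Rightarrow> real) set" where
  "test_functions \<Omega> =
     {\<phi>. (\<forall>k. Ck k \<phi>) \<and> compact (closure {x. \<phi> x \<noteq> 0}) \<and> closure {x. \<phi> x \<noteq> 0} \<subseteq> \<Omega>}"

definition grad :: "('a::euclidean_space \<Rightarrow> real) \<Rightarrow> 'a \<Rightarrow> 'a" where
  "grad f x = (\<Sum>i\<in>Basis. frechet_derivative f (at x) i *\<^sub>R i)"

definition L2_on :: "'a::euclidean_space set \<Rightarrow> ('a \<Rightarrow> 'b::euclidean_space) \<Rightarrow> bool" where
  "L2_on \<Omega> f \<longleftrightarrow>
     f \<in> borel_measurable (lebesgue_on \<Omega>) \<and> integrable (lebesgue_on \<Omega>) (\<lambda>x. (norm (f x))\<^sup>2)"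

definition weak_gradient ::
  "'a::euclidean_space set \<Rightarrow> ('a \<Rightarrow> real) \<Rightarrow> ('a \<Rightarrow> 'a) \<Rightarrow> bool" where
  "weak_gradient \<Omega> u G \<longleftrightarrow> L2_on \<Omega> u \<and> L2_on \<Omega> G \<and>
     (\<forall>\<phi>\<in>test_functions \<Omega>.
        (LINT x|lebesgue_on \<Omega>. u x *\<^sub>R grad \<phi> x) = - (LINT x|lebesgue_on \<Omega>. \<phi> x *\<^sub>R G x))"

text \<open>The closure of the test functions in the norm of \<open>H\<^sup>1(\<Omega>)\<close>.\<close>

definition H1_0 :: "'a::euclidean_space set \<Rightarrow> ('a \<Rightarrow> real) set" where
  "H1_0 \<Omega> = {u. \<exists>G. weak_gradient \<Omega> u G \<and>
     (\<exists>\<phi>. (\<forall>n::nat. \<phi> n \<in> test_functions \<Omega>) \<and>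
          (\<lambda>n. (LINT x|lebesgue_on \<Omega>. (\<phi> n x - u x)\<^sup>2) +
               (LINT x|lebesgue_on \<Omega>. (norm (grad (\<phi> n) x - G x))\<^sup>2)) \<longlonglongrightarrow> 0)}"

subsection \<open>Dirichlet eigenvalues\<close>

text \<open>
  The solutions in \<open>H\<^sup>1\<^sub>0(\<Omega>)\<close> of \<open>- \<Delta> u = t u\<close> in \<open>\<Omega>\<close>, in the sense of distributions.  The zero
  function is included, so \<open>t\<close> is an eigenvalue iff this space has positive dimension.
\<close>

definition dirichlet_eigenspace :: "'a::euclidean_space set \<Rightarrow> real \<Rightarrow> ('a \<Rightarrow> real) set" where
  "dirichlet_eigenspace \<Omega> t = {u \<in> H1_0 \<Omega>. \<exists>G. weak_gradient \<Omega> u G \<and>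
     (\<forall>\<phi>\<in>test_functions \<Omega>.
        (LINT x|lebesgue_on \<Omega>. G x \<bullet> grad \<phi> x) = t * (LINT x|lebesgue_on \<Omega>. u x * \<phi> x))}"

text \<open>
  \<open>has_dim_ae \<Omega> E m\<close>: modulo equality almost everywhere, the space \<open>E\<close> has a basis of \<open>m\<close>
  elements.  In particular \<open>E\<close> is finite-dimensional.
\<close>

definition has_dim_ae :: "'a::euclidean_space set \<Rightarrow> ('a \<Rightarrow> real) set \<Rightarrow> nat \<Rightarrow> bool" where
  "has_dim_ae \<Omega> E m \<longleftrightarrow> (\<exists>b :: nat \<Rightarrow> 'a \<Rightarrow> real.
     (\<forall>i<m. b i \<in> E) \<and>
     (\<forall>c :: nat \<Rightarrow> real.
        (AE x in lebesgue_on \<Omega>. (\<Sum>i<m. c i * b i x) = 0) \<longrightarrow> (\<forall>i<m. c i = 0)) \<and>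
     (\<forall>u\<in>E. \<exists>c :: nat \<Rightarrow> real. AE x in lebesgue_on \<Omega>. u x = (\<Sum>i<m. c i * b i x)))"

text \<open>
  \<open>lam 1 \<le> lam 2 \<le> \<dots>\<close> enumerates the eigenvalues, each repeated according to its multiplicity
  (the value \<open>lam 0\<close> is irrelevant).
\<close>

definition dirichlet_spectrum :: "'a::euclidean_space set \<Rightarrow> (nat \<Rightarrow> real) \<Rightarrow> bool" where
  "dirichlet_spectrum \<Omega> lam \<longleftrightarrow> mono_on {1..} lam \<and>
     (\<forall>t. finite {k\<in>{1..}. lam k = t} \<and>
          has_dim_ae \<Omega> (dirichlet_eigenspace \<Omega> t) (card {k\<in>{1..}. lam k = t}))"

text \<open>
  For \<open>h \<ge> 1\<close> and \<open>\<Omega>\<close> open, bounded and nonempty.  The empty set has no spectrum; the usual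
  convention for it is the value \<open>\<infinity>\<close>, so it never competes for a minimum.
\<close>

definition dirichlet_eigenvalue :: "nat \<Rightarrow> 'a::euclidean_space set \<Rightarrow> real" where
  "dirichlet_eigenvalue h \<Omega> = (THE t. \<exists>lam. dirichlet_spectrum \<Omega> lam \<and> lam h = t)"

subsection \<open>The minimization problem\<close>

text \<open>Boundedness is required explicitly since \<open>diameter\<close> is unspecified on unbounded sets.\<close>

definition admissible :: "real \<Rightarrow> 'a::euclidean_space set \<Rightarrow> bool" where
  "admissible D \<Omega> \<longleftrightarrow> open \<Omega> \<and> \<Omega> \<noteq> {} \<and> bounded \<Omega> \<and> diameter \<Omega> \<le> D"

definition minimizer :: "real \<Rightarrow> nat \<Rightarrow> 'a::euclidean_space set \<Rightarrow> bool" where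
  "minimizer D h \<Omega> \<longleftrightarrow> is_arg_min (dirichlet_eigenvalue h) (admissible D) \<Omega>"

subsection \<open>Bodies of constant width\<close>

text \<open>The supporting hyperplane of \<open>K\<close> with outer normal \<open>\<xi>\<close>.\<close>

definition supporting_hyperplane :: "'a::euclidean_space set \<Rightarrow> 'a \<Rightarrow> 'a set" where
  "supporting_hyperplane K \<xi> = {x. \<xi> \<bullet> x = (SUP y\<in>K. \<xi> \<bullet> y)}"

definition width :: "'a::euclidean_space set \<Rightarrow> 'a \<Rightarrow> real" where
  "width K \<xi> = setdist (supporting_hyperplane K \<xi>) (supporting_hyperplane K (- \<xi>))"

definition constant_width_body :: "'a::euclidean_space set \<Rightarrow> real \<Rightarrow> bool" where
  "constant_width_body K w \<longleftrightarrow> convex K \<and> compact K \<and> interior K \<noteq> {} \<and>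
     (\<forall>\<xi>. norm \<xi> = 1 \<longrightarrow> width K \<xi> = w)"

subsection \<open>Sets of zero capacity\<close>

text \<open>
  Capacity associated with the norm of \<open>H\<^sup>1\<close>.  It is defined on compact sets through smooth
  functions; other sets are tested by their compact subsets.
\<close>

definition zero_capacity :: "'a::euclidean_space set \<Rightarrow> bool" where
  "zero_capacity E \<longleftrightarrow> (\<forall>K. compact K \<and> K \<subseteq> E \<longrightarrow>
     (\<forall>\<epsilon>>0. \<exists>\<phi>\<in>test_functions UNIV. (\<forall>x\<in>K. 1 \<le> \<phi> x) \<and>
        (LINT x|lebesgue. (\<phi> x)\<^sup>2) + (LINT x|lebesgue. (norm (grad \<phi> x))\<^sup>2) < \<epsilon>))"

end

theory Submission
 imports Defs "HOL-Complex_Analysis.Great_Picard" "HOL-Library.Diagonal_Subsequence"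
begin

text \<open>Extend the functions of \<open>H\<^sup>1\<^sub>0(Om)\<close> by zero and record each together with its gradient: this gives a closed
 subspace \<open>H10 Om\<close> of one fixed Hilbert space of pairs, which increases with \<open>Om\<close>.  The eigenvalues are the successive minima of
 the Rayleigh quotient there, so they do not increase when the domain grows (\<open>eigenvalue_upper\<close>, \<open>eigen_frame\<close>).

 Translate a minimizing sequence into a fixed ball and take the spans of the first \<open>h\<close> eigenfunctions.  By Rellich's
 theorem (\<open>rellich\<close>) these converge in \<open>L\<^sup>2\<close>, and by \<open>graph_weak_limit\<close> the energy does not increase.  The
 limits live on a set of diameter at most \<open>D\<close> (\<open>limit_support_diameter\<close>), which lies in a body \<open>K\<close> of constant width \<open>D\<close>
 (\<open>constant_width_superset\<close>, by completion).  As \<open>K\<close> is convex, functions of \<open>H\<^sup>1\<close> vanishing outside \<open>K\<close> belong to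
 \<open>H10 (interior K)\<close> (\<open>H10_convex\<close>), so the min-max principle makes the interior of \<open>K\<close> a minimizer.

 Now complete an arbitrary minimizer \<open>Om\<close> to such a \<open>K\<close>.  The interior \<open>Q\<close> of \<open>K\<close> has the same eigenvalue, so some
 eigenfunction of \<open>Q\<close> comes from \<open>H10 Om\<close> and vanishes outside \<open>Om\<close> (\<open>eigenvalue_equal_eigenpair\<close>).  But a solution of
 \<open>- \<Delta> u = t u\<close> on a connected set is zero almost everywhere or nonzero almost everywhere (\<open>unique_continuation\<close>); hence \<open>Om\<close> fills
 \<open>Q\<close> up to a null set and has closure \<open>K\<close> (\<open>minimizer_structure\<close>).  Unique continuation rests on a compactly
 supported kernel that reproduces solutions (\<open>helmholtz_kernel_exists\<close>): it makes them analytic along short segments, and a zero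
 set of positive measure recurs under small translations.

 For \<open>h = 1\<close>, reflect a convex minimizer in a hyperplane halving the mass of its positive eigenfunction \<open>u\<close>.  The
 polarization of \<open>u\<close> is an eigenfunction of another minimizer; by unique continuation and \<open>first_eigenpairs_overlap\<close> it is \<open>u\<close>
 or its mirror image, and balance forces \<open>u\<close> to be symmetric (\<open>first_minimizer_symmetric\<close>).  The reflections in all coordinate
 directions compose to a point reflection, so the minimizer is contained in, and therefore is, a ball of diameter \<open>D\<close>
 (\<open>first_minimizer_ball\<close>).  A general minimizer is contained in such a ball, whose positive eigenfunction is approximated in
 \<open>H\<^sup>1\<close> by test functions vanishing on the omitted set, which thus has zero capacity (\<open>zero_capacity_complement\<close>).\<close>

abbreviation lborel_integral :: "('a::euclidean_space => 'b::{banach, second_countable_topology}) => 'b" (binder "LB " 10)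
 where "lborel_integral f \<equiv> integral\<^sup>L lborel f"

abbreviation almost_all :: "('a::euclidean_space => bool) => bool" (binder "AEL " 10)
 where "almost_all P \<equiv> almost_everywhere lborel P"

notation (input) scaleR (infixr "*R" 75)

abbreviation test where "test \<equiv> test_functions"

abbreviation evD where "evD \<equiv> dirichlet_eigenvalue"

notation (input) LIMSEQ ("((_)/ ---> (_))" [60, 60] 60)

section \<open>Smooth functions\<close>

abbreviation smooth :: "('a::euclidean_space => real) => bool" where
 "smooth f \<equiv> \<forall>k. Ck k f"

definition pd :: "('a::euclidean_space => real) => 'a => 'a => real" where
 "pd f v x = frechet_derivative f (at x) v"

lemma Ck_SucI:
 assumes "!!x. (f has_derivative f' x) (at x)" "!!i. i \<in> Basis ==> Ck k (%x. f' x i)"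
 shows "Ck (Suc k) f"
proof -
 have "frechet_derivative f (at x) = f' x" for x
  using frechet_derivative_at[OF assms(1)] by simp
 then show ?thesis using assms by (auto simp: differentiable_def)
qed

lemma Ck_Suc_derivative: "Ck (Suc k) f ==> (f has_derivative (%v. pd f v x)) (at x)"
 unfolding pd_def by (simp add: frechet_derivative_works)

lemma Ck_continuous: "Ck k f ==> continuous_on S f"
proof (cases k)
 case 0 assume "Ck k f" with 0 show ?thesis by (auto intro: continuous_on_subset)
next
 case (Suc m) assume "Ck k f"
 with Suc have "!!x. f differentiable (at x)" by simp
 then show ?thesis
  by (meson continuous_at_imp_continuous_on differentiable_imp_continuous_within)
qed

lemma Ck_SucD: "Ck (Suc k) f ==> Ck k f"
proof (induction k arbitrary: f)
 case 0 then show ?case using Ck_continuous[OF 0] by simp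
next
 case (Suc k)
 have "Ck (Suc k) (%x. frechet_derivative f (at x) i)" if "i \<in> Basis" for i
  using Suc.prems that unfolding Ck.simps(2)[of "Suc k"] by blast
 then have "Ck k (%x. frechet_derivative f (at x) i)" if "i \<in> Basis" for i
  using Suc.IH that by blast
 moreover have "\<forall>x. f differentiable at x"
  using Suc.prems unfolding Ck.simps(2)[of "Suc k"] by blast
 ultimately show ?case unfolding Ck.simps(2)[of k] by blast
qed

lemma Ck_const: "Ck k (%x. c)"
proof (induction k arbitrary: c)
 case (Suc k) then show ?case by (intro Ck_SucI[of _ "%x v. 0"]) auto
qed auto

lemma Ck_add: "Ck k f ==> Ck k g ==> Ck k (%x. f x + g x)"
proof (induction k arbitrary: f g)
 case (Suc k)
 show ?case
 proof (rule Ck_SucI)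
  show "((%x. f x + g x) has_derivative (%v. pd f v x + pd g v x)) (at x)" for x
   using Suc.prems by (intro has_derivative_add Ck_Suc_derivative)
  show "Ck k (%x. pd f i x + pd g i x)" if "i \<in> Basis" for i
   using that Suc by (auto simp: pd_def)
 qed
qed (auto intro!: continuous_intros)

lemma Ck_mult: "Ck k f ==> Ck k g ==> Ck k (%x. f x * g x)"
proof (induction k arbitrary: f g)
 case (Suc k)
 show ?case
 proof (rule Ck_SucI)
  show "((%x. f x * g x) has_derivative (%v. f x * pd g v x + pd f v x * g x)) (at x)" for x
   using Suc.prems by (intro has_derivative_mult Ck_Suc_derivative)
  show "Ck k (%x. f x * pd g i x + pd f i x * g x)" if "i \<in> Basis" for i
   using that Suc.prems Ck_SucD[OF Suc.prems(1)] Ck_SucD[OF Suc.prems(2)]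
   by (intro Ck_add Suc.IH) (auto simp: pd_def)
 qed
qed (auto intro!: continuous_intros)

lemma Ck_scale: "Ck k f ==> Ck k (%x. c * f x)"
 by (rule Ck_mult[OF Ck_const])

lemma Ck_minus: "Ck k f ==> Ck k (%x. - f x)"
 using Ck_scale[of k f "-1"] by simp

lemma Ck_diff: "Ck k f ==> Ck k g ==> Ck k (%x. f x - g x)"
 using Ck_add[OF _ Ck_minus, of k f g] by simp

lemma Ck_sum: "(!!i. i \<in> I ==> Ck k (f i)) ==> Ck k (%x. \<Sum>i\<in>I. f i x)"
 by (induction I rule: infinite_finite_induct) (auto intro: Ck_const Ck_add)

lemma Ck_linear:
 assumes "bounded_linear f"
 shows "Ck k f"
proof (cases k)
 case 0 then show ?thesis using assms by (simp add: linear_continuous_on)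
next
 case (Suc m) then show ?thesis
  using Ck_SucI[of f "%x. f" m] bounded_linear_imp_has_derivative[OF assms] by (simp add: Ck_const)
qed

lemma Ck_inner: "Ck k (%x. x \<bullet> v)"
 by (intro Ck_linear bounded_linear_inner_left)

lemma Ck_sqnorm: "Ck k (%x::'a::euclidean_space. (norm x)\<^sup>2)"
proof -
 have "(%x::'a. (norm x)\<^sup>2) = (%x. \<Sum>b\<in>Basis. (x \<bullet> b) * (x \<bullet> b))"
  by (simp add: power2_norm_eq_inner euclidean_inner[of x x for x])
 then show ?thesis by (simp only: Ck_sum Ck_mult Ck_inner)
qed

lemma pd_sum_Basis:
 assumes "f differentiable (at x)"
 shows "pd f v x = (\<Sum>i\<in>Basis. (v \<bullet> i) * pd f i x)"
proof -
 interpret linear "frechet_derivative f (at x)"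
  using linear_frechet_derivative[OF assms] .
 have "pd f v x = frechet_derivative f (at x) (\<Sum>i\<in>Basis. (v \<bullet> i) *R i)"
  by (simp add: pd_def euclidean_representation)
 then show ?thesis by (simp add: sum scaleR pd_def)
qed

lemma Ck_pd: "Ck (Suc k) f ==> Ck k (pd f v)"
proof -
 assume f: "Ck (Suc k) f"
 then have "pd f v = (%x. \<Sum>i\<in>Basis. (v \<bullet> i) * pd f i x)"
  by (intro ext pd_sum_Basis) simp
 moreover have "Ck k (%x. \<Sum>i\<in>Basis. (v \<bullet> i) * pd f i x)"
  using f by (intro Ck_sum Ck_scale) (simp add: pd_def)
 ultimately show ?thesis by simp
qed

lemma Ck_affine:
 fixes L :: "'a::euclidean_space => 'b::euclidean_space"
 assumes "bounded_linear L"
 shows "Ck k f ==> Ck k (%x. f (c + L x))"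
proof (induction k arbitrary: f)
 case 0
 have "continuous_on UNIV (%x. c + L x)"
  using assms by (intro continuous_intros linear_continuous_on)
 with 0 show ?case using continuous_on_compose2[of UNIV f UNIV] by auto
next
 case (Suc k)
 show ?case
 proof (rule Ck_SucI)
  show "((%x. f (c + L x)) has_derivative (%v. pd f (L v) (c + L x))) (at x)" for x
   by (rule has_derivative_compose[OF _ Ck_Suc_derivative[OF Suc.prems]])
     (auto intro!: derivative_eq_intros bounded_linear_imp_has_derivative assms)
  show "Ck k (%x. pd f (L i) (c + L x))" for i
   using Suc.IH[OF Ck_pd[OF Suc.prems]] .
 qed
qed

lemma Ck_compose:
 fixes f :: "real => real"
 shows "Ck k f ==> Ck k g ==> Ck k (%x. f (g x))"
proof (induction k arbitrary: f g)
 case 0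
 then show ?case using continuous_on_compose2[of UNIV f UNIV g] by auto
next
 case (Suc k)
 show ?case
 proof (rule Ck_SucI)
  have lin: "pd f r y = r * pd f 1 y" for r y
   using pd_sum_Basis[of f y r] Suc.prems by simp
  show "((%x. f (g x)) has_derivative (%v. pd g v x * pd f 1 (g x))) (at x)" for x
   using has_derivative_compose[OF Ck_Suc_derivative[OF Suc.prems(2)] Ck_Suc_derivative[OF Suc.prems(1)]]
   unfolding lin[of "pd g _ _"] .
  show "Ck k (%x. pd g i x * pd f 1 (g x))" if "i \<in> Basis" for i
   by (intro Ck_mult Suc.IH[of "pd f 1"] Ck_pd Suc.prems Ck_SucD[OF Suc.prems(2)])
 qed
qed

lemma Ck_local:
 "(!!x. \<exists>U g. open U & x \<in> U & Ck k g & (\<forall>y\<in>U. f y = g y)) ==> Ck k f"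
proof (induction k arbitrary: f)
 case 0
 have "isCont f x" for x
 proof -
  obtain U g where U: "open U" "x \<in> U" "Ck 0 g" "\<forall>y\<in>U. f y = g y" using 0 by blast
  then have "isCont g x" by (simp add: continuous_on_eq_continuous_at)
  then show ?thesis
   using U by (subst isCont_cong[of _ g]) (auto simp: eventually_nhds)
 qed
 then show ?case by (simp add: continuous_on_eq_continuous_at)
next
 case (Suc k)
 have d: "f differentiable at x & (\<exists>U g. open U & x \<in> U & Ck (Suc k) g & (\<forall>y\<in>U. pd f i y = pd g i y))" for x i
 proof -
  obtain U g where U: "open U" "x \<in> U" "Ck (Suc k) g" "\<forall>y\<in>U. f y = g y" using Suc.prems by blast
  have *: "(f has_derivative (%v. pd g v y)) (at y)" if "y \<in> U" for y
   using has_derivative_transform_within_open[OF Ck_Suc_derivative[OF U(3)] U(1) that] U(4) by metis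
  then have "pd f i y = pd g i y" if "y \<in> U" for y
   using frechet_derivative_at[OF *[OF that]] by (simp add: pd_def)
  then show ?thesis using * U by (auto simp: differentiable_def)
 qed
 have "Ck k (pd f i)" for i
 proof (rule Suc.IH)
  show "\<exists>U g. open U & x \<in> U & Ck k g & (\<forall>y\<in>U. pd f i y = g y)" for x
   using d[of x i] Ck_pd by blast
 qed
 then show ?case using d by (simp add: pd_def[abs_def])
qed

lemma smooth_DERIV_I:
 assumes "!!x. (f has_real_derivative f' x) (at x)" "Ck k f'"
 shows "Ck (Suc k) f"
 using assms by (intro Ck_SucI[of f "%x v. f' x * v"]) (auto simp: has_field_derivative_def)

lemma Ck_exp: "Ck k (%x::real. exp (c * x))"
proof (induction k)
 case 0 show ?case by (auto intro!: continuous_intros)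
next
 case (Suc k)
 show ?case
  by (rule smooth_DERIV_I[of _ "%x. c * exp (c * x)"])
    (auto intro!: derivative_eq_intros Ck_scale[of k "%x. exp (c * x)"] Suc)
qed

subsection \<open>The flat function\<close>

text \<open>For a polynomial \<open>q\<close> the function \<open>q(1/s) exp(-1/s)\<close>, extended by 0, has a derivative of the same form, so
 all of them are smooth.\<close>

definition flat :: "real poly => real => real" where
 "flat q s = (if s > 0 then poly q (1 / s) * exp (- 1 / s) else 0)"

lemma poly_exp_tendsto: "((%s. poly q (1 / s) * exp (- 1 / s)) \<longlongrightarrow> 0) (at_right (0::real))"
proof -
 have 1: "((%x. poly q x / exp x) \<longlongrightarrow> 0) at_top"
 proof (induction q)
  case (pCons a q)
  have "((%x. (\<Sum>i\<le>degree (pCons a q). coeff (pCons a q) i * (x ^ i / exp x))) \<longlongrightarrow> (\<Sum>i\<le>degree (pCons a q). coeff (pCons a q) i * 0)) at_top"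
   by (intro tendsto_intros tendsto_power_div_exp_0)
  then show ?case
   by (simp add: poly_altdef sum_divide_distrib divide_simps mult.assoc)
 qed simp
 have 2: "LIM s at_right (0::real). 1 / s :> at_top"
  using filterlim_inverse_at_top_right by (simp add: inverse_eq_divide)
 have "((%s. poly q (1 / s) / exp (1 / s)) \<longlongrightarrow> 0) (at_right (0::real))"
  by (rule filterlim_compose[OF 1 2])
 then show ?thesis by (simp add: exp_minus divide_inverse)
qed

lemma flat_deriv:
 "(flat q has_real_derivative flat ([:0, 0, 1:] * (q - pderiv q)) s) (at s)"
proof -
 consider "s > 0" | "s < 0" | "s = 0" by linarith
 then show ?thesis
 proof cases
  case 1
  have "((%s. poly q (1 / s) * exp (- 1 / s)) has_real_derivative
    flat ([:0, 0, 1:] * (q - pderiv q)) s) (at s)"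
   using 1 by (auto intro!: derivative_eq_intros DERIV_chain2[of "poly q"] poly_DERIV
     simp: flat_def field_simps power2_eq_square)
  then show ?thesis
   by (rule has_field_derivative_transform_within_open[of _ _ _ "{0<..}"]) (use 1 in \<open>auto simp: flat_def\<close>)
 next
  case 2
  have "((%s. 0) has_real_derivative flat ([:0, 0, 1:] * (q - pderiv q)) s) (at s)"
   using 2 by (simp add: flat_def)
  then show ?thesis
   by (rule has_field_derivative_transform_within_open[of _ _ _ "{..<0}"]) (use 2 in \<open>auto simp: flat_def\<close>)
 next
  case 3
  have "((%y. flat q y / y) \<longlongrightarrow> 0) (at_right 0)"
   using poly_exp_tendsto[of "[:0, 1:] * q"]
   by (rule tendsto_cong[THEN iffD1, rotated])
     (auto simp: flat_def eventually_at_right_field intro!: exI[of _ 1])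
  moreover have "((%y. flat q y / y) \<longlongrightarrow> 0) (at_left 0)"
   by (rule tendsto_eventually) (auto simp: flat_def eventually_at_left_field intro!: exI[of _ "-1"])
  ultimately have "((%y. flat q y / y) \<longlongrightarrow> 0) (at 0)"
   by (simp add: filterlim_split_at_real)
  then show ?thesis using 3 by (simp add: has_field_derivative_iff flat_def)
 qed
qed

lemma smooth_flat: "Ck k (flat q)"
proof (induction k arbitrary: q)
 case 0
 have "isCont (flat q) x" for x using DERIV_isCont flat_deriv by blast
 then show ?case by (simp add: continuous_on_eq_continuous_at)
next
 case (Suc k) show ?case by (rule smooth_DERIV_I[OF flat_deriv Suc])
qed

section \<open>Test functions\<close>

lemma test_smooth: "phi \<in> test Om ==> Ck k phi"
 by (simp add: test_functions_def)

lemma test_I: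
 assumes "smooth phi" "compact S" "S \<subseteq> Om" "!!x. x ~: S ==> phi x = 0"
 shows "phi \<in> test Om"
proof -
 have "closure {x. phi x ~= 0} \<subseteq> S"
  using assms by (intro closure_minimal) (auto simp: compact_imp_closed)
 then show ?thesis
  using assms unfolding test_functions_def
  by (auto simp: compact_eq_bounded_closed intro: bounded_subset)
qed

lemma test_E:
 assumes "phi \<in> test Om"
 obtains S where "compact S" "S \<subseteq> Om" "!!x. x ~: S ==> phi x = 0"
 using assms that[of "closure {x. phi x ~= 0}"] closure_subset[of "{x. phi x ~= 0}"]
 unfolding test_functions_def by blast

lemma test_mono: "Om \<subseteq> Om' ==> phi \<in> test Om ==> phi \<in> test Om'"
 by (auto simp: test_functions_def)

lemma test_zero: "(%x. 0) \<in> test Om"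
 by (rule test_I[of _ "{}"]) (auto intro: Ck_const)

lemma test_mult: "phi \<in> test Om ==> smooth f ==> (%x. f x * phi x) \<in> test Om"
proof -
 assume *: "phi \<in> test Om" "smooth f"
 obtain S where "compact S" "S \<subseteq> Om" "!!x. x ~: S ==> phi x = 0" using test_E[OF *(1)] by metis
 then show ?thesis
  using * test_smooth[OF *(1)] by (intro test_I[of _ S]) (auto intro!: Ck_mult)
qed

lemma test_scale: "phi \<in> test Om ==> (%x. c * phi x) \<in> test Om"
 by (rule test_mult) (auto intro: Ck_const)

lemma test_add:
 assumes "phi \<in> test Om" "psi \<in> test Om"
 shows "(%x. phi x + psi x) \<in> test Om"
proof -
 obtain S T where "compact S" "S \<subseteq> Om" "!!x. x ~: S ==> phi x = 0"
  "compact T" "T \<subseteq> Om" "!!x. x ~: T ==> psi x = 0" using assms test_E by metis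
 then show ?thesis
  using assms by (intro test_I[of _ "S \<union> T"]) (auto intro!: Ck_add intro: test_smooth)
qed

lemma test_diff:
 assumes "phi \<in> test Om" "psi \<in> test Om"
 shows "(%x. phi x - psi x) \<in> test Om"
 using test_add[OF assms(1) test_scale[OF assms(2), of "-1"]] by simp

lemma test_deriv: "phi \<in> test Om ==> (phi has_derivative (%v. pd phi v x)) (at x)"
 by (metis Ck_Suc_derivative test_smooth)

lemma pd_zero_off:
 assumes "closed S" "!!x. x ~: S ==> phi x = 0" "x ~: S"
 shows "pd phi v x = 0"
proof -
 have "(phi has_derivative (%v. 0)) (at x)"
  by (rule has_derivative_transform_within_open[of "%x. 0" _ _ _ "- S"]) (use assms in auto)
 then show ?thesis unfolding pd_def using frechet_derivative_at by metis
qed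

lemma test_pd: "phi \<in> test Om ==> pd phi v \<in> test Om"
proof -
 assume *: "phi \<in> test Om"
 obtain S where "compact S" "S \<subseteq> Om" "!!x. x ~: S ==> phi x = 0" using test_E[OF *] by metis
 then show ?thesis
  by (intro test_I[of _ S] allI Ck_pd test_smooth[OF *] pd_zero_off[of S]) (auto intro: compact_imp_closed)
qed

lemma pd_linear: "phi \<in> test Om ==> linear (%v. pd phi v x)"
 using test_deriv has_derivative_linear by blast

lemma grad_inner: "f differentiable (at x) ==> grad f x \<bullet> v = pd f v x"
 by (subst pd_sum_Basis) (auto simp: grad_def pd_def inner_sum_right inner_commute mult.commute intro!: sum.cong)

lemma grad_eqI:
 assumes "(f has_derivative (%v. g \<bullet> v)) (at x)"
 shows "grad f x = g"
proof -
 have "frechet_derivative f (at x) = (%v. g \<bullet> v)"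
  using frechet_derivative_at[OF assms] by simp
 then show ?thesis by (simp add: grad_def euclidean_representation)
qed

lemma test_grad_inner: "phi \<in> test Om ==> grad phi x \<bullet> v = pd phi v x"
 by (rule grad_inner) (metis test_deriv differentiable_def)

lemma test_has_grad: "phi \<in> test Om ==> (phi has_derivative (%v. grad phi x \<bullet> v)) (at x)"
 by (simp add: test_grad_inner test_deriv)

lemma grad_zero_off:
 assumes "closed S" "!!x. x ~: S ==> phi x = 0" "x ~: S"
 shows "grad phi x = 0"
 using pd_zero_off[OF assms] by (simp add: grad_def pd_def)

lemma continuous_grad: "smooth phi ==> continuous_on S (grad phi)"
 unfolding grad_def[abs_def] pd_def[symmetric]
 by (intro continuous_intros Ck_continuous[of 0] Ck_pd) blast

lemma grad_test_continuous: "phi \<in> test Om ==> continuous_on S (grad phi)"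
 using continuous_grad test_smooth by blast

lemma grad_add:
 assumes "phi \<in> test Om" "psi \<in> test Om"
 shows "grad (%x. phi x + psi x) x = grad phi x + grad psi x"
 by (rule grad_eqI) (auto intro!: derivative_eq_intros test_has_grad assms simp: inner_left_distrib)

lemma grad_scale:
 assumes "phi \<in> test Om"
 shows "grad (%x. c * phi x) x = c *R grad phi x"
 by (rule grad_eqI) (auto intro!: derivative_eq_intros test_has_grad assms)

lemma test_affine:
 fixes L L' :: "'a::euclidean_space => 'a"
 assumes phi: "phi \<in> test Om"
  and L: "linear L" "linear L'" "!!x. L' (L x) = x" "!!x. L (L' x) = x" "!!u v. L u \<bullet> v = u \<bullet> L v"
 shows "(%x. phi (a + L x)) \<in> test ((%x. a + L x) -` Om)"
  and "grad (%x. phi (a + L x)) x = L (grad phi (a + L x))"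
proof -
 obtain S where S: "compact S" "S \<subseteq> Om" "!!x. x ~: S ==> phi x = 0" using phi test_E by blast
 have bl: "bounded_linear L" "bounded_linear L'" using L by (simp_all add: linear_conv_bounded_linear)
 show "(%x. phi (a + L x)) \<in> test ((%x. a + L x) -` Om)"
 proof (rule test_I[of _ "(%y. L' (y - a)) ` S"])
  show "compact ((%y. L' (y - a)) ` S)"
   using S by (intro compact_continuous_image continuous_intros linear_continuous_on_compose[OF _ L(2)])
  show "phi (a + L x) = 0" if "x ~: (%y. L' (y - a)) ` S" for x
   using S(3) that L(3) by (metis (no_types, lifting) add_diff_cancel_left' image_eqI)
 qed (use S L(4) in \<open>auto intro!: Ck_affine test_smooth[OF phi] bl\<close>)
 show "grad (%x. phi (a + L x)) x = L (grad phi (a + L x))"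
  unfolding L(5)
  by (rule grad_eqI, unfold L(5), rule has_derivative_compose[OF _ test_has_grad[OF phi]])
    (auto intro!: derivative_eq_intros bounded_linear_imp_has_derivative bl)
qed

definition bump :: "'a::euclidean_space => real" where
 "bump y = flat [:0, 0, 1:] (1 - (norm y)\<^sup>2)"

lemma smooth_bump: "Ck k bump"
 unfolding bump_def[abs_def] by (intro Ck_compose[OF smooth_flat] Ck_diff Ck_const Ck_sqnorm)

lemma bump_pos: "norm y < 1 ==> bump y > 0"
 by (simp add: bump_def flat_def power_less_one_iff)

lemma bump_nonneg: "bump y >= 0"
 by (simp add: bump_def flat_def)

lemma bump_zero: "norm y >= 1 ==> bump y = 0"
 using power_mono[of 1 "norm y" 2] by (simp add: bump_def flat_def not_less)

section \<open>The Hilbert space of square integrable functions\<close>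

definition sqint :: "('a::euclidean_space => 'b::euclidean_space) => bool" where
 "sqint f \<longleftrightarrow> f \<in> borel_measurable borel & integrable lborel (%x. (norm (f x))\<^sup>2)"

lemma sqint_meas[measurable_dest]: "sqint f ==> f \<in> borel_measurable borel"
 by (simp add: sqint_def)

lemma sqint_inner:
 assumes "sqint f" "sqint g"
 shows "integrable lborel (%x. f x \<bullet> g x)"
proof (rule Bochner_Integration.integrable_bound)
 show "integrable lborel (%x. (norm (f x))\<^sup>2 + (norm (g x))^2)"
  using assms by (auto simp: sqint_def)
 have "\<bar>u \<bullet> v\<bar> <= (norm u)^2 + (norm v)^2" for u v :: 'b
 proof -
  have "\<bar>u \<bullet> v\<bar> <= norm u * norm v" by (rule Cauchy_Schwarz_ineq2)
  moreover have "2 * (norm u * norm v) <= (norm u)^2 + (norm v)^2"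
   using sum_squares_bound[of "norm u" "norm v"] by simp
  moreover have "norm u * norm v >= 0" by simp
  ultimately show ?thesis by linarith
 qed
 then show "AEL x. norm (f x \<bullet> g x) <= norm ((norm (f x))^2 + (norm (g x))^2)"
  by (auto simp: abs_of_nonneg)
qed (use assms in \<open>auto simp: sqint_def\<close>)

lemma sqint_add:
 assumes "sqint f" "sqint g"
 shows "sqint (%x. f x + g x)"
proof -
 have "integrable lborel (%x. (norm (f x))\<^sup>2 + 2 * (f x \<bullet> g x) + (norm (g x))^2)"
  using assms sqint_inner[OF assms] by (intro Bochner_Integration.integrable_add integrable_mult_right) (auto simp: sqint_def)
 moreover have "(norm (u + v))^2 = (norm u)^2 + 2 * (u \<bullet> v) + (norm v)^2" for u v :: 'b
  by (simp add: power2_norm_eq_inner inner_add inner_commute)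
 ultimately show ?thesis using assms by (auto simp: sqint_def)
qed

lemma sqint_scale: "sqint f ==> sqint (%x. c *R f x)"
 by (auto simp: sqint_def power_mult_distrib)

lemma sqint_uminus: "sqint f ==> sqint (%x. - f x)"
 by (auto simp: sqint_def)

lemma sqint_diff: "sqint f ==> sqint g ==> sqint (%x. f x - g x)"
 using sqint_add[OF _ sqint_uminus, of f g] by simp

lemma sqint_zero: "sqint (%x. 0)"
 by (simp add: sqint_def)

lemma sqint_bound:
 assumes "sqint f" "g \<in> borel_measurable borel" "!!x. norm (g x) <= norm (f x)"
 shows "sqint g"
proof -
 have "integrable lborel (%x. (norm (g x))\<^sup>2)"
  by (rule Bochner_Integration.integrable_bound[of _ "%x. (norm (f x))\<^sup>2"])
    (use assms in \<open>auto simp: sqint_def intro!: power_mono\<close>)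
 then show ?thesis using assms by (simp add: sqint_def)
qed

text \<open>Restricting the relation to square integrable functions lets its quotient be the whole space \<open>L\<^sup>2\<close>.\<close>

definition eq_ae :: "('a::euclidean_space => 'b::euclidean_space) => ('a => 'b) => bool" where
 "eq_ae f g \<longleftrightarrow> sqint f & sqint g & (AEL x. f x = g x)"

quotient_type (overloaded) ('a, 'b) L2 = "'a::euclidean_space => 'b::euclidean_space" / partial: eq_ae
proof (rule part_equivpI)
 show "\<exists>f :: 'a => 'b. eq_ae f f" by (rule exI[of _ "%x. 0"]) (simp add: eq_ae_def sqint_zero)
 show "symp (eq_ae :: ('a => 'b) => _)"
  by (auto simp: symp_def eq_ae_def elim: AE_mp)
 show "transp (eq_ae :: ('a => 'b) => _)"
  unfolding transp_def eq_ae_def by (auto elim!: AE_mp)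
qed

abbreviation "toL2 \<equiv> abs_L2"
abbreviation "L2f \<equiv> rep_L2"

lemma sqint_L2f: "sqint (L2f U)"
 using Quotient3_rel_rep[OF Quotient3_L2, of U U] by (simp add: eq_ae_def)

lemma L2f_meas[measurable]: "L2f U \<in> borel_measurable borel"
 using sqint_L2f sqint_meas by blast

lemma toL2_L2f[simp]: "toL2 (L2f U) = U"
 by (rule Quotient3_abs_rep[OF Quotient3_L2])

lemma L2f_toL2: "sqint f ==> AEL x. L2f (toL2 f) x = f x"
 using rep_abs_rsp_left[OF Quotient3_L2, of f f] by (simp add: eq_ae_def)

lemma toL2_eq_iff: "sqint f ==> sqint g ==> toL2 f = toL2 g \<longleftrightarrow> (AEL x. f x = g x)"
 using Quotient3_rel[OF Quotient3_L2, of f g] by (simp add: eq_ae_def)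

lemma toL2_eqI: "sqint f ==> sqint g ==> (AEL x. f x = g x) ==> toL2 f = toL2 g"
 by (simp add: toL2_eq_iff)

lemma L2_eq_iff: "U = V \<longleftrightarrow> (AEL x. L2f U x = L2f V x)"
 using toL2_eq_iff[OF sqint_L2f sqint_L2f, of U V] by simp

instantiation L2 :: (euclidean_space, euclidean_space) real_vector
begin

lift_definition zero_L2 :: "('a, 'b) L2" is "%x. 0"
 by (simp add: eq_ae_def sqint_zero)

lift_definition plus_L2 :: "('a, 'b) L2 => ('a, 'b) L2 => ('a, 'b) L2" is "%f g x. f x + g x"
 by (auto simp: eq_ae_def sqint_add)

lift_definition minus_L2 :: "('a, 'b) L2 => ('a, 'b) L2 => ('a, 'b) L2" is "%f g x. f x - g x"
 by (auto simp: eq_ae_def sqint_diff)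

lift_definition uminus_L2 :: "('a, 'b) L2 => ('a, 'b) L2" is "%f x. - f x"
 by (auto simp: eq_ae_def sqint_uminus)

lift_definition scaleR_L2 :: "real => ('a, 'b) L2 => ('a, 'b) L2" is "%c f x. c *R f x"
 by (auto simp: eq_ae_def sqint_scale)

instance
proof
 fix U V Z :: "('a, 'b) L2" and a b :: real
 show "U + V + Z = U + (V + Z)" by transfer (simp add: eq_ae_def sqint_add add.assoc)
 show "U + V = V + U" by transfer (simp add: eq_ae_def sqint_add add.commute)
 show "0 + U = U" by transfer (simp add: eq_ae_def)
 show "- U + U = 0" by transfer (simp add: eq_ae_def sqint_zero)
 show "U - V = U + - V" by transfer (simp add: eq_ae_def sqint_diff)
 show "a *R (U + V) = a *R U + a *R V"
  by transfer (simp add: eq_ae_def sqint_add sqint_scale scaleR_add_right)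
 show "(a + b) *R U = a *R U + b *R U"
  by transfer (simp add: eq_ae_def sqint_add sqint_scale scaleR_add_left)
 show "a *R b *R U = (a * b) *R U"
  by transfer (simp add: eq_ae_def sqint_scale)
 show "1 *R U = U" by transfer (simp add: eq_ae_def)
qed

end

instantiation L2 :: (euclidean_space, euclidean_space) real_inner
begin

lift_definition inner_L2 :: "('a, 'b) L2 => ('a, 'b) L2 => real" is "%f g. \<integral>x. f x \<bullet> g x \<partial>lborel"
proof -
 fix f f' g g' :: "'a => 'b"
 assume *: "eq_ae f f'" "eq_ae g g'"
 then have "AEL x. f x = f' x" "AEL x. g x = g' x" by (simp_all add: eq_ae_def)
 then have "AEL x. f x \<bullet> g x = f' x \<bullet> g' x" by eventually_elim simp
 then show "(LB x. f x \<bullet> g x) = (LB x. f' x \<bullet> g' x)"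
  using * by (intro integral_cong_AE) (auto simp: eq_ae_def sqint_def)
qed

definition "norm_L2 (U :: ('a, 'b) L2) = sqrt (U \<bullet> U)"
definition "dist_L2 (U :: ('a, 'b) L2) V = norm (U - V)"
definition "sgn_L2 (U :: ('a, 'b) L2) = U /\<^sub>R norm U"
definition "uniformity_L2 = (INF e\<in>{0<..}. principal {(x :: ('a, 'b) L2, y). dist x y < e})"
definition "open_L2 (U :: ('a, 'b) L2 set) \<longleftrightarrow> (\<forall>x\<in>U. eventually (%(x', y). x' = x --> y \<in> U) uniformity)"

instance
proof
 fix U V Z :: "('a, 'b) L2" and a b :: real
 show "dist U V = norm (U - V)" by (simp add: dist_L2_def)
 show "sgn U = U /\<^sub>R norm U" by (simp add: sgn_L2_def)
 show "uniformity = (INF e\<in>{0<..}. principal {(x :: ('a, 'b) L2, y). dist x y < e})"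
  by (simp add: uniformity_L2_def)
 show "open S \<longleftrightarrow> (\<forall>x\<in>S. eventually (%(x', y). x' = x --> y \<in> S) uniformity)" for S :: "('a, 'b) L2 set"
  by (simp add: open_L2_def)
 show "U \<bullet> V = V \<bullet> U" by transfer (simp add: inner_commute)
 show "(U + V) \<bullet> Z = U \<bullet> Z + V \<bullet> Z"
  by transfer (simp add: eq_ae_def inner_add_left Bochner_Integration.integral_add sqint_inner)
 show "(a *R U) \<bullet> V = a * (U \<bullet> V)" by transfer simp
 show "0 <= U \<bullet> U" by transfer simp
 show "norm U = sqrt (U \<bullet> U)" by (simp add: norm_L2_def)
 show "U \<bullet> U = 0 \<longleftrightarrow> U = 0"
 proof transfer
  fix f :: "'a => 'b" assume "eq_ae f f"
  then have f: "sqint f" by (simp add: eq_ae_def)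
  have "(LB x. f x \<bullet> f x) = 0 \<longleftrightarrow> (AEL x. f x \<bullet> f x = 0)"
   by (rule integral_nonneg_eq_0_iff_AE[OF sqint_inner[OF f f]]) simp
  then show "(LB x. f x \<bullet> f x) = 0 \<longleftrightarrow> eq_ae f (%x. 0)"
   using f by (simp add: eq_ae_def sqint_zero)
 qed
qed

end

lemma inner_toL2: "sqint f ==> sqint g ==> toL2 f \<bullet> toL2 g = (LB x. f x \<bullet> g x)"
 by (rule inner_L2.abs_eq) (simp_all add: eq_ae_def)

lemma norm_toL2: "sqint f ==> (norm (toL2 f))^2 = (LB x. (norm (f x))\<^sup>2)"
 by (simp add: power2_norm_eq_inner inner_toL2)

lemma inner_L2f: "U \<bullet> V = (LB x. L2f U x \<bullet> L2f V x)"
 using inner_toL2[OF sqint_L2f sqint_L2f, of U V] by simp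

lemma norm_L2f: "(norm U)^2 = (LB x. (norm (L2f U x))\<^sup>2)"
 using norm_toL2[OF sqint_L2f, of U] by simp

lemma toL2_add: "sqint f ==> sqint g ==> toL2 f + toL2 g = toL2 (%x. f x + g x)"
 by (rule plus_L2.abs_eq) (simp_all add: eq_ae_def)

lemma toL2_diff: "sqint f ==> sqint g ==> toL2 f - toL2 g = toL2 (%x. f x - g x)"
 by (rule minus_L2.abs_eq) (simp_all add: eq_ae_def)

lemma toL2_scale: "sqint f ==> c *R toL2 f = toL2 (%x. c *R f x)"
 by (rule scaleR_L2.abs_eq) (simp_all add: eq_ae_def)

lemma toL2_zero: "0 = toL2 (%x. 0)"
 by (rule zero_L2.abs_eq)

lemma L2f_zero: "AEL x. L2f 0 x = 0"
 unfolding toL2_zero by (rule L2f_toL2[OF sqint_zero])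

lemma L2f_add: "AEL x. L2f (U + V) x = L2f U x + L2f V x"
 using L2f_toL2[OF sqint_add[OF sqint_L2f sqint_L2f], of U V]
 by (simp add: toL2_add[OF sqint_L2f sqint_L2f, symmetric])

lemma L2f_diff: "AEL x. L2f (U - V) x = L2f U x - L2f V x"
 using L2f_toL2[OF sqint_diff[OF sqint_L2f sqint_L2f], of U V]
 by (simp add: toL2_diff[OF sqint_L2f sqint_L2f, symmetric])

lemma L2f_scale: "AEL x. L2f (c *R U) x = c *R L2f U x"
 using L2f_toL2[OF sqint_scale[OF sqint_L2f], of c U]
 by (simp add: toL2_scale[OF sqint_L2f, symmetric])

lemma L2f_sum: "AEL x. L2f (\<Sum>i\<in>I. c i *R U i) x = (\<Sum>i\<in>I. c i *R L2f (U i) x)"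
proof (induction I rule: infinite_finite_induct)
 case (insert i I)
 have "AEL x. L2f (c i *R U i + (\<Sum>i\<in>I. c i *R U i)) x = c i *R L2f (U i) x + (\<Sum>i\<in>I. c i *R L2f (U i) x)"
  using insert.IH L2f_add[of "c i *R U i" "\<Sum>i\<in>I. c i *R U i"] L2f_scale[of "c i" "U i"]
  by eventually_elim simp
 then show ?case using insert.hyps by simp
qed (auto intro: L2f_zero)

lemma nn_norm_L2: "(\<integral>\<^sup>+x. ennreal ((norm (L2f U x))^2) \<partial>lborel) = ennreal ((norm U)^2)"
 unfolding norm_L2f using sqint_L2f[of U] by (intro nn_integral_eq_integral) (auto simp: sqint_def)

lemma sqint_nn:
 assumes "f \<in> borel_measurable borel" "(\<integral>\<^sup>+x. ennreal ((norm (f x))^2) \<partial>lborel) <= ennreal c" "c >= 0"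
 shows "sqint f" "(norm (toL2 f))^2 <= c"
proof -
 have "(\<integral>\<^sup>+x. ennreal (norm ((norm (f x))^2)) \<partial>lborel) < \<infinity>"
  using assms(2) by (simp add: le_less_trans)
 then show f: "sqint f" unfolding sqint_def using assms(1) by (auto intro!: integrableI_bounded)
 have "(norm (toL2 f))^2 = (LB x. (norm (f x))\<^sup>2)" by (rule norm_toL2[OF f])
 also have "\<dots> <= c"
  by (subst integral_eq_nn_integral)
    (use assms f in \<open>auto simp: sqint_def intro!: enn2real_leI\<close>)
 finally show "(norm (toL2 f))^2 <= c" .
qed

text \<open>A suitably weighted sum of the squared steps is still integrable, hence finite almost everywhere; at such points
 the steps are dominated by a geometric sequence.\<close>

lemma L2_fast_Cauchy_AE:
 fixes X :: "nat => ('a::euclidean_space, 'b::euclidean_space) L2"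
 assumes "!!n. (norm (X (Suc n) - X n))\<^sup>2 <= (1/8) ^ n"
 shows "AEL x. convergent (%n. L2f (X n) x)"
proof -
 define d where "d n x = L2f (X (Suc n)) x - L2f (X n) x" for n x
 have [measurable]: "d n \<in> borel_measurable borel" for n unfolding d_def[abs_def] by measurable
 have d: "(\<integral>\<^sup>+x. ennreal ((norm (d n x))^2) \<partial>lborel) <= ennreal ((1/8)^n)" for n
 proof -
  have "(\<integral>\<^sup>+x. ennreal ((norm (d n x))^2) \<partial>lborel) = (\<integral>\<^sup>+x. ennreal ((norm (L2f (X (Suc n) - X n) x))^2) \<partial>lborel)"
   using L2f_diff[of "X (Suc n)" "X n"] by (intro nn_integral_cong_AE) (auto simp: d_def)
  then show ?thesis using assms[of n] by (simp add: nn_norm_L2 ennreal_leI)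
 qed
 have "(\<integral>\<^sup>+x. (\<Sum>n. ennreal (4^n * (norm (d n x))^2)) \<partial>lborel)
   = (\<Sum>n. \<integral>\<^sup>+x. ennreal (4^n * (norm (d n x))^2) \<partial>lborel)"
  by (rule nn_integral_suminf) measurable
 also have "\<dots> <= (\<Sum>n. ennreal ((1/2)^n))"
 proof (rule suminf_le)
  fix n
  have "(\<integral>\<^sup>+x. ennreal (4^n * (norm (d n x))^2) \<partial>lborel) = ennreal (4^n) * (\<integral>\<^sup>+x. ennreal ((norm (d n x))^2) \<partial>lborel)"
   by (subst nn_integral_cmult[symmetric]) (auto simp: ennreal_mult)
  also have "\<dots> <= ennreal (4^n) * ennreal ((1/8)^n)" by (intro mult_left_mono d) simp
  also have "\<dots> = ennreal ((1/2)^n)"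
   by (subst ennreal_mult[symmetric]) (auto simp: power_mult_distrib[symmetric])
  finally show "(\<integral>\<^sup>+x. ennreal (4^n * (norm (d n x))^2) \<partial>lborel) <= ennreal ((1/2)^n)" .
 qed auto
 also have "\<dots> < \<infinity>"
  by (subst suminf_ennreal_eq[of _ 2]) (auto intro: power_half_series geometric_sums[of "1/2::real", simplified])
 finally have "AEL x. (\<Sum>n. ennreal (4^n * (norm (d n x))^2)) ~= \<infinity>"
  by (intro nn_integral_noteq_infinite) auto
 then show ?thesis
 proof eventually_elim
  case (elim x)
  have "\<exists>S\<ge>0. t = ennreal S" if "t ~= \<infinity>" for t :: ennreal
   using that by (cases t) auto
  from this[OF elim] obtain S where S: "(\<Sum>n. ennreal (4^n * (norm (d n x))^2)) = ennreal S" "S >= 0"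
   by blast
  have pow4: "(2^n)^2 = (4::real)^n" for n :: nat
   by (simp add: power2_eq_square power_mult_distrib[symmetric])
  have le: "norm (d n x) <= sqrt S * (1/2)^n" for n
  proof -
   have "ennreal (4^n * (norm (d n x))^2) <= ennreal S"
    using sum_le_suminf[of "%n. ennreal (4^n * (norm (d n x))^2)" "{n}", OF summableI] unfolding S(1)
    by simp
   then have "4^n * (norm (d n x))^2 <= S" using S by (simp add: ennreal_le_iff)
   then have "(2^n * norm (d n x))^2 <= S"
    by (simp add: power_mult_distrib pow4)
   then have "2^n * norm (d n x) <= sqrt S" by (simp add: real_le_rsqrt)
   then show ?thesis by (simp add: field_simps power_one_over)
  qed
  have "summable (%n. d n x)"
   by (rule summable_comparison_test'[of "%n. sqrt S * (1/2)^n" 0])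
     (use le in \<open>auto intro!: summable_mult summable_geometric\<close>)
  then have "convergent (%n. L2f (X n) x - L2f (X 0) x)"
   by (simp add: summable_iff_convergent d_def sum_lessThan_telescope[of "%n. L2f (X n) x"])
  then have "convergent (%n. L2f (X n) x - L2f (X 0) x + L2f (X 0) x)"
   by (intro convergent_add convergent_const)
  then show ?case by simp
 qed
qed

text \<open>Riesz-Fischer: a fast subsequence converges almost everywhere, and Fatou's lemma identifies its limit as the limit in norm.\<close>

instance L2 :: (euclidean_space, euclidean_space) complete_space
proof
 fix X :: "nat => ('a, 'b) L2"
 assume X: "Cauchy X"
 have "\<exists>r. strict_mono r & (\<forall>n. \<forall>m\<ge>r n. dist (X m) (X (r n)) < (1/8)^(Suc n))"
 proof -
  have ev: "\<exists>N. \<forall>m\<ge>N. \<forall>k\<ge>N. dist (X m) (X k) < (1/8)^(Suc n)" for n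
   using metric_CauchyD[OF X, of "(1/8)^(Suc n)"] by simp
  have "\<exists>r. \<forall>n. (\<forall>m\<ge>r n. dist (X m) (X (r n)) < (1/8)^(Suc n)) & r n < r (Suc n)"
  proof (rule dependent_nat_choice)
   show "\<exists>x. \<forall>m\<ge>x. dist (X m) (X x) < (1/8)^(Suc 0)" using ev[of 0] by blast
   fix x n
   obtain N where N: "\<forall>m\<ge>N. \<forall>k\<ge>N. dist (X m) (X k) < (1/8)^(Suc (Suc n))" using ev by blast
   then show "\<exists>y. (\<forall>m\<ge>y. dist (X m) (X y) < (1/8)^(Suc (Suc n))) & x < y"
    by (intro exI[of _ "max N (Suc x)"]) auto
  qed
  then show ?thesis by (metis strict_mono_Suc_iff)
 qed
 then obtain r :: "nat => nat" where r: "strict_mono r" "!!n m. m >= r n ==> dist (X m) (X (r n)) < (1/8)^(Suc n)"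
  by blast
 define Y where "Y n = X (r n)" for n
 have "(norm (Y (Suc n) - Y n))^2 <= (1/8)^n" for n
 proof -
  have *: "norm (Y (Suc n) - Y n) <= (1/8)^Suc n"
   using r(2)[of n "r (Suc n)"] r(1) by (simp add: Y_def dist_norm strict_mono_leD)
  then have "(norm (Y (Suc n) - Y n))^2 <= ((1/8)^Suc n)^2" by (intro power_mono) auto
  also have "\<dots> <= (1/8)^n" unfolding power_mult[symmetric] by (rule power_decreasing) auto
  finally show ?thesis .
 qed
 then have conv: "AEL x. convergent (%n. L2f (Y n) x)" by (rule L2_fast_Cauchy_AE)
 define f where "f x = lim (%n. L2f (Y n) x)" for x
 have [measurable]: "f \<in> borel_measurable borel" unfolding f_def[abs_def] by measurable
 have est: "(\<integral>\<^sup>+x. ennreal ((norm (f x - L2f (X k) x))^2) \<partial>lborel) <= ennreal (e^2)"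
  if e: "e > 0" "!!m. m >= N ==> norm (X m - X k) <= e" for e k N
 proof -
  have "(\<integral>\<^sup>+x. ennreal ((norm (f x - L2f (X k) x))^2) \<partial>lborel)
   = (\<integral>\<^sup>+x. liminf (%n. ennreal ((norm (L2f (Y n - X k) x))^2)) \<partial>lborel)"
  proof (rule nn_integral_cong_AE)
   have "AEL x. \<forall>n. L2f (Y n - X k) x = L2f (Y n) x - L2f (X k) x"
    unfolding AE_all_countable using L2f_diff by blast
   with conv show "AEL x. ennreal ((norm (f x - L2f (X k) x))^2) = liminf (%n. ennreal ((norm (L2f (Y n - X k) x))^2))"
   proof eventually_elim
    case (elim x)
    then have "(%n. L2f (Y n) x) ---> f x" by (simp add: f_def convergent_LIMSEQ_iff)
    then have "(%n. ennreal ((norm (L2f (Y n) x - L2f (X k) x))^2)) ---> ennreal ((norm (f x - L2f (X k) x))^2)"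
     by (intro tendsto_ennrealI tendsto_intros)
    from lim_imp_Liminf[OF sequentially_bot this]
    show ?case using elim(2) by simp
   qed
  qed
  also have "\<dots> <= liminf (%n. \<integral>\<^sup>+x. ennreal ((norm (L2f (Y n - X k) x))^2) \<partial>lborel)"
   by (rule nn_integral_liminf) measurable
  also have "\<dots> <= ennreal (e^2)"
   unfolding nn_norm_L2
  proof (rule Liminf_le)
   show "\<forall>\<^sub>F n in sequentially. ennreal ((norm (Y n - X k))^2) <= ennreal (e^2)"
    using e r(1) by (intro eventually_sequentiallyI[of N])
     (auto simp: Y_def intro!: ennreal_leI power_mono dest: order_trans[OF _ seq_suble])
  qed simp
  finally show ?thesis .
 qed
 have ex: "\<exists>N. \<forall>k\<ge>N. \<forall>m\<ge>N. norm (X m - X k) <= e" if "e > 0" for e :: real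
  using X that unfolding Cauchy_def dist_norm by (meson less_imp_le)
 obtain N where N: "!!k m. k >= N ==> m >= N ==> norm (X m - X k) <= 1" using ex[of 1] by auto
 have "sqint (%x. f x - L2f (X N) x)"
  by (rule sqint_nn(1)[of _ "1\<^sup>2"]) (use est[of 1 N N] N in auto)
 from sqint_add[OF this sqint_L2f[of "X N"]] have f: "sqint f" by simp
 have "X ---> toL2 f"
 proof (rule LIMSEQ_I)
  fix e :: real assume "e > 0"
  then obtain N where N: "!!k m. k >= N ==> m >= N ==> norm (X m - X k) <= e/2" using ex[of "e/2"] by auto
  have "norm (X k - toL2 f) < e" if "k >= N" for k
  proof -
   have "(norm (toL2 (%x. f x - L2f (X k) x)))^2 <= (e/2)^2"
    by (rule sqint_nn(2)) (use est[of "e/2" N k] N that \<open>e > 0\<close> in auto)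
   then have "norm (toL2 (%x. f x - L2f (X k) x)) <= e/2"
    using \<open>e > 0\<close> by (meson half_gt_zero less_imp_le power2_le_imp_le)
   moreover have "toL2 (%x. f x - L2f (X k) x) = toL2 f - X k"
    using toL2_diff[OF f sqint_L2f[of "X k"]] by simp
   ultimately show ?thesis using \<open>e > 0\<close> by (simp add: norm_minus_commute)
  qed
  then show "\<exists>N. \<forall>k\<ge>N. norm (X k - toL2 f) < e" by blast
 qed
 then show "convergent X" by (auto simp: convergent_def)
qed

section \<open>Compact quadratic forms in Hilbert space\<close>

text \<open>Gaussian elimination of one unknown at a time.\<close>

lemma homogeneous_system_nontrivial:
 fixes A :: "'j => 'i => real"
 assumes "finite J" "finite I" "card J < card I"
 shows "\<exists>c. (\<exists>i\<in>I. c i ~= 0) & (\<forall>j\<in>J. (\<Sum>i\<in>I. c i * A j i) = 0)"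
 using assms
proof (induction J arbitrary: I A rule: finite_induct)
 case empty
 then have "I ~= {}" by auto
 then show ?case by (intro exI[of _ "%_. 1"]) auto
next
 case (insert j J)
 show ?case
 proof (cases "\<forall>i\<in>I. A j i = 0")
  case True
  have "card J < card I" using insert by simp
  then obtain c where "\<exists>i\<in>I. c i ~= 0" "\<forall>j\<in>J. (\<Sum>i\<in>I. c i * A j i) = 0"
   using insert.IH[of I A] insert.prems by blast
  then show ?thesis using True by (intro exI[of _ c]) auto
 next
  case False
  then obtain p where p: "p \<in> I" "A j p ~= 0" by blast
  define B where "B k i = A k i - A k p * A j i / A j p" for k i
  have "card J < card (I - {p})" using insert p by auto
  then obtain c where c: "\<exists>i\<in>I-{p}. c i ~= 0" "\<forall>k\<in>J. (\<Sum>i\<in>I-{p}. c i * B k i) = 0"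
   using insert.IH[of "I - {p}" B] insert.prems by blast
  define s where "s = (\<Sum>i\<in>I-{p}. c i * A j i) / A j p"
  define c' where "c' i = (if i = p then - s else c i)" for i
  have sum: "(\<Sum>i\<in>I. c' i * A k i) = (\<Sum>i\<in>I-{p}. c i * A k i) - s * A k p" for k
   using p insert.prems by (subst sum.remove[of I p]) (auto simp: c'_def intro!: sum.cong)
  have "(\<Sum>i\<in>I. c' i * A j i) = 0" using p by (simp add: sum s_def)
  moreover have "(\<Sum>i\<in>I. c' i * A k i) = 0" if "k \<in> J" for k
  proof -
   have "0 = (\<Sum>i\<in>I-{p}. c i * A k i - (A k p / A j p) * (c i * A j i))"
    using c(2)[rule_format, OF that] by (simp add: B_def right_diff_distrib mult.commute mult.left_commute)
   also have "\<dots> = (\<Sum>i\<in>I-{p}. c i * A k i) - s * A k p"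
    by (simp add: sum_subtractf s_def sum_distrib_left sum_distrib_right sum_divide_distrib mult_ac)
   finally show ?thesis by (simp add: sum)
  qed
  moreover have "\<exists>i\<in>I. c' i ~= 0" using c(1) by (auto simp: c'_def)
  ultimately show ?thesis by (intro exI[of _ c']) auto
 qed
qed

lemma parallelogram:
 fixes x y :: "'a::real_inner"
 shows "(norm (x - y))^2 = 2 * (norm x)^2 + 2 * (norm y)^2 - (norm (x + y))\<^sup>2"
 by (simp add: power2_norm_eq_inner inner_add inner_diff inner_commute)

text \<open>Weak compactness in elementary form: almost minimal elements of the convex hulls of the tails
 form a Cauchy sequence by the parallelogram law.\<close>

lemma graph_weak_limit:
 fixes W :: "('h::real_inner \<times> 'e::{real_inner,complete_space}) set"
 assumes W: "convex W" "closed W"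
  and X: "!!n. X n \<in> W" "(%n. fst (X n)) ---> u" "!!n. norm (snd (X n)) <= a n" "a ---> b"
 shows "\<exists>G. (u, G) \<in> W & norm G <= b"
proof -
 define C where "C n = convex hull (X ` {n..})" for n
 define d where "d n = (INF p\<in>C n. norm (snd p))" for n
 have ne: "C n ~= {}" for n by (auto simp: C_def)
 have CW: "C n \<subseteq> W" for n unfolding C_def using W(1) X(1) by (intro hull_minimal) auto
 have anti: "C m \<subseteq> C n" if "n <= m" for m n
  unfolding C_def using that by (intro hull_mono) auto
 have bb: "bdd_below ((%p. norm (snd p)) ` C n)" for n by (intro bdd_belowI[of _ 0]) auto
 have dle: "d n <= norm (snd p)" if "p \<in> C n" for p n
  unfolding d_def using that bb by (rule cINF_lower[rotated])
 have d0: "d n >= 0" for n unfolding d_def using ne by (intro cINF_greatest) auto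
 have "incseq d"
  unfolding d_def incseq_def using anti ne bb by (auto intro!: cINF_superset_mono)
 obtain M where M: "!!n. a n <= M" using X(4) by (metis Bseq_def convergentI convergent_imp_Bseq abs_le_D1 real_norm_def)
 have "d n <= M" for n
  using dle[of "X n" n] X(3)[of n] M[of n] hull_subset[of "X ` {n..}" convex] by (force simp: C_def)
 then obtain l where l: "d ---> l" using incseq_convergent[OF \<open>incseq d\<close>, of M] by blast
 have "\<exists>p\<in>C n. norm (snd p) < d n + inverse (real (Suc n))" for n
 proof -
  have "(INF p\<in>C n. norm (snd p)) < d n + inverse (real (Suc n))" by (simp add: d_def)
  then show ?thesis using cINF_less_iff[OF ne bb] by blast
 qed
 then obtain Y where Y: "!!n. Y n \<in> C n" "!!n. norm (snd (Y n)) < d n + inverse (real (Suc n))" by metis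
 define D where "D n = d n + inverse (real (Suc n))" for n
 have D: "D ---> l" unfolding D_def using tendsto_add[OF l LIMSEQ_inverse_real_of_nat] by simp
 have key: "(norm (snd (Y n) - snd (Y m)))^2 <= 2 * (D n)^2 + 2 * (D m)^2 - 4 * (d (min n m))^2" for n m
 proof -
  let ?k = "min n m"
  have "Y n \<in> C ?k" "Y m \<in> C ?k" using Y(1) anti[of ?k n] anti[of ?k m] by auto
  then have "(1/2) *R Y n + (1/2) *R Y m \<in> C ?k"
   unfolding C_def using convex_convex_hull by (intro convexD) auto
  from dle[OF this] have "d ?k <= norm ((1/2) *R (snd (Y n) + snd (Y m)))" by (simp add: scaleR_add_right)
  then have "2 * d ?k <= norm (snd (Y n) + snd (Y m))" by simp
  then have "(2 * d ?k)^2 <= (norm (snd (Y n) + snd (Y m)))^2" using d0[of ?k] by (intro power_mono) auto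
  moreover have "(norm (snd (Y n)))^2 <= (D n)^2" for n using Y(2)[of n] by (intro power_mono) (auto simp: D_def)
  note this[of n] this[of m]
  ultimately show ?thesis by (simp add: parallelogram power_mult_distrib)
 qed
 have "Cauchy (%n. snd (Y n))"
 proof (rule metric_CauchyI)
  fix e :: real assume e: "e > 0"
  have l0: "l >= 0" using LIMSEQ_le_const[OF l] d0 by blast
  have "(%n. (D n)\<^sup>2) ---> l\<^sup>2" "(%n. (d n)\<^sup>2) ---> l\<^sup>2" by (intro tendsto_intros D l)+
  then have "\<forall>\<^sub>F n in sequentially. (D n)\<^sup>2 < l\<^sup>2 + e^2/8" "\<forall>\<^sub>F n in sequentially. (d n)\<^sup>2 > l\<^sup>2 - e\<^sup>2/8"
   using e by (auto elim!: order_tendstoD)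
  then have "\<forall>\<^sub>F n in sequentially. (D n)\<^sup>2 < l\<^sup>2 + e^2/8 & (d n)^2 > l\<^sup>2 - e\<^sup>2/8" by eventually_elim simp
  then obtain N where N: "!!n. n >= N ==> (D n)^2 < l\<^sup>2 + e^2/8 & (d n)^2 > l\<^sup>2 - e\<^sup>2/8"
   by (auto simp: eventually_sequentially)
  have "dist (snd (Y m)) (snd (Y n)) < e" if "m >= N" "n >= N" for m n
  proof -
   have "(dist (snd (Y m)) (snd (Y n)))^2 < e\<^sup>2"
    unfolding dist_norm using key[of m n] N[OF that(1)] N[OF that(2)] N[of "min m n"] that by auto
   then show ?thesis using e by (simp add: power2_less_imp_less)
  qed
  then show "\<exists>M. \<forall>m\<ge>M. \<forall>n\<ge>M. dist (snd (Y m)) (snd (Y n)) < e" by blast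
 qed
 then obtain G where G: "(%n. snd (Y n)) ---> G" using Cauchy_convergent convergent_def by blast
 have u: "(%n. fst (Y n)) ---> u"
 proof (rule metric_LIMSEQ_I)
  fix e :: real assume "e > 0"
  then obtain N where N: "!!n. n >= N ==> dist (fst (X n)) u < e" using metric_LIMSEQ_D[OF X(2)] by blast
  have "C N \<subseteq> fst -` ball u e"
   unfolding C_def using N by (intro hull_minimal convex_linear_vimage linear_fst) (auto simp: dist_commute)
  then show "\<exists>N. \<forall>n\<ge>N. dist (fst (Y n)) u < e"
   using subsetD[OF anti Y(1)] by (intro exI[of _ N]) (fastforce simp: dist_commute)
 qed
 have "norm G <= b"
 proof (rule field_le_epsilon)
  fix e :: real assume "e > 0"
  then obtain N where N: "!!n. n >= N ==> a n < b + e"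
   using order_tendstoD(2)[OF X(4), of "b + e"] by (auto simp: eventually_sequentially)
  have "norm (snd (X n)) <= b + e" if "n >= N" for n using X(3)[of n] N[OF that] by simp
  then have "C N \<subseteq> snd -` cball 0 (b + e)"
   unfolding C_def by (intro hull_minimal convex_linear_vimage linear_snd) auto
  then have "\<forall>n\<ge>N. norm (snd (Y n)) <= b + e" using subsetD[OF anti Y(1)] by fastforce
  then show "norm G <= b + e" using LIMSEQ_le_const2[OF tendsto_norm[OF G]] by blast
 qed
 moreover have "(u, G) \<in> W"
 proof (rule closed_sequentially[OF W(2)])
  show "Y n \<in> W" for n using Y(1) CW by blast
  show "Y ---> (u, G)" using tendsto_Pair[OF u G] by simp
 qed
 ultimately show ?thesis by blast
qed

lemma quadratic_vertex:
 fixes a b c :: real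
 assumes "!!t. 0 <= a + 2 * t * b + t^2 * c" "a <= 0"
 shows "b = 0"
proof (rule ccontr)
 assume b: "b ~= 0"
 define d where "d = \<bar>c\<bar> + 1"
 have d: "d > 0" by (simp add: d_def)
 have "0 <= a + 2 * (- b / d) * b + (- b / d)^2 * c" by (rule assms(1))
 also have "\<dots> <= 2 * (- b / d) * b + (b / d)^2 * d"
 proof -
  have "(- b / d)^2 * c <= (b / d)^2 * d" by (simp add: d_def mult_left_mono)
  then show ?thesis using assms(2) by linarith
 qed
 also have "\<dots> = - b\<^sup>2 / d"
  using d by (simp add: power2_eq_square field_simps)
 finally show False using b d by (auto simp: divide_le_0_iff)
qed

text \<open>Abstracts from the pairs (function, gradient): the first component carries the \<open>L\<^sup>2\<close> inner product, the second the
 energy, and \<open>compact\<close> is Rellich's theorem.\<close>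

locale compact_form =
 fixes W :: "('h::{real_inner,complete_space} \<times> 'e::{real_inner,complete_space}) set"
 assumes subspace: "subspace W" and closed: "closed W"
  and inj: "(0, G) \<in> W ==> G = 0"
  and compact: "!!X B. (!!n::nat. X n \<in> W) ==> (!!n. norm (X n) <= B) ==>
    \<exists>r u. strict_mono (r :: nat => nat) & (%n. fst (X (r n))) ---> u"
  and infinite_dim: "!!(k::nat) f. \<exists>p\<in>W. fst p ~= 0 & (\<forall>j<k. f j \<bullet> fst p = 0)"

text \<open>Each member minimizes the Rayleigh quotient among the elements orthogonal to the earlier ones.\<close>

definition eigen_seq :: "('h::real_inner \<times> 'e::real_inner) set => (nat => 'h \<times> 'e) => bool" where
 "eigen_seq W e \<longleftrightarrow> (\<forall>n. e n \<in> W & norm (fst (e n)) = 1 & (\<forall>j<n. fst (e j) \<bullet> fst (e n) = 0) &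
   (\<forall>q\<in>W. (\<forall>j<n. fst (e j) \<bullet> fst q = 0) -->
    (norm (snd (e n)))^2 * (norm (fst q))^2 <= (norm (snd q))^2))"

context compact_form
begin

text \<open>A minimizing sequence has a subsequence converging in the first component, and \<open>graph_weak_limit\<close> bounds the energy of the limit.\<close>

lemma rayleigh_minimizer:
 fixes k :: nat and f :: "nat => 'h"
 shows "\<exists>p\<in>W. norm (fst p) = 1 & (\<forall>j<k. f j \<bullet> fst p = 0) &
   (\<forall>q\<in>W. (\<forall>j<k. f j \<bullet> fst q = 0) --> (norm (snd p))^2 * (norm (fst q))^2 <= (norm (snd q))^2)"
proof -
 define V where "V = {p\<in>W. \<forall>j<k. f j \<bullet> fst p = 0}"
 have Vs: "subspace V"
  using subspace unfolding V_def subspace_def by (auto simp: inner_add_right)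
 have Vc: "closed V"
 proof -
  have "V = W \<inter> (\<Inter>j\<in>{..<k}. {p. f j \<bullet> fst p = 0})" by (auto simp: V_def)
  moreover have "closed {p. f j \<bullet> fst p = 0}" for j
   by (intro closed_Collect_eq continuous_intros)
  ultimately show ?thesis using closed by (auto intro!: closed_Int closed_INT)
 qed
 define S where "S = {q\<in>V. norm (fst q) = 1}"
 have normalize: "q /\<^sub>R norm (fst q) \<in> S" if "q \<in> V" "fst q ~= 0" for q
  using that Vs by (auto simp: S_def subspace_scale)
 have ne: "S ~= {}"
  using infinite_dim[of k f] normalize by (force simp: V_def)
 define m where "m = (INF q\<in>S. norm (snd q))"
 have bb: "bdd_below ((%p. norm (snd p)) ` S)" by (intro bdd_belowI[of _ 0]) auto
 have m0: "m >= 0" unfolding m_def using ne by (intro cINF_greatest) auto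
 have mle: "m * norm (fst q) <= norm (snd q)" if "q \<in> V" for q
 proof (cases "fst q = 0")
  case False
  have "m <= norm (snd (q /\<^sub>R norm (fst q)))"
   unfolding m_def using normalize[OF that False] bb by (rule cINF_lower[rotated])
  then show ?thesis using False by (simp add: field_simps)
 qed simp
 have "\<exists>q\<in>S. norm (snd q) < m + inverse (real (Suc n))" for n
 proof -
  have "(INF q\<in>S. norm (snd q)) < m + inverse (real (Suc n))" by (simp add: m_def)
  then show ?thesis using cINF_less_iff[OF ne bb] by blast
 qed
 then obtain X where X: "!!n. X n \<in> S" "!!n. norm (snd (X n)) < m + inverse (real (Suc n))" by metis
 have "\<exists>r u. strict_mono (r :: nat => nat) & (%n. fst (X (r n))) ---> u"
 proof (rule compact)
  show "X n \<in> W" for n using X(1)[of n] by (simp add: S_def V_def)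
  show "norm (X n) <= 1 + (m + 1)" for n
  proof -
   have "norm (X n) <= norm (fst (X n)) + norm (snd (X n))"
    using norm_Pair_le[of "fst (X n)" "snd (X n)"] by simp
   also have "\<dots> <= 1 + (m + 1)"
    using X(1)[of n] X(2)[of n] inverse_le_1_iff[of "real (Suc n)"] by (simp add: S_def)
   finally show ?thesis .
  qed
 qed
 then obtain r u where r: "strict_mono r" "(%n. fst (X (r n))) ---> u" by blast
 have "\<exists>G. (u, G) \<in> V & norm G <= m"
 proof (rule graph_weak_limit[OF subspace_imp_convex[OF Vs] Vc])
  show "X (r n) \<in> V" for n using X(1) by (simp add: S_def)
  show "norm (snd (X (r n))) <= m + inverse (real (Suc (r n)))" for n using X(2) by (simp add: less_imp_le)
  show "(%n. m + inverse (real (Suc (r n)))) ---> m"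
   using LIMSEQ_subseq_LIMSEQ[OF LIMSEQ_inverse_real_of_nat_add[of m] r(1)] by (simp add: o_def)
 qed (rule r)
 then obtain G where G: "(u, G) \<in> V" "norm G <= m" by blast
 have u1: "norm u = 1"
  using tendsto_norm[OF r(2)] X(1) by (simp add: S_def LIMSEQ_const_iff)
 have "(norm G)^2 * (norm (fst q))^2 <= (norm (snd q))^2" if "q \<in> V" for q
 proof -
  have "norm G * norm (fst q) <= m * norm (fst q)" using G(2) by (intro mult_right_mono) auto
  also have "\<dots> <= norm (snd q)" by (rule mle[OF that])
  finally show ?thesis unfolding power_mult_distrib[symmetric] by (intro power_mono) auto
 qed
 then show ?thesis using G(1) u1 by (intro bexI[of _ "(u, G)"]) (auto simp: V_def)
qed

lemma eigen_seq_exists: "\<exists>e. eigen_seq W e"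
proof -
 let ?P = "%(e :: nat => 'h \<times> 'e) n p. p \<in> W & norm (fst p) = 1 & (\<forall>j<n. fst (e j) \<bullet> fst p = 0) &
   (\<forall>q\<in>W. (\<forall>j<n. fst (e j) \<bullet> fst q = 0) --> (norm (snd p))^2 * (norm (fst q))^2 <= (norm (snd q))^2)"
 have "\<exists>e. \<forall>n. ?P e n (e n)"
 proof (rule dependent_wf_choice[OF wf_less])
  show "?P f n p = ?P g n p" if "!!z. (z, n) \<in> {(x, y). x < y} ==> f z = g z" for f g n p
   using that by simp
  show "\<exists>p. ?P f n p" for n f
   using rayleigh_minimizer[of n "%j. fst (f j)"] by blast
 qed
 then show ?thesis unfolding eigen_seq_def by blast
qed

end

locale eigen_form = compact_form W
 for W :: "('h::{real_inner,complete_space} \<times> 'e::{real_inner,complete_space}) set" +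
 fixes e :: "nat => 'h \<times> 'e"
 assumes e: "eigen_seq W e"
begin

definition ev :: "nat => real" where "ev n = (norm (snd (e n)))^2"

lemma e_W: "e n \<in> W" and e_norm: "norm (fst (e n)) = 1"
 and e_min: "q \<in> W ==> (!!j. j < n ==> fst (e j) \<bullet> fst q = 0) ==> ev n * (norm (fst q))^2 <= (norm (snd q))^2"
 using e unfolding eigen_seq_def ev_def by blast+

lemma e_orth: "fst (e i) \<bullet> fst (e j) = (if i = j then 1 else 0)"
proof (cases i j rule: linorder_cases)
 case less then show ?thesis using e by (simp add: eigen_seq_def)
next
 case equal then show ?thesis using e_norm[of j] by (simp add: norm_eq_1)
next
 case greater then show ?thesis using e by (subst inner_commute) (simp add: eigen_seq_def)
qed

lemma ev_mono: "n <= m ==> ev n <= ev m"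
 using e_min[OF e_W, of n m] by (simp add: e_orth e_norm ev_def)

lemma ev_nonneg: "ev n >= 0"
 by (simp add: ev_def)

lemma euler_lagrange_orth:
 assumes p: "p \<in> W" "!!j. j < n ==> fst (e j) \<bullet> fst p = 0" "(norm (snd p))^2 <= ev n * (norm (fst p))^2"
  and q: "q \<in> W" "!!j. j < n ==> fst (e j) \<bullet> fst q = 0"
 shows "snd p \<bullet> snd q = ev n * (fst p \<bullet> fst q)"
proof -
 have "0 <= ((norm (snd p))^2 - ev n * (norm (fst p))^2) + 2 * t * (snd p \<bullet> snd q - ev n * (fst p \<bullet> fst q))
   + t^2 * ((norm (snd q))^2 - ev n * (norm (fst q))^2)" for t
 proof -
  have "p + t *R q \<in> W" using p q subspace by (simp add: subspace_add subspace_scale)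
  then have "ev n * (norm (fst (p + t *R q)))^2 <= (norm (snd (p + t *R q)))^2"
   using p q by (intro e_min) (auto simp: inner_add_right)
  then show ?thesis
   unfolding power2_norm_eq_inner
   by (simp add: inner_add inner_commute power2_eq_square algebra_simps)
 qed
 then have "snd p \<bullet> snd q - ev n * (fst p \<bullet> fst q) = 0"
  using p(3) by (intro quadratic_vertex) auto
 then show ?thesis by simp
qed

lemma project_off:
 fixes q :: "'h \<times> 'e"
 assumes "q \<in> W"
 shows "q - (\<Sum>i<n. (fst (e i) \<bullet> fst q) *R e i) \<in> W"
  and "j < n ==> fst (e j) \<bullet> fst (q - (\<Sum>i<n. (fst (e i) \<bullet> fst q) *R e i)) = 0"
proof -
 show "q - (\<Sum>i<n. (fst (e i) \<bullet> fst q) *R e i) \<in> W"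
  using assms subspace e_W by (intro subspace_diff subspace_sum subspace_scale)
 show "fst (e j) \<bullet> fst (q - (\<Sum>i<n. (fst (e i) \<bullet> fst q) *R e i)) = 0" if "j < n"
  using that by (simp add: inner_diff_right fst_sum inner_sum_right e_orth if_distrib[of "%x. _ * x"] cong: if_cong)
qed

text \<open>A minimizer orthogonal to the earlier eigenvectors satisfies the equation when tested with elements that are orthogonal to
 them too; the components of a general test element along them contribute nothing on either side.\<close>

lemma euler_lagrange:
 assumes "p \<in> W" "!!j. j < n ==> fst (e j) \<bullet> fst p = 0" "(norm (snd p))^2 <= ev n * (norm (fst p))^2" "q \<in> W"
 shows "snd p \<bullet> snd q = ev n * (fst p \<bullet> fst q)"
 using assms
proof (induction n arbitrary: p q rule: less_induct)
 case (less n)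
 let ?s = "\<Sum>i<n. (fst (e i) \<bullet> fst q) *R e i"
 have eig: "snd (e i) \<bullet> snd p = 0" if "i < n" for i
  using less.IH[OF that e_W[of i] _ _ less.prems(1)] less.prems(2)[OF that]
  by (simp add: e_orth ev_def e_norm)
 have "snd p \<bullet> snd (q - ?s) = ev n * (fst p \<bullet> fst (q - ?s))"
  by (rule euler_lagrange_orth[OF less.prems(1-3) project_off[OF less.prems(4)]])
 moreover have "snd p \<bullet> snd ?s = 0"
  using eig by (simp add: snd_sum inner_sum_right inner_commute[of "snd p"])
 moreover have "fst p \<bullet> fst ?s = 0"
  using less.prems(2) by (simp add: fst_sum inner_sum_right inner_commute[of "fst p"])
 ultimately show ?case by (simp add: inner_diff_right)
qed

lemma e_eigen: "q \<in> W ==> snd (e n) \<bullet> snd q = ev n * (fst (e n) \<bullet> fst q)"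
 by (rule euler_lagrange) (auto simp: e_W e_orth ev_def e_norm)

lemma e_snd_orth: "snd (e i) \<bullet> snd (e j) = (if i = j then ev i else 0)"
 using e_eigen[OF e_W, of i j] by (simp add: e_orth)

text \<open>Otherwise the orthonormal sequence would be bounded in energy and have a convergent subsequence.\<close>

lemma ev_unbounded: "\<exists>n. ev n > B"
proof (rule ccontr)
 assume "~ ?thesis"
 then have B: "ev n <= B" for n by (simp add: not_less)
 have "\<exists>r u. strict_mono (r :: nat => nat) & (%n. fst (e (r n))) ---> u"
 proof (rule compact)
  show "norm (e n) <= 1 + sqrt B" for n
  proof -
   have "norm (e n) <= norm (fst (e n)) + norm (snd (e n))"
    using norm_Pair_le[of "fst (e n)" "snd (e n)"] by simp
   also have "norm (snd (e n)) <= sqrt B" using B[of n] by (simp add: ev_def real_le_rsqrt)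
   finally show ?thesis by (simp add: e_norm)
  qed
 qed (rule e_W)
 then obtain r u where r: "strict_mono (r :: nat => nat)" "(%n. fst (e (r n))) ---> u" by blast
 have "Cauchy (%n. fst (e (r n)))" using r(2) by (rule LIMSEQ_imp_Cauchy)
 then obtain N where N: "!!m n. m >= N ==> n >= N ==> dist (fst (e (r m))) (fst (e (r n))) < 1"
  using metric_CauchyD[of _ 1] by (metis zero_less_one)
 have "r N ~= r (Suc N)" using r(1) by (simp add: strict_mono_eq)
 then have "(dist (fst (e (r N))) (fst (e (r (Suc N)))))^2 = 2"
  by (simp add: dist_norm power2_norm_eq_inner inner_diff e_orth)
 moreover have "(dist (fst (e (r N))) (fst (e (r (Suc N)))))^2 < 1"
  using N[of N "Suc N"] by (simp add: abs_square_less_1)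
 ultimately show False by simp
qed

lemma ev_finite: "finite {n. ev n <= t}"
proof -
 obtain N where "ev N > t" using ev_unbounded by blast
 then have "{n. ev n <= t} \<subseteq> {..<N}" using ev_mono by (force simp: not_less[symmetric])
 then show ?thesis by (rule finite_subset) simp
qed

text \<open>The remainder is orthogonal to all \<open>e n\<close> and has Rayleigh quotient \<open>t\<close>.  If it were nonzero, it would bound every
 \<open>ev n\<close> by \<open>t\<close>.\<close>

lemma eigenvector_expansion:
 assumes p: "p \<in> W" "!!q. q \<in> W ==> snd p \<bullet> snd q = t * (fst p \<bullet> fst q)"
 shows "p = (\<Sum>n\<in>{n. ev n = t}. (fst (e n) \<bullet> fst p) *R e n)"
proof -
 let ?T = "{n. ev n = t}"
 have fin: "finite ?T" using ev_finite[of t] by (rule finite_subset[rotated]) auto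
 define q where "q = p - (\<Sum>n\<in>?T. (fst (e n) \<bullet> fst p) *R e n)"
 have qW: "q \<in> W" unfolding q_def using p(1) subspace e_W
  by (intro subspace_diff subspace_sum subspace_scale)
 have off: "fst (e n) \<bullet> fst p = 0" if "ev n ~= t" for n
  using e_eigen[OF p(1), of n] p(2)[OF e_W, of n] that by (simp add: inner_commute)
 have orth: "fst (e n) \<bullet> fst q = 0" for n
  using fin off[of n]
  by (simp add: q_def inner_diff_right fst_sum inner_sum_right e_orth if_distrib[of "%x. _ * x"] sum.delta cong: if_cong)
 have "snd q \<bullet> snd q' = t * (fst q \<bullet> fst q')" if "q' \<in> W" for q'
  using p(2)[OF that] e_eigen[OF that]
  by (simp add: q_def inner_diff_left fst_sum snd_sum inner_sum_left right_diff_distrib sum_distrib_left algebra_simps)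
 from this[OF qW] have n: "(norm (snd q))^2 = t * (norm (fst q))^2" by (simp add: power2_norm_eq_inner)
 obtain n where "ev n > t" using ev_unbounded by blast
 moreover have "ev n * (norm (fst q))^2 <= (norm (snd q))^2" using e_min[OF qW] orth by blast
 ultimately have "(ev n - t) * (norm (fst q))^2 <= 0" "ev n - t > 0" using n by (auto simp: algebra_simps)
 then have "(norm (fst q))^2 <= 0" by (simp add: mult_le_0_iff)
 then have "fst q = 0" by simp
 then have "snd q = 0" using inj[of "snd q"] qW by (metis prod.collapse)
 with \<open>fst q = 0\<close> have "q = 0" by (simp add: prod_eq_iff)
 then show ?thesis by (simp add: q_def)
qed

text \<open>Courant-Fischer: \<open>h\<close> vectors have a nontrivial combination satisfying the \<open>h - 1\<close> conditions of orthogonality.\<close>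

lemma frame_orthogonal:
 fixes v :: "nat => 'h \<times> 'e" and h :: nat
 assumes "0 < h"
 shows "\<exists>c. (\<exists>i<h. c i ~= 0) & (\<forall>j<h - 1. fst (e j) \<bullet> fst (\<Sum>i<h. c i *R v i) = 0)"
proof -
 obtain c where "\<exists>i\<in>{..<h}. c i ~= 0" "\<forall>j\<in>{..<h-1}. (\<Sum>i<h. c i * (fst (e j) \<bullet> fst (v i))) = 0"
  using homogeneous_system_nontrivial[of "{..<h-1}" "{..<h}" "%j i. fst (e j) \<bullet> fst (v i)"] assms by auto
 then show ?thesis by (intro exI[of _ c]) (auto simp: fst_sum inner_sum_right)
qed

lemma minmax_upper:
 fixes v :: "nat => 'h \<times> 'e" and h :: nat
 assumes "0 < h" and v: "!!i. i < h ==> v i \<in> W"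
  and indep: "!!c. fst (\<Sum>i<h. c i *R v i) = 0 ==> \<forall>i<h. c i = 0"
  and L: "!!c. (norm (snd (\<Sum>i<h. c i *R v i)))\<^sup>2 <= L * (norm (fst (\<Sum>i<h. c i *R v i)))^2"
 shows "ev (h - 1) <= L"
proof -
 obtain c where c: "\<exists>i<h. c i ~= 0" "\<forall>j<h - 1. fst (e j) \<bullet> fst (\<Sum>i<h. c i *R v i) = 0"
  using frame_orthogonal[OF assms(1)] by blast
 let ?q = "\<Sum>i<h. c i *R v i"
 have "?q \<in> W" using v subspace by (intro subspace_sum subspace_scale) auto
 then have "ev (h - 1) * (norm (fst ?q))^2 <= (norm (snd ?q))^2" using c(2) by (intro e_min) auto
 also have "\<dots> <= L * (norm (fst ?q))^2" by (rule L)
 finally have "(ev (h - 1) - L) * (norm (fst ?q))^2 <= 0" by (simp add: algebra_simps)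
 moreover have "(norm (fst ?q))^2 > 0" using indep[of c] c(1) by auto
 ultimately show ?thesis by (simp add: mult_le_0_iff)
qed

lemma e_combination:
 "(norm (fst (\<Sum>i<h. c i *R e i)))^2 = (\<Sum>i<h. (c i)\<^sup>2)"
 "(norm (snd (\<Sum>i<h. c i *R e i)))^2 = (\<Sum>i<h. (c i)\<^sup>2 * ev i)"
 unfolding power2_norm_eq_inner
 by (simp_all add: fst_sum snd_sum inner_sum_left inner_sum_right e_orth e_snd_orth
   if_distrib[of "%x. _ * x"] power2_eq_square mult.assoc cong: if_cong)

lemma e_combination_le: "(norm (snd (\<Sum>i<h. c i *R e i)))^2 <= ev (h - 1) * (norm (fst (\<Sum>i<h. c i *R e i)))^2"
proof -
 have "(\<Sum>i<h. (c i)\<^sup>2 * ev i) <= (\<Sum>i<h. (c i)\<^sup>2 * ev (h - 1))"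
  by (intro sum_mono mult_left_mono ev_mono) auto
 then show ?thesis by (simp add: e_combination sum_distrib_left mult.commute)
qed

end

section \<open>Affine changes of variables\<close>

text \<open>Diagonal linear parts suffice: dilations, translations and reflections in coordinate hyperplanes.\<close>

definition dmap :: "('a::euclidean_space => real) => 'a => 'a => 'a" where
 "dmap c t x = t + (\<Sum>j\<in>Basis. (c j * (x \<bullet> j)) *R j)"

lemma dmap_const: "dmap (%_. s) t x = t + s *R x"
 unfolding dmap_def scaleR_scaleR[symmetric] scaleR_sum_right[symmetric] euclidean_representation ..

lemma dmap_meas[measurable]: "dmap c t \<in> borel_measurable borel"
 unfolding dmap_def[abs_def] by measurable

lemma nn_integral_dmap:
 fixes f :: "'a::euclidean_space => ennreal"
 assumes [measurable]: "f \<in> borel_measurable borel" and "!!j. j \<in> Basis ==> c j ~= 0"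
 shows "(\<integral>\<^sup>+x. f x \<partial>lborel) = ennreal \<bar>\<Prod>j\<in>Basis. c j\<bar> * (\<integral>\<^sup>+x. f (dmap c t x) \<partial>lborel)"
 by (subst lborel_affine_euclidean[OF assms(2), where t = t])
   (auto simp: nn_integral_density nn_integral_distr nn_integral_cmult dmap_def prod_nonneg abs_prod)

lemma integral_dmap:
 fixes f :: "'a::euclidean_space => 'b::{banach, second_countable_topology}"
 assumes "f \<in> borel_measurable borel" and "!!j. j \<in> Basis ==> c j ~= 0"
 shows "(LB x. f x) = \<bar>\<Prod>j\<in>Basis. c j\<bar> *R (LB x. f (dmap c t x))"
proof -
 note [measurable] = assms(1)
 show ?thesis
  by (subst lborel_affine_euclidean[OF assms(2), where t = t])
    (auto simp: integral_density integral_distr dmap_def prod_nonneg abs_prod)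
qed

lemma integrable_dmap:
 fixes f :: "'a::euclidean_space => 'b::{banach, second_countable_topology}"
 assumes "integrable lborel f" and "!!j. j \<in> Basis ==> c j ~= 0"
 shows "integrable lborel (%x. f (dmap c t x))"
proof -
 have [measurable]: "f \<in> borel_measurable borel" using assms(1) by auto
 have "(\<integral>\<^sup>+x. norm (f x) \<partial>lborel) < \<infinity>" using assms(1) by (simp add: integrable_iff_bounded)
 then have "ennreal \<bar>\<Prod>j\<in>Basis. c j\<bar> * (\<integral>\<^sup>+x. norm (f (dmap c t x)) \<partial>lborel) < \<infinity>"
  by (subst (asm) nn_integral_dmap[of _ c t]) (use assms(2) in auto)
 moreover have "ennreal \<bar>\<Prod>j\<in>Basis. c j\<bar> ~= 0" using assms(2) by auto
 ultimately have "(\<integral>\<^sup>+x. norm (f (dmap c t x)) \<partial>lborel) < \<infinity>"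
  by (auto simp: ennreal_mult_less_top)
 then show ?thesis by (auto simp: integrable_iff_bounded)
qed

lemma AE_dmap:
 assumes "AEL x. P x" and "!!j. j \<in> Basis ==> c j ~= 0"
 shows "AEL x. P (dmap c t x)"
proof -
 obtain N where N: "{x\<in>space lborel. ~ P x} \<subseteq> N" "emeasure lborel N = 0" "N \<in> sets lborel"
  using assms(1) by (rule AE_E)
 have [measurable]: "N \<in> sets borel" using N(3) by simp
 have "0 = (\<integral>\<^sup>+x. indicator N x \<partial>lborel)" using N(2) by simp
 also have "\<dots> = ennreal \<bar>\<Prod>j\<in>Basis. c j\<bar> * (\<integral>\<^sup>+x. indicator N (dmap c t x) \<partial>lborel)"
  by (rule nn_integral_dmap) (use assms in auto)
 finally have "(\<integral>\<^sup>+x. indicator N (dmap c t x) \<partial>lborel) = (0::ennreal)"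
  using assms(2) by auto
 then have "AEL x. indicator N (dmap c t x) = (0::ennreal)"
  by (subst (asm) nn_integral_0_iff_AE) auto
 then show ?thesis by eventually_elim (use N(1) in \<open>auto split: split_indicator_asm\<close>)
qed

lemma integral_shift:
 fixes f :: "'a::euclidean_space => 'b::{banach, second_countable_topology}"
 assumes "f \<in> borel_measurable borel"
 shows "(LB x. f (t + x)) = (LB x. f x)"
 using integral_dmap[OF assms, of "%_. 1" t] by (simp add: dmap_const)

lemma integral_reflect_point:
 fixes f :: "'a::euclidean_space => 'b::{banach, second_countable_topology}"
 assumes "f \<in> borel_measurable borel"
 shows "(LB x. f (t - x)) = (LB x. f x)"
 using integral_dmap[OF assms, of "%_. -1" t] by (simp add: dmap_const abs_prod)

lemma nn_integral_shift:
 assumes "f \<in> borel_measurable borel"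
 shows "(\<integral>\<^sup>+x. f (t + x) \<partial>lborel) = (\<integral>\<^sup>+x. f x \<partial>lborel)"
 using nn_integral_dmap[OF assms, of "%_. 1" t] by (simp add: dmap_const)

section \<open>Integration of test functions\<close>

lemma compact_support_integrable:
 fixes f :: "'a::euclidean_space => 'b::euclidean_space"
 assumes "continuous_on UNIV f" "compact S" "!!x. x ~: S ==> f x = 0"
 shows "integrable lborel f" "sqint f"
proof -
 have *: "integrable lborel g" if "continuous_on UNIV g" "!!x. x ~: S ==> g x = 0" for g :: "'a => 'c::euclidean_space"
 proof -
  have "integrable lborel (%x. indicator S x *R g x)"
   using assms(2) that by (intro borel_integrable_compact) (auto intro: continuous_on_subset)
  moreover have "(%x. indicator S x *R g x) = g" using that by (auto simp: fun_eq_iff split: split_indicator)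
  ultimately show ?thesis by simp
 qed
 show "integrable lborel f" using * assms by blast
 have "integrable lborel (%x. (norm (f x))\<^sup>2)"
  using assms by (intro *) (auto intro!: continuous_intros)
 then show "sqint f" using assms(1) by (auto simp: sqint_def intro: borel_measurable_continuous_onI)
qed

lemma test_cont: "phi \<in> test Om ==> continuous_on S phi"
 using Ck_continuous test_smooth by blast

lemma test_meas: "phi \<in> test Om ==> phi \<in> borel_measurable borel"
 using test_cont borel_measurable_continuous_onI by blast

lemma test_integrable: "phi \<in> test Om ==> integrable lborel phi"
 and test_sqint: "phi \<in> test Om ==> sqint phi"
 and grad_sqint: "phi \<in> test Om ==> sqint (grad phi)"
 and grad_integrable: "phi \<in> test Om ==> integrable lborel (grad phi)"
proof -
 assume *: "phi \<in> test Om"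
 then obtain S where S: "compact S" "!!x. x ~: S ==> phi x = 0" using test_E by metis
 then have g: "!!x. x ~: S ==> grad phi x = 0" using grad_zero_off compact_imp_closed by metis
 show "integrable lborel phi" "sqint phi" using compact_support_integrable[OF test_cont[OF *] S] by auto
 show "sqint (grad phi)" "integrable lborel (grad phi)"
  using compact_support_integrable[OF grad_test_continuous[OF *] S(1) g] by auto
qed

lemma test_vec_sqint: "phi \<in> test Om ==> sqint (%x. phi x *R v)"
proof -
 assume *: "phi \<in> test Om"
 then obtain S where S: "compact S" "!!x. x ~: S ==> phi x = 0" using test_E by metis
 then show ?thesis by (intro compact_support_integrable(2)[of _ S] continuous_intros test_cont[OF *]) auto
qed

lemma test_bounded:
 assumes "phi \<in> test Om"
 obtains K where "K >= 0" "!!x. \<bar>phi x\<bar> <= K"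
proof -
 obtain S where S: "compact S" "!!x. x ~: S ==> phi x = 0" using assms test_E by metis
 have "bounded (phi ` S)" using compact_continuous_image[OF test_cont[OF assms] S(1)] compact_imp_bounded by blast
 then obtain K where K: "!!x. x \<in> S ==> \<bar>phi x\<bar> <= K" by (auto simp: bounded_iff)
 show ?thesis
 proof (rule that[of "\<bar>K\<bar>"])
  show "\<bar>phi x\<bar> <= \<bar>K\<bar>" for x using K[of x] S(2)[of x] by (cases "x \<in> S") auto
 qed simp
qed

lemma grad_bounded:
 assumes "phi \<in> test Om"
 obtains K where "K >= 0" "!!x. norm (grad phi x) <= K"
proof -
 have "\<exists>K\<ge>0. \<forall>x. \<bar>pd phi i x\<bar> <= K" for i
  using test_bounded[OF test_pd[OF assms]] by metis
 then obtain K where K: "!!i. K i >= 0" "!!i x. \<bar>pd phi i x\<bar> <= K i" by metis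
 show ?thesis
 proof (rule that[of "\<Sum>i\<in>Basis. K i"])
  show "norm (grad phi x) <= (\<Sum>i\<in>Basis. K i)" for x
   using order_trans[OF norm_le_l1[of "grad phi x"] sum_mono[of Basis "%i. \<bar>grad phi x \<bullet> i\<bar>" K]] K(2)
   by (simp add: test_grad_inner[OF assms])
 qed (use K in \<open>auto intro: sum_nonneg\<close>)
qed

lemma test_lipschitz:
 assumes "phi \<in> test Om"
 obtains K where "K >= 0" "!!x y. \<bar>phi x - phi y\<bar> <= K * norm (x - y)"
proof -
 obtain K where K: "K >= 0" "!!x. norm (grad phi x) <= K" using grad_bounded[OF assms] by blast
 have "norm (phi x - phi y) <= K * norm (x - y)" for x y
 proof (rule differentiable_bound[of UNIV phi "%x v. grad phi x \<bullet> v"])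
  show "onorm (%v. grad phi x \<bullet> v) <= K" for x
  proof (rule onorm_le)
   show "norm (grad phi x \<bullet> v) <= K * norm v" for v
    using Cauchy_Schwarz_ineq2[of "grad phi x" v] mult_right_mono[OF K(2)[of x], of "norm v"] by simp
  qed
 qed (use test_has_grad[OF assms] in auto)
 then show ?thesis using that K(1) by (metis real_norm_def)
qed

lemma grad_lipschitz:
 assumes "phi \<in> test Om"
 obtains K where "K >= 0" "!!x y. norm (grad phi x - grad phi y) <= K * norm (x - y)"
proof -
 have "\<exists>K\<ge>0. \<forall>x y. \<bar>pd phi i x - pd phi i y\<bar> <= K * norm (x - y)" for i
  using test_lipschitz[OF test_pd[OF assms]] by metis
 then obtain K where K: "!!i. K i >= 0" "!!i x y. \<bar>pd phi i x - pd phi i y\<bar> <= K i * norm (x - y)" by metis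
 show ?thesis
 proof (rule that[of "\<Sum>i\<in>Basis. K i"])
  show "norm (grad phi x - grad phi y) <= (\<Sum>i\<in>Basis. K i) * norm (x - y)" for x y
   using order_trans[OF norm_le_l1[of "grad phi x - grad phi y"]
     sum_mono[of Basis "%i. \<bar>(grad phi x - grad phi y) \<bullet> i\<bar>" "%i. K i * norm (x - y)"]] K(2)
   by (simp add: inner_diff_left sum_distrib_right test_grad_inner[OF assms])
 qed (use K in \<open>auto intro: sum_nonneg\<close>)
qed

lemma test_taylor:
 assumes "phi \<in> test Om"
 obtains K where "K >= 0" "!!x h. \<bar>phi (x + h) - phi x - pd phi h x\<bar> <= K * (norm h)^2"
proof -
 obtain K where K: "K >= 0" "!!x y. norm (grad phi x - grad phi y) <= K * norm (x - y)"
  using grad_lipschitz[OF assms] by blast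
 have "\<bar>phi (x + h) - phi x - pd phi h x\<bar> <= K * (norm h)^2" for x h
 proof -
  have "\<exists>t\<in>{0..1}. phi (x + 1 *R h) - phi (x + 0 *R h) = pd phi ((1 - 0) *R h) (x + t *R h)"
  proof (rule mvt_very_simple)
   fix t :: real
   have "((%t. phi (x + t *R h)) has_derivative (%s. pd phi (s *R h) (x + t *R h))) (at t)"
    by (rule has_derivative_compose[OF _ test_deriv[OF assms]]) (auto intro!: derivative_eq_intros)
   then show "((%t. phi (x + t *R h)) has_derivative (%s. pd phi ((s) *R h) (x + t *R h))) (at t within {0..1})"
    by (rule has_derivative_at_withinI)
  qed simp
  then obtain t where t: "t \<in> {0..1}" "phi (x + h) - phi x = pd phi h (x + t *R h)" by auto
  have "\<bar>phi (x + h) - phi x - pd phi h x\<bar> = \<bar>(grad phi (x + t *R h) - grad phi x) \<bullet> h\<bar>"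
   by (simp add: t(2) inner_diff_left test_grad_inner[OF assms])
  also have "\<dots> <= norm (grad phi (x + t *R h) - grad phi x) * norm h" by (rule Cauchy_Schwarz_ineq2)
  also have "\<dots> <= (K * norm (t *R h)) * norm h"
   using K(2)[of "x + t *R h" x] by (intro mult_right_mono) auto
  also have "\<dots> <= (K * norm h) * norm h"
   using t(1) K(1) by (intro mult_right_mono mult_left_mono) (auto simp: mult_left_le_one_le)
  finally show ?thesis by (simp add: power2_eq_square mult.assoc)
 qed
 then show ?thesis using that K(1) by blast
qed

lemma test_outside_ball:
 assumes "phi \<in> test Om"
 obtains R where "R > 0" "!!x. norm x >= R ==> phi x = 0"
proof -
 obtain S where S: "compact S" "!!x. x ~: S ==> phi x = 0" using assms test_E by metis
 obtain R where R: "R > 0" "\<forall>x\<in>S. norm x < R" using compact_imp_bounded[OF S(1)] bounded_pos_less by metis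
 show ?thesis by (rule that[of R]) (use S R in force)+
qed

text \<open>Convergence comes from the Taylor estimate; the Lipschitz bound and the compact support dominate the quotients.\<close>

lemma test_quotient:
 assumes phi: "phi \<in> test Om"
 obtains w where "integrable lborel w" "integrable lborel (%x. (w x)\<^sup>2)" "w \<in> borel_measurable borel"
  "!!k x. \<bar>real (Suc k) * (phi (x + v /\<^sub>R real (Suc k)) - phi x)\<bar> <= w x"
  "!!x. (%k. real (Suc k) * (phi (x + v /\<^sub>R real (Suc k)) - phi x)) ---> pd phi v x"
proof -
 obtain R where R: "R > 0" "!!x. norm x >= R ==> phi x = 0" using test_outside_ball[OF phi] by blast
 obtain L where L: "L >= 0" "!!x y. \<bar>phi x - phi y\<bar> <= L * norm (x - y)" using test_lipschitz[OF phi] by blast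
 obtain K where K: "K >= 0" "!!x h. \<bar>phi (x + h) - phi x - pd phi h x\<bar> <= K * (norm h)^2" using test_taylor[OF phi] by blast
 define w where "w x = (L * norm v) * indicator (cball 0 (R + norm v)) x" for x :: 'a
 have i: "integrable lborel (indicator (cball 0 (R + norm v)) :: 'a => real)"
  using emeasure_bounded_finite[of "cball (0::'a) (R + norm v)"] by (intro integrable_real_indicator) auto
 have w: "integrable lborel w" using i unfolding w_def by (rule integrable_mult_right)
 have "(%x. (w x)\<^sup>2) = (%x. (L * norm v)\<^sup>2 * indicator (cball 0 (R + norm v)) x)"
  by (auto simp: w_def fun_eq_iff split: split_indicator)
 then have w2: "integrable lborel (%x. (w x)\<^sup>2)" by (simp only: integrable_mult_right[OF i])
 show ?thesis
 proof (rule that[OF w w2])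
  show "w \<in> borel_measurable borel" using w by auto
  show "\<bar>real (Suc k) * (phi (x + v /\<^sub>R real (Suc k)) - phi x)\<bar> <= w x" for k x
  proof (cases "x \<in> cball 0 (R + norm v)")
   case True
   have "real (Suc k) * \<bar>phi (x + v /\<^sub>R real (Suc k)) - phi x\<bar> <= real (Suc k) * (L * (norm v / real (Suc k)))"
    using L(2)[of "x + v /\<^sub>R real (Suc k)" x] by (intro mult_left_mono) (auto simp: divide_inverse mult_ac)
   then show ?thesis using True by (simp add: w_def abs_mult)
  next
   case False
   have "norm (v /\<^sub>R real (Suc k)) <= norm v"
    using mult_right_mono[of "inverse (real (Suc k))" 1 "norm v"] inverse_le_1_iff[of "real (Suc k)"] by simp
   moreover have "norm x <= norm (x + v /\<^sub>R real (Suc k)) + norm (v /\<^sub>R real (Suc k))"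
    using norm_triangle_ineq4[of "x + v /\<^sub>R real (Suc k)" "v /\<^sub>R real (Suc k)"] by simp
   moreover have "norm v >= 0" "norm x > R + norm v" using False by auto
   ultimately have "norm (x + v /\<^sub>R real (Suc k)) >= R" "norm x >= R" by linarith+
   then show ?thesis using R(2) False by (simp add: w_def)
  qed
  show "(%k. real (Suc k) * (phi (x + v /\<^sub>R real (Suc k)) - phi x)) ---> pd phi v x" for x
  proof (rule LIMSEQ_I, goal_cases)
   case (1 e)
   obtain N where N: "inverse (real (Suc N)) < e / (K * (norm v)^2 + 1)"
    using reals_Archimedean[of "e / (K * (norm v)^2 + 1)"] 1 K(1) by (auto simp: add_nonneg_pos)
   have "norm (real (Suc k) * (phi (x + v /\<^sub>R real (Suc k)) - phi x) - pd phi v x) < e" if "k >= N" for k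
   proof -
    let ?h = "v /\<^sub>R real (Suc k)"
    have lin: "pd phi v x = real (Suc k) * pd phi ?h x"
     using linear_scale[OF pd_linear[OF phi, of x], of "inverse (real (Suc k))" v] by (simp del: of_nat_Suc)
    have "norm (real (Suc k) * (phi (x + ?h) - phi x) - pd phi v x) = real (Suc k) * \<bar>phi (x + ?h) - phi x - pd phi ?h x\<bar>"
     unfolding lin right_diff_distrib[symmetric] by (simp add: abs_mult del: of_nat_Suc)
    also have "\<dots> <= real (Suc k) * (K * (norm ?h)^2)" by (intro mult_left_mono K(2)) auto
    also have "\<dots> = (K * (norm v)^2) * inverse (real (Suc k))"
     by (simp add: power_mult_distrib power2_eq_square field_simps del: of_nat_Suc)
    also have "\<dots> <= (K * (norm v)^2 + 1) * inverse (real (Suc N))"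
     using that K(1) by (intro mult_mono) auto
    also have "\<dots> < e" 
    proof -
     have "0 < K * (norm v)^2 + 1" using K(1) by (intro add_nonneg_pos) auto
     then show ?thesis using N by (simp add: pos_less_divide_eq mult.commute del: of_nat_Suc)
    qed
    finally show ?thesis .
   qed
   then show ?case by blast
  qed
 qed
qed

lemma integral_pd_zero:
 assumes phi: "phi \<in> test Om"
 shows "(LB x. pd phi v x) = 0"
proof -
 note [measurable] = test_meas[OF phi] test_meas[OF test_pd[OF phi]]
 obtain w where w: "integrable lborel w" "!!k x. \<bar>real (Suc k) * (phi (x + v /\<^sub>R real (Suc k)) - phi x)\<bar> <= w x"
  "!!x. (%k. real (Suc k) * (phi (x + v /\<^sub>R real (Suc k)) - phi x)) ---> pd phi v x"
  using test_quotient[OF phi] by metis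
 have "(%k. \<integral>x. real (Suc k) * (phi (x + v /\<^sub>R real (Suc k)) - phi x) \<partial>lborel) ---> (LB x. pd phi v x)"
  by (rule integral_dominated_convergence[where w = w]) (use w in \<open>auto simp del: of_nat_Suc\<close>)
 moreover have "(LB x. real (Suc k) * (phi (x + v /\<^sub>R real (Suc k)) - phi x)) = 0" for k
 proof -
  have "integrable lborel (%x. phi (v /\<^sub>R real (Suc k) + x))"
   using integrable_dmap[OF test_integrable[OF phi], of "%_. 1" "v /\<^sub>R real (Suc k)"] by (simp add: dmap_const)
  then show ?thesis
   using test_integrable[OF phi] integral_shift[OF test_meas[OF phi], of "v /\<^sub>R real (Suc k)"]
   by (simp add: add.commute del: of_nat_Suc)
 qed
 ultimately show ?thesis by (simp add: LIMSEQ_const_iff)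
qed

lemma pd_mult:
 assumes "smooth f" "smooth g"
 shows "pd (%x. f x * g x) v x = f x * pd g v x + pd f v x * g x"
proof -
 have "((%x. f x * g x) has_derivative (%v. f x * pd g v x + pd f v x * g x)) (at x)"
  using assms by (intro has_derivative_mult Ck_Suc_derivative[of 0]) blast+
 from frechet_derivative_at[OF this] show ?thesis unfolding pd_def by metis
qed

lemma integration_by_parts:
 assumes phi: "phi \<in> test Om" and f: "smooth f"
 shows "(LB x. f x * pd phi v x) = - (LB x. pd f v x * phi x)"
proof -
 have s: "smooth phi" using test_smooth[OF phi] by blast
 have "(LB x. f x * pd phi v x + pd f v x * phi x) = 0"
  using integral_pd_zero[OF test_mult[OF phi f], of v] by (simp add: pd_mult[OF f s])
 moreover have "integrable lborel (%x. f x * pd phi v x)"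
  by (rule test_integrable[OF test_mult[OF test_pd[OF phi] f]])
 moreover have "integrable lborel (%x. pd f v x * phi x)"
  by (rule test_integrable[OF test_mult[OF phi]]) (use f Ck_pd in blast)
 ultimately show ?thesis by simp
qed

text \<open>Telescoping reduces a translation to arbitrarily short ones, for which the difference quotient
 converges to the derivative.\<close>

lemma translation_estimate:
 assumes phi: "phi \<in> test Om"
 shows "(LB x. (phi (x + y) - phi x)\<^sup>2) <= (norm y)^2 * (LB x. (norm (grad phi x))\<^sup>2)"
proof -
 note [measurable] = test_meas[OF phi] test_meas[OF test_pd[OF phi]]
 define S where "S t = toL2 (%x. phi (t + x))" for t
 have sq: "sqint (%x. phi (t + x))" for t
  using integrable_dmap[of "%x. (norm (phi x))\<^sup>2" "%_. 1" t] test_sqint[OF phi]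
  by (auto simp: sqint_def dmap_const)
 have d: "S s - S t = toL2 (%x. phi (s + x) - phi (t + x))" for s t
  unfolding S_def by (rule toL2_diff[OF sq sq])
 have n: "(norm (S s - S t))^2 = (LB x. (phi (s + x) - phi (t + x))\<^sup>2)" for s t
  unfolding d by (subst norm_toL2[OF sqint_diff[OF sq sq]]) simp
 have inv: "norm (S (r + s) - S (r + t)) = norm (S s - S t)" for r s t
 proof -
  have "(norm (S (r + s) - S (r + t)))^2 = (norm (S s - S t))^2"
   unfolding n using integral_shift[of "%x. (phi (s + x) - phi (t + x))\<^sup>2" r] by (simp add: add.assoc add.left_commute)
  then show ?thesis by simp
 qed
 have tele: "norm (S y - S 0) <= real (Suc k) * norm (S (y /\<^sub>R real (Suc k)) - S 0)" for k
 proof -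
  let ?h = "y /\<^sub>R real (Suc k)"
  have "norm (S (real j *R ?h) - S 0) <= real j * norm (S ?h - S 0)" for j
  proof (induction j)
   case (Suc j)
   have "norm (S (real (Suc j) *R ?h) - S 0) <= norm (S (real j *R ?h + ?h) - S (real j *R ?h + 0)) + norm (S (real j *R ?h) - S 0)"
    using norm_triangle_ineq[of "S (real j *R ?h + ?h) - S (real j *R ?h)" "S (real j *R ?h) - S 0"]
    by (simp add: algebra_simps)
   then show ?case using Suc unfolding inv by (simp add: algebra_simps)
  qed simp
  from this[of "Suc k"] show ?thesis by (simp del: of_nat_Suc)
 qed
 obtain w where w: "integrable lborel (%x. (w x)\<^sup>2)" "!!k x. \<bar>real (Suc k) * (phi (x + y /\<^sub>R real (Suc k)) - phi x)\<bar> <= w x"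
  "!!x. (%k. real (Suc k) * (phi (x + y /\<^sub>R real (Suc k)) - phi x)) ---> pd phi y x" "w \<in> borel_measurable borel"
  using test_quotient[OF phi] by metis
 note [measurable] = w(4)
 have "(%k. \<integral>x. (real (Suc k) * (phi (x + y /\<^sub>R real (Suc k)) - phi x))\<^sup>2 \<partial>lborel) ---> (LB x. (pd phi y x)\<^sup>2)"
 proof (rule integral_dominated_convergence[where w = "%x. (w x)\<^sup>2"])
  show "AEL x. (%k. (real (Suc k) * (phi (x + y /\<^sub>R real (Suc k)) - phi x))\<^sup>2) ---> (pd phi y x)\<^sup>2"
   by (intro AE_I2 tendsto_intros w)
  show "AEL x. norm ((real (Suc k) * (phi (x + y /\<^sub>R real (Suc k)) - phi x))^2) <= (w x)^2" for k
   using order_trans[OF w(2) abs_ge_self] by (intro AE_I2) (auto simp del: of_nat_Suc simp: abs_le_square_iff[symmetric])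
 qed (use w in auto)
 moreover have "(LB x. (real (Suc k) * (phi (x + y /\<^sub>R real (Suc k)) - phi x))\<^sup>2) = (real (Suc k) * norm (S (y /\<^sub>R real (Suc k)) - S 0))^2" for k
  unfolding power_mult_distrib n by (simp add: add.commute del: of_nat_Suc)
 ultimately have "(norm (S y - S 0))^2 <= (LB x. (pd phi y x)\<^sup>2)"
  using tele by (intro LIMSEQ_le_const) (auto intro!: power_mono simp del: of_nat_Suc)
 also have "\<dots> <= (LB x. (norm y)\<^sup>2 * (norm (grad phi x))^2)"
 proof (rule integral_mono)
  show "integrable lborel (%x. (pd phi y x)\<^sup>2)" using test_sqint[OF test_pd[OF phi], of y] by (simp add: sqint_def)
  show "integrable lborel (%x. (norm y)\<^sup>2 * (norm (grad phi x))^2)"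
   using grad_sqint[OF phi] by (simp add: sqint_def)
  show "(pd phi y x)^2 <= (norm y)^2 * (norm (grad phi x))^2" for x
   using Cauchy_Schwarz_ineq2[of "grad phi x" y] unfolding test_grad_inner[OF phi] power_mult_distrib[symmetric]
   by (simp add: abs_le_square_iff[symmetric] abs_mult mult.commute)
 qed
 finally show ?thesis by (simp add: n add.commute)
qed

section \<open>The space of pairs (function, gradient)\<close>

text \<open>Functions on all domains are extended by zero and live in one space, in which the second component is determined by the
 first (\<open>gradient_unique\<close>).\<close>

definition H10 :: "'a::euclidean_space set => (('a, real) L2 \<times> ('a, 'a) L2) set" where
 "H10 Om = closure ((%phi. (toL2 phi, toL2 (grad phi))) ` test Om)"

abbreviation gp :: "('a::euclidean_space => real) => ('a, real) L2 \<times> ('a, 'a) L2" where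
 "gp phi \<equiv> (toL2 phi, toL2 (grad phi))"

lemma gp_H10: "phi \<in> test Om ==> gp phi \<in> H10 Om"
 unfolding H10_def by (rule subsetD[OF closure_subset], rule imageI)

lemma H10_closed: "closed (H10 Om)"
 by (simp add: H10_def)

lemma H10_mono: "Om \<subseteq> Om' ==> H10 Om \<subseteq> H10 Om'"
 unfolding H10_def by (intro closure_mono image_mono) (auto intro: test_mono)

lemma H10_subset: "closed S ==> (!!phi. phi \<in> test Om ==> gp phi \<in> S) ==> H10 Om \<subseteq> S"
 unfolding H10_def by (intro closure_minimal) auto

lemma subspace_closure:
 fixes S :: "'v::real_normed_vector set"
 assumes "subspace S"
 shows "subspace (closure S)"
proof (rule subspaceI)
 show "0 \<in> closure S" using subspace_0[OF assms] closure_subset by blast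
 fix x y assume "x \<in> closure S" "y \<in> closure S"
 then obtain f g where f: "!!n. f n \<in> S" "f ---> x" "!!n. g n \<in> S" "g ---> y"
  unfolding closure_sequential by blast
 then have "!!n. f n + g n \<in> S" "(%n. f n + g n) ---> x + y"
  using subspace_add[OF assms] by (auto intro: tendsto_add)
 then show "x + y \<in> closure S" unfolding closure_sequential by (intro exI[of _ "%n. f n + g n"]) auto
next
 fix c x assume "x \<in> closure S"
 then obtain f where f: "!!n. f n \<in> S" "f ---> x"
  unfolding closure_sequential by blast
 then have "!!n. c *R f n \<in> S" "(%n. c *R f n) ---> c *R x"
  using subspace_scale[OF assms] by (auto intro: tendsto_intros)
 then show "c *R x \<in> closure S" unfolding closure_sequential by (intro exI[of _ "%n. c *R f n"]) auto
qed

lemma H10_subspace: "subspace (H10 Om)"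
 unfolding H10_def
proof (intro subspace_closure subspaceI)
 show "0 \<in> gp ` test Om"
 proof (rule image_eqI[OF _ test_zero])
  have "grad (%x::'a. 0) = (%x. 0)" by (rule ext) (rule grad_zero_off[of "{}"], auto)
  then show "0 = gp (%x::'a. 0)" by (simp add: zero_prod_def toL2_zero)
 qed
 show "p + q \<in> gp ` test Om" if pq: "p \<in> gp ` test Om" "q \<in> gp ` test Om" for p q
 proof -
  obtain phi psi where *: "phi \<in> test Om" "psi \<in> test Om" "p = gp phi" "q = gp psi"
   using pq by (elim imageE) metis
  have "grad (%x. phi x + psi x) = (%x. grad phi x + grad psi x)" using grad_add[OF *(1,2)] by blast
  then have "p + q = gp (%x. phi x + psi x)"
   using * by (simp add: toL2_add test_sqint grad_sqint)
  then show ?thesis using test_add[OF *(1,2)] by blast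
 qed
 show "c *R p \<in> gp ` test Om" if p: "p \<in> gp ` test Om" for c p
 proof -
  obtain phi where *: "phi \<in> test Om" "p = gp phi" using p by (elim imageE) metis
  have "grad (%x. c * phi x) = (%x. c *R grad phi x)" using grad_scale[OF *(1)] by blast
  then have "c *R p = gp (%x. c * phi x)"
   using * toL2_scale[OF test_sqint[OF *(1)], of c] by (simp add: toL2_scale grad_sqint)
  then show ?thesis using test_scale[OF *(1)] by blast
 qed
qed

lemma H10_approx:
 assumes "p \<in> H10 Om"
 obtains phi where "!!n. phi n \<in> test Om" "(%n::nat. gp (phi n)) ---> p"
proof -
 obtain x where x: "!!n. x n \<in> gp ` test Om" "x ---> p"
  using assms unfolding H10_def closure_sequential by blast
 have "\<exists>phi. phi \<in> test Om & x n = gp phi" for n using x(1) by blast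
 then obtain phi where "!!n. phi n \<in> test Om" "!!n. x n = gp (phi n)" by metis
 moreover from this have "x = (%n. gp (phi n))" by blast
 ultimately show ?thesis using that[of phi] x(2) by simp
qed

lemma weak_derivative:
 assumes p: "(U, G) \<in> H10 UNIV" and psi: "psi \<in> test Om"
 shows "G \<bullet> toL2 (%x. psi x *R v) = - (U \<bullet> toL2 (pd psi v))"
proof -
 have "H10 UNIV \<subseteq> {p. snd p \<bullet> toL2 (%x. psi x *R v) = - (fst p \<bullet> toL2 (pd psi v))}"
 proof (rule H10_subset)
  show "closed {p :: ('a, real) L2 \<times> ('a, 'a) L2. snd p \<bullet> toL2 (%x. psi x *R v) = - (fst p \<bullet> toL2 (pd psi v))}"
   by (intro closed_Collect_eq continuous_intros)
  fix phi :: "'a => real" assume phi: "phi \<in> test UNIV"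
  have "toL2 (grad phi) \<bullet> toL2 (%x. psi x *R v) = (LB x. pd phi v x * psi x)"
   by (simp add: inner_toL2 grad_sqint[OF phi] test_vec_sqint[OF psi] test_grad_inner[OF phi] mult.commute)
  also have "\<dots> = - (LB x. phi x * pd psi v x)"
   using integration_by_parts[OF psi, of phi v] test_smooth[OF phi] by simp
  also have "(LB x. phi x * pd psi v x) = toL2 phi \<bullet> toL2 (pd psi v)"
   by (simp add: inner_toL2 test_sqint[OF phi] test_sqint[OF test_pd[OF psi]])
  finally show "gp phi \<in> {p. snd p \<bullet> toL2 (%x. psi x *R v) = - (fst p \<bullet> toL2 (pd psi v))}" by simp
 qed
 then show ?thesis using p by auto
qed

definition lap :: "('a::euclidean_space => real) => 'a => real" where
 "lap f x = (\<Sum>i\<in>Basis. pd (pd f i) i x)"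

lemma test_lap: "phi \<in> test Om ==> lap phi \<in> test Om"
proof -
 assume *: "phi \<in> test Om"
 have "(%x. \<Sum>i\<in>I. pd (pd phi i) i x) \<in> test Om" for I
  by (induction I rule: infinite_finite_induct) (auto intro!: test_zero test_add test_pd *)
 then show ?thesis unfolding lap_def[abs_def] .
qed

lemma grad_eq_sum: "grad phi x = (\<Sum>i\<in>Basis. pd phi i x *R i)"
 by (simp add: grad_def pd_def)

lemma toL2_sum:
 assumes "!!i. i \<in> I ==> sqint (f i)"
 shows "(\<Sum>i\<in>I. toL2 (f i)) = toL2 (%x. \<Sum>i\<in>I. f i x) & sqint (%x. \<Sum>i\<in>I. f i x)"
 using assms
proof (induction I rule: infinite_finite_induct)
 case (insert i I)
 then show ?case using toL2_add[of "f i" "%x. \<Sum>i\<in>I. f i x"] sqint_add[of "f i" "%x. \<Sum>i\<in>I. f i x"] by simp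
qed (auto simp: toL2_zero sqint_zero)

lemma weak_laplacian:
 assumes p: "(U, G) \<in> H10 UNIV" and psi: "psi \<in> test Om"
 shows "G \<bullet> toL2 (grad psi) = - (U \<bullet> toL2 (lap psi))"
proof -
 have "toL2 (grad psi) = (\<Sum>i\<in>Basis. toL2 (%x. pd psi i x *R i))"
  unfolding grad_eq_sum[abs_def]
  by (rule conjunct1[OF toL2_sum, symmetric]) (rule test_vec_sqint[OF test_pd[OF psi]])
 moreover have "toL2 (lap psi) = (\<Sum>i\<in>Basis. toL2 (pd (pd psi i) i))"
  unfolding lap_def[abs_def]
  by (rule conjunct1[OF toL2_sum, symmetric]) (rule test_sqint[OF test_pd[OF test_pd[OF psi]]])
 ultimately show ?thesis
  by (simp add: inner_sum_right weak_derivative[OF p test_pd[OF psi]] sum_negf)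
qed

text \<open>Integration by parts shows that \<open>G\<close> is orthogonal to all gradients of test functions, hence to its own limit \<open>G\<close>.\<close>

lemma gradient_unique:
 assumes "(0, G) \<in> H10 Om"
 shows "G = 0"
proof -
 have G: "(0, G) \<in> H10 UNIV" using assms H10_mono[of Om UNIV] by auto
 have "H10 UNIV \<subseteq> {p. G \<bullet> snd p = 0}"
  by (rule H10_subset) (auto simp: weak_laplacian[OF G] intro!: closed_Collect_eq continuous_intros)
 then show ?thesis using G by auto
qed

lemma gradient_unique': "(U, G) \<in> H10 Om ==> (U, G') \<in> H10 Om' ==> G = G'"
 using gradient_unique[of "G - G'" UNIV] subspace_diff[OF H10_subspace, of "(U, G)" UNIV "(U, G')"]
  H10_mono[of Om UNIV] H10_mono[of Om' UNIV] by auto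

subsection \<open>Functions vanishing on a set\<close>

definition vanish :: "'a::euclidean_space set => ('a, 'b::euclidean_space) L2 set" where
 "vanish A = {U. AEL x. x \<in> A --> L2f U x = 0}"

lemma vanish_toL2: "sqint f ==> toL2 f \<in> vanish A \<longleftrightarrow> (AEL x. x \<in> A --> f x = 0)"
 unfolding vanish_def mem_Collect_eq using L2f_toL2[of f]
 by (auto elim: eventually_elim2)

lemma sqint_indicator:
 assumes "sqint f" "A \<in> sets borel"
 shows "sqint (%x. indicator A x *R f x)"
proof (rule sqint_bound[OF assms(1)])
 show "(%x. indicator A x *R f x) \<in> borel_measurable borel"
  using sqint_meas[OF assms(1)] assms(2) by measurable
 show "norm (indicator A x *R f x) <= norm (f x)" for x by (simp add: indicator_def)
qed

lemma vanish_closed: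
 assumes [measurable]: "A \<in> sets borel"
 shows "closed (vanish A :: ('a::euclidean_space, 'b::euclidean_space) L2 set)"
proof -
 have "vanish A = (\<Inter>V\<in>vanish (-A). {U :: ('a, 'b) L2. U \<bullet> V = 0})"
 proof (intro equalityI subsetI INT_I CollectI)
  fix U V :: "('a, 'b) L2" assume "U \<in> vanish A" "V \<in> vanish (-A)"
  then have "AEL x. x \<in> A --> L2f U x = 0" "AEL x. x \<in> - A --> L2f V x = 0"
   by (simp_all add: vanish_def)
  then have "AEL x. L2f U x \<bullet> L2f V x = 0" by eventually_elim auto
  then show "U \<bullet> V = 0" unfolding inner_L2f by (subst integral_cong_AE[where g = "%x. 0"]) auto
 next
  fix U :: "('a, 'b) L2" assume *: "U \<in> (\<Inter>V\<in>vanish (-A). {U. U \<bullet> V = 0})"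
  have si: "sqint (%x. indicator A x *R L2f U x)" by (intro sqint_indicator sqint_L2f) auto
  have "toL2 (%x. indicator A x *R L2f U x) \<in> vanish (-A)" by (simp add: vanish_toL2[OF si])
  with * have "toL2 (L2f U) \<bullet> toL2 (%x. indicator A x *R L2f U x) = 0" by simp
  then have "(LB x. L2f U x \<bullet> (indicator A x *R L2f U x)) = 0"
   by (subst (asm) inner_toL2[OF sqint_L2f si])
  then have "AEL x. L2f U x \<bullet> (indicator A x *R L2f U x) = 0"
   by (subst (asm) integral_nonneg_eq_0_iff_AE[OF sqint_inner[OF sqint_L2f si]]) auto
  then show "U \<in> vanish A" unfolding vanish_def by (auto elim!: eventually_mono)
 qed
 moreover have "closed {U :: ('a, 'b) L2. U \<bullet> V = 0}" for V by (intro closed_Collect_eq continuous_intros)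
 ultimately show ?thesis by (metis (no_types, lifting) closed_INT)
qed

lemma H10_vanish:
 assumes "open Om" "p \<in> H10 Om"
 shows "fst p \<in> vanish (- Om)" "snd p \<in> vanish (- Om)"
proof -
 have "H10 Om \<subseteq> fst -` vanish (-Om) \<inter> snd -` vanish (-Om)"
 proof (rule H10_subset)
  show "closed (fst -` vanish (-Om) \<inter> snd -` vanish (-Om) :: (('a, real) L2 \<times> ('a, 'a) L2) set)"
   using assms(1) by (intro closed_Int closed_vimage_fst closed_vimage_snd vanish_closed) auto
  fix phi assume *: "phi \<in> test Om"
  obtain S where S: "compact S" "S \<subseteq> Om" "!!x. x ~: S ==> phi x = 0" using test_E[OF *] by metis
  have "grad phi x = 0" if "x ~: S" for x using grad_zero_off[OF compact_imp_closed] S that by metis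
  then show "gp phi \<in> fst -` vanish (-Om) \<inter> snd -` vanish (-Om)"
   using S by (auto simp: vanish_toL2 test_sqint[OF *] grad_sqint[OF *])
 qed
 then show "fst p \<in> vanish (- Om)" "snd p \<in> vanish (- Om)" using assms(2) by auto
qed

lemma vanish_integrable:
 assumes "U \<in> vanish (- B)" "bounded B"
 shows "integrable lborel (L2f U)"
proof -
 obtain R where R: "B \<subseteq> cball 0 R" 
  using bounded_subset_ballD[OF assms(2), of 0] ball_subset_cball by (meson subset_trans)
 have sc: "sqint (%x::'a. indicator (cball 0 R) x :: real)"
 proof -
  have "integrable lborel (indicator (cball 0 R) :: 'a => real)"
   using emeasure_bounded_finite[of "cball (0::'a) R"] by (intro integrable_real_indicator) auto
  moreover have "(%x::'a. (norm (indicator (cball 0 R) x :: real))\<^sup>2) = (indicator (cball 0 R) :: 'a => real)"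
   by (rule ext) (simp add: indicator_def)
  ultimately show ?thesis by (simp only: sqint_def) simp
 qed
 have sn: "sqint (%x. norm (L2f U x))" using sqint_L2f[of U] by (auto simp: sqint_def)
 have "integrable lborel (%x. norm (L2f U x) * indicator (cball 0 R) x)"
  using sqint_inner[OF sn sc] by simp
 then have "integrable lborel (%x. norm (L2f U x))"
 proof (rule integrable_cong_AE_imp)
  show "AEL x. norm (L2f U x) * indicator (cball 0 R) x = norm (L2f U x)"
   using assms(1) R unfolding vanish_def by (auto elim!: eventually_mono split: split_indicator)
 qed simp
 then show ?thesis by (simp add: integrable_norm_iff)
qed

section \<open>Mollification\<close>

definition conv :: "('a::euclidean_space => real) => ('a => 'b::euclidean_space) => 'a => 'b" where
 "conv rho f x = (LB y. rho (x - y) *R f y)"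

definition mollifier :: "real => ('a::euclidean_space => real) => bool" where
 "mollifier eps rho \<longleftrightarrow> rho \<in> test UNIV & (\<forall>y. rho y >= 0) & (LB y. rho y) = 1 &
   (\<forall>y. eps <= norm y --> rho y = 0)"

lemma mollifier_exists:
 assumes "eps > 0"
 obtains rho :: "'a::euclidean_space => real" where "mollifier eps rho"
proof -
 define b :: "'a => real" where "b y = bump (0 + (1/eps) *R y)" for y
 have b: "b \<in> test UNIV"
 proof (rule test_I[of _ "cball 0 eps"])
  show "smooth b" unfolding b_def[abs_def] by (intro allI Ck_affine smooth_bump bounded_linear_scaleR_right)
  show "b x = 0" if "x ~: cball 0 eps" for x
   using that assms unfolding b_def by (intro bump_zero) (auto simp: field_simps)
 qed auto
 have b0: "b y >= 0" for y by (simp add: b_def bump_nonneg)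
 have z: "b y = 0" if "eps <= norm y" for y
  using that assms unfolding b_def by (intro bump_zero) (auto simp: field_simps)
 have "(LB y. b y) ~= 0"
 proof
  assume "(LB y. b y) = 0"
  then have ae: "AEL y. b y = 0"
   using integral_nonneg_eq_0_iff_AE[OF test_integrable[OF b]] b0 by auto
  have pos: "b y > 0" if "y \<in> ball 0 eps" for y
   using that assms unfolding b_def by (intro bump_pos) (auto simp: field_simps)
  have "AEL y. y ~: ball (0::'a) eps"
   using ae by eventually_elim (use pos in force)
  then have "emeasure lborel (ball (0::'a) eps) = 0"
   by (subst (asm) AE_iff_measurable[of "ball 0 eps"]) auto
  then have "negligible (ball (0::'a) eps)" by (simp add: negligible_iff_emeasure0)
  then show False using assms by (metis interior_open open_ball ball_eq_empty negligible_imp_sets open_not_negligible not_le)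
 qed
 moreover have "(LB y. b y) >= 0" using b0 by (intro Bochner_Integration.integral_nonneg) auto
 ultimately have "mollifier eps (%y. (1 / (LB y. b y)) * b y)"
  unfolding mollifier_def using b b0 z
  by (auto intro!: test_scale[OF b, of "1 / (LB y. b y)", simplified])
 then show ?thesis by (rule that)
qed

lemma reflect_test: "rho \<in> test UNIV ==> (%y. rho (x - y)) \<in> test UNIV"
 and pd_reflect: "rho \<in> test UNIV ==> pd (%y. rho (x - y)) v y = - pd rho v (x - y)"
proof -
 assume *: "rho \<in> test UNIV"
 have L: "linear (uminus :: 'a => 'a)" by (simp add: linear_uminus)
 show 1: "(%y. rho (x - y)) \<in> test UNIV"
  using test_affine(1)[OF *, of uminus uminus x] L by simp
 have "grad (%y. rho (x - y)) y = - grad rho (x - y)"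
  using test_affine(2)[OF *, of uminus uminus x y] L by simp
 then show "pd (%y. rho (x - y)) v y = - pd rho v (x - y)"
  using test_grad_inner[OF 1, of y v] test_grad_inner[OF *, of "x - y" v] by simp
qed

lemma conv_inner:
 assumes "rho \<in> test UNIV"
 shows "conv rho (L2f U) x = (toL2 (%y. rho (x - y)) \<bullet> (U :: ('a::euclidean_space, real) L2))"
 unfolding conv_def inner_toL2[OF test_sqint[OF reflect_test[OF assms]] sqint_L2f, of x U, simplified]
 by simp

lemma conv_integrable:
 assumes "rho \<in> test UNIV" "sqint f"
 shows "integrable lborel (%y. rho (x - y) *R f y)"
proof (rule Bochner_Integration.integrable_bound)
 have r: "sqint (%y. rho (x - y))" using test_sqint[OF reflect_test[OF assms(1)]] .
 then show "integrable lborel (%y. (norm (rho (x - y)))\<^sup>2 + (norm (f y))^2)" using assms(2) by (simp add: sqint_def)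
 have "\<bar>a\<bar> * b <= a\<^sup>2 + b^2" if "b >= 0" for a b :: real
 proof -
  have "2 * \<bar>a\<bar> * b <= a\<^sup>2 + b^2" using sum_squares_bound[of "\<bar>a\<bar>" b] by simp
  moreover have "\<bar>a\<bar> * b >= 0" using that by simp
  ultimately show ?thesis by linarith
 qed
 then show "AEL y. norm (rho (x - y) *R f y) <= norm ((norm (rho (x - y)))^2 + (norm (f y))^2)"
  by (auto simp: abs_of_nonneg)
 show "(%y. rho (x - y) *R f y) \<in> borel_measurable lborel"
  using sqint_meas[OF r] sqint_meas[OF assms(2)] by measurable
qed

lemma conv_meas:
 assumes [measurable]: "rho \<in> borel_measurable borel" "f \<in> borel_measurable borel"
 shows "conv rho f \<in> borel_measurable borel"
proof -
 have "(%x. \<integral>y. rho (x - y) *R f y \<partial>lborel) \<in> borel_measurable lborel"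
  by (rule lborel.borel_measurable_lebesgue_integral) measurable
 then show ?thesis by (simp add: conv_def[abs_def])
qed

text \<open>Jensen's inequality for the squared norm: expand the variance.\<close>

lemma norm_average_squared_le:
 fixes f :: "'a::euclidean_space => 'b::euclidean_space"
 assumes "!!y. k y >= 0" "integrable lborel k" "(LB y. k y) = 1"
  "integrable lborel (%y. k y *R f y)" "integrable lborel (%y. k y * (norm (f y))^2)"
 shows "(norm (LB y. k y *R f y))^2 <= (LB y. k y * (norm (f y))^2)"
proof -
 define m where "m = (LB y. k y *R f y)"
 have eq: "k y * (norm (f y - m))^2 = k y * (norm (f y))^2 - 2 * ((k y *R f y) \<bullet> m) + (norm m)^2 * k y" for y
  by (simp add: power2_norm_eq_inner inner_diff inner_commute algebra_simps)
 have "0 <= (LB y. k y * (norm (f y - m))^2)"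
  using assms(1) by (intro Bochner_Integration.integral_nonneg) auto
 also have "\<dots> = (LB y. k y * (norm (f y))^2) - 2 * (m \<bullet> m) + (norm m)^2"
 proof -
  have "integrable lborel (%y. 2 * ((k y *R f y) \<bullet> m))"
   "(LB y. 2 * ((k y *R f y) \<bullet> m)) = 2 * (m \<bullet> m)"
   using integrable_inner_left[OF assms(4), of m] integral_inner_left[OF assms(4), of m]
   by (auto simp only: m_def integral_mult_right_zero intro: integrable_mult_right)
  then show ?thesis unfolding eq using assms(2,3,5) by simp
 qed
 finally show ?thesis by (simp add: m_def power2_norm_eq_inner)
qed

lemma mollifier_test: "mollifier eps rho ==> rho \<in> test UNIV"
 by (simp add: mollifier_def)

lemma mollifier_integral: "mollifier eps rho ==> (LB y. rho (x - y)) = 1"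
 by (subst integral_reflect_point[OF test_meas[OF mollifier_test]]) (auto simp: mollifier_def)

lemma test_mult_integrable:
 fixes g :: "'a::euclidean_space => real"
 assumes "rho \<in> test UNIV" "integrable lborel g"
 shows "integrable lborel (%y. rho (x - y) * g y)"
proof -
 obtain K where K: "K >= 0" "!!x. \<bar>rho x\<bar> <= K" using test_bounded[OF assms(1)] by blast
 show ?thesis
 proof (rule Bochner_Integration.integrable_bound)
  show "integrable lborel (%y. K * norm (g y))" using assms(2) by auto
  show "(%y. rho (x - y) * g y) \<in> borel_measurable lborel"
   using test_meas[OF reflect_test[OF assms(1)]] assms(2) by measurable
  show "AEL y. norm (rho (x - y) * g y) <= norm (K * norm (g y))"
   using K by (intro AE_I2) (auto simp: abs_mult intro!: mult_right_mono)
 qed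
qed

lemma conv_L2:
 fixes f :: "'a::euclidean_space => 'b::euclidean_space"
 assumes rho: "mollifier eps rho" and f: "sqint f"
 shows "sqint (conv rho f)" "norm (toL2 (conv rho f)) <= norm (toL2 f)"
proof -
 note r = mollifier_test[OF rho]
 note [measurable] = test_meas[OF r] sqint_meas[OF f]
 have i: "integrable lborel (%y. rho (x - y) * (norm (f y))^2)" for x
  using f by (intro test_mult_integrable[OF r]) (simp add: sqint_def)
 have p: "rho y >= 0" for y using rho by (simp add: mollifier_def)
 have 1: "(norm (conv rho f x))^2 <= (LB y. rho (x - y) * (norm (f y))^2)" for x
  unfolding conv_def
  using p i conv_integrable[OF r f] mollifier_integral[OF rho] test_integrable[OF reflect_test[OF r]]
  by (intro norm_average_squared_le) auto
 have "(\<integral>\<^sup>+x. ennreal ((norm (conv rho f x))^2) \<partial>lborel) <= (\<integral>\<^sup>+x. \<integral>\<^sup>+y. ennreal (rho (x - y) * (norm (f y))^2) \<partial>lborel \<partial>lborel)"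
  using 1 i p by (intro nn_integral_mono) (subst nn_integral_eq_integral, auto intro: ennreal_leI)
 also have "\<dots> = (\<integral>\<^sup>+y. \<integral>\<^sup>+x. ennreal (rho (x - y) * (norm (f y))^2) \<partial>lborel \<partial>lborel)"
  by (rule lborel_pair.Fubini') measurable
 also have "\<dots> = (\<integral>\<^sup>+y. ennreal ((norm (f y))^2) \<partial>lborel)"
 proof (rule nn_integral_cong)
  fix y
  have "(\<integral>\<^sup>+x. ennreal (rho (x - y) * (norm (f y))^2) \<partial>lborel) = ennreal ((norm (f y))^2) * (\<integral>\<^sup>+x. ennreal (rho (- y + x)) \<partial>lborel)"
   using p by (subst nn_integral_cmult[symmetric]) (auto simp: ennreal_mult mult.commute)
  also have "(\<integral>\<^sup>+x. ennreal (rho (- y + x)) \<partial>lborel) = (\<integral>\<^sup>+x. ennreal (rho x) \<partial>lborel)"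
   by (rule nn_integral_shift) measurable
  also have "\<dots> = 1"
   using rho test_integrable[OF r] p by (subst nn_integral_eq_integral) (auto simp: mollifier_def)
  finally show "(\<integral>\<^sup>+x. ennreal (rho (x - y) * (norm (f y))^2) \<partial>lborel) = ennreal ((norm (f y))^2)" by simp
 qed
 also have "\<dots> = ennreal ((norm (toL2 f))^2)"
  unfolding norm_toL2[OF f] using f by (intro nn_integral_eq_integral) (auto simp: sqint_def)
 finally have *: "(\<integral>\<^sup>+x. ennreal ((norm (conv rho f x))^2) \<partial>lborel) <= ennreal ((norm (toL2 f))^2)" .
 have m: "conv rho f \<in> borel_measurable borel" by (rule conv_meas) measurable
 show "sqint (conv rho f)" using sqint_nn(1)[OF m *] by simp
 have "(norm (toL2 (conv rho f)))^2 <= (norm (toL2 f))^2" using sqint_nn(2)[OF m *] by simp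
 then show "norm (toL2 (conv rho f)) <= norm (toL2 f)" by (rule power2_le_imp_le) simp
qed

lemma conv_cong_AE:
 assumes "f \<in> borel_measurable borel" "g \<in> borel_measurable borel" "rho \<in> borel_measurable borel"
  "AEL x. f x = g x"
 shows "conv rho f = conv rho g"
proof
 note [measurable] = assms(1-3)
 show "conv rho f x = conv rho g x" for x
  unfolding conv_def by (rule integral_cong_AE) (use assms(4) in auto)
qed

lemma conv_toL2: "sqint f ==> rho \<in> test UNIV ==> conv rho (L2f (toL2 f)) = conv rho f"
 by (intro conv_cong_AE L2f_toL2 L2f_meas sqint_meas test_meas)

definition moll :: "('a::euclidean_space => real) => ('a, 'b::euclidean_space) L2 => ('a, 'b) L2" where
 "moll rho U = toL2 (conv rho (L2f U))"

lemma moll_norm: "mollifier eps rho ==> norm (moll rho U) <= norm U"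
 using conv_L2(2)[of eps rho "L2f U"] by (simp add: moll_def sqint_L2f)

lemma moll_diff:
 assumes rho: "mollifier eps rho"
 shows "moll rho (U - V) = moll rho U - moll rho V"
proof -
 note r = mollifier_test[OF rho]
 have "conv rho (L2f (U - V)) = conv rho (%x. L2f U x - L2f V x)"
  using test_meas[OF r] by (intro conv_cong_AE L2f_diff) measurable
 also have "\<dots> = (%x. conv rho (L2f U) x - conv rho (L2f V) x)"
  unfolding conv_def using conv_integrable[OF r sqint_L2f[of U]] conv_integrable[OF r sqint_L2f[of V]]
  by (simp add: scaleR_diff_right)
 finally show ?thesis
  unfolding moll_def using toL2_diff[OF conv_L2(1)[OF rho sqint_L2f[of U]] conv_L2(1)[OF rho sqint_L2f[of V]]] by simp
qed

lemma moll_continuous: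
 assumes "mollifier eps rho"
 shows "continuous_on S (moll rho)"
 unfolding continuous_on_iff
proof safe
 fix x and e :: real assume "e > 0"
 then show "\<exists>d>0. \<forall>x'\<in>S. dist x' x < d --> dist (moll rho x') (moll rho x) < e"
  using le_less_trans[OF moll_norm[OF assms]] unfolding dist_norm moll_diff[OF assms, symmetric] by blast
qed

text \<open>By Jensen's inequality the error is at most an average of translation errors over \<open>norm y <= eps\<close>.\<close>

lemma moll_close:
 assumes rho: "mollifier eps rho" and p: "(U, G) \<in> H10 UNIV"
 shows "norm (moll rho U - U) <= eps * norm G"
proof -
 note r = mollifier_test[OF rho]
 have r0: "rho y >= 0" for y using rho by (simp add: mollifier_def)
 have eps: "eps >= 0"
 proof (rule ccontr)
  assume "~ eps >= 0"
  then have "eps <= norm y" for y :: 'a using norm_ge_zero[of y] by linarith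
  then have "rho = (%_. 0)" using rho by (simp add: mollifier_def fun_eq_iff)
  then show False using rho by (simp add: mollifier_def)
 qed
 have "H10 UNIV \<subseteq> {p. norm (moll rho (fst p) - fst p) <= eps * norm (snd p)}"
 proof (rule H10_subset)
  show "closed {p. norm (moll rho (fst p) - fst p) <= eps * norm (snd p :: ('a, 'a) L2)}"
   by (intro closed_Collect_le continuous_intros continuous_on_compose2[OF moll_continuous[OF rho, of UNIV]]) auto
  fix phi :: "'a => real" assume phi: "phi \<in> test UNIV"
  note [measurable] = test_meas[OF r] test_meas[OF phi]
  define E where "E = (norm (toL2 (grad phi)))^2"
  have E: "E = (LB x. (norm (grad phi x))\<^sup>2)" unfolding E_def by (rule norm_toL2[OF grad_sqint[OF phi]])
  have sh: "sqint (%x. phi (x - y) - phi x)" for y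
  proof -
   have "integrable lborel (%x. (norm (phi (- y + x)))\<^sup>2)"
    using integrable_dmap[of "%x. (norm (phi x))\<^sup>2" "%_. 1" "- y"] test_sqint[OF phi]
    by (auto simp: sqint_def dmap_const)
   then have "sqint (%x. phi (x - y))" by (auto simp: sqint_def)
   then show ?thesis by (rule sqint_diff[OF _ test_sqint[OF phi]])
  qed
  have tr: "(\<integral>\<^sup>+x. ennreal ((phi (x - y) - phi x)^2) \<partial>lborel) <= ennreal ((norm y)^2 * E)" for y
  proof -
   have "(\<integral>\<^sup>+x. ennreal ((phi (x - y) - phi x)^2) \<partial>lborel) = ennreal (LB x. (phi (x - y) - phi x)\<^sup>2)"
    using sh[of y] by (intro nn_integral_eq_integral) (auto simp: sqint_def)
   also have "\<dots> <= ennreal ((norm y)^2 * E)"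
    using translation_estimate[OF phi, of "- y"] by (intro ennreal_leI) (simp add: E)
   finally show ?thesis .
  qed
  have d: "conv rho phi x - phi x = (LB y. rho y *R (phi (x - y) - phi x))" for x
  proof -
   have "conv rho phi x = (LB y. rho y * phi (x - y))"
    unfolding conv_def using integral_reflect_point[of "%y. rho y * phi (x - y)" x] by simp
   moreover have "integrable lborel (%y. rho y * phi (x - y))"
   proof -
    have "smooth (%y. phi (x - y))" by (intro allI test_smooth[OF reflect_test[OF phi]])
    from test_integrable[OF test_mult[OF r this]] show ?thesis by (simp add: mult.commute)
   qed
   ultimately show ?thesis
    using rho test_integrable[OF r] by (simp add: right_diff_distrib mollifier_def)
  qed
  have 1: "(norm (conv rho phi x - phi x))^2 <= (LB y. rho y * (norm (phi (x - y) - phi x))^2)"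
   and i: "integrable lborel (%y. rho y * (norm (phi (x - y) - phi x))^2)" for x
  proof -
   have s: "smooth (%y. phi (x - y) - phi x)"
    by (intro allI Ck_diff Ck_const test_smooth[OF reflect_test[OF phi]])
   have "smooth (%y. (phi (x - y) - phi x) * (phi (x - y) - phi x))" using s by (intro allI Ck_mult) auto
   from test_integrable[OF test_mult[OF r this]]
   show i: "integrable lborel (%y. rho y * (norm (phi (x - y) - phi x))^2)"
    by (simp add: power2_eq_square mult.commute)
   show "(norm (conv rho phi x - phi x))^2 <= (LB y. rho y * (norm (phi (x - y) - phi x))^2)"
    unfolding d using r0 test_integrable[OF r] rho i test_integrable[OF test_mult[OF r s]]
    by (intro norm_average_squared_le) (auto simp: mollifier_def mult.commute)
  qed
  have "(\<integral>\<^sup>+x. ennreal ((norm (conv rho phi x - phi x))^2) \<partial>lborel)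
    <= (\<integral>\<^sup>+x. \<integral>\<^sup>+y. ennreal (rho y * (norm (phi (x - y) - phi x))^2) \<partial>lborel \<partial>lborel)"
   using 1 i r0 by (intro nn_integral_mono) (subst nn_integral_eq_integral, auto intro: ennreal_leI)
  also have "\<dots> = (\<integral>\<^sup>+y. \<integral>\<^sup>+x. ennreal (rho y * (norm (phi (x - y) - phi x))^2) \<partial>lborel \<partial>lborel)"
   by (rule lborel_pair.Fubini') measurable
  also have "\<dots> <= (\<integral>\<^sup>+y. ennreal (rho y) * ennreal (eps^2 * E) \<partial>lborel)"
  proof (rule nn_integral_mono)
   fix y :: 'a
   have "(\<integral>\<^sup>+x. ennreal (rho y * (norm (phi (x - y) - phi x))^2) \<partial>lborel) = ennreal (rho y) * (\<integral>\<^sup>+x. ennreal ((phi (x - y) - phi x)^2) \<partial>lborel)"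
    using r0 by (subst nn_integral_cmult[symmetric]) (auto simp: ennreal_mult)
   also have "\<dots> <= ennreal (rho y) * ennreal (eps^2 * E)"
   proof (cases "eps <= norm y")
    case True then show ?thesis using rho by (simp add: mollifier_def)
   next
    case False
    have "(norm y)^2 * E <= eps\<^sup>2 * E" using False by (intro mult_right_mono power_mono) (auto simp: E_def)
    then show ?thesis by (intro mult_left_mono order_trans[OF tr] ennreal_leI) auto
   qed
   finally show "(\<integral>\<^sup>+x. ennreal (rho y * (norm (phi (x - y) - phi x))^2) \<partial>lborel) <= ennreal (rho y) * ennreal (eps^2 * E)" .
  qed
  also have "\<dots> = ennreal (eps^2 * E)"
  proof -
   have "(\<integral>\<^sup>+y. ennreal (rho y) \<partial>lborel) = 1"
    using rho test_integrable[OF r] r0 by (subst nn_integral_eq_integral) (auto simp: mollifier_def)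
   then show ?thesis by (subst nn_integral_multc) auto
  qed
  finally have *: "(\<integral>\<^sup>+x. ennreal ((norm (conv rho phi x - phi x))^2) \<partial>lborel) <= ennreal (eps^2 * E)" .
  have cs: "sqint (conv rho phi)" using conv_L2(1)[OF rho test_sqint[OF phi]] .
  have m: "(%x. conv rho phi x - phi x) \<in> borel_measurable borel" using sqint_meas[OF cs] by measurable
  have "moll rho (toL2 phi) - toL2 phi = toL2 (%x. conv rho phi x - phi x)"
   unfolding moll_def conv_toL2[OF test_sqint[OF phi] r] by (rule toL2_diff[OF cs test_sqint[OF phi]])
  then have "(norm (moll rho (toL2 phi) - toL2 phi))^2 <= (eps * norm (toL2 (grad phi)))^2"
   using sqint_nn(2)[OF m *] by (simp add: E_def power_mult_distrib)
  then have "norm (moll rho (toL2 phi) - toL2 phi) <= eps * norm (toL2 (grad phi))"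
   by (rule power2_le_imp_le) (use eps in auto)
  then show "gp phi \<in> {p. norm (moll rho (fst p) - fst p) <= eps * norm (snd p)}" by simp
 qed
 then show ?thesis using p by auto
qed

subsection \<open>Smoothness of convolutions\<close>

lemma has_derivative_quadratic_error:
 fixes f :: "'a::real_normed_vector => 'b::real_normed_vector"
 assumes A: "bounded_linear A" and C: "!!h. norm (f (x + h) - f x - A h) <= C * (norm h)^2"
 shows "(f has_derivative A) (at x)"
proof (rule has_derivativeI_sandwich[of 1])
 fix y assume "y ~= x" "dist y x < 1"
 have "norm (f y - f x - A (y - x)) / norm (y - x) <= C * (norm (y - x))^2 / norm (y - x)"
  using C[of "y - x"] by (intro divide_right_mono) auto
 then show "norm (f y - f x - A (y - x)) / norm (y - x) <= C * norm (y - x)"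
  using \<open>y ~= x\<close> by (simp add: power2_eq_square split: if_splits)
next
 have "((%y. C * norm (y - x)) \<longlongrightarrow> C * norm (x - x)) (at x)" by (intro tendsto_intros)
 then show "((%y. C * norm (y - x)) \<longlongrightarrow> 0) (at x)" by simp
qed (use A in auto)

lemma conv_has_derivative:
 fixes f :: "'a::euclidean_space => real"
 assumes phi: "phi \<in> test UNIV" and f: "integrable lborel f"
 shows "(conv phi f has_derivative (%v. conv (pd phi v) f x)) (at x)"
proof -
 obtain K where K: "K >= 0" "!!x h. \<bar>phi (x + h) - phi x - pd phi h x\<bar> <= K * (norm h)^2"
  using test_taylor[OF phi] by blast
 note i = test_mult_integrable[OF _ f]
 show ?thesis
 proof (rule has_derivative_quadratic_error[where C = "K * (LB y. norm (f y))"])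
  have "linear (%v. conv (pd phi v) f x)"
  proof (rule linearI)
   show "conv (pd phi (u + v)) f x = conv (pd phi u) f x + conv (pd phi v) f x" for u v
    using i[OF test_pd[OF phi]] by (simp add: conv_def linear_add[OF pd_linear[OF phi]] distrib_right)
   show "conv (pd phi (c *R v)) f x = c *R conv (pd phi v) f x" for c v
    by (simp add: conv_def linear_scale[OF pd_linear[OF phi]] mult.assoc)
  qed
  then show "bounded_linear (%v. conv (pd phi v) f x)" by (simp add: linear_conv_bounded_linear)
  fix h
  have eq: "conv phi f (x + h) - conv phi f x - conv (pd phi h) f x
    = (LB y. (phi (x - y + h) - phi (x - y) - pd phi h (x - y)) * f y)"
   using i[OF phi, of "x + h"] i[OF phi, of x] i[OF test_pd[OF phi], of h x]
   by (simp add: conv_def left_diff_distrib algebra_simps)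
  have int: "integrable lborel (%y. (phi (x - y + h) - phi (x - y) - pd phi h (x - y)) * f y)"
   using i[OF phi, of "x + h"] i[OF phi, of x] i[OF test_pd[OF phi], of h x]
   by (simp add: left_diff_distrib algebra_simps)
  have "norm (LB y. (phi (x - y + h) - phi (x - y) - pd phi h (x - y)) * f y)
    <= (LB y. norm ((phi (x - y + h) - phi (x - y) - pd phi h (x - y)) * f y))"
   by (rule integral_norm_bound)
  also have "\<dots> <= (LB y. (K * (norm h)^2) * norm (f y))"
   using K by (intro integral_mono integrable_norm int f integrable_mult_right)
    (auto simp: abs_mult intro!: mult_right_mono)
  finally show "norm (conv phi f (x + h) - conv phi f x - conv (pd phi h) f x)
    <= K * (LB y. norm (f y)) * (norm h)^2"
   unfolding eq by (simp add: mult_ac)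
 qed
qed

lemma pd_conv:
 fixes f :: "'a::euclidean_space => real"
 assumes "phi \<in> test UNIV" "integrable lborel f"
 shows "pd (conv phi f) v = conv (pd phi v) f"
 by (rule ext) (simp add: pd_def[of "conv phi f"] frechet_derivative_at[OF conv_has_derivative[OF assms], symmetric])

lemma smooth_conv:
 fixes f :: "'a::euclidean_space => real"
 assumes "integrable lborel f"
 shows "phi \<in> test UNIV ==> Ck k (conv phi f)"
proof (induction k arbitrary: phi)
 case 0
 have "isCont (conv phi f) x" for x
  using conv_has_derivative[OF 0 assms] by (rule has_derivative_continuous)
 then show ?case by (simp add: continuous_at_imp_continuous_on)
next
 case (Suc k)
 show ?case by (rule Ck_SucI[OF conv_has_derivative[OF Suc.prems assms]]) (rule Suc.IH[OF test_pd[OF Suc.prems]])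
qed

lemma conv_zero:
 fixes U :: "('a::euclidean_space, 'b::euclidean_space) L2"
 assumes rho: "mollifier eps rho" and U: "U \<in> vanish (- B)" and x: "!!y. y \<in> B ==> eps <= norm (x - y)"
 shows "conv rho (L2f U) x = 0"
proof -
 have "AEL y. rho (x - y) *R L2f U y = 0"
  using U unfolding vanish_def mem_Collect_eq
  by eventually_elim (use rho x in \<open>auto simp: mollifier_def\<close>)
 then show ?thesis unfolding conv_def by (rule integral_eq_zero_AE)
qed

lemma vanish_mono: "A \<subseteq> B ==> U \<in> vanish B ==> U \<in> vanish A"
 unfolding vanish_def mem_Collect_eq by (erule eventually_mono) auto

lemma grad_conv:
 assumes p: "(U, G) \<in> H10 UNIV" and rho: "rho \<in> test UNIV" and i: "integrable lborel (L2f U)"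
 shows "grad (conv rho (L2f U)) x = conv rho (L2f G) x"
proof (rule grad_eqI)
 note refl = reflect_test[OF rho, of x]
 have "conv (pd rho v) (L2f U) x = conv rho (L2f G) x \<bullet> v" for v
 proof -
  have "conv (pd rho v) (L2f U) x = - (U \<bullet> toL2 (pd (%y. rho (x - y)) v))"
   unfolding conv_def using inner_toL2[OF sqint_L2f test_sqint[OF test_pd[OF refl]], of U v]
   by (simp add: pd_reflect[OF rho] mult.commute)
  also have "\<dots> = G \<bullet> toL2 (%y. rho (x - y) *R v)" by (rule weak_derivative[OF p refl, symmetric])
  also have "\<dots> = (LB y. (rho (x - y) *R L2f G y) \<bullet> v)"
   using inner_toL2[OF sqint_L2f test_vec_sqint[OF refl], of G v] by simp
  also have "\<dots> = conv rho (L2f G) x \<bullet> v"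
   unfolding conv_def by (rule integral_inner_left) (rule conv_integrable[OF rho sqint_L2f])
  finally show ?thesis .
 qed
 then show "(conv rho (L2f U) has_derivative (%v. conv rho (L2f G) x \<bullet> v)) (at x)"
  using conv_has_derivative[OF rho i, of x] by simp
qed

text \<open>The mollified function is smooth with compact support in \<open>Om\<close>, and its gradient is the mollified gradient.\<close>

lemma moll_H10:
 assumes p: "(U, G) \<in> H10 UNIV" and S: "compact S" "U \<in> vanish (- S)"
  and rho: "mollifier eps rho" and sub: "!!x y. y \<in> S ==> norm (x - y) <= eps ==> x \<in> Om"
 shows "(moll rho U, moll rho G) \<in> H10 Om"
proof -
 note r = mollifier_test[OF rho]
 have i: "integrable lborel (L2f U)" by (rule vanish_integrable[OF S(2) compact_imp_bounded[OF S(1)]])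
 let ?K = "\<Union>x\<in>S. \<Union>y\<in>cball 0 eps. {x + y}"
 have "conv rho (L2f U) \<in> test Om"
 proof (rule test_I)
  show "smooth (conv rho (L2f U))" using smooth_conv[OF i r] by blast
  show "compact ?K" using compact_sums'[OF S(1) compact_cball] .
  show "?K \<subseteq> Om" using sub by auto
  show "conv rho (L2f U) x = 0" if "x ~: ?K" for x
  proof (rule conv_zero[OF rho S(2)])
   fix y assume "y \<in> S"
   show "eps <= norm (x - y)"
   proof (rule ccontr)
    assume "~ eps <= norm (x - y)"
    then have "x - y \<in> cball 0 eps" by simp
    then have "x \<in> ?K" using \<open>y \<in> S\<close> by (intro UN_I[of y] UN_I[of "x - y"]) auto
    then show False using that by blast
   qed
  qed
 qed
 moreover have "grad (conv rho (L2f U)) = conv rho (L2f G)"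
  by (rule ext) (rule grad_conv[OF p r i])
 ultimately show ?thesis using gp_H10[of "conv rho (L2f U)" Om] by (simp add: moll_def)
qed

subsection \<open>Rellich's theorem\<close>

lemma norm_reflect_test:
 assumes "rho \<in> test UNIV"
 shows "norm (toL2 (%y. rho (x - y))) = norm (toL2 rho)"
proof -
 note [measurable] = test_meas[OF assms]
 have "(norm (toL2 (%y. rho (x - y))))^2 = (norm (toL2 rho))^2"
  using integral_reflect_point[of "%y. (norm (rho y))\<^sup>2" x]
  by (simp add: norm_toL2[OF test_sqint[OF assms]] norm_toL2[OF test_sqint[OF reflect_test[OF assms]]])
 then show ?thesis by simp
qed

lemma norm_reflect_diff:
 assumes "rho \<in> test UNIV"
 shows "norm (toL2 (%y. rho (x - y)) - toL2 (%y. rho (z - y))) <= norm (x - z) * norm (toL2 (grad rho))"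
proof -
 note [measurable] = test_meas[OF assms]
 have s: "sqint (%y. rho (x - y))" for x by (rule test_sqint[OF reflect_test[OF assms]])
 have "(norm (toL2 (%y. rho (x - y)) - toL2 (%y. rho (z - y))))^2 = (LB y. (rho (x - y) - rho (z - y))\<^sup>2)"
  by (simp add: toL2_diff[OF s s] norm_toL2[OF sqint_diff[OF s s]])
 also have "\<dots> = (LB y. (rho (y + (x - z)) - rho y)\<^sup>2)"
  using integral_reflect_point[of "%y. (rho (y + (x - z)) - rho y)\<^sup>2" z] by simp
 also have "\<dots> <= (norm (x - z))^2 * (norm (toL2 (grad rho)))^2"
  unfolding norm_toL2[OF grad_sqint[OF assms]] by (rule translation_estimate[OF assms])
 finally show ?thesis unfolding power_mult_distrib[symmetric] by (rule power2_le_imp_le) simp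
qed

lemma moll_uniform_bound:
 fixes U V :: "('a::euclidean_space, real) L2"
 assumes rho: "mollifier eps rho"
  and e: "!!x. x \<in> S ==> \<bar>conv rho (L2f U) x - conv rho (L2f V) x\<bar> <= e"
  and off: "!!x. x ~: S ==> conv rho (L2f U) x = conv rho (L2f V) x"
  and S: "compact S" and "e >= 0"
 shows "(norm (moll rho U - moll rho V))^2 <= e\<^sup>2 * measure lborel S"
proof -
 note s = conv_L2(1)[OF rho sqint_L2f]
 have [measurable]: "S \<in> sets borel" using S by (simp add: borel_closed compact_imp_closed)
 have i: "integrable lborel (indicator S :: 'a => real)"
  using emeasure_compact_finite[OF S] by (intro integrable_real_indicator) auto
 have "(norm (moll rho U - moll rho V))^2 = (LB x. (conv rho (L2f U) x - conv rho (L2f V) x)\<^sup>2)"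
  by (simp add: moll_def toL2_diff[OF s s] norm_toL2[OF sqint_diff[OF s s]])
 also have "\<dots> <= (LB x. e\<^sup>2 * indicator S x)"
 proof (rule integral_mono)
  show "integrable lborel (%x. (conv rho (L2f U) x - conv rho (L2f V) x)\<^sup>2)"
   using sqint_diff[OF s[of U] s[of V]] by (simp add: sqint_def)
  show "integrable lborel (%x. e\<^sup>2 * indicator S x :: real)" by (rule integrable_mult_right[OF i])
  show "(conv rho (L2f U) x - conv rho (L2f V) x)^2 <= e\<^sup>2 * indicator S x" for x
   using e[of x] off[of x] \<open>e >= 0\<close> by (cases "x \<in> S") (auto simp: abs_le_square_iff[symmetric])
 qed
 also have "\<dots> = e^2 * measure lborel S" by simp
 finally show ?thesis .
qed

lemma conv_equicontinuous:
 fixes U :: "('a::euclidean_space, real) L2"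
 assumes rho: "rho \<in> test UNIV" and "norm U <= B"
 shows "\<bar>conv rho (L2f U) x\<bar> <= norm (toL2 rho) * B"
  and "\<bar>conv rho (L2f U) x - conv rho (L2f U) z\<bar> <= norm (x - z) * norm (toL2 (grad rho)) * B"
proof -
 have "\<bar>conv rho (L2f U) x\<bar> <= norm (toL2 (%y. rho (x - y))) * norm U"
  unfolding conv_inner[OF rho] by (rule Cauchy_Schwarz_ineq2)
 also have "\<dots> <= norm (toL2 rho) * B"
  unfolding norm_reflect_test[OF rho] using assms(2) by (intro mult_left_mono) auto
 finally show "\<bar>conv rho (L2f U) x\<bar> <= norm (toL2 rho) * B" .
 have "\<bar>conv rho (L2f U) x - conv rho (L2f U) z\<bar> <= norm (toL2 (%y. rho (x - y)) - toL2 (%y. rho (z - y))) * norm U"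
  unfolding conv_inner[OF rho] inner_diff_left[symmetric] by (rule Cauchy_Schwarz_ineq2)
 also have "\<dots> <= norm (x - z) * norm (toL2 (grad rho)) * B"
  using norm_reflect_diff[OF rho] assms(2) by (intro mult_mono) auto
 finally show "\<bar>conv rho (L2f U) x - conv rho (L2f U) z\<bar> <= norm (x - z) * norm (toL2 (grad rho)) * B" .
qed

text \<open>Arzela-Ascoli: for fixed \<open>rho\<close> the mollified functions are uniformly bounded and equicontinuous.\<close>

lemma moll_compact:
 fixes U :: "nat => ('a::euclidean_space, real) L2"
 assumes rho: "mollifier eps rho" and U: "!!n. U n \<in> vanish (- cball 0 R)" "!!n. norm (U n) <= B"
 shows "\<exists>k. strict_mono (k :: nat => nat) & Cauchy (%n. moll rho (U (k n)))"
proof -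
 note r = mollifier_test[OF rho]
 define S :: "'a set" where "S = cball 0 (R + eps)"
 have S: "compact S" by (simp add: S_def)
 have B: "B >= 0" using U(2)[of 0] norm_ge_zero order_trans by blast
 define L where "L = norm (toL2 (grad rho)) * B + 1"
 have L: "L > 0" using B by (simp add: L_def add_nonneg_pos)
 obtain g k where k: "strict_mono (k :: nat => nat)"
  "!!e. 0 < e ==> \<exists>N. \<forall>n x. n >= N & x \<in> S --> norm (conv rho (L2f (U (k n))) x - g x) < e"
 proof (rule Arzela_Ascoli[OF S, of "%n. conv rho (L2f (U n))" "norm (toL2 rho) * B"])
  show "norm (conv rho (L2f (U n)) x) <= norm (toL2 rho) * B" for n x
   using conv_equicontinuous(1)[OF r U(2)] by simp
  show "\<exists>d. 0 < d & (\<forall>n y. y \<in> S & norm (x - y) < d --> norm (conv rho (L2f (U n)) x - conv rho (L2f (U n)) y) < e)"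
   if "0 < e" for x e
  proof (intro exI[of _ "e / L"] conjI allI impI)
   fix n y assume y: "y \<in> S & norm (x - y) < e / L"
   have "norm (conv rho (L2f (U n)) x - conv rho (L2f (U n)) y) <= norm (x - y) * (norm (toL2 (grad rho)) * B)"
    using conv_equicontinuous(2)[OF r U(2)] by (simp add: mult.assoc)
   also have "\<dots> <= norm (x - y) * L" by (intro mult_left_mono) (auto simp: L_def)
   also have "\<dots> < e" using y L by (simp add: pos_less_divide_eq)
   finally show "norm (conv rho (L2f (U n)) x - conv rho (L2f (U n)) y) < e" .
  qed (use that L in simp)
 qed blast
 have off: "conv rho (L2f (U n)) x = 0" if "x ~: S" for n x
 proof (rule conv_zero[OF rho U(1)])
  fix y :: 'a assume "y \<in> cball 0 R"
  then show "eps <= norm (x - y)"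
   using that norm_triangle_ineq2[of x y] by (simp add: S_def)
 qed
 have "Cauchy (%n. moll rho (U (k n)))"
 proof (rule metric_CauchyI)
  fix e :: real assume e: "e > 0"
  define m where "m = measure lborel S + 1"
  have m: "m > 0" by (simp add: m_def add_nonneg_pos)
  define d where "d = e / (2 * sqrt m)"
  have d: "d > 0" using e m by (simp add: d_def)
  obtain N where N: "!!n x. n >= N ==> x \<in> S ==> norm (conv rho (L2f (U (k n))) x - g x) < d/2"
   using k(2)[of "d/2"] d by (metis half_gt_zero)
  have "dist (moll rho (U (k i))) (moll rho (U (k j))) < e" if "i >= N" "j >= N" for i j
  proof -
   have "(norm (moll rho (U (k i)) - moll rho (U (k j))))^2 <= d\<^sup>2 * measure lborel S"
   proof (rule moll_uniform_bound[OF rho _ _ S])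
    fix x assume "x \<in> S"
    then show "\<bar>conv rho (L2f (U (k i))) x - conv rho (L2f (U (k j))) x\<bar> <= d"
     using N[OF that(1), of x] N[OF that(2), of x] unfolding real_norm_def by linarith
   qed (use off d in auto)
   also have "\<dots> <= d\<^sup>2 * m" by (intro mult_left_mono) (auto simp: m_def)
   also have "\<dots> < e\<^sup>2" using e m by (simp add: d_def power_divide power_mult_distrib)
   finally show ?thesis unfolding dist_norm by (rule power2_less_imp_less) (use e in auto)
  qed
  then show "\<exists>M. \<forall>m\<ge>M. \<forall>n\<ge>M. dist (moll rho (U (k m))) (moll rho (U (k n))) < e" by blast
 qed
 then show ?thesis using k(1) by blast
qed

text \<open>Mollification at scale \<open>eps\<close> moves the functions by at most \<open>eps\<close> times their energy norm and makes the sequence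
 compact; a diagonal subsequence serves all scales \<open>1 / (j + 1)\<close>.\<close>

lemma rellich:
 fixes X :: "nat => ('a::euclidean_space, real) L2 \<times> ('a, 'a) L2"
 assumes X: "!!n. X n \<in> H10 UNIV" "!!n. fst (X n) \<in> vanish (- cball 0 R)" "!!n. norm (X n) <= B"
 shows "\<exists>r u. strict_mono (r :: nat => nat) & (%n. fst (X (r n))) ---> u"
proof -
 define U where "U n = fst (X n)" for n
 have U: "norm (U n) <= B" for n 
  using norm_fst_le[of "fst (X n)" "snd (X n)"] X(3)[of n] by (simp add: U_def)
 have G: "norm (snd (X n)) <= B" for n
  using norm_snd_le[of "snd (X n)" "fst (X n)"] X(3)[of n] by simp
 have B: "B >= 0" using U[of 0] norm_ge_zero order_trans by blast
 have "\<exists>rho :: 'a => real. mollifier (inverse (real (Suc j))) rho" for j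
  using mollifier_exists[of "inverse (real (Suc j))"] by (metis inverse_positive_iff_positive of_nat_0_less_iff zero_less_Suc)
 then obtain rho :: "nat => 'a => real" where rho: "!!j. mollifier (inverse (real (Suc j))) (rho j)" by metis
 define P where "P j s \<longleftrightarrow> Cauchy (%n. moll (rho j) (U (s n)))" for j and s :: "nat => nat"
 interpret subseqs P
 proof
  show "\<exists>r'. strict_mono r' & P j (s \<circ> r')" if "strict_mono s" for j and s :: "nat => nat"
   using moll_compact[OF rho[of j], of "%n. U (s n)" R B] X(2) U by (simp add: P_def U_def)
 qed
 have hold: "P j (diagseq \<circ> ((+) (Suc j)))" for j
 proof (rule diagseq_holds)
  show "P n (s \<circ> r)" if "strict_mono r" "P n s" for n and s r :: "nat => nat"
   using Cauchy_subseq_Cauchy[OF that(2)[unfolded P_def] that(1)] by (simp add: P_def o_def)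
 qed
 have hC: "Cauchy (%n. moll (rho j) (U (diagseq (Suc j + n))))" for j
  using hold[of j] P_def[of j "diagseq \<circ> ((+) (Suc j))"] by (simp only: o_def)
 have "Cauchy (%n. U (diagseq n))"
 proof (rule metric_CauchyI)
  fix e :: real assume e: "e > 0"
  obtain j where j: "inverse (real (Suc j)) < e / (3 * (B + 1))"
   using reals_Archimedean[of "e / (3 * (B + 1))"] e B by auto
  have "inverse (real (Suc j)) * B <= inverse (real (Suc j)) * (B + 1)" by (intro mult_left_mono) auto
  also have "\<dots> < e / 3" using j B by (simp add: pos_less_divide_eq field_simps del: of_nat_Suc)
  finally have j': "inverse (real (Suc j)) * B < e / 3" .
  have close: "norm (moll (rho j) (U n) - U n) < e / 3" for n
  proof -
   have "(U n, snd (X n)) \<in> H10 UNIV" using X(1) by (simp add: U_def)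
   from moll_close[OF rho this] have "norm (moll (rho j) (U n) - U n) <= inverse (real (Suc j)) * norm (snd (X n))" .
   also have "\<dots> <= inverse (real (Suc j)) * B" using G by (intro mult_left_mono) auto
   finally show ?thesis using j' by linarith
  qed
  obtain N where N: "!!m n. m >= N ==> n >= N ==>
    dist (moll (rho j) (U (diagseq (Suc j + m)))) (moll (rho j) (U (diagseq (Suc j + n)))) < e / 3"
   using metric_CauchyD[OF hC[of j], of "e/3"] e by (metis divide_pos_pos zero_less_numeral)
  have "dist (U (diagseq m)) (U (diagseq n)) < e" if "m >= Suc j + N" "n >= Suc j + N" for m n
  proof -
   have "norm (moll (rho j) (U (diagseq m)) - moll (rho j) (U (diagseq n))) < e / 3"
    using N[of "m - Suc j" "n - Suc j"] that by (simp add: dist_norm)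
   moreover have "U (diagseq m) - U (diagseq n) = (moll (rho j) (U (diagseq m)) - moll (rho j) (U (diagseq n)))
     - (moll (rho j) (U (diagseq m)) - U (diagseq m)) + (moll (rho j) (U (diagseq n)) - U (diagseq n))" by simp
   then have "norm (U (diagseq m) - U (diagseq n)) <= norm (moll (rho j) (U (diagseq m)) - moll (rho j) (U (diagseq n)))
     + norm (moll (rho j) (U (diagseq m)) - U (diagseq m)) + norm (moll (rho j) (U (diagseq n)) - U (diagseq n))"
    using norm_triangle_ineq[of "(moll (rho j) (U (diagseq m)) - moll (rho j) (U (diagseq n)))
     - (moll (rho j) (U (diagseq m)) - U (diagseq m))" "moll (rho j) (U (diagseq n)) - U (diagseq n)"]
     norm_triangle_ineq4[of "moll (rho j) (U (diagseq m)) - moll (rho j) (U (diagseq n))" "moll (rho j) (U (diagseq m)) - U (diagseq m)"]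
    by simp
   ultimately show ?thesis using close[of "diagseq m"] close[of "diagseq n"] unfolding dist_norm by linarith
  qed
  then show "\<exists>M. \<forall>m\<ge>M. \<forall>n\<ge>M. dist (U (diagseq m)) (U (diagseq n)) < e" by blast
 qed
 then obtain u where "(%n. U (diagseq n)) ---> u" using Cauchy_convergent convergent_def by blast
 then show ?thesis using subseq_diagseq by (intro exI[of _ diagseq] exI[of _ u]) (simp add: U_def)
qed

text \<open>Disjointly supported bumps provide arbitrarily many independent test functions.\<close>

lemma test_orthogonal_exists:
 fixes f :: "nat => ('a::euclidean_space, real) L2"
 assumes "open Om" "Om ~= {}"
 shows "\<exists>p\<in>H10 Om. fst p ~= 0 & (\<forall>j<k. f j \<bullet> fst p = 0)"
proof -
 obtain x0 where "x0 \<in> Om" using assms(2) by blast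
 then obtain R where R: "R > 0" "ball x0 R \<subseteq> Om" using assms(1) openE by blast
 obtain b :: 'a where b: "b \<in> Basis" using nonempty_Basis by blast
 define eps where "eps = R / (3 * real (k + 2))"
 have eps: "eps > 0" using R by (simp add: eps_def)
 obtain rho :: "'a => real" where rho: "mollifier eps rho" using mollifier_exists[OF eps] by blast
 note r = mollifier_test[OF rho]
 define a where "a i = x0 + (3 * eps * real i) *R b" for i
 define phi where "phi i x = rho (x - a i)" for i x
 have phi0: "phi i x = 0" if "eps <= norm (x - a i)" for i x using rho that by (simp add: phi_def mollifier_def)
 have phi: "phi i \<in> test Om" if "i <= k" for i
 proof (rule test_I[of _ "cball (a i) eps"])
  show "smooth (phi i)"
   using Ck_affine[OF bounded_linear_ident test_smooth[OF r], of _ "- a i"] by (simp add: phi_def[abs_def])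
  show "cball (a i) eps \<subseteq> Om"
  proof
   fix x assume "x \<in> cball (a i) eps"
   then have "norm (x - a i) <= eps" by (simp add: dist_norm norm_minus_commute)
   moreover have "norm (a i - x0) = 3 * eps * real i" using b eps by (simp add: a_def)
   moreover have "norm (x - x0) <= norm (x - a i) + norm (a i - x0)"
    using norm_triangle_ineq[of "x - a i" "a i - x0"] by simp
   ultimately have "norm (x - x0) <= eps + 3 * eps * real i" by linarith
   also have "\<dots> <= eps + 3 * eps * real k" using that eps by simp
   also have "\<dots> < eps * (3 * real (k + 2))" using eps by (simp add: algebra_simps)
   also have "\<dots> = R" by (simp add: eps_def)
   finally show "x \<in> Om" using R(2) by (auto simp: dist_norm norm_minus_commute)
  qed
 qed (use phi0 in \<open>auto simp: dist_norm norm_minus_commute\<close>)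
 have sep: "phi i x * phi j x = 0" if "i ~= j" for i j x
 proof (rule ccontr)
  assume "phi i x * phi j x ~= 0"
  then have "norm (x - a i) < eps" "norm (x - a j) < eps" using phi0 not_le by fastforce+
  then have "norm (a i - a j) < 2 * eps"
   using norm_triangle_ineq4[of "x - a j" "x - a i"] by simp
  moreover have "norm (a i - a j) = 3 * eps * \<bar>real i - real j\<bar>"
   using b eps by (simp add: a_def scaleR_diff_left[symmetric] right_diff_distrib[symmetric] abs_mult)
  moreover have "\<bar>real i - real j\<bar> >= 1" using that by linarith
  then have "3 * eps * 1 <= 3 * eps * \<bar>real i - real j\<bar>" using eps by (intro mult_left_mono) auto
  ultimately show False using eps by linarith
 qed
 obtain c where c: "\<exists>i\<in>{..k}. c i ~= 0" "\<forall>j\<in>{..<k}. (\<Sum>i\<in>{..k}. c i * (f j \<bullet> toL2 (phi i))) = 0"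
  using homogeneous_system_nontrivial[of "{..<k}" "{..k}" "%j i. f j \<bullet> toL2 (phi i)"] by auto
 define p where "p = (\<Sum>i\<in>{..k}. c i *R gp (phi i))"
 have fp: "fst p = (\<Sum>i\<in>{..k}. c i *R toL2 (phi i))" by (simp add: p_def fst_sum)
 have "p \<in> H10 Om" unfolding p_def
  by (intro subspace_sum subspace_scale H10_subspace gp_H10 phi) auto
 moreover have "\<forall>j<k. f j \<bullet> fst p = 0" using c(2) by (simp add: fp inner_sum_right)
 moreover have "fst p ~= 0"
 proof
  assume z: "fst p = 0"
  obtain i where i: "i <= k" "c i ~= 0" using c(1) by auto
  have "toL2 (phi i) \<bullet> toL2 (phi j) = 0" if "j <= k" "j ~= i" for j
   using inner_toL2[OF test_sqint[OF phi[OF i(1)]] test_sqint[OF phi[OF that(1)]]] sep[of i j] that by simp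
  then have "(\<Sum>j\<in>{..k} - {i}. c j * (toL2 (phi i) \<bullet> toL2 (phi j))) = 0" by (intro sum.neutral) auto
  moreover have "0 = toL2 (phi i) \<bullet> fst p" using z by simp
  moreover have "\<dots> = (\<Sum>j\<in>{..k}. c j * (toL2 (phi i) \<bullet> toL2 (phi j)))" by (simp add: fp inner_sum_right)
  ultimately have "0 = c i * (toL2 (phi i) \<bullet> toL2 (phi i))" using i by (simp add: sum.remove[of "{..k}" i])
  then have "toL2 (phi i) = 0" using i by simp
  then have "AEL x. phi i x = 0"
   using toL2_eq_iff[OF test_sqint[OF phi[OF i(1)]] sqint_zero] by (simp add: toL2_zero)
  then have "(LB x. phi i x) = 0" by (rule integral_eq_zero_AE)
  moreover have "(LB x. phi i x) = 1"
   using integral_shift[OF test_meas[OF r], of "- a i"] rho by (simp add: phi_def mollifier_def)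
  ultimately show False by simp
 qed
 ultimately show ?thesis by blast
qed

lemma compact_form_H10:
 fixes Om :: "'a::euclidean_space set"
 assumes "open Om" "bounded Om" "Om ~= {}"
 shows "compact_form (H10 Om)"
proof
 show "subspace (H10 Om)" by (rule H10_subspace)
 show "closed (H10 Om)" by (rule H10_closed)
 show "G = 0" if "(0, G) \<in> H10 Om" for G using gradient_unique[OF that] .
 show "\<exists>p\<in>H10 Om. fst p ~= 0 & (\<forall>j<k. f j \<bullet> fst p = 0)" for k :: nat and f
  by (rule test_orthogonal_exists[OF assms(1,3)])
 obtain R where R: "Om \<subseteq> cball 0 R"
  using bounded_subset_ballD[OF assms(2), of 0] ball_subset_cball by (meson subset_trans)
 show "\<exists>r u. strict_mono (r :: nat => nat) & (%n. fst (X (r n))) ---> u"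
  if "!!n. X n \<in> H10 Om" "!!n. norm (X n) <= B" for X B
 proof (rule rellich)
  show "X n \<in> H10 UNIV" for n using that(1) H10_mono[of Om UNIV] by auto
  show "fst (X n) \<in> vanish (- cball 0 R)" for n
   by (rule vanish_mono[OF _ H10_vanish(1)[OF assms(1) that(1)]]) (use R in auto)
 qed (rule that(2))
qed

section \<open>The Dirichlet spectrum\<close>

lemma AE_lebesgue_on_iff:
 assumes "open Om"
 shows "(AE x in lebesgue_on Om. P x) \<longleftrightarrow> (AEL x. x \<in> Om --> P x)"
 using assms by (subst AE_restrict_space_iff) (auto simp: AE_completion_iff)

lemma borel_indicator_scale:
 assumes "open Om" "h \<in> borel_measurable borel"
 shows "(%x. indicator Om x *R (h x :: 'b::euclidean_space)) \<in> borel_measurable borel"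
 using assms by (intro borel_measurable_scaleR borel_measurable_indicator) auto

lemma measurable_lebesgue_on_borel:
 assumes "h \<in> borel_measurable borel"
 shows "h \<in> borel_measurable (lebesgue_on Om)"
 using assms by (intro measurable_restrict_space1 measurable_completion) auto

lemma LINT_lebesgue_on:
 fixes h :: "'a::euclidean_space => 'b::euclidean_space"
 assumes "open Om" "h \<in> borel_measurable borel"
 shows "(LINT x|lebesgue_on Om. h x) = (LB x. indicator Om x *R h x)"
  and "integrable (lebesgue_on Om) h \<longleftrightarrow> integrable lborel (%x. indicator Om x *R h x)"
proof -
 note [measurable] = borel_indicator_scale[OF assms]
 show "(LINT x|lebesgue_on Om. h x) = (LB x. indicator Om x *R h x)"
  using assms(1) by (subst integral_restrict_space) (auto simp: integral_completion)
 show "integrable (lebesgue_on Om) h \<longleftrightarrow> integrable lborel (%x. indicator Om x *R h x)"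
  using assms(1) by (subst integrable_restrict_space) (auto simp: integrable_completion)
qed

lemma lebesgue_borel_representative:
 fixes g :: "'a::euclidean_space => 'b::euclidean_space"
 assumes "g \<in> borel_measurable lebesgue"
 obtains g' where "g' \<in> borel_measurable borel" "AEL x. g x = g' x"
proof -
 have "\<exists>h\<in>borel_measurable lborel. AEL x. g x \<bullet> i = h x" for i
  using assms by (intro completion_ex_borel_measurable_real) auto
 then obtain h where h: "!!i. h i \<in> borel_measurable lborel" "!!i. AEL x. g x \<bullet> i = h i x" by metis
 show ?thesis
 proof (rule that)
  show "(%x. \<Sum>i\<in>Basis. h i x *R i) \<in> borel_measurable borel" using h(1) by auto
  have "AEL x. \<forall>i\<in>(Basis :: 'b set). g x \<bullet> i = h i x"
   by (intro AE_finite_allI finite_Basis h(2))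
  then show "AEL x. g x = (\<Sum>i\<in>Basis. h i x *R i)"
   by eventually_elim (metis (no_types, lifting) euclidean_representation sum.cong)
 qed
qed

lemma L2_on_extension:
 fixes f :: "'a::euclidean_space => 'b::euclidean_space"
 assumes Om: "open Om" and f: "L2_on Om f"
 obtains F :: "('a, 'b) L2" where "F \<in> vanish (- Om)" "AEL x. x \<in> Om --> f x = L2f F x"
proof -
 have O: "Om \<inter> space lebesgue \<in> sets lebesgue" using Om by auto
 have "(%x. indicator Om x *R f x) \<in> borel_measurable lebesgue"
  using f O by (simp add: L2_on_def borel_measurable_restrict_space_iff)
 then obtain g where g: "g \<in> borel_measurable borel" "AEL x. indicator Om x *R f x = g x"
  by (rule lebesgue_borel_representative)
 have "integrable lebesgue (%x. indicator Om x *R (norm (f x))\<^sup>2)"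
  using f O by (simp add: L2_on_def integrable_restrict_space)
 then have "integrable lebesgue (%x. (norm (g x))\<^sup>2)"
 proof (rule integrable_cong_AE_imp)
  show "(%x. (norm (g x))\<^sup>2) \<in> borel_measurable lebesgue" using g(1) by (intro measurable_completion) auto
  have "AE x in lebesgue. indicator Om x *R f x = g x" using g(2) by (simp add: AE_completion_iff)
  then show "AE x in lebesgue. indicator Om x *R (norm (f x))\<^sup>2 = (norm (g x))^2"
   by eventually_elim (auto split: split_indicator_asm simp: indicator_def split: if_splits)
 qed
 then have "integrable lborel (%x. (norm (g x))\<^sup>2)" using g(1) by (subst (asm) integrable_completion) auto
 then have sg: "sqint g" using g(1) by (simp add: sqint_def)
 show ?thesis
 proof (rule that)
  show "toL2 g \<in> vanish (- Om)"
   unfolding vanish_toL2[OF sg] using g(2) by eventually_elim (auto simp: indicator_def)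
  show "AEL x. x \<in> Om --> f x = L2f (toL2 g) x"
   using g(2) L2f_toL2[OF sg] by eventually_elim (auto simp: indicator_def)
 qed
qed

lemma L2_on_L2f: "open Om ==> L2_on Om (L2f F)"
proof -
 assume Om: "open Om"
 have "integrable lborel (%x. (norm (L2f F x))\<^sup>2)" using sqint_L2f[of F] by (simp add: sqint_def)
 then have "integrable lborel (%x. indicator Om x *R (norm (L2f F x))\<^sup>2)"
  using Om by (intro integrable_mult_indicator) auto
 then show ?thesis unfolding L2_on_def
  using LINT_lebesgue_on(2)[OF Om, of "%x. (norm (L2f F x))\<^sup>2"]
  by (auto intro: measurable_lebesgue_on_borel)
qed

lemma L2_on_meas: "L2_on Om f ==> f \<in> borel_measurable (lebesgue_on Om)"
 by (simp add: L2_on_def)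

text \<open>Translates the integrals over \<open>Om\<close> in the definition of eigenfunctions into inner products of extensions by zero.\<close>

lemma LINT_inner:
 fixes f g :: "'a::euclidean_space => 'b::euclidean_space"
 assumes Om: "open Om" and f: "L2_on Om f" "AEL x. x \<in> Om --> f x = L2f F x"
  and g: "sqint g" "!!x. x ~: Om ==> g x = 0"
 shows "(LINT x|lebesgue_on Om. f x \<bullet> g x) = F \<bullet> toL2 g"
proof -
 note [measurable] = sqint_meas[OF g(1)]
 have "(LINT x|lebesgue_on Om. f x \<bullet> g x) = (LINT x|lebesgue_on Om. L2f F x \<bullet> g x)"
  using f L2_on_meas[OF f(1)] measurable_lebesgue_on_borel[of g Om] measurable_lebesgue_on_borel[OF L2f_meas, of F Om]
  by (intro integral_cong_AE borel_measurable_inner) (auto simp: AE_lebesgue_on_iff[OF Om] elim!: eventually_mono)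
 also have "\<dots> = (LB x. indicator Om x *R (L2f F x \<bullet> g x))"
  by (rule LINT_lebesgue_on(1)[OF Om]) measurable
 also have "\<dots> = (LB x. L2f F x \<bullet> g x)"
  by (rule Bochner_Integration.integral_cong) (use g(2) in \<open>auto simp: indicator_def\<close>)
 also have "\<dots> = F \<bullet> toL2 g" using inner_toL2[OF sqint_L2f g(1), of F] by simp
 finally show ?thesis .
qed

lemma test_off: "phi \<in> test Om ==> x ~: Om ==> phi x = 0"
 by (erule test_E) blast

lemma grad_off: "phi \<in> test Om ==> x ~: Om ==> grad phi x = 0"
 by (simp add: grad_eq_sum test_off[OF test_pd])

lemma L2_on_product_integrable:
 assumes f: "L2_on Om f" and g: "L2_on Om g"
 shows "integrable (lebesgue_on Om) (%x. f x *R g x)"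
proof (rule Bochner_Integration.integrable_bound)
 show "integrable (lebesgue_on Om) (%x. (norm (f x))\<^sup>2 + (norm (g x))^2)" using f g by (simp add: L2_on_def)
 show "(%x. f x *R g x) \<in> borel_measurable (lebesgue_on Om)"
  using L2_on_meas[OF f] L2_on_meas[OF g] by (rule borel_measurable_scaleR)
 have "norm (f x *R g x) <= (norm (f x))^2 + (norm (g x))^2" for x
 proof -
  have "2 * (norm (f x) * norm (g x)) <= (norm (f x))^2 + (norm (g x))^2"
   using sum_squares_bound[of "norm (f x)" "norm (g x)"] by simp
  moreover have "norm (f x) * norm (g x) >= 0" by simp
  ultimately show ?thesis unfolding norm_scaleR real_norm_def[symmetric] by linarith
 qed
 then show "AE x in lebesgue_on Om. norm (f x *R g x) <= norm ((norm (f x))^2 + (norm (g x))^2)"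
  by (auto simp: abs_of_nonneg)
qed

lemma sqint_L2_on:
 assumes "open Om" "sqint g"
 shows "L2_on Om g"
proof -
 have "integrable lborel (%x. indicator Om x *R (norm (g x))\<^sup>2)"
  using assms by (intro integrable_mult_indicator) (auto simp: sqint_def)
 then show ?thesis unfolding L2_on_def
  using LINT_lebesgue_on(2)[OF assms(1), of "%x. (norm (g x))\<^sup>2"] sqint_meas[OF assms(2)]
  by (auto intro: measurable_lebesgue_on_borel)
qed

text \<open>Componentwise, the vector identity defining the weak gradient consists of inner products of extensions by zero.\<close>

lemma weak_gradient_iff:
 assumes Om: "open Om" and u: "L2_on Om u" "AEL x. x \<in> Om --> u x = L2f U x"
  and G: "L2_on Om G" "AEL x. x \<in> Om --> G x = L2f V x"
 shows "weak_gradient Om u G \<longleftrightarrow>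
  (\<forall>phi\<in>test Om. \<forall>v. V \<bullet> toL2 (%x. phi x *R v) = - (U \<bullet> toL2 (pd phi v)))"
proof -
 have "(LINT x|lebesgue_on Om. u x *R grad phi x) = - (LINT x|lebesgue_on Om. phi x *R G x) \<longleftrightarrow>
   (\<forall>v. V \<bullet> toL2 (%x. phi x *R v) = - (U \<bullet> toL2 (pd phi v)))" if phi: "phi \<in> test Om" for phi
 proof -
  have 1: "(LINT x|lebesgue_on Om. u x *R grad phi x) \<bullet> v = U \<bullet> toL2 (pd phi v)" for v
  proof -
   have "(LINT x|lebesgue_on Om. u x *R grad phi x) \<bullet> v = (LINT x|lebesgue_on Om. u x \<bullet> pd phi v x)"
    using integral_inner_left[OF L2_on_product_integrable[OF u(1) sqint_L2_on[OF Om grad_sqint[OF phi]]], of v]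
    by (simp add: test_grad_inner[OF phi])
   also have "\<dots> = U \<bullet> toL2 (pd phi v)"
    by (rule LINT_inner[OF Om u test_sqint[OF test_pd[OF phi]] test_off[OF test_pd[OF phi]]])
   finally show ?thesis .
  qed
  have 2: "(LINT x|lebesgue_on Om. phi x *R G x) \<bullet> v = V \<bullet> toL2 (%x. phi x *R v)" for v
  proof -
   have "(LINT x|lebesgue_on Om. phi x *R G x) \<bullet> v = (LINT x|lebesgue_on Om. G x \<bullet> (phi x *R v))"
    using integral_inner_left[OF L2_on_product_integrable[OF sqint_L2_on[OF Om test_sqint[OF phi]] G(1)], of v]
    by simp
   also have "\<dots> = V \<bullet> toL2 (%x. phi x *R v)"
    using test_off[OF phi] by (intro LINT_inner[OF Om G test_vec_sqint[OF phi]]) auto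
   finally show ?thesis .
  qed
  show ?thesis
   unfolding euclidean_eq_iff[of "LINT x|lebesgue_on Om. u x *R grad phi x"] inner_minus_left 1 2
  proof
   assume *: "\<forall>b\<in>Basis. U \<bullet> toL2 (pd phi b) = - (V \<bullet> toL2 (%x. phi x *R b))"
   have "(LINT x|lebesgue_on Om. u x *R grad phi x) = - (LINT x|lebesgue_on Om. phi x *R G x)"
    unfolding euclidean_eq_iff[of "LINT x|lebesgue_on Om. u x *R grad phi x"] inner_minus_left 1 2 by (rule *)
   then show "\<forall>v. V \<bullet> toL2 (%x. phi x *R v) = - (U \<bullet> toL2 (pd phi v))"
    unfolding 1[symmetric] 2[symmetric] by simp
  qed simp
 qed
 then show ?thesis unfolding weak_gradient_def using u(1) G(1) by simp
qed

lemma L2_distance_lebesgue_on: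
 fixes f :: "'a::euclidean_space => 'b::euclidean_space"
 assumes Om: "open Om" and f: "L2_on Om f" "F \<in> vanish (- Om)" "AEL x. x \<in> Om --> f x = L2f F x"
  and g: "sqint g" "!!x. x ~: Om ==> g x = 0"
 shows "(LINT x|lebesgue_on Om. (norm (g x - f x))\<^sup>2) = (norm (toL2 g - F))^2"
proof -
 note [measurable] = sqint_meas[OF g(1)]
 have "(LINT x|lebesgue_on Om. (norm (g x - f x))\<^sup>2) = (LINT x|lebesgue_on Om. (norm (g x - L2f F x))\<^sup>2)"
 proof (rule integral_cong_AE)
  show "(%x. (norm (g x - f x))\<^sup>2) \<in> borel_measurable (lebesgue_on Om)"
   using L2_on_meas[OF f(1)] measurable_lebesgue_on_borel[OF sqint_meas[OF g(1)]] by measurable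
  show "(%x. (norm (g x - L2f F x))\<^sup>2) \<in> borel_measurable (lebesgue_on Om)"
   by (rule measurable_lebesgue_on_borel) measurable
 qed (use f(3) in \<open>auto simp: AE_lebesgue_on_iff[OF Om] elim!: eventually_mono\<close>)
 also have "\<dots> = (LB x. indicator Om x *R (norm (g x - L2f F x))\<^sup>2)"
  by (rule LINT_lebesgue_on(1)[OF Om]) measurable
 also have "\<dots> = (LB x. (norm (g x - L2f F x))\<^sup>2)"
 proof (rule integral_cong_AE)
  show "(%x. indicator Om x *R (norm (g x - L2f F x))\<^sup>2) \<in> borel_measurable lborel"
   using borel_indicator_scale[OF Om, of "%x. (norm (g x - L2f F x))\<^sup>2"] by measurable
  show "AEL x. indicator Om x *R (norm (g x - L2f F x))\<^sup>2 = (norm (g x - L2f F x))^2"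
   using f(2) unfolding vanish_def mem_Collect_eq by eventually_elim (use g(2) in \<open>auto simp: indicator_def\<close>)
 qed measurable
 also have "\<dots> = (norm (toL2 g - F))^2"
  using norm_toL2[OF sqint_diff[OF g(1) sqint_L2f[of F]]] toL2_diff[OF g(1) sqint_L2f[of F]] by simp
 finally show ?thesis .
qed

lemma H10_imp_H1_0:
 assumes Om: "open Om" and p: "(U, G) \<in> H10 Om"
 shows "weak_gradient Om (L2f U) (L2f G)" "L2f U \<in> H1_0 Om"
proof -
 have p': "(U, G) \<in> H10 UNIV" using p H10_mono[of Om UNIV] by auto
 note U = L2_on_L2f[OF Om, of U] and G = L2_on_L2f[OF Om, of G]
 show wg: "weak_gradient Om (L2f U) (L2f G)"
  using weak_gradient_iff[OF Om U _ G, of U G] weak_derivative[OF p'] by auto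
 obtain phi where phi: "!!n. phi n \<in> test Om" "(%n. gp (phi n)) ---> (U, G)"
  using H10_approx[OF p] by blast
 note v = H10_vanish[OF Om p, simplified]
 have lim: "(%n. toL2 (phi n)) ---> U" "(%n. toL2 (grad (phi n))) ---> G"
  using tendsto_fst[OF phi(2)] tendsto_snd[OF phi(2)] by auto
 have "(%n. (norm (toL2 (phi n) - U))\<^sup>2 + (norm (toL2 (grad (phi n)) - G))^2) ---> (norm (U - U))\<^sup>2 + (norm (G - G))^2"
  by (intro tendsto_intros lim)
 moreover have "(LINT x|lebesgue_on Om. (phi n x - L2f U x)\<^sup>2) = (norm (toL2 (phi n) - U))^2" for n
  using L2_distance_lebesgue_on[OF Om U v(1) _ test_sqint[OF phi(1)[of n]] test_off[OF phi(1)[of n]]] by simp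
 moreover have "(LINT x|lebesgue_on Om. (norm (grad (phi n) x - L2f G x))\<^sup>2) = (norm (toL2 (grad (phi n)) - G))^2" for n
  using L2_distance_lebesgue_on[OF Om G v(2) _ grad_sqint[OF phi(1)[of n]] grad_off[OF phi(1)[of n]]] by simp
 ultimately show "L2f U \<in> H1_0 Om"
  unfolding H1_0_def using wg phi(1)
  by (intro CollectI exI[of _ "L2f G"] conjI exI[of _ phi]) auto
qed

lemma H1_0_imp_H10:
 assumes Om: "open Om" and u: "u \<in> H1_0 Om"
 obtains U G where "(U, G) \<in> H10 Om" "L2_on Om u" "AEL x. x \<in> Om --> u x = L2f U x"
proof -
 obtain g phi where wg: "weak_gradient Om u g" and phi: "!!n::nat. phi n \<in> test Om"
  and lim: "(%n. (LINT x|lebesgue_on Om. (phi n x - u x)\<^sup>2) + (LINT x|lebesgue_on Om. (norm (grad (phi n) x - g x))\<^sup>2)) ---> 0"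
  using u unfolding H1_0_def by blast
 have L: "L2_on Om u" "L2_on Om g" using wg by (auto simp: weak_gradient_def)
 obtain U where U: "U \<in> vanish (- Om)" "AEL x. x \<in> Om --> u x = L2f U x" using L2_on_extension[OF Om L(1)] .
 obtain G where G: "G \<in> vanish (- Om)" "AEL x. x \<in> Om --> g x = L2f G x" using L2_on_extension[OF Om L(2)] .
 have 1: "(LINT x|lebesgue_on Om. (phi n x - u x)\<^sup>2) = (norm (toL2 (phi n) - U))^2" for n
  using L2_distance_lebesgue_on[OF Om L(1) U test_sqint[OF phi[of n]] test_off[OF phi[of n]]] by simp
 have 2: "(LINT x|lebesgue_on Om. (norm (grad (phi n) x - g x))\<^sup>2) = (norm (toL2 (grad (phi n)) - G))^2" for n
  using L2_distance_lebesgue_on[OF Om L(2) G grad_sqint[OF phi[of n]] grad_off[OF phi[of n]]] by simp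
 have "(%n. (norm (gp (phi n) - (U, G)))\<^sup>2) ---> 0"
  using lim unfolding 1 2 by (simp add: norm_Pair)
 then have "(%n. sqrt ((norm (gp (phi n) - (U, G)))^2)) ---> sqrt 0" by (rule tendsto_real_sqrt)
 then have "(%n. gp (phi n)) ---> (U, G)" by (simp add: tendsto_norm_zero_iff LIM_zero_cancel del: diff_Pair)
 then have "(U, G) \<in> H10 Om"
  by (rule closed_sequentially[OF H10_closed, rotated]) (rule gp_H10[OF phi])
 then show ?thesis using that L(1) U(2) by blast
qed

text \<open>The weak eigenvalue equation, tested with the whole closed space instead of only with test functions.\<close>

definition eigenpair :: "'a::euclidean_space set => real => ('a, real) L2 \<times> ('a, 'a) L2 => bool" where
 "eigenpair Om t p \<longleftrightarrow> p \<in> H10 Om & (\<forall>q\<in>H10 Om. snd p \<bullet> snd q = t * (fst p \<bullet> fst q))"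

lemma eigenpairI_test:
 assumes "p \<in> H10 Om" "!!phi. phi \<in> test Om ==> snd p \<bullet> toL2 (grad phi) = t * (fst p \<bullet> toL2 phi)"
 shows "eigenpair Om t p"
proof -
 have "H10 Om \<subseteq> {q. snd p \<bullet> snd q = t * (fst p \<bullet> fst q)}"
  by (rule H10_subset) (use assms(2) in \<open>auto intro!: closed_Collect_eq continuous_intros\<close>)
 then show ?thesis using assms(1) by (auto simp: eigenpair_def)
qed

lemma eigenspace_imp_eigenpair:
 assumes Om: "open Om" and u: "u \<in> dirichlet_eigenspace Om t"
 obtains p where "eigenpair Om t p" "AEL x. x \<in> Om --> u x = L2f (fst p) x"
proof -
 obtain g where wg: "weak_gradient Om u g" and eq: "!!phi. phi \<in> test Om ==>
   (LINT x|lebesgue_on Om. g x \<bullet> grad phi x) = t * (LINT x|lebesgue_on Om. u x * phi x)" and u0: "u \<in> H1_0 Om"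
  using u by (auto simp: dirichlet_eigenspace_def)
 obtain U G where p: "(U, G) \<in> H10 Om" and Lu: "L2_on Om u" and U: "AEL x. x \<in> Om --> u x = L2f U x"
  using H1_0_imp_H10[OF Om u0] .
 have Lg: "L2_on Om g" using wg by (simp add: weak_gradient_def)
 obtain V where V: "V \<in> vanish (- Om)" "AEL x. x \<in> Om --> g x = L2f V x" using L2_on_extension[OF Om Lg] .
 have p': "(U, G) \<in> H10 UNIV" using p H10_mono[of Om UNIV] by auto
 have "G \<bullet> toL2 (grad phi) = t * (U \<bullet> toL2 phi)" if phi: "phi \<in> test Om" for phi
 proof -
  have s: "toL2 (grad phi) = (\<Sum>i\<in>Basis. toL2 (%x. pd phi i x *R i))"
   unfolding grad_eq_sum[abs_def]
   by (rule conjunct1[OF toL2_sum, symmetric]) (rule test_vec_sqint[OF test_pd[OF phi]])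
  have "V \<bullet> toL2 (grad phi) = (\<Sum>i\<in>Basis. - (U \<bullet> toL2 (pd (pd phi i) i)))"
   unfolding s inner_sum_right using weak_gradient_iff[OF Om Lu U Lg V(2)] wg test_pd[OF phi] by simp
  also have "\<dots> = G \<bullet> toL2 (grad phi)"
   unfolding s inner_sum_right using weak_derivative[OF p' test_pd[OF phi]] by simp
  finally have "G \<bullet> toL2 (grad phi) = V \<bullet> toL2 (grad phi)" by simp
  also have "\<dots> = t * (U \<bullet> toL2 phi)"
   using eq[OF phi] LINT_inner[OF Om Lg V(2) grad_sqint[OF phi] grad_off[OF phi]]
    LINT_inner[OF Om Lu U test_sqint[OF phi] test_off[OF phi]] by simp
  finally show ?thesis .
 qed
 then have "eigenpair Om t (U, G)" using p by (intro eigenpairI_test) auto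
 then show ?thesis using that[of "(U, G)"] U by simp
qed

lemma eigenpair_imp_eigenspace:
 assumes Om: "open Om" and p: "eigenpair Om t p"
 shows "L2f (fst p) \<in> dirichlet_eigenspace Om t"
proof -
 obtain U G where pp: "p = (U, G)" by force
 have h: "(U, G) \<in> H10 Om" using p by (simp add: pp eigenpair_def)
 have "(LINT x|lebesgue_on Om. L2f G x \<bullet> grad phi x) = t * (LINT x|lebesgue_on Om. L2f U x * phi x)"
  if phi: "phi \<in> test Om" for phi
  using p gp_H10[OF phi] LINT_inner[OF Om L2_on_L2f[OF Om] _ grad_sqint[OF phi] grad_off[OF phi], of G G]
    LINT_inner[OF Om L2_on_L2f[OF Om] _ test_sqint[OF phi] test_off[OF phi], of U U]
  by (auto simp: eigenpair_def pp)
 then show ?thesis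
  unfolding dirichlet_eigenspace_def using H10_imp_H1_0[OF Om h] by (auto simp: pp)
qed

text \<open>Otherwise the expansions of the \<open>m\<close> basis elements in \<open>m'\<close> elements have a nontrivial linear relation.\<close>

lemma has_dim_ae_le:
 assumes "has_dim_ae Om E m" "has_dim_ae Om E m'"
 shows "m <= m'"
proof (rule ccontr)
 assume "~ m <= m'"
 obtain b where b: "!!i. i < m ==> b i \<in> E"
  "!!c :: nat => real. (AE x in lebesgue_on Om. (\<Sum>i<m. c i * b i x) = 0) ==> \<forall>i<m. c i = 0"
  using assms(1) unfolding has_dim_ae_def by blast
 obtain b' where b': "!!u. u \<in> E ==> \<exists>c :: nat => real. AE x in lebesgue_on Om. u x = (\<Sum>j<m'. c j * b' j x)"
  using assms(2) unfolding has_dim_ae_def by blast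
 have "\<forall>i. \<exists>c :: nat => real. i < m --> (AE x in lebesgue_on Om. b i x = (\<Sum>j<m'. c j * b' j x))"
  using b' b(1) by blast
 then obtain C :: "nat => nat => real" where C: "!!i. i < m ==> AE x in lebesgue_on Om. b i x = (\<Sum>j<m'. C i j * b' j x)"
  by metis
 obtain c where c: "\<exists>i\<in>{..<m}. c i ~= 0" "\<forall>j\<in>{..<m'}. (\<Sum>i<m. c i * C i j) = 0"
  using homogeneous_system_nontrivial[of "{..<m'}" "{..<m}" "%j i. C i j"] \<open>~ m <= m'\<close> by auto
 have "AE x in lebesgue_on Om. \<forall>i\<in>{..<m}. b i x = (\<Sum>j<m'. C i j * b' j x)"
  by (intro AE_finite_allI) (auto intro: C)
 then have "AE x in lebesgue_on Om. (\<Sum>i<m. c i * b i x) = 0"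
 proof eventually_elim
  case (elim x)
  have "(\<Sum>i<m. c i * b i x) = (\<Sum>i<m. \<Sum>j<m'. c i * C i j * b' j x)"
   using elim by (intro sum.cong) (auto simp: sum_distrib_left mult.assoc)
  also have "\<dots> = (\<Sum>j<m'. (\<Sum>i<m. c i * C i j) * b' j x)"
   by (subst sum.swap) (simp add: sum_distrib_right)
  also have "\<dots> = 0" using c(2) by simp
  finally show ?case .
 qed
 then show False using b(2) c(1) by auto
qed

text \<open>The multiplicities determine the number of indices with value at most \<open>t\<close>, and by monotonicity \<open>f k <= t\<close> holds
 exactly when \<open>k\<close> is at most that number.\<close>

lemma mono_enumeration_unique:
 fixes f g :: "nat => real"
 assumes f: "mono_on {1..} f" and g: "mono_on {1..} g"
  and fin: "!!t. finite {k\<in>{1..}. f k = t}" "!!t. finite {k\<in>{1..}. g k = t}"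
  and card: "!!t. card {k\<in>{1..}. f k = t} = card {k\<in>{1..}. g k = t}"
  and unb: "!!B. \<exists>k\<ge>1. f k > B" and h: "1 <= h"
 shows "f h = g h"
proof -
 have fle: "finite {k\<in>{1..}. f k <= t}" for t
 proof -
  obtain K where K: "K >= 1" "f K > t" using unb by blast
  have "{k\<in>{1..}. f k <= t} \<subseteq> {..K}"
  proof
   fix k assume "k \<in> {k\<in>{1..}. f k <= t}"
   then show "k \<in> {..K}" using mono_onD[OF f, of K k] K by (cases "k <= K") auto
  qed
  then show ?thesis by (rule finite_subset) simp
 qed
 define T where "T t = f ` {k\<in>{1..}. f k <= t}" for t
 have split: "{k\<in>{1..}. f k <= t} = (\<Union>s\<in>T t. {k\<in>{1..}. f k = s})"
  and splitg: "{k\<in>{1..}. g k <= t} = (\<Union>s\<in>T t. {k\<in>{1..}. g k = s})" for t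
 proof -
  show "{k\<in>{1..}. f k <= t} = (\<Union>s\<in>T t. {k\<in>{1..}. f k = s})" by (auto simp: T_def)
  have "g k \<in> T t" if "k >= 1" "g k <= t" for k
  proof -
   have "card {j\<in>{1..}. g j = g k} ~= 0" using fin(2)[of "g k"] that by auto
   then have "{j\<in>{1..}. f j = g k} ~= {}" using card[of "g k"] by (metis card.empty)
   then show ?thesis using that by (force simp: T_def)
  qed
  then show "{k\<in>{1..}. g k <= t} = (\<Union>s\<in>T t. {k\<in>{1..}. g k = s})" by (auto simp: T_def)
 qed
 have finT: "finite (T t)" for t unfolding T_def using fle by simp
 have gle: "finite {k\<in>{1..}. g k <= t}" for t unfolding splitg using finT fin(2) by auto
 have N: "card {k\<in>{1..}. f k <= t} = card {k\<in>{1..}. g k <= t}" for t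
  unfolding split splitg
  using finT fin card by (subst (1 2) card_UN_disjoint) auto
 have seg: "a k <= t \<longleftrightarrow> k <= card {j\<in>{1..}. a j <= t}"
  if a: "mono_on {1..} a" "finite {j\<in>{1..}. a j <= t}" "k >= 1" for a :: "nat => real" and k t
 proof
  assume "a k <= t"
  then have "{1..k} \<subseteq> {j\<in>{1..}. a j <= t}"
   using order_trans[OF mono_onD[OF a(1), of _ k]] a(3) by (simp add: subset_iff)
  then show "k <= card {j\<in>{1..}. a j <= t}" using card_mono[OF a(2), of "{1..k}"] by simp
 next
  assume k: "k <= card {j\<in>{1..}. a j <= t}"
  show "a k <= t"
  proof (rule ccontr)
   assume "~ a k <= t"
   have "{j\<in>{1..}. a j <= t} \<subseteq> {1..<k}"
   proof
    fix j assume j: "j \<in> {j\<in>{1..}. a j <= t}"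
    then have "j < k" using mono_onD[OF a(1), of k j] a(3) \<open>~ a k <= t\<close> by (cases "j < k") auto
    then show "j \<in> {1..<k}" using j by simp
   qed
   from card_mono[OF _ this] show False using k a(3) by simp
  qed
 qed
 have "g h <= f h" using seg[OF f fle h, of "f h"] seg[OF g gle h, of "f h"] N by simp
 moreover have "f h <= g h" using seg[OF f fle h, of "g h"] seg[OF g gle h, of "g h"] N by simp
 ultimately show ?thesis by simp
qed

context
 fixes Om :: "'a::euclidean_space set" and e
 assumes Om: "open Om" and ef: "eigen_form (H10 Om) e"
begin

interpretation eigen_form "H10 Om" e by (rule ef)

lemma eigenpair_e: "eigenpair Om (ev n) (e n)"
 using e_W e_eigen by (auto simp: eigenpair_def)

text \<open>Spanning is \<open>eigenvector_expansion\<close>; independence is orthonormality.\<close>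

lemma eigenspace_dimension: "has_dim_ae Om (dirichlet_eigenspace Om t) (card {n. ev n = t})"
proof -
 let ?T = "{n. ev n = t}"
 have fin: "finite ?T" using ev_finite[of t] by (rule finite_subset[rotated]) auto
 then obtain \<pi> where \<pi>: "bij_betw \<pi> {..<card ?T} ?T"
  using ex_bij_betw_nat_finite[OF fin] by (auto simp: atLeast0LessThan)
 define b where "b i = L2f (fst (e (\<pi> i)))" for i
 show ?thesis unfolding has_dim_ae_def
 proof (intro exI[of _ b] conjI allI impI ballI)
  fix i assume "i < card ?T"
  then have "ev (\<pi> i) = t" using \<pi> by (auto simp: bij_betw_def)
  then show "b i \<in> dirichlet_eigenspace Om t"
   using eigenpair_imp_eigenspace[OF Om eigenpair_e[of "\<pi> i"]] by (simp add: b_def)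
 next
  fix c :: "nat => real" and i assume z: "AE x in lebesgue_on Om. (\<Sum>i<card ?T. c i * b i x) = 0" and i: "i < card ?T"
  let ?V = "\<Sum>i<card ?T. c i *R fst (e (\<pi> i))"
  have v: "AEL x. \<forall>i. x \<in> - Om --> b i x = 0"
   unfolding AE_all_countable b_def using H10_vanish(1)[OF Om e_W] by (simp add: vanish_def)
  have "AEL x. L2f ?V x = 0"
   using z[unfolded AE_lebesgue_on_iff[OF Om]] v L2f_sum[where I = "{..<card ?T}" and c = c and U = "%i. fst (e (\<pi> i))"]
   by eventually_elim (auto simp: b_def)
  then have "?V = 0" using L2_eq_iff[of ?V 0] L2f_zero[where 'a='a and 'b=real] by (auto elim: eventually_elim2)
  then have "0 = fst (e (\<pi> i)) \<bullet> ?V" by simp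
  also have "\<dots> = (\<Sum>j<card ?T. c j * (if i = j then 1 else 0))"
   unfolding inner_sum_right
  proof (rule sum.cong)
   fix j assume "j \<in> {..<card ?T}"
   then have "\<pi> i = \<pi> j \<longleftrightarrow> i = j" using \<pi> i by (auto simp: bij_betw_def inj_on_def)
   then show "fst (e (\<pi> i)) \<bullet> (c j *R fst (e (\<pi> j))) = c j * (if i = j then 1 else 0)" by (simp add: e_orth)
  qed simp
  also have "\<dots> = c i" using i by (simp add: if_distrib[of "%x. _ * x"] cong: if_cong)
  finally show "c i = 0" by simp
 next
  fix u assume "u \<in> dirichlet_eigenspace Om t"
  then obtain p where p: "eigenpair Om t p" "AEL x. x \<in> Om --> u x = L2f (fst p) x"
   using eigenspace_imp_eigenpair[OF Om] by blast
  have "p = (\<Sum>n\<in>?T. (fst (e n) \<bullet> fst p) *R e n)"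
   using p(1) by (intro eigenvector_expansion) (auto simp: eigenpair_def)
  also have "\<dots> = (\<Sum>i<card ?T. (fst (e (\<pi> i)) \<bullet> fst p) *R e (\<pi> i))"
   using \<pi> by (rule sum.reindex_bij_betw[symmetric])
  finally have "fst p = (\<Sum>i<card ?T. (fst (e (\<pi> i)) \<bullet> fst p) *R fst (e (\<pi> i)))"
   by (metis (no_types, lifting) fst_scaleR fst_sum sum.cong)
  then have "AEL x. L2f (fst p) x = (\<Sum>i<card ?T. (fst (e (\<pi> i)) \<bullet> fst p) * b i x)"
   using L2f_sum[where I = "{..<card ?T}" and c = "%i. fst (e (\<pi> i)) \<bullet> fst p" and U = "%i. fst (e (\<pi> i))"] by (simp add: b_def)
  with p(2) have "AE x in lebesgue_on Om. u x = (\<Sum>i<card ?T. (fst (e (\<pi> i)) \<bullet> fst p) * b i x)"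
   unfolding AE_lebesgue_on_iff[OF Om] by eventually_elim auto
  then show "\<exists>c. AE x in lebesgue_on Om. u x = (\<Sum>i<card ?T. c i * b i x)"
   by (intro exI[of _ "%i. fst (e (\<pi> i)) \<bullet> fst p"])
 qed
qed

lemma card_shift: "card {k\<in>{1..}. ev (k - 1) = t} = card {n. ev n = t}"
 and finite_shift: "finite {k\<in>{1..}. ev (k - 1) = t}"
proof -
 have eq: "{k\<in>{1..}. ev (k - 1) = t} = Suc ` {n. ev n = t}"
  by (auto simp: image_iff) (metis Suc_diff_1 One_nat_def Suc_le_D diff_Suc_1)
 have fin: "finite {n. ev n = t}" using ev_finite[of t] by (rule finite_subset[rotated]) auto
 show "card {k\<in>{1..}. ev (k - 1) = t} = card {n. ev n = t}" unfolding eq by (simp add: card_image)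
 show "finite {k\<in>{1..}. ev (k - 1) = t}" unfolding eq using fin by simp
qed

lemma dirichlet_spectrum_ev: "dirichlet_spectrum Om (%k. ev (k - 1))"
 unfolding dirichlet_spectrum_def card_shift
 using finite_shift eigenspace_dimension by (auto intro!: mono_onI ev_mono)

lemma dirichlet_eigenvalue_ev:
 assumes h: "1 <= h"
 shows "evD h Om = ev (h - 1)"
 unfolding dirichlet_eigenvalue_def
proof (rule the_equality)
 show "\<exists>lam. dirichlet_spectrum Om lam & lam h = ev (h - 1)" using dirichlet_spectrum_ev by blast
 fix t assume "\<exists>lam. dirichlet_spectrum Om lam & lam h = t"
 then obtain lam where lam: "dirichlet_spectrum Om lam" "lam h = t" by blast
 have "ev (h - 1) = lam h"
 proof (rule mono_enumeration_unique[of "%k. ev (k - 1)" lam])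
  show "mono_on {1..} (%k. ev (k - 1))" by (auto intro!: mono_onI ev_mono)
  show "card {k\<in>{1..}. ev (k - 1) = s} = card {k\<in>{1..}. lam k = s}" for s
   using has_dim_ae_le eigenspace_dimension[of s] lam(1)
   unfolding card_shift dirichlet_spectrum_def by (meson le_antisym)
  show "\<exists>k\<ge>1. B < ev (k - 1)" for B
   using ev_unbounded[of B] by (metis diff_Suc_1 le_add1 plus_1_eq_Suc)
 qed (use lam(1) h finite_shift in \<open>auto simp: dirichlet_spectrum_def\<close>)
 then show "t = ev (h - 1)" using lam(2) by simp
qed

end

lemma eigen_form_exists:
 assumes "open Om" "bounded Om" "Om ~= {}"
 obtains e where "eigen_form (H10 Om) e"
proof -
 interpret compact_form "H10 Om" using compact_form_H10[OF assms] .
 obtain e where "eigen_seq (H10 Om) e" using eigen_seq_exists by blast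
 then have "eigen_form (H10 Om) e" by unfold_locales
 then show ?thesis by (rule that)
qed

section \<open>Affine substitutions\<close>

lemma dmap_inner: "j \<in> Basis ==> dmap c t x \<bullet> j = t \<bullet> j + c j * (x \<bullet> j)"
 by (simp add: dmap_def inner_add_left inner_sum_left inner_Basis if_distrib[of "%z. _ * z"] cong: if_cong)

lemma dmap_shift: "dmap c t x = t + dmap c 0 x"
 by (simp add: dmap_def)

lemma dmap_linear: "linear (dmap c 0)"
 by (rule linearI) (auto simp: dmap_def algebra_simps sum.distrib scaleR_sum_right)

lemma dmap_inverse:
 fixes x :: "'a::euclidean_space"
 assumes "!!j::'a. j \<in> Basis ==> c j ~= 0"
 shows "dmap (%j. 1 / c j) 0 (dmap c 0 x) = x" "dmap c 0 (dmap (%j. 1 / c j) 0 x) = x"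
 by (rule euclidean_eqI; simp add: dmap_inner assms)+

lemma dmap_self_adjoint: "dmap c 0 u \<bullet> v = u \<bullet> dmap c 0 v"
 by (simp add: dmap_def inner_sum_left inner_sum_right inner_commute mult_ac)

text \<open>Composition with an affine map; \<open>A\<close> is the identity on functions and the transposed linear part on gradients.\<close>

definition pull :: "('a::euclidean_space => real) => 'a => ('b::euclidean_space => 'b) => ('a, 'b) L2 => ('a, 'b) L2" where
 "pull c t A U = toL2 (%x. A (L2f U (dmap c t x)))"

context
 fixes c :: "'a::euclidean_space => real" and t :: 'a and A :: "'b::euclidean_space => 'b"
 assumes c: "!!j. j \<in> Basis ==> c j ~= 0" and A: "linear A"
begin

lemma A_bounded: "bounded_linear A"
 using A by (simp add: linear_conv_bounded_linear)

lemma sqint_pull: "sqint f ==> sqint (%x. A (f (dmap c t x)))"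
proof -
 assume f: "sqint f"
 note [measurable] = sqint_meas[OF f]
 obtain K where K: "!!v. norm (A v) <= K * norm v" using linear_bounded_pos[OF A] by metis
 have "integrable lborel (%x. K\<^sup>2 * (norm (f (dmap c t x)))^2)"
  using f c by (intro integrable_mult_right integrable_dmap[of "%x. (norm (f x))\<^sup>2"]) (auto simp: sqint_def)
 moreover have [measurable]: "A \<in> borel_measurable borel"
  by (intro borel_measurable_continuous_onI linear_continuous_on A_bounded)
 moreover have "(norm (A v))^2 <= K\<^sup>2 * (norm v)^2" for v
  using power_mono[OF K[of v], of 2] by (simp add: power_mult_distrib)
 ultimately have "integrable lborel (%x. (norm (A (f (dmap c t x))))\<^sup>2)"
  by (intro Bochner_Integration.integrable_bound[of lborel "%x. K\<^sup>2 * (norm (f (dmap c t x)))^2" "%x. (norm (A (f (dmap c t x))))\<^sup>2"]) auto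
 then show ?thesis unfolding sqint_def by simp
qed

lemma pull_toL2:
 assumes f: "sqint f"
 shows "pull c t A (toL2 f) = toL2 (%x. A (f (dmap c t x)))"
proof -
 have "AEL x. L2f (toL2 f) (dmap c t x) = f (dmap c t x)"
  by (rule AE_dmap[where c = c and t = t, OF L2f_toL2[OF f] c])
 then show ?thesis unfolding pull_def
  by (intro toL2_eqI sqint_pull sqint_L2f f) (auto elim!: eventually_mono)
qed

lemma pull_norm_le:
 assumes "!!v. norm (A v) <= K * norm v"
 shows "\<bar>\<Prod>j\<in>Basis. c j\<bar> * (norm (pull c t A U))^2 <= K\<^sup>2 * (norm U)^2"
proof -
 have s: "sqint (%x. A (L2f U x))"
 proof -
  obtain K' where K': "!!v. norm (A v) <= K' * norm v" "K' > 0" using linear_bounded_pos[OF A] by metis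
  show ?thesis
  proof (rule sqint_bound[of "%x. K' *R L2f U x"])
   show "sqint (%x. K' *R L2f U x)" by (intro sqint_scale sqint_L2f)
   show "(%x. A (L2f U x)) \<in> borel_measurable borel"
    using borel_measurable_continuous_onI[OF linear_continuous_on[OF A_bounded]] by measurable
  qed (use K' in simp)
 qed
 have "\<bar>\<Prod>j\<in>Basis. c j\<bar> * (norm (pull c t A U))^2 = (LB x. (norm (A (L2f U x)))\<^sup>2)"
  unfolding pull_def norm_toL2[OF sqint_pull[OF sqint_L2f]]
  using integral_dmap[of "%x. (norm (A (L2f U x)))\<^sup>2" c t] c sqint_meas[OF s] by simp
 also have "\<dots> <= (LB x. K\<^sup>2 * (norm (L2f U x))^2)"
 proof (rule integral_mono)
  show "(norm (A (L2f U x)))^2 <= K\<^sup>2 * (norm (L2f U x))^2" for x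
   using power_mono[OF assms[of "L2f U x"], of 2] by (simp add: power_mult_distrib)
 qed (use s sqint_L2f[of U] in \<open>auto simp: sqint_def\<close>)
 finally show ?thesis by (simp add: norm_L2f)
qed

lemma pull_linear: "linear (pull c t A)"
proof (rule linearI)
 note s = sqint_L2f
 fix U V :: "('a, 'b) L2" and r :: real
 have "pull c t A (U + V) = toL2 (%x. A (L2f U (dmap c t x)) + A (L2f V (dmap c t x)))"
  unfolding pull_def using AE_dmap[where c = c and t = t, OF L2f_add[of U V] c]
  by (intro toL2_eqI sqint_pull s sqint_add) (auto simp: linear_add[OF A] elim!: eventually_mono)
 then show "pull c t A (U + V) = pull c t A U + pull c t A V"
  unfolding pull_def by (simp add: toL2_add sqint_pull s)
 have "pull c t A (r *R U) = toL2 (%x. r *R A (L2f U (dmap c t x)))"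
  unfolding pull_def using AE_dmap[where c = c and t = t, OF L2f_scale[of r U] c]
  by (intro toL2_eqI sqint_pull s sqint_scale) (auto simp: linear_scale[OF A] elim!: eventually_mono)
 then show "pull c t A (r *R U) = r *R pull c t A U"
  unfolding pull_def by (simp add: toL2_scale sqint_pull s)
qed

lemma pull_bounded_linear: "bounded_linear (pull c t A)"
proof -
 obtain K where K: "!!v. norm (A v) <= K * norm v" "K > 0" using linear_bounded_pos[OF A] by metis
 define P where "P = \<bar>\<Prod>j\<in>Basis. c j\<bar>"
 have P: "P > 0" unfolding P_def using c by auto
 have "norm (pull c t A U) <= norm U * (K / sqrt P)" for U
 proof (rule power2_le_imp_le)
  show "(norm (pull c t A U))^2 <= (norm U * (K / sqrt P))^2"
   using pull_norm_le[OF K(1), of U] P by (simp add: P_def[symmetric] power_mult_distrib power_divide field_simps)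
 qed (use K P in auto)
 then show ?thesis
  using pull_linear by (intro bounded_linear_intro[where K = "K / sqrt P"]) (auto simp: linear_add linear_scale)
qed

lemma pull_continuous: "continuous_on S (pull c t A)"
 by (rule linear_continuous_on[OF pull_bounded_linear])

lemma pull_vanish:
 assumes "U \<in> vanish B"
 shows "pull c t A U \<in> vanish (dmap c t -` B)"
proof -
 have "AEL x. x \<in> B --> L2f U x = 0" using assms by (simp add: vanish_def)
 then have "AEL x. dmap c t x \<in> B --> L2f U (dmap c t x) = 0" by (rule AE_dmap[where c = c and t = t, OF _ c])
 then show ?thesis
  unfolding pull_def vanish_toL2[OF sqint_pull[OF sqint_L2f]]
  by eventually_elim (auto simp: linear_0[OF A])
qed

end

lemma linear_ident': "linear (%v::'v::real_vector. v)"
 by (rule linearI) auto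

lemma H10_pull:
 fixes c :: "'a::euclidean_space => real"
 assumes c: "!!j. j \<in> Basis ==> c j ~= 0" and p: "(U, G) \<in> H10 Om"
 shows "(pull c t (%v. v) U, pull c t (dmap c 0) G) \<in> H10 (dmap c t -` Om)"
proof -
 have "H10 Om \<subseteq> (%p. (pull c t (%v. v) (fst p), pull c t (dmap c 0) (snd p))) -` H10 (dmap c t -` Om)"
 proof (rule H10_subset)
  have "continuous_on UNIV (%p. (pull c t (%v::real. v) (fst p), pull c t (dmap c 0) (snd p)))"
   by (intro continuous_on_Pair continuous_on_compose2[OF pull_continuous[where c = c and t = t, OF c linear_ident']]
      continuous_on_compose2[OF pull_continuous[where c = c and t = t, OF c dmap_linear]] continuous_intros) auto
  then show "closed ((%p. (pull c t (%v. v) (fst p), pull c t (dmap c 0) (snd p))) -` H10 (dmap c t -` Om))"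
   unfolding continuous_on_eq_continuous_at[OF open_UNIV] by (intro continuous_closed_vimage[OF H10_closed]) blast
  fix phi assume phi: "phi \<in> test Om"
  note * = test_affine[where a = t and L = "dmap c 0" and L' = "dmap (%j. 1 / c j) 0",
    OF phi dmap_linear dmap_linear dmap_inverse[of c, OF c] dmap_self_adjoint, folded dmap_shift]
  have g: "grad (%x. phi (dmap c t x)) = (%x. dmap c 0 (grad phi (dmap c t x)))"
   by (rule ext) (rule *(2))
  have "(%x. phi (dmap c t x)) \<in> test (dmap c t -` Om)" using *(1) by (simp add: vimage_def)
  from gp_H10[OF this] show "gp phi \<in> (%p. (pull c t (%v. v) (fst p), pull c t (dmap c 0) (snd p))) -` H10 (dmap c t -` Om)"
   using g by (simp add: pull_toL2[where c = c and t = t, OF c linear_ident' test_sqint[OF phi]]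
     pull_toL2[where c = c and t = t, OF c dmap_linear grad_sqint[OF phi]])
 qed
 then show ?thesis using p by auto
qed

lemma pull_inner:
 fixes c :: "'a::euclidean_space => real" and U V :: "('a, real) L2"
 assumes c: "!!j. j \<in> Basis ==> c j ~= 0"
 shows "\<bar>\<Prod>j\<in>Basis. c j\<bar> * (pull c t (%v. v) U \<bullet> pull c t (%v. v) V) = U \<bullet> V"
proof -
 have s: "sqint (%x. L2f U (dmap c t x))" for U :: "('a, real) L2"
  using sqint_pull[where c = c and t = t, OF c linear_ident' sqint_L2f[of U]] by simp
 show ?thesis
  unfolding pull_def inner_toL2[OF s s] inner_L2f[of U V]
  using integral_dmap[of "%x. L2f U x \<bullet> L2f V x" c t] c by (simp del: inner_real_def)
qed

section \<open>Functions vanishing outside a convex body\<close>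

lemma test_dilation_limit:
 fixes psi :: "'a::euclidean_space => real" and r :: "nat => real"
 assumes psi: "psi \<in> test UNIV" and r: "!!n. r n >= 1" "r ---> 1"
 shows "(%n. pull (%_. r n) ((1 - r n) *R z) (%v. v) (toL2 psi)) ---> toL2 psi"
proof -
 obtain R where R: "R > 0" "!!x. norm x >= R ==> psi x = 0" using test_outside_ball[OF psi] by blast
 obtain L where L: "L >= 0" "!!x y. \<bar>psi x - psi y\<bar> <= L * norm (x - y)" using test_lipschitz[OF psi] by blast
 note [measurable] = test_meas[OF psi]
 have r0: "r n ~= 0" for n using r(1)[of n] by auto
 define T where "T n x = (1 - r n) *R z + r n *R x" for n x
 have T: "dmap (%_. r n) ((1 - r n) *R z) x = T n x" for n x by (simp add: dmap_const T_def)
 have Tx: "T n x - x = (r n - 1) *R (x - z)" "T n x - z = r n *R (x - z)" for n x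
  by (simp_all add: T_def algebra_simps)
 define Q where "Q = R + norm z"
 have bnd: "\<bar>psi (T n x) - psi x\<bar> <= (L * Q * (r n - 1)) * indicator (cball z Q) x" for n x
 proof (cases "x \<in> cball z Q")
  case True
  then have "norm (x - z) <= Q" by (simp add: dist_norm norm_minus_commute)
  then have "(r n - 1) * norm (x - z) <= (r n - 1) * Q" using r(1)[of n] by (intro mult_left_mono) auto
  then have "L * norm (T n x - x) <= L * ((r n - 1) * Q)" using r(1)[of n] L(1) by (intro mult_left_mono) (auto simp: Tx)
  then show ?thesis using True order_trans[OF L(2)[of "T n x" x]] by (simp add: mult_ac)
 next
  case False
  then have g: "norm (x - z) > Q" by (simp add: dist_norm norm_minus_commute)
  have "norm x >= norm (x - z) - norm z" using norm_triangle_ineq4[of x z] by simp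
  then have 1: "psi x = 0" using g by (intro R(2)) (simp add: Q_def)
  have "norm (T n x - z) >= norm (x - z)" using r(1)[of n] mult_right_mono[of 1 "r n" "norm (x - z)"] by (simp add: Tx)
  moreover have "norm (T n x) >= norm (T n x - z) - norm z" using norm_triangle_ineq4[of "T n x" z] by simp
  ultimately have "psi (T n x) = 0" using g by (intro R(2)) (simp add: Q_def)
  then show ?thesis using 1 False by simp
 qed
 have i: "integrable lborel (indicator (cball z Q) :: 'a => real)"
  using emeasure_bounded_finite[of "cball z Q"] by (intro integrable_real_indicator) auto
 have n: "(norm (pull (%_. r n) ((1 - r n) *R z) (%v. v) (toL2 psi) - toL2 psi))^2 <= (L * Q * (r n - 1))^2 * measure lborel (cball z Q)" for n
 proof -
  note s = sqint_pull[where c = "%_. r n" and t = "(1 - r n) *R z", OF r0 linear_ident' test_sqint[OF psi], unfolded T]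
  have "(norm (pull (%_. r n) ((1 - r n) *R z) (%v. v) (toL2 psi) - toL2 psi))^2 = (LB x. (psi (T n x) - psi x)\<^sup>2)"
   using pull_toL2[where c = "%_. r n" and t = "(1 - r n) *R z", OF r0 linear_ident' test_sqint[OF psi], unfolded T]
   by (simp add: toL2_diff[OF s test_sqint[OF psi]] norm_toL2[OF sqint_diff[OF s test_sqint[OF psi]]])
  also have "\<dots> <= (LB x. (L * Q * (r n - 1))\<^sup>2 * indicator (cball z Q) x)"
  proof (rule integral_mono)
   show "integrable lborel (%x. (psi (T n x) - psi x)\<^sup>2)" using sqint_diff[OF s test_sqint[OF psi]] by (simp add: sqint_def)
   show "(psi (T n x) - psi x)^2 <= (L * Q * (r n - 1))^2 * indicator (cball z Q) x" for x
    using power_mono[OF bnd[of n x], of 2] by (cases "x \<in> cball z Q") (auto simp: power_mult_distrib)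
  qed (use i in \<open>auto intro: integrable_mult_right\<close>)
  finally show ?thesis by simp
 qed
 have "(%n. (L * Q * (r n - 1))\<^sup>2 * measure lborel (cball z Q)) ---> (L * Q * (1 - 1))\<^sup>2 * measure lborel (cball z Q)"
  by (intro tendsto_intros r)
 then have "(%n. (norm (pull (%_. r n) ((1 - r n) *R z) (%v. v) (toL2 psi) - toL2 psi))\<^sup>2) ---> 0"
  using Lim_null_comparison[OF always_eventually, of "%n. (norm (pull (%_. r n) ((1 - r n) *R z) (%v. v) (toL2 psi) - toL2 psi))\<^sup>2"
    "%n. (L * Q * (r n - 1))\<^sup>2 * measure lborel (cball z Q)" sequentially] n by simp
 then have "(%n. sqrt ((norm (pull (%_. r n) ((1 - r n) *R z) (%v. v) (toL2 psi) - toL2 psi))^2)) ---> sqrt 0"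
  by (rule tendsto_real_sqrt)
 then show ?thesis by (simp add: tendsto_norm_zero_iff LIM_zero_cancel)
qed

text \<open>Dilations by \<open>r n >= 1\<close> are contractions, so the limit passes from test functions to their closure.\<close>

lemma dilation_limit:
 fixes r :: "nat => real" and x0 :: "'a::euclidean_space"
 assumes p: "(U, G) \<in> H10 UNIV" and r: "!!n. r n >= 1" "r ---> 1"
 shows "(%n. pull (%_. r n) ((1 - r n) *R x0) (%v. v) U) ---> U"
proof (rule metric_LIMSEQ_I)
 fix e :: real assume e: "e > 0"
 let ?T = "%n. pull (%_. r n) ((1 - r n) *R x0) (%v::real. v)"
 have r0: "r n ~= 0" for n using r(1)[of n] by auto
 have contr: "norm (?T n V) <= norm V" for n V
 proof (rule power2_le_imp_le)
  have "1 * (norm (?T n V))^2 <= \<bar>\<Prod>j\<in>(Basis::'a set). r n\<bar> * (norm (?T n V))^2"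
   using r(1)[of n] by (intro mult_right_mono) auto
  also have "\<dots> <= 1\<^sup>2 * (norm V)^2" using r0[of n] by (intro pull_norm_le linear_ident') auto
  finally show "(norm (?T n V))^2 <= (norm V)^2" by simp
 qed simp
 obtain phi where phi: "!!n. phi n \<in> test UNIV" "(%n::nat. gp (phi n)) ---> (U, G)"
  using H10_approx[OF p] by blast
 have "(%n. toL2 (phi n)) ---> U" using tendsto_fst[OF phi(2)] by simp
 then obtain k where k: "dist (toL2 (phi k)) U < e/3" using metric_LIMSEQ_D[of _ U "e/3"] e by (metis divide_pos_pos order_refl zero_less_numeral)
 obtain N where N: "!!n. n >= N ==> dist (?T n (toL2 (phi k))) (toL2 (phi k)) < e/3"
  using metric_LIMSEQ_D[OF test_dilation_limit[where z = x0, OF phi(1)[of k] r], of "e/3"] e by auto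
 have "dist (?T n U) U < e" if "n >= N" for n
 proof -
  have "dist (?T n U) (?T n (toL2 (phi k))) <= dist U (toL2 (phi k))"
   unfolding dist_norm using linear_diff[OF pull_linear[where c = "%_. r n", OF r0 linear_ident']] contr[of n "U - toL2 (phi k)"] by metis
  then show ?thesis
   using k N[OF that] dist_triangle[of "?T n U" U "?T n (toL2 (phi k))"]
    dist_triangle[of "?T n (toL2 (phi k))" U "toL2 (phi k)"] by (simp add: dist_commute)
 qed
 then show "\<exists>N. \<forall>n\<ge>N. dist (?T n U) U < e" by blast
qed

text \<open>Shrinking towards an interior point moves the support into the open set; mollifying then
 yields test functions with almost the same energy.\<close>

lemma H10_convex:
 fixes K :: "'a::euclidean_space set"
 assumes K: "convex K" "compact K" "interior K ~= {}" and p: "(U, G) \<in> H10 UNIV" and U: "U \<in> vanish (- K)"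
 shows "(U, G) \<in> H10 (interior K)"
proof -
 obtain x0 where x0: "x0 \<in> interior K" using K(3) by blast
 define r where "r n = 1 + inverse (real (Suc n))" for n
 have r1: "r n > 1" for n by (simp add: r_def)
 have r: "!!n. r n >= 1" "r ---> 1" using LIMSEQ_inverse_real_of_nat_add[of 1] by (auto simp: r_def[abs_def])
 have r0: "r n ~= 0" for n using r1[of n] by simp
 define V where "V n = pull (%_. r n) ((1 - r n) *R x0) (%v::real. v) U" for n
 define F where "F n = pull (%_. r n) ((1 - r n) *R x0) (dmap (%_. r n) 0) G" for n
 have VF: "(V n, F n) \<in> H10 UNIV" for n
  unfolding V_def F_def using H10_pull[where c = "%_. r n", OF r0 p] by simp
 have F: "norm (F n) <= r n * norm G" for n
 proof (rule power2_le_imp_le)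
  have "1 * (norm (F n))^2 <= \<bar>\<Prod>j\<in>(Basis::'a set). r n\<bar> * (norm (F n))^2"
   using r(1)[of n] by (intro mult_right_mono) auto
  also have "\<dots> <= (r n)^2 * (norm G)^2" unfolding F_def
   using r0[of n] r(1)[of n] by (intro pull_norm_le dmap_linear) (auto simp: dmap_const)
  finally show "(norm (F n))^2 <= (r n * norm G)^2" by (simp add: power_mult_distrib)
 qed (use r(1)[of n] in simp)
 define S where "S n = (%y. y - (1 - 1 / r n) *R (y - x0)) ` K" for n
 have S: "compact (S n)" for n unfolding S_def by (intro compact_continuous_image K continuous_intros)
 have SK: "S n \<subseteq> interior K" for n
  unfolding S_def using mem_interior_convex_shrink[OF K(1) x0] r1[of n] by auto
 have VS: "V n \<in> vanish (- S n)" for n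
 proof (rule vanish_mono)
  show "V n \<in> vanish (dmap (%_. r n) ((1 - r n) *R x0) -` (- K))"
   unfolding V_def using r0 by (intro pull_vanish linear_ident' U)
  show "- S n \<subseteq> dmap (%_. r n) ((1 - r n) *R x0) -` (- K)"
  proof (intro subsetI vimageI2 ComplI notI)
   fix x assume x: "x \<in> - S n" and "dmap (%_. r n) ((1 - r n) *R x0) x \<in> K"
   then have y: "(1 - r n) *R x0 + r n *R x \<in> K" (is "?y \<in> K") by (simp add: dmap_const)
   have 1: "?y - x0 = r n *R (x - x0)" by (simp add: algebra_simps)
   have "(1 - 1 / r n) *R (?y - x0) = (r n - 1) *R (x - x0)"
    unfolding 1 scaleR_scaleR using r0[of n] by (simp add: left_diff_distrib)
   then have "?y - (1 - 1 / r n) *R (?y - x0) = x" using r0[of n] by (simp add: algebra_simps)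
   then have "x \<in> S n" unfolding S_def using y by (intro image_eqI[of x _ ?y]) auto
   then show False using x by simp
  qed
 qed
 have "\<exists>eps (rho :: 'a => real). eps <= inverse (real (Suc n)) & mollifier eps rho & (\<forall>x y. y \<in> S n --> norm (x - y) <= eps --> x \<in> interior K)" for n
 proof -
  obtain eps where eps: "eps > 0" "(\<Union>x\<in>S n. cball x eps) \<subseteq> interior K"
   using compact_subset_open_imp_cball_epsilon_subset[OF S open_interior SK] by blast
  define del where "del = min eps (inverse (real (Suc n)))"
  have "del > 0" using eps by (simp add: del_def)
  then obtain rho :: "'a => real" where "mollifier del rho" using mollifier_exists by blast
  moreover have "x \<in> interior K" if "y \<in> S n" "norm (x - y) <= del" for x y
   using eps(2) that by (force simp: del_def dist_norm norm_minus_commute)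
  ultimately show ?thesis by (intro exI[of _ del] exI[of _ rho]) (auto simp: del_def)
 qed
 then obtain eps and rho :: "nat => 'a => real" where rho: "!!n. eps n <= inverse (real (Suc n))" "!!n. mollifier (eps n) (rho n)"
  "!!n x y. y \<in> S n ==> norm (x - y) <= eps n ==> x \<in> interior K" by metis
 have "\<exists>G'. (U, G') \<in> H10 (interior K) & norm G' <= norm G"
 proof (rule graph_weak_limit[OF subspace_imp_convex[OF H10_subspace] H10_closed])
  show "(moll (rho n) (V n), moll (rho n) (F n)) \<in> H10 (interior K)" for n
   by (rule moll_H10[OF VF S VS rho(2,3)])
  have "V ---> U" unfolding V_def[abs_def] by (rule dilation_limit[OF p r])
  moreover have "(%n. moll (rho n) (V n) - V n) ---> 0"
  proof (rule Lim_null_comparison)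
   show "\<forall>\<^sub>F n in sequentially. norm (moll (rho n) (V n) - V n) <= inverse (real (Suc n)) * (r n * norm G)"
   proof (rule always_eventually, rule allI)
    fix n
    have "norm (moll (rho n) (V n) - V n) <= eps n * norm (F n)" by (rule moll_close[OF rho(2) VF])
    also have "\<dots> <= inverse (real (Suc n)) * norm (F n)" using rho(1) by (intro mult_right_mono) auto
    also have "\<dots> <= inverse (real (Suc n)) * (r n * norm G)" using F by (intro mult_left_mono) auto
    finally show "norm (moll (rho n) (V n) - V n) <= inverse (real (Suc n)) * (r n * norm G)" .
   qed
   have "(%n. inverse (real (Suc n)) * (r n * norm G)) ---> 0 * (1 * norm G)"
    by (intro tendsto_mult r tendsto_const LIMSEQ_inverse_real_of_nat)
   then show "(%n. inverse (real (Suc n)) * (r n * norm G)) ---> 0" by simp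
  qed
  ultimately have "(%n. (moll (rho n) (V n) - V n) + V n) ---> 0 + U" by (intro tendsto_add)
  then show "(%n. fst (moll (rho n) (V n), moll (rho n) (F n))) ---> U" by simp
  show "norm (snd (moll (rho n) (V n), moll (rho n) (F n))) <= r n * norm G" for n
   using order_trans[OF moll_norm[OF rho(2)] F] by simp
  have "(%n. r n * norm G) ---> 1 * norm G" by (intro tendsto_mult r tendsto_const)
  then show "(%n. r n * norm G) ---> norm G" by simp
 qed
 then show ?thesis using gradient_unique'[OF p] by blast
qed

section \<open>Variational characterization of the eigenvalues\<close>

abbreviation dom :: "'a::euclidean_space set => bool" where
 "dom Om \<equiv> open Om & bounded Om & Om ~= {}"

lemma eigenvalue_upper:
 fixes v :: "nat => ('a::euclidean_space, real) L2 \<times> ('a, 'a) L2"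
 assumes "dom Om" "1 <= h" "!!i. i < h ==> v i \<in> H10 Om"
  "!!c. fst (\<Sum>i<h. c i *R v i) = 0 ==> \<forall>i<h. c i = 0"
  "!!c. (norm (snd (\<Sum>i<h. c i *R v i)))\<^sup>2 <= L * (norm (fst (\<Sum>i<h. c i *R v i)))^2"
 shows "evD h Om <= L"
proof -
 obtain e where ef: "eigen_form (H10 Om) e" using eigen_form_exists assms(1) by metis
 interpret eigen_form "H10 Om" e by (rule ef)
 show ?thesis
  using dirichlet_eigenvalue_ev[OF _ ef assms(2)] minmax_upper[of h v L] assms by simp
qed

lemma eigen_frame:
 assumes "dom Om" "1 <= h"
 obtains e :: "nat => ('a::euclidean_space, real) L2 \<times> ('a, 'a) L2"
 where "!!i. e i \<in> H10 Om" "!!i j. fst (e i) \<bullet> fst (e j) = (if i = j then 1 else 0)"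
  "!!c. (norm (fst (\<Sum>i<h. c i *R e i)))\<^sup>2 = (\<Sum>i<h. (c i)\<^sup>2)"
  "!!c. (norm (snd (\<Sum>i<h. c i *R e i)))\<^sup>2 <= evD h Om * (norm (fst (\<Sum>i<h. c i *R e i)))^2"
proof -
 obtain e where ef: "eigen_form (H10 Om) e" using eigen_form_exists assms(1) by metis
 interpret eigen_form "H10 Om" e by (rule ef)
 show ?thesis
  using that[of e] e_W e_orth e_combination_le e_combination(1) dirichlet_eigenvalue_ev[OF _ ef assms(2)] assms(1) by simp
qed

lemma eigenvalue_nonneg: "dom Om ==> 1 <= h ==> evD h Om >= 0"
proof -
 assume *: "dom Om" "1 <= h"
 obtain e where ef: "eigen_form (H10 Om) e" using eigen_form_exists *(1) by metis
 interpret eigen_form "H10 Om" e by (rule ef)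
 show ?thesis using dirichlet_eigenvalue_ev[OF _ ef *(2)] ev_nonneg * by simp
qed

lemma orthonormal_independent:
 fixes e :: "nat => ('h::real_inner \<times> 'g::real_vector)"
 assumes "(norm (fst (\<Sum>i<h. c i *R e i)))^2 = (\<Sum>i<h. (c i)\<^sup>2)" "fst (\<Sum>i<h. c i *R e i) = 0"
 shows "\<forall>i<h. c i = (0::real)"
 using assms by (simp add: sum_nonneg_eq_0_iff)

lemma eigenvalue_mono:
 assumes "dom Om" "dom Om'" "Om \<subseteq> Om'" "1 <= h"
 shows "evD h Om' <= evD h Om"
proof -
 obtain e where e: "!!i. e i \<in> H10 Om" "!!i j. fst (e i) \<bullet> fst (e j) = (if i = j then 1 else 0)" "!!c. (norm (fst (\<Sum>i<h. c i *R e i)))\<^sup>2 = (\<Sum>i<h. (c i)\<^sup>2)"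
  "!!c. (norm (snd (\<Sum>i<h. c i *R e i)))\<^sup>2 <= evD h Om * (norm (fst (\<Sum>i<h. c i *R e i)))^2"
  by (rule eigen_frame[OF assms(1,4)]) (rule that)
 show ?thesis
 proof (rule eigenvalue_upper[OF assms(2,4)])
  show "e i \<in> H10 Om'" for i using e(1) H10_mono[OF assms(3)] by blast
  show "\<forall>i<h. c i = 0" if "fst (\<Sum>i<h. c i *R e i) = 0" for c by (rule orthonormal_independent[OF e(3) that])
 qed (rule e(4))
qed

text \<open>Some nonzero combination of the first \<open>h\<close> eigenfunctions of the smaller domain is orthogonal to the first \<open>h - 1\<close> of
 the larger one.  Its Rayleigh quotient is at most the common eigenvalue, so it attains the minimum there.\<close>

lemma eigenvalue_equal_eigenpair:
 assumes "dom Om" "dom Om'" "Om \<subseteq> Om'" "1 <= h" "evD h Om <= evD h Om'"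
 obtains p where "p \<in> H10 Om" "fst p ~= 0" "eigenpair Om' (evD h Om') p"
proof -
 obtain v where v: "!!i. v i \<in> H10 Om" "!!i j. fst (v i) \<bullet> fst (v j) = (if i = j then 1 else 0)" "!!c. (norm (fst (\<Sum>i<h. c i *R v i)))\<^sup>2 = (\<Sum>i<h. (c i)\<^sup>2)"
  "!!c. (norm (snd (\<Sum>i<h. c i *R v i)))\<^sup>2 <= evD h Om * (norm (fst (\<Sum>i<h. c i *R v i)))^2"
  by (rule eigen_frame[OF assms(1,4)]) (rule that)
 obtain e where ef: "eigen_form (H10 Om') e" using eigen_form_exists assms(2) by metis
 interpret eigen_form "H10 Om'" e by (rule ef)
 have ev: "evD h Om' = ev (h - 1)" using dirichlet_eigenvalue_ev[OF _ ef assms(4)] assms(2) by blast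
 obtain c where c: "\<exists>i<h. c i ~= 0" "\<forall>j<h - 1. fst (e j) \<bullet> fst (\<Sum>i<h. c i *R v i) = 0"
  using frame_orthogonal[of h v] assms(4) by auto
 define p where "p = (\<Sum>i<h. c i *R v i)"
 have p: "p \<in> H10 Om" unfolding p_def by (intro subspace_sum subspace_scale H10_subspace v)
 have "(norm (snd p))^2 <= evD h Om * (norm (fst p))^2" unfolding p_def by (rule v(4))
 also have "\<dots> <= ev (h - 1) * (norm (fst p))^2" using assms(5) ev by (intro mult_right_mono) auto
 finally have le: "(norm (snd p))^2 <= ev (h - 1) * (norm (fst p))^2" .
 have p': "p \<in> H10 Om'" using p H10_mono[OF assms(3)] by auto
 have "eigenpair Om' (ev (h - 1)) p"
  unfolding eigenpair_def using p' c(2) le by (auto intro!: euler_lagrange simp: p_def)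
 moreover have "fst p ~= 0" using orthonormal_independent[OF v(3)] c(1) by (auto simp: p_def)
 ultimately show ?thesis using that p ev by simp
qed

lemma first_eigenvalue_upper:
 assumes "dom Om" "p \<in> H10 Om"
 shows "evD 1 Om * (norm (fst p))^2 <= (norm (snd p))^2"
proof -
 obtain e where ef: "eigen_form (H10 Om) e" using eigen_form_exists assms(1) by metis
 interpret eigen_form "H10 Om" e by (rule ef)
 show ?thesis using dirichlet_eigenvalue_ev[OF _ ef, of 1] e_min[OF assms(2), of 0] assms(1) by simp
qed

lemma first_eigenpairI:
 assumes "dom Om" "p \<in> H10 Om" "(norm (snd p))^2 <= evD 1 Om * (norm (fst p))^2"
 shows "eigenpair Om (evD 1 Om) p"
proof -
 obtain e where ef: "eigen_form (H10 Om) e" using eigen_form_exists assms(1) by metis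
 interpret eigen_form "H10 Om" e by (rule ef)
 show ?thesis using dirichlet_eigenvalue_ev[OF _ ef, of 1] euler_lagrange[OF assms(2), of 0] assms by (auto simp: eigenpair_def)
qed

lemma eigenpair_energy: "eigenpair Om t p ==> (norm (snd p))^2 = t * (norm (fst p))^2"
 by (simp add: eigenpair_def power2_norm_eq_inner)

section \<open>A reproducing kernel for the Helmholtz equation\<close>

lemma integral_pos_continuous:
 fixes f :: "'a::euclidean_space => real"
 assumes "continuous_on UNIV f" "integrable lborel f" "!!x. f x >= 0" "f a > 0"
 shows "(LB x. f x) > 0"
proof -
 have "(LB x. f x) ~= 0"
 proof
  assume "(LB x. f x) = 0"
  then have ae: "AEL x. f x = 0" using integral_nonneg_eq_0_iff_AE[OF assms(2)] assms(3) by auto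
  define V where "V = {x. f x > 0}"
  have V: "open V" unfolding V_def using assms(1) by (intro open_Collect_less) auto
  have "AEL x. x ~: V" using ae by eventually_elim (simp add: V_def)
  then have "emeasure lborel V = 0" using V by (subst (asm) AE_iff_measurable[of V]) auto
  then have "negligible V" using V by (simp add: negligible_iff_emeasure0)
  then have "V = {}" using V open_not_negligible by blast
  then show False using assms(4) by (auto simp: V_def)
 qed
 moreover have "(LB x. f x) >= 0" using assms(3) by simp
 ultimately show ?thesis by simp
qed

lemma test_bump: "(bump :: 'a::euclidean_space => real) \<in> test UNIV"
 by (rule test_I[of _ "cball 0 1"]) (auto intro: smooth_bump bump_zero)

text \<open>The radial function whose gradient is \<open>2 y bump y\<close>.\<close>

definition bump_potential :: "'a::euclidean_space => real" where
 "bump_potential y = - flat 1 (1 - (norm y)\<^sup>2)"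

lemma test_bump_potential: "(bump_potential :: 'a::euclidean_space => real) \<in> test UNIV"
proof (rule test_I[of _ "cball 0 1"])
 show "smooth (bump_potential :: 'a => real)"
  unfolding bump_potential_def[abs_def] by (intro allI Ck_minus Ck_compose[OF smooth_flat] Ck_diff Ck_const Ck_sqnorm)
 show "bump_potential x = 0" if "x ~: cball 0 1" for x :: 'a
  using that power_mono[of 1 "norm x" 2] by (simp add: bump_potential_def flat_def not_less)
qed auto

lemma bump_potential_zero: "norm y >= 1 ==> bump_potential y = 0"
 using power_mono[of 1 "norm y" 2] by (simp add: bump_potential_def flat_def not_less)

lemma pd_bump_potential: "pd bump_potential v y = 2 * (y \<bullet> v) * bump y"
proof -
 have "(bump_potential has_derivative (%v. 2 * (y \<bullet> v) * bump y)) (at y)"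
 proof -
  have 1: "((%y. 1 - (norm y)\<^sup>2) has_derivative (%v. - (2 * (y \<bullet> v)))) (at y)"
   unfolding power2_norm_eq_inner by (auto intro!: derivative_eq_intros simp: inner_commute)
  have 2: "(flat 1 has_derivative (%t. flat [:0, 0, 1:] s * t)) (at s)" for s
   using flat_deriv[of 1 s] by (simp add: has_field_derivative_def)
  show ?thesis unfolding bump_potential_def[abs_def] bump_def
   using has_derivative_minus[OF has_derivative_compose[OF 1 2]] by (simp add: mult_ac)
 qed
 from frechet_derivative_at[OF this] show ?thesis unfolding pd_def by metis
qed

lemma pd_affine:
 fixes f :: "'b::euclidean_space => real" and L :: "'a::euclidean_space => 'b"
 assumes "smooth f" "bounded_linear L"
 shows "pd (%x. f (c + L x)) v x = pd f (L v) (c + L x)"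
proof -
 have "((%x. f (c + L x)) has_derivative (%v. pd f (L v) (c + L x))) (at x)"
  by (rule has_derivative_compose[OF _ Ck_Suc_derivative[of 0]])
    (use assms in \<open>auto intro!: derivative_eq_intros bounded_linear_imp_has_derivative simp del: Ck.simps\<close>)
 from frechet_derivative_at[OF this] show ?thesis unfolding pd_def by metis
qed

text \<open>The weighted mean of a harmonic function over a ball of radius \<open>r\<close> does not depend on \<open>r\<close>:
 since \<open>2 y bump y\<close> is a gradient, the derivative in \<open>r\<close> becomes an integral of the Laplacian.\<close>

lemma harmonic_mean_value:
 fixes w :: "'b::euclidean_space => real"
 assumes w: "w \<in> test UNIV" and harm: "!!y. y \<in> ball z R ==> lap w y = 0" and r: "0 <= r" "r < R"
 shows "(LB y. bump y * w (z + r *R y)) = w z * (LB y. bump (y :: 'b))"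
proof -
 define F where "F r = (LB y. bump y * w (z + r *R y))" for r
 have sw: "smooth w" using test_smooth[OF w] by blast
 have bl: "bounded_linear (%y::'b. r *R y)" for r by (rule bounded_linear_scaleR_right)
 have sm: "smooth f ==> smooth (%y. f (z + r *R y))" for f :: "'b => real" and r
  using Ck_affine[OF bl] by blast
 obtain K where K: "K >= 0" "!!x h. \<bar>w (x + h) - w x - pd w h x\<bar> <= K * (norm h)^2" using test_taylor[OF w] by blast
 have pdw: "smooth (pd w v)" for v using test_smooth[OF test_pd[OF w]] by blast
 have expand: "bump y * pd w y x = (\<Sum>i\<in>Basis. bump y * ((y \<bullet> i) * pd w i x))" for x y
  by (subst pd_sum_Basis) (use test_deriv[OF w] in \<open>auto simp: differentiable_def sum_distrib_left\<close>)
 have int: "integrable lborel (%y. bump y * w (z + r *R y))" for r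
  using test_integrable[OF test_mult[OF test_bump sm[OF sw]]] by (simp add: mult.commute)
 have inti: "integrable lborel (%y. bump y * ((y \<bullet> i) * pd w i (z + r *R y)))" for r i
 proof -
  have "smooth (%y. (y \<bullet> i) * pd w i (z + r *R y))" using sm[OF pdw] by (intro allI Ck_mult Ck_inner) blast
  from test_integrable[OF test_mult[OF test_bump this]] show ?thesis by (simp add: mult.commute)
 qed
 have intd: "integrable lborel (%y. bump y * pd w y (z + r *R y))" for r
  unfolding expand by (intro Bochner_Integration.integrable_sum inti)
 have deriv: "(F has_derivative (%h. h * (LB y. bump y * pd w y (z + r *R y)))) (at r)" for r
 proof (rule has_derivative_quadratic_error[where C = "K * (LB y. bump (y :: 'b))"])
  show "bounded_linear (%h. h * (LB y. bump y * pd w y (z + r *R y)))" by (rule bounded_linear_mult_left)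
  fix h :: real
  have lin: "pd w (h *R y) x = h * pd w y x" for x y using linear_scale[OF pd_linear[OF w, of x], of h y] by simp
  have ge: "bump y * (w (z + r *R y + h *R y) - w (z + r *R y) - h * pd w y (z + r *R y))
    = bump y * w (z + (r + h) *R y) - bump y * w (z + r *R y) - h * (bump y * pd w y (z + r *R y))" for y
   by (simp add: scaleR_left_distrib add.assoc right_diff_distrib)
  have eq: "F (r + h) - F r - h * (LB y. bump y * pd w y (z + r *R y))
    = (LB y. bump y * (w (z + r *R y + h *R y) - w (z + r *R y) - pd w (h *R y) (z + r *R y)))"
   (is "_ = (LB y. ?g y)") unfolding lin F_def ge
   using int[of "r + h"] int[of r] intd[of r] by simp
  have gi: "integrable lborel ?g" unfolding lin ge
   using int[of "r + h"] int[of r] integrable_mult_right[OF intd[of r], of h] by simp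
  have "norm (LB y. ?g y) <= (LB y. norm (?g y))" by (rule integral_norm_bound)
  also have "\<dots> <= (LB y. (K * h^2) * bump (y::'b))"
  proof (rule integral_mono)
   show "norm (?g y) <= (K * h^2) * bump y" for y
   proof (cases "norm y < 1")
    case True
    have "\<bar>w (z + r *R y + h *R y) - w (z + r *R y) - pd w (h *R y) (z + r *R y)\<bar> <= K * (norm (h *R y))^2" by (rule K(2))
    also have "\<dots> <= K * h^2" using True K(1)
     by (intro mult_left_mono) (auto simp: power_mult_distrib mult_left_le power_le_one)
    finally show ?thesis using mult_left_mono[OF _ bump_nonneg[of y]] bump_nonneg[of y] by (metis abs_mult abs_of_nonneg mult.commute real_norm_def)
   qed (simp add: bump_zero)
  qed (use gi test_integrable[OF test_bump] in auto)
  finally show "norm (F (r + h) - F r - h * (LB y. bump y * pd w y (z + r *R y))) <= K * (LB y. bump (y :: 'b)) * (norm h)^2"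
   unfolding eq by (simp add: mult_ac)
 qed
 have zero: "(LB y. bump y * pd w y (z + s *R y)) = 0" if s: "0 <= s" "s < R" for s
 proof -
  have IBP: "(LB y. bump y * ((y \<bullet> i) * pd w i (z + s *R y)))
    = - (s / 2) * (LB y. bump_potential y * pd (pd w i) i (z + s *R y))" if "i \<in> Basis" for i
  proof -
   have "(LB y. pd w i (z + s *R y) * pd bump_potential i y)
     = - (LB y. pd (%y. pd w i (z + s *R y)) i y * bump_potential y)"
    by (rule integration_by_parts[OF test_bump_potential sm[OF pdw[of i], of s]])
   moreover have "pd (%y. pd w i (z + s *R y)) i y = s * pd (pd w i) i (z + s *R y)" for y
    using pd_affine[OF pdw[of i] bl[of s], of z i y] linear_scale[OF pd_linear[OF test_pd[OF w, of i], of "z + s *R y"], of s i] by simp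
   ultimately have "(LB y. 2 * (bump y * ((y \<bullet> i) * pd w i (z + s *R y))))
     = - (s * (LB y. bump_potential y * pd (pd w i) i (z + s *R y)))"
    unfolding pd_bump_potential by (simp add: mult_ac)
   then show ?thesis by simp
  qed
  have ip: "integrable lborel (%y. bump_potential y * pd (pd w i) i (z + s *R y))" for i
  proof -
   have "smooth (pd (pd w i) i)" using test_smooth[OF test_pd[OF test_pd[OF w]]] by blast
   from test_integrable[OF test_mult[OF test_bump_potential sm[OF this]]] show ?thesis by (simp add: mult.commute)
  qed
  have "(LB y. bump y * pd w y (z + s *R y)) = (\<Sum>i\<in>Basis. - (s / 2) * (LB y. bump_potential y * pd (pd w i) i (z + s *R y)))"
   unfolding expand by (subst Bochner_Integration.integral_sum[OF inti]) (simp add: IBP)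
  also have "\<dots> = - (s / 2) * (LB y. bump_potential y * lap w (z + s *R y))"
   unfolding lap_def sum_distrib_left by (subst Bochner_Integration.integral_sum[OF ip]) (simp add: sum_distrib_left)
  also have "(%y. bump_potential y * lap w (z + s *R y)) = (%_. 0)"
  proof
   fix y :: 'b
   show "bump_potential y * lap w (z + s *R y) = 0"
   proof (cases "norm y < 1")
    case True
    have "s * norm y <= s * 1" using True s by (intro mult_left_mono) auto
    then have "z + s *R y \<in> ball z R" using s by (simp add: dist_norm)
    then show ?thesis using harm by simp
   qed (simp add: bump_potential_zero)
  qed
  finally show ?thesis by simp
 qed
 have "F r = F 0"
 proof (cases "r = 0")
  case False
  have "\<exists>x\<in>{0..r}. F r - F 0 = (%h. h * (LB y. bump y * pd w y (z + x *R y))) (r - 0)"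
   by (rule mvt_very_simple[OF r(1)]) (rule has_derivative_at_withinI[OF deriv])
  then show ?thesis using zero r by auto
 qed simp
 then show ?thesis by (simp add: F_def)
qed

subsection \<open>Cutoff functions and products\<close>

text \<open>Mollify the indicator function of a neighbourhood of \<open>K\<close>.\<close>

lemma cutoff_exists:
 fixes K :: "'a::euclidean_space set"
 assumes "compact K" "open V" "K \<subseteq> V"
 obtains eta where "eta \<in> test V" "!!x. x \<in> K ==> eta x = 1" "!!x. 0 <= eta x & eta x <= 1"
proof -
 obtain e where e: "e > 0" "(\<Union>x\<in>K. cball x e) \<subseteq> V"
  using compact_subset_open_imp_cball_epsilon_subset[OF assms] by blast
 define eps where "eps = e / 2"
 have eps: "eps > 0" using e by (simp add: eps_def)
 obtain rho :: "'a => real" where rho: "mollifier eps rho" using mollifier_exists[OF eps] by blast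
 note r = mollifier_test[OF rho]
 define B where "B = (\<Union>x\<in>K. \<Union>y\<in>cball 0 eps. {x + y})"
 have B: "compact B" unfolding B_def by (rule compact_sums'[OF assms(1) compact_cball])
 have mB: "B \<in> sets borel" using B by (simp add: borel_closed compact_imp_closed)
 have iB: "integrable lborel (indicator B :: 'a => real)"
  using emeasure_compact_finite[OF B] mB by (intro integrable_real_indicator) auto
 define eta where "eta = conv rho (indicator B :: 'a => real)"
 have p: "rho y >= 0" for y using rho by (simp add: mollifier_def)
 have z: "rho y = 0" if "eps <= norm y" for y using rho that by (simp add: mollifier_def)
 have ri: "integrable lborel (%y. rho (x - y))" for x by (rule test_integrable[OF reflect_test[OF r]])
 have i: "integrable lborel (%y. rho (x - y) * indicator B y)" for x by (rule test_mult_integrable[OF r iB])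
 let ?C = "\<Union>x\<in>B. \<Union>y\<in>cball 0 eps. {x + y}"
 have sm: "smooth eta" unfolding eta_def using smooth_conv[OF iB r] by blast
 have tst: "eta \<in> test V"
 proof (rule test_I[OF sm])
  show "compact ?C" by (rule compact_sums'[OF B compact_cball])
  show "?C \<subseteq> V"
  proof
   fix x assume "x \<in> ?C"
   then obtain k y y' where "k \<in> K" "norm y <= eps" "norm y' <= eps" "x = k + y + y'" by (auto simp: B_def)
   then have "x \<in> cball k e" using norm_triangle_ineq[of y y'] by (simp add: dist_norm norm_minus_commute eps_def algebra_simps)
   then show "x \<in> V" using e(2) \<open>k \<in> K\<close> by blast
  qed
  show "eta x = 0" if "x ~: ?C" for x
  proof -
   have "rho (x - y) *R (indicator B y :: real) = 0" for y
   proof (cases "y \<in> B & norm (x - y) < eps")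
    case True
    then have "x \<in> ?C" by (intro UN_I[of y] UN_I[of "x - y"]) auto
    then show ?thesis using that by blast
   qed (auto simp: z not_less)
   then show ?thesis unfolding eta_def conv_def by (simp only: Bochner_Integration.integral_zero)
  qed
 qed
 show ?thesis
 proof (rule that[OF tst])
  fix x assume x: "x \<in> K"
  have "rho (x - y) * indicator B y = rho (x - y)" for y
  proof (cases "norm (x - y) < eps")
   case True
   then have "y \<in> B" unfolding B_def using x by (intro UN_I[of x] UN_I[of "y - x"]) (auto simp: norm_minus_commute)
   then show ?thesis by simp
  qed (simp add: z)
  then show "eta x = 1" using mollifier_integral[OF rho, of x] unfolding eta_def conv_def real_scaleR_def by (simp only:)
 next
  fix x
  have "eta x >= 0" unfolding eta_def conv_def using p by (intro Bochner_Integration.integral_nonneg) auto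
  moreover have "eta x <= (LB y. rho (x - y))"
   unfolding eta_def conv_def real_scaleR_def using p by (intro integral_mono i ri) (auto simp: indicator_def)
  ultimately show "0 <= eta x & eta x <= 1" using mollifier_integral[OF rho, of x] by simp
 qed
qed

lemma sum_Basis_prod:
 "(\<Sum>i\<in>Basis. g i) = (\<Sum>i\<in>Basis. g (i, 0)) + (\<Sum>i\<in>Basis. g (0::'a::euclidean_space, i::'b::euclidean_space))"
 unfolding Basis_prod_def
 by (subst sum.union_disjoint) (auto simp: sum.reindex inj_on_def)

lemma Ck_fst: "Ck k f ==> Ck k (%p :: 'a::euclidean_space \<times> 'b::euclidean_space. f (fst p))"
 using Ck_affine[OF bounded_linear_fst, of k f 0] by simp

lemma Ck_snd: "Ck k f ==> Ck k (%p :: 'a::euclidean_space \<times> 'b::euclidean_space. f (snd p))"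
 using Ck_affine[OF bounded_linear_snd, of k f 0] by simp

lemma lap_product:
 fixes f :: "'a::euclidean_space => real" and psi :: "real => real"
 assumes f: "smooth f" and psi: "smooth psi"
 shows "lap (%p. f (fst p) * psi (snd p)) (x, t) = lap f x * psi t + f x * pd (pd psi 1) 1 t"
proof -
 have 1: "pd (%p. g (fst p) * h (snd p)) v = (%p. g (fst p) * pd h (snd v) (snd p) + pd g (fst v) (fst p) * h (snd p))"
  if "smooth g" "smooth h" for g :: "'a => real" and h :: "real => real" and v
 proof
  fix p
  show "pd (%p. g (fst p) * h (snd p)) v p = g (fst p) * pd h (snd v) (snd p) + pd g (fst v) (fst p) * h (snd p)"
   using that pd_affine[OF that(1) bounded_linear_fst, of 0 v p] pd_affine[OF that(2) bounded_linear_snd, of 0 v p]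
   by (subst pd_mult) (auto intro: Ck_fst Ck_snd)
 qed
 have z: "pd g 0 = (%_. 0)" if g: "smooth g" for g :: "'c::euclidean_space => real"
 proof
  fix x
  have "g differentiable (at x)" using g[rule_format, of "Suc 0"] by simp
  then show "pd g 0 x = 0" by (simp add: pd_sum_Basis[of g x 0])
 qed
 have s: "smooth (pd f i)" "smooth (pd psi r)" for i r
  using Ck_pd[OF f[rule_format]] Ck_pd[OF psi[rule_format]] by auto
 have a: "pd (%p. f (fst p) * psi (snd p)) (i, 0) = (%p. pd f i (fst p) * psi (snd p))" for i
  unfolding 1[OF f psi] by (simp add: z[OF psi])
 have b: "pd (%p. f (fst p) * psi (snd p)) (0, 1) = (%p. f (fst p) * pd psi 1 (snd p))"
  unfolding 1[OF f psi] by (simp add: z[OF f])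
 have c: "pd (%p. pd f i (fst p) * psi (snd p)) (i, 0) (x, t) = pd (pd f i) i x * psi t" for i
  unfolding 1[OF s(1) psi] by (simp add: z[OF psi])
 have d: "pd (%p. f (fst p) * pd psi 1 (snd p)) (0, 1) (x, t) = f x * pd (pd psi 1) 1 t"
  unfolding 1[OF f s(2)] by (simp add: z[OF f])
 show ?thesis unfolding lap_def sum_Basis_prod by (simp add: a b c d sum_distrib_right)
qed

lemma test_partial_integral:
 fixes Phi :: "'a::euclidean_space \<times> real => real"
 assumes Phi: "Phi \<in> test UNIV"
 shows "((%x. \<integral>t. Phi (x, t) \<partial>lborel) has_derivative (%v. \<integral>t. pd Phi (v, 0) (x, t) \<partial>lborel)) (at x)"
proof -
 have slice: "(%t. Psi (x, t)) \<in> test UNIV" if psi: "Psi \<in> test UNIV" for Psi :: "'a \<times> real => real" and x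
 proof -
  obtain S where S: "compact S" "!!p. p ~: S ==> Psi p = 0" using test_E[OF psi] by metis
  show ?thesis
  proof (rule test_I[of _ "snd ` S"])
   show "smooth (%t. Psi (x, t))"
   proof
    fix k
    have "bounded_linear (%t::real. (0::'a, t))" by (intro bounded_linear_Pair bounded_linear_zero bounded_linear_ident)
    from Ck_affine[OF this, of k Psi "(x, 0)"] show "Ck k (%t. Psi (x, t))" using test_smooth[OF psi] by simp
   qed
   show "compact (snd ` S)" using S(1) by (intro compact_continuous_image continuous_intros)
   show "Psi (x, t) = 0" if "t ~: snd ` S" for t using S(2)[of "(x, t)"] that by force
  qed simp
 qed
 obtain R where R: "R > 0" "!!p. norm p >= R ==> Phi p = 0" using test_outside_ball[OF Phi] by blast
 obtain K where K: "K >= 0" "!!x h. \<bar>Phi (x + h) - Phi x - pd Phi h x\<bar> <= K * (norm h)^2" using test_taylor[OF Phi] by blast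
 note i = test_integrable[OF slice[OF Phi]] and ip = test_integrable[OF slice[OF test_pd[OF Phi]]]
 have ind: "integrable lborel (indicator {-R..R} :: real => real)"
  using R(1) by (intro integrable_real_indicator) (auto simp: emeasure_lborel_Icc)
 have zd: "pd Phi v p = 0" if "norm p > R" for v p
  by (rule pd_zero_off[of "cball 0 R"]) (use R that in auto)
 show ?thesis
 proof (rule has_derivative_quadratic_error[where C = "K * (2 * R)"])
  have "linear (%v. \<integral>t. pd Phi (v, 0) (x, t) \<partial>lborel)"
  proof (rule linearI)
   have a: "pd Phi (u + v, 0) p = pd Phi (u, 0) p + pd Phi (v, 0) p" for u v p
    using linear_add[OF pd_linear[OF Phi, of p], of "(u, 0)" "(v, 0)"] by simp
   have b: "pd Phi (c *R v, 0) p = c * pd Phi (v, 0) p" for c v p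
    using linear_scale[OF pd_linear[OF Phi, of p], of c "(v, 0)"] by simp
   show "(LB t. pd Phi (u + v, 0) (x, t)) = (LB t. pd Phi (u, 0) (x, t)) + (LB t. pd Phi (v, 0) (x, t))" for u v
    unfolding a by (rule Bochner_Integration.integral_add[OF ip ip])
   show "(LB t. pd Phi (c *R v, 0) (x, t)) = c *R (LB t. pd Phi (v, 0) (x, t))" for c v
    unfolding b by simp
  qed
  then show "bounded_linear (%v. \<integral>t. pd Phi (v, 0) (x, t) \<partial>lborel)" by (simp add: linear_conv_bounded_linear)
  fix h
  let ?g = "%t. Phi (x + h, t) - Phi (x, t) - pd Phi (h, 0) (x, t)"
  have eq: "(LB t. Phi (x + h, t)) - (LB t. Phi (x, t)) - (LB t. pd Phi (h, 0) (x, t)) = (LB t. ?g t)"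
   using i ip by simp
  have "norm (LB t. ?g t) <= (LB t. norm (?g t))" by (rule integral_norm_bound)
  also have "\<dots> <= (LB t. (K * (norm h)^2) * indicator {-R..R} t)"
  proof (rule integral_mono)
   show "integrable lborel (%t. norm (?g t))" using i ip by auto
   show "integrable lborel (%t. (K * (norm h)^2) * indicator {-R..R} t :: real)" by (rule integrable_mult_right[OF ind])
   show "norm (?g t) <= (K * (norm h)^2) * indicator {-R..R} t" for t
   proof (cases "\<bar>t\<bar> <= R")
    case True then show ?thesis using K(2)[of "(x, t)" "(h, 0)"] by (simp add: norm_Pair abs_le_iff)
   next
    case False
    then have "norm (x + h, t) > R" "norm (x, t) > R"
     using norm_snd_le[of t "x + h"] norm_snd_le[of t x] by auto
    then show ?thesis using R(2) zd K(1) by simp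
   qed
  qed
  also have "\<dots> = K * (2 * R) * (norm h)^2" using R(1) by simp
  finally show "norm ((LB t. Phi (x + h, t)) - (LB t. Phi (x, t)) - (LB t. pd Phi (h, 0) (x, t))) <= K * (2 * R) * (norm h)^2"
   unfolding eq .
 qed
qed

lemma smooth_partial_integral:
 fixes Phi :: "'a::euclidean_space \<times> real => real"
 shows "Phi \<in> test UNIV ==> Ck k (%x. \<integral>t. Phi (x, t) \<partial>lborel)"
proof (induction k arbitrary: Phi)
 case 0
 have "isCont (%x. \<integral>t. Phi (x, t) \<partial>lborel) x" for x
  using test_partial_integral[OF 0] by (rule has_derivative_continuous)
 then show ?case by (simp add: continuous_at_imp_continuous_on)
next
 case (Suc k)
 show ?case by (rule Ck_SucI[OF test_partial_integral[OF Suc.prems]]) (rule Suc.IH[OF test_pd[OF Suc.prems]])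
qed

lemma pair_integral_test:
 fixes Phi :: "'a::euclidean_space \<times> real => real"
 assumes "integrable lborel Phi"
 shows "(LB x. (LB t. Phi (x, t))) = (LB p. Phi p)" "integrable lborel (%x. \<integral>t. Phi (x, t) \<partial>lborel)"
 using lborel_pair.integral_fst'[of Phi] lborel_pair.integrable_fst'[of Phi] assms by (auto simp: lborel_prod)

text \<open>\<open>kap r\<close> is a positive weight on the ball of radius \<open>r\<close> whose averages reproduce solutions of \<open>- \<Delta> f = mu\<^sup>2 f\<close>;
 the bound on its derivatives scales with \<open>1 / r\<close>.\<close>

definition helmholtz_kernel :: "real => real => (real => 'a::euclidean_space => real) => bool" where
 "helmholtz_kernel mu C kap \<longleftrightarrow> C >= 0 & (\<forall>r. 0 < r & r <= 1 --> kap r \<in> test UNIV &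
   (\<forall>z. kap r z >= 0) & (\<forall>z. norm z < r --> kap r z > 0) & (\<forall>z. r <= norm z --> kap r z = 0) &
   (\<forall>v. (LB z. \<bar>pd (kap r) v z\<bar>) <= C * norm v / r) &
   (\<forall>f\<in>test UNIV. \<forall>x R. r < R --> (\<forall>y\<in>ball x R. lap f y = - (mu^2 * f y)) --> conv (kap r) f x = f x))"

text \<open>If \<open>\<Delta> f = - mu\<^sup>2 f\<close> then \<open>f x * exp (mu t)\<close> is harmonic in one more variable; integrating its mean value
 property over \<open>t\<close> gives a kernel on the original space.\<close>

lemma helmholtz_extension:
 fixes f :: "'a::euclidean_space => real"
 assumes f: "f \<in> test UNIV" and R: "0 < R" and eq: "!!y. y \<in> ball x R ==> lap f y = - (mu^2 * f y)"
 shows "\<exists>w\<in>test UNIV. (\<forall>p\<in>ball (x, 0) R. lap w p = 0) & (\<forall>y t. \<bar>t\<bar> <= R --> w (y, t :: real) = f y * exp (mu * t))"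
proof -
 obtain eta :: "real => real" where eta: "eta \<in> test UNIV" "!!t. t \<in> {-R..R} ==> eta t = 1"
  by (rule cutoff_exists[OF compact_Icc[of "- R" R] open_UNIV subset_UNIV]) (rule that)
 define psi where "psi t = exp (mu * t) * eta t" for t
 have psi: "psi \<in> test UNIV" unfolding psi_def[abs_def] by (rule test_mult[OF eta(1)]) (blast intro: Ck_exp)
 define w where "w p = f (fst p) * psi (snd p)" for p :: "'a \<times> real"
 obtain S where S: "compact S" "!!y. y ~: S ==> f y = 0" using test_E[OF f] by metis
 obtain T where T: "compact T" "!!y. y ~: T ==> psi y = 0" using test_E[OF psi] by metis
 have sf: "smooth f" and spsi: "smooth psi" using test_smooth[OF f] test_smooth[OF psi] by blast+
 have "w \<in> test UNIV"
 proof (rule test_I[of _ "S \<times> T"])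
  show "smooth w" unfolding w_def[abs_def] using sf spsi by (intro allI Ck_mult Ck_fst Ck_snd) blast+
  show "w p = 0" if "p ~: S \<times> T" for p using that S T by (cases p) (auto simp: w_def)
 qed (auto intro: compact_Times S T)
 moreover have "lap w (y, t) = 0" if p: "(y, t) \<in> ball (x, 0) R" for y t
 proof -
  have y: "y \<in> ball x R" and t: "t \<in> {-R<..<R}"
   using p norm_fst_le[of "x - y" "- t"] norm_snd_le[of "- t" "x - y"] by (auto simp: dist_norm)
  have pe: "pd (%s. c * exp (mu * s)) 1 s = c * mu * exp (mu * s)" for c s :: real
  proof -
   have "((%s. c * exp (mu * s)) has_derivative (%h. h * (c * mu * exp (mu * s)))) (at s)"
    by (auto intro!: derivative_eq_intros)
   from frechet_derivative_at[OF this] show ?thesis unfolding pd_def by (metis mult_1)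
  qed
  have loc: "pd g 1 s = pd h 1 s" if "smooth g" "!!s. s \<in> {-R<..<R} ==> g s = h s" "s \<in> {-R<..<R}" for g h :: "real => real" and s
   unfolding pd_def using frechet_derivative_transform_within_open[of g s "{-R<..<R}" h] that
   by (metis Ck.simps(2) open_greaterThanLessThan)
  have 1: "pd psi 1 s = mu * exp (mu * s)" if "s \<in> {-R<..<R}" for s
   using loc[OF spsi _ that, of "%s. exp (mu * s)"] pe[of 1 s] eta(2) by (simp add: psi_def)
  have "pd (pd psi 1) 1 t = mu * mu * exp (mu * t)"
   using loc[of "pd psi 1" "%s. mu * exp (mu * s)" t] 1 t pe[of mu t] Ck_pd[OF spsi[rule_format]] by simp
  then have "lap w (y, t) = lap f y * exp (mu * t) + f y * (mu * mu * exp (mu * t))"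
   unfolding w_def[abs_def] lap_product[OF sf spsi] using eta(2) t by (simp add: psi_def)
  then show ?thesis by (simp add: eq[OF y] power2_eq_square)
 qed
 moreover have "w (y, t) = f y * exp (mu * t)" if "\<bar>t\<bar> <= R" for y t
  using that eta(2)[of t] by (simp add: w_def psi_def abs_le_iff)
 ultimately show ?thesis by (intro bexI[of _ w]) auto
qed

text \<open>The mean value property of the harmonic extension \<open>f x * exp (mu t)\<close> weights \<open>f\<close> with a bump function on the product space; its
 integral over \<open>t\<close> is the kernel, and rescaling to radius \<open>r\<close> costs a factor \<open>1 / r\<close> in the derivative.\<close>

lemma helmholtz_kernel_exists:
 assumes mu: "0 <= mu"
 shows "\<exists>C (kap :: real => 'a::euclidean_space => real). helmholtz_kernel mu C kap"
proof -
 let ?N = "DIM('a)"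
 define c where "c = (LB p. bump (p :: 'a \<times> real))"
 have c: "c > 0" unfolding c_def
  by (rule integral_pos_continuous[of _ 0]) (auto intro: test_cont[OF test_bump] test_integrable[OF test_bump] bump_nonneg bump_pos)
 define Phi where "Phi r p = exp (mu * r * snd p) * bump ((1 / r) *R fst p, snd p)" for r and p :: "'a \<times> real"
 define kap where "kap r z = inverse (c * r ^ ?N) * (LB t. Phi r (z, t))" for r z
 define C where "C = inverse c * exp mu * (LB p. norm (grad bump (p :: 'a \<times> real)))"
 have C: "C >= 0" using c by (simp add: C_def)
 have bl: "bounded_linear (%p. ((1 / r) *R fst p, snd p) :: 'a \<times> real)" for r
  by (intro bounded_linear_Pair bounded_linear_compose[OF bounded_linear_scaleR_right bounded_linear_fst] bounded_linear_snd)
 have sb: "smooth (%p :: 'a \<times> real. bump ((1 / r) *R fst p, snd p) :: real)" for r using Ck_affine[OF bl smooth_bump, of _ 0 r] by simp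
 have se: "smooth (%p :: 'a \<times> real. exp (mu * r * snd p))" for r using Ck_snd[OF Ck_exp[of _ "mu * r"]] by blast
 have z0: "bump ((1 / r) *R z, t) = 0" if "0 < r" "r <= norm z | 1 <= \<bar>t\<bar>" for r t :: real and z :: 'a
 proof (rule bump_zero)
  have "norm z / r >= 1 | \<bar>t\<bar> >= 1" using that by auto
  moreover have "norm z / r <= norm ((1 / r) *R z, t)" "\<bar>t\<bar> <= norm ((1 / r) *R z, t)"
   using norm_fst_le[of "(1 / r) *R z" t] norm_snd_le[of t "(1 / r) *R z"] that(1) by auto
  ultimately show "1 <= norm ((1 / r) *R z, t)" by linarith
 qed
 have tP: "Phi r \<in> test UNIV" if r: "0 < r" for r
 proof (rule test_I[of _ "cball 0 r \<times> cball 0 1"])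
  show "smooth (Phi r)" unfolding Phi_def[abs_def] using sb se by (intro allI Ck_mult) blast+
  show "Phi r p = 0" if "p ~: cball 0 r \<times> cball 0 1" for p using z0[OF r, of "fst p" "snd p"] that by (cases p) (auto simp: Phi_def)
 qed (auto intro: compact_Times)
 have slice: "integrable lborel (%t. Psi (z, t))" if "continuous_on UNIV Psi" "!!t. \<bar>t\<bar> > 1 ==> Psi (z, t) = 0" for Psi :: "'a \<times> real => real" and z
 proof (rule compact_support_integrable(1)[of _ "{-1..1}"])
  show "continuous_on UNIV (%t. Psi (z, t))" by (rule continuous_on_compose2[OF that(1)]) (auto intro!: continuous_intros)
 qed (use that in auto)
 have "helmholtz_kernel mu C kap" unfolding helmholtz_kernel_def
 proof (intro conjI C allI impI ballI)
  fix r :: real assume r: "0 < r & r <= 1"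
  note tp = tP[OF conjunct1[OF r]]
  have cr: "inverse (c * r ^ ?N) > 0" using c r by simp
  have P0: "Phi r p >= 0" for p by (simp add: Phi_def bump_nonneg)
  have zt: "Phi r (z, t) = 0" if "\<bar>t\<bar> >= 1" for z t using z0[of r z t] that r by (simp add: Phi_def)
  show n: "kap r z >= 0" for z unfolding kap_def using cr P0 by (intro mult_nonneg_nonneg Bochner_Integration.integral_nonneg) auto
  show z: "kap r z = 0" if "r <= norm z" for z using z0[of r z] that r by (simp add: kap_def Phi_def)
  show t: "kap r \<in> test UNIV"
  proof (rule test_I[of _ "cball 0 r"])
   show "smooth (kap r)" unfolding kap_def[abs_def] by (intro allI Ck_scale smooth_partial_integral tp)
  qed (auto simp: z)
  show "kap r z > 0" if "norm z < r" for z
  proof -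
   have "(LB t. Phi r (z, t)) > 0"
   proof (rule integral_pos_continuous[of _ 0])
    show "continuous_on UNIV (%t. Phi r (z, t))"
     by (rule continuous_on_compose2[OF test_cont[OF tp]]) (auto intro!: continuous_intros)
    show "integrable lborel (%t. Phi r (z, t))" by (rule slice) (auto intro: test_cont[OF tp] zt)
    show "Phi r (z, 0) > 0" unfolding Phi_def using that r by (auto intro!: bump_pos simp: norm_Pair)
   qed (rule P0)
   then show ?thesis unfolding kap_def using cr by simp
  qed
  show "(LB z. \<bar>pd (kap r) v z\<bar>) <= C * norm v / r" for v
  proof -
   let ?G = "%p :: 'a \<times> real. norm (grad bump p)"
   have tv: "pd (Phi r) (v, 0) \<in> test UNIV" by (rule test_pd[OF tp])
   have pdk: "pd (kap r) v z = inverse (c * r ^ ?N) * (LB t. pd (Phi r) (v, 0) (z, t))" for z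
   proof -
    have "(kap r has_derivative (%v. inverse (c * r ^ ?N) * (LB t. pd (Phi r) (v, 0) (z, t)))) (at z)"
     unfolding kap_def[abs_def] by (rule has_derivative_mult_right[OF test_partial_integral[OF tp]])
    from frechet_derivative_at[OF this] show ?thesis unfolding pd_def by metis
   qed
   have iG: "integrable lborel ?G" using grad_integrable[OF test_bump] by (rule integrable_norm)
   have cG: "continuous_on UNIV ?G" by (intro continuous_on_norm continuous_grad allI smooth_bump)
   have zG: "?G (z, t) = 0" if "\<bar>t\<bar> > 1" for z t
   proof -
    have b: "bump p = 0" if "p ~: cball 0 1" for p :: "'a \<times> real" using that by (intro bump_zero) simp
    have "(z, t) ~: cball 0 1" using that norm_snd_le[of t z] by simp
    from grad_zero_off[OF closed_cball b this] show ?thesis by simp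
   qed
   have bound: "\<bar>pd (Phi r) (v, 0) (z, t)\<bar> <= exp mu * norm v / r * ?G ((1 / r) *R z, t)" for z t
   proof -
    have "pd (Phi r) (v, 0) (z, t) = exp (mu * r * t) * pd (%p. bump ((1 / r) *R fst p, snd p)) (v, 0) (z, t)
      + pd (%p. exp (mu * r * snd p)) (v, 0) (z, t) * bump ((1 / r) *R z, t)"
     unfolding Phi_def[abs_def] by (subst pd_mult[OF se sb]) simp
    also have "pd (%p. bump ((1 / r) *R fst p, snd p)) (v, 0) (z, t) = pd bump ((1 / r) *R v, 0) ((1 / r) *R z, t)"
     using pd_affine[OF allI[OF smooth_bump] bl[of r], of 0 "(v, 0)" "(z, t)"] by simp
    also have "pd (%p :: 'a \<times> real. exp (mu * r * snd p)) (v, 0) (z, t) = 0"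
    proof -
     have "((%p :: 'a \<times> real. exp (mu * r * snd p)) has_derivative (%v. exp (mu * r * t) * (mu * r * snd v))) (at (z, t))"
      by (auto intro!: derivative_eq_intros)
     from frechet_derivative_at[OF this] show ?thesis unfolding pd_def by (metis mult_zero_right snd_conv)
    qed
    also have "pd bump ((1 / r) *R v, 0) ((1 / r) *R z, t) = grad bump ((1 / r) *R z, t) \<bullet> ((1 / r) *R v, 0)"
     by (rule test_grad_inner[OF test_bump, symmetric])
    finally have pe: "pd (Phi r) (v, 0) (z, t) = exp (mu * r * t) * (grad bump ((1 / r) *R z, t) \<bullet> ((1 / r) *R v, 0))"
     by simp
    have "\<bar>grad bump ((1 / r) *R z, t) \<bullet> ((1 / r) *R v, 0)\<bar> <= ?G ((1 / r) *R z, t) * (norm v / r)"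
     using Cauchy_Schwarz_ineq2[of "grad bump ((1 / r) *R z, t)" "((1 / r) *R v, 0 :: real)"] r by (simp add: norm_Pair)
    from mult_left_mono[OF this exp_ge_zero[of "mu * r * t"]]
    have "\<bar>pd (Phi r) (v, 0) (z, t)\<bar> <= exp (mu * r * t) * (?G ((1 / r) *R z, t) * (norm v / r))"
     unfolding pe abs_mult by simp
    also have "\<dots> <= exp mu * (?G ((1 / r) *R z, t) * (norm v / r))"
    proof (cases "\<bar>t\<bar> <= 1")
     case True
     have "r * t <= r * 1" using r True by (intro mult_left_mono) auto
     then have "r * t <= 1" using r by linarith
     then have "mu * (r * t) <= mu * 1" using mu by (intro mult_left_mono) auto
     then show ?thesis using r by (intro mult_right_mono) (auto simp: mult.assoc)
    qed (simp add: zG)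
    finally show ?thesis by (simp add: mult_ac)
   qed
   define g where "g z = (LB t. ?G (z, t))" for z
   have ig: "integrable lborel g" "(LB z. g z) = (LB p. ?G p)"
    using pair_integral_test[OF iG] by (simp_all add: g_def[abs_def])
   have ig': "integrable lborel (%z. g ((1 / r) *R z))"
    using integrable_dmap[OF ig(1), of "%_. 1 / r" 0] r by (simp add: dmap_const)
   have "(LB z. \<bar>pd (kap r) v z\<bar>) <= (LB z. inverse (c * r ^ ?N) * (exp mu * norm v / r * g ((1 / r) *R z)))"
   proof (rule integral_mono)
    show "integrable lborel (%z. \<bar>pd (kap r) v z\<bar>)" by (intro integrable_abs test_integrable[OF test_pd[OF t]])
    show "integrable lborel (%z. inverse (c * r ^ ?N) * (exp mu * norm v / r * g ((1 / r) *R z)))"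
     by (intro integrable_mult_right ig')
    fix z
    have "\<bar>\<integral>t. pd (Phi r) (v, 0) (z, t) \<partial>lborel\<bar> <= (LB t. \<bar>pd (Phi r) (v, 0) (z, t)\<bar>)"
     by (rule integral_abs_bound)
    also have "\<dots> <= (LB t. exp mu * norm v / r * ?G ((1 / r) *R z, t))"
    proof (rule integral_mono[OF _ _ bound])
     show "integrable lborel (%t. exp mu * norm v / r * ?G ((1 / r) *R z, t))"
      by (intro integrable_mult_right slice cG zG)
     have "pd (Phi r) (v, 0) (z, t) = 0" if "\<bar>t\<bar> > 1" for t
      using bound[of z t] zG[OF that] by simp
     then show "integrable lborel (%t. \<bar>pd (Phi r) (v, 0) (z, t)\<bar>)"
      by (intro integrable_abs slice test_cont[OF tv]) auto
    qed
    finally have "\<bar>\<integral>t. pd (Phi r) (v, 0) (z, t) \<partial>lborel\<bar> <= exp mu * norm v / r * g ((1 / r) *R z)" by (simp add: g_def)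
    from mult_left_mono[OF this less_imp_le[OF cr]]
    show "\<bar>pd (kap r) v z\<bar> <= inverse (c * r ^ ?N) * (exp mu * norm v / r * g ((1 / r) *R z))"
     unfolding pdk abs_mult abs_of_pos[OF cr] .
   qed
   also have "\<dots> = inverse (c * r ^ ?N) * (exp mu * norm v / r) * (LB z. g ((1 / r) *R z))" by simp
   also have "(LB z. g ((1 / r) *R z)) = r ^ ?N * (LB z. g z)"
    using integral_dmap[of g "%_. 1 / r" 0] ig(1) r by (simp add: dmap_const power_divide)
   finally show ?thesis using r c by (simp add: ig(2) C_def field_simps)
  qed
  show "conv (kap r) f x = f x" if f: "f \<in> test UNIV" and rR: "r < R" and eq: "\<forall>y\<in>ball x R. lap f y = - (mu^2 * f y)" for f x R
  proof -
   have "0 < R" using r rR by simp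
   then obtain w where w: "w \<in> test UNIV" "!!p. p \<in> ball (x, 0) R ==> lap w p = 0"
    "!!y t. \<bar>t\<bar> <= R ==> w (y, t :: real) = f y * exp (mu * t)"
    using helmholtz_extension[OF f, of R x mu] eq by blast
   have m: "(%y. kap r (x - y) * f y) \<in> borel_measurable borel"
    using test_meas[OF reflect_test[OF t]] test_meas[OF f] by measurable
   have bw: "Phi r (- (r *R z), s) * f (x + r *R z) = bump (z, s) * w ((x, 0) + r *R (z, s))" for z s
   proof (cases "\<bar>s\<bar> < 1")
    case True
    have "r * \<bar>s\<bar> <= r * 1" using True r by (intro mult_left_mono) auto
    moreover have "\<bar>r * s\<bar> = r * \<bar>s\<bar>" using r by (simp add: abs_mult)
    ultimately have "\<bar>r * s\<bar> <= R" using r rR by linarith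
    moreover have "bump (- z, s) = bump (z, s)" by (simp add: bump_def norm_Pair)
    ultimately show ?thesis using w(3)[of "r * s" "x + r *R z"] r by (simp add: Phi_def mult_ac)
   next
    case False
    then show ?thesis using zt[of s] bump_zero[of "(z, s)"] norm_snd_le[of s z] by simp
   qed
   have iw: "integrable lborel (%p. bump p * w ((x, 0) + r *R p))"
   proof -
    have "smooth (%p. w ((x, 0) + r *R p))" using Ck_affine[OF bounded_linear_scaleR_right[of r] test_smooth[OF w(1)], of _ "(x, 0)"] by blast
    from test_integrable[OF test_mult[OF test_bump this]] show ?thesis by (simp add: mult.commute)
   qed
   have "conv (kap r) f x = r ^ ?N * (LB z. kap r (x - (x + r *R z)) * f (x + r *R z))"
    unfolding conv_def using integral_dmap[OF m, of "%_. r" x] r by (simp add: dmap_const)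
   also have "\<dots> = (r ^ ?N * inverse (c * r ^ ?N)) * (LB z. (LB s. Phi r (- (r *R z), s) * f (x + r *R z)))"
    by (simp add: kap_def mult.assoc)
   also have "\<dots> = inverse c * (LB p. bump p * w ((x, 0) + r *R p))"
    unfolding bw pair_integral_test(1)[OF iw] using r by simp
   also have "\<dots> = inverse c * (w (x, 0) * c)"
    unfolding c_def by (subst harmonic_mean_value[OF w(1) w(2), of _ R]) (use r rR in auto)
   also have "\<dots> = f x" using c w(3)[of 0 x] \<open>0 < R\<close> by simp
   finally show ?thesis .
  qed
 qed
 then show ?thesis by blast
qed

section \<open>Completion to a body of constant width\<close>

text \<open>Zorn's lemma: a maximal set of diameter at most \<open>D\<close> contains every point that it could be enlarged by.\<close>

lemma diametrically_complete_superset: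
 fixes S :: "'a::euclidean_space set"
 assumes "0 <= D" "!!x y. x \<in> S ==> y \<in> S ==> dist x y <= D"
 shows "\<exists>K. S \<subseteq> K & (\<forall>x\<in>K. \<forall>y\<in>K. dist x y <= D) & (\<forall>z. (\<forall>x\<in>K. dist x z <= D) --> z \<in> K)"
proof -
 define A where "A = {T. S \<subseteq> T & (\<forall>x\<in>T. \<forall>y\<in>T. dist x y <= D)}"
 have "\<exists>M\<in>A. \<forall>X\<in>A. M \<subseteq> X --> X = M"
 proof (rule subset_Zorn_nonempty)
  show "A ~= {}" using assms by (auto simp: A_def)
  fix C assume C: "C ~= {}" "subset.chain A C"
  then have sub: "C \<subseteq> A" and lin: "!!X Y. X \<in> C ==> Y \<in> C ==> X \<subseteq> Y | Y \<subseteq> X"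
   by (auto simp: subset_chain_def)
  have "dist x y <= D" if xy: "x \<in> \<Union>C" "y \<in> \<Union>C" for x y
  proof -
   obtain X Y where XY: "X \<in> C" "x \<in> X" "Y \<in> C" "y \<in> Y" using xy by blast
   then obtain Z where "Z \<in> C" "x \<in> Z" "y \<in> Z" using lin[of X Y] by blast
   then show ?thesis using sub by (auto simp: A_def)
  qed
  moreover have "S \<subseteq> \<Union>C" using C(1) sub by (auto simp: A_def)
  ultimately show "\<Union>C \<in> A" by (auto simp: A_def)
 qed
 then obtain M where M: "M \<in> A" "!!X. X \<in> A ==> M \<subseteq> X ==> X = M" by blast
 have "z \<in> M" if z: "\<forall>x\<in>M. dist x z <= D" for z
 proof -
  have "insert z M \<in> A" using M(1) z assms(1) by (auto simp: A_def dist_commute)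
  then show "z \<in> M" using M(2)[of "insert z M"] by blast
 qed
 then show ?thesis using M(1) by (intro exI[of _ M]) (auto simp: A_def)
qed

text \<open>Let \<open>p\<close> be a highest point of a complete set \<open>K\<close>, and suppose that some \<open>p + w\<close> in \<open>K\<close> is
 farther than \<open>D\<close> from \<open>p - D xi\<close>.  Among the circles of radius \<open>D\<close> through \<open>p\<close> and \<open>p + w\<close> in
 their common plane with \<open>xi\<close>, take the one with the lower centre \<open>p + c\<close>.  Its short arc between the
 two points lies in every ball of radius \<open>D\<close> containing them, hence in \<open>K\<close>; but the top \<open>p + c + D xi\<close>
 of the circle belongs to this arc and is higher than \<open>p\<close>.\<close>

lemma complete_opposite_point:
 fixes K :: "'a::euclidean_space set"
 assumes D: "0 < D" and diam: "!!x y. x \<in> K ==> y \<in> K ==> dist x y <= D"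
  and complete: "!!z. (!!x. x \<in> K ==> dist x z <= D) ==> z \<in> K"
  and xi: "norm xi = 1" and p: "p \<in> K" "!!y. y \<in> K ==> xi \<bullet> y <= xi \<bullet> p"
 shows "p - D *R xi \<in> K"
proof (rule ccontr)
 assume "p - D *R xi ~: K"
 then obtain z where z: "z \<in> K" "dist z (p - D *R xi) > D" using complete not_le by blast
 define w where "w = z - p"
 define r where "r = norm w"
 define b where "b = - (xi \<bullet> w)"
 have xi1: "xi \<bullet> xi = 1" using xi by (simp add: norm_eq_1)
 have ww: "w \<bullet> w = r^2" by (simp add: r_def power2_norm_eq_inner)
 have xiw: "xi \<bullet> w = - b" by (simp add: b_def)
 have far: "norm (w + D *R xi) > D" using z(2) by (simp add: w_def dist_norm algebra_simps)
 have b0: "b >= 0" using p(2)[OF z(1)] by (simp add: b_def w_def inner_diff_right)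
 have rD: "r <= D" using diam[OF z(1) p(1)] by (simp add: r_def w_def dist_norm)
 have "D^2 < (norm (w + D *R xi))^2" using far D by (intro power_strict_mono) auto
 also have "\<dots> = r^2 - 2 * D * b + D^2"
  unfolding power2_norm_eq_inner using ww xiw xi1 by (simp add: inner_add inner_commute power2_eq_square)
 finally have key: "2 * D * b < r\<^sup>2" by simp
 have r0: "r > 0" using key b0 D by (metis mult_nonneg_nonneg less_eq_real_def norm_ge_zero not_less power_zero_numeral r_def zero_le_numeral)
 define s where "s = 1 - b\<^sup>2 / r^2"
 define h where "h = sqrt (D^2 - r\<^sup>2 / 4)"
 have hh: "h^2 = D^2 - r\<^sup>2 / 4" and h0: "h > 0"
 proof -
  have "r^2 <= D\<^sup>2" using rD r0 by (intro power_mono) auto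
  moreover have "D^2 > 0" using D by simp
  ultimately have "D^2 - r\<^sup>2 / 4 > 0" by linarith
  then show "h^2 = D^2 - r\<^sup>2 / 4" "h > 0" by (auto simp: h_def)
 qed
 have ineq: "4 * h^2 * b^2 < r ^ 4 * s"
 proof -
  have "(2 * D * b)^2 < (r^2)^2" using key b0 D by (intro power_strict_mono) auto
  then have "4 * D^2 * b^2 < r ^ 4" by (simp add: power_mult_distrib power_mult[symmetric])
  moreover have "r ^ 4 * s = r ^ 4 - r\<^sup>2 * b^2" using r0
   by (simp add: s_def right_diff_distrib power2_eq_square power4_eq_xxxx)
  moreover have "4 * h^2 * b^2 = 4 * D^2 * b^2 - r\<^sup>2 * b^2" by (simp add: hh algebra_simps)
  ultimately show ?thesis by linarith
 qed
 have s0: "s > 0"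
 proof -
  have "0 <= 4 * h^2 * b^2" by simp
  then have "r ^ 4 * s > 0" using ineq by linarith
  then show ?thesis using r0 by (simp add: zero_less_mult_iff)
 qed
 define q where "q = sqrt s"
 have q: "q > 0" "q^2 = s" using s0 by (auto simp: q_def)
 define e where "e = xi + (b / r^2) *R w"
 have ew: "e \<bullet> w = 0" and ee: "e \<bullet> e = s" and exi: "xi \<bullet> e = s"
  using r0 by (auto simp: e_def inner_add xiw ww xi1 s_def inner_commute[of w xi] power2_eq_square)
 define c where "c = (1/2) *R w - (h / q) *R e"
 have cc: "c \<bullet> c = D^2"
 proof -
  have "c \<bullet> c = r^2 / 4 + (h / q)^2 * s"
   by (simp add: c_def inner_diff ew ee ww inner_commute[of w e] power2_eq_square)
  also have "(h / q)^2 * s = h^2" using q s0 by (simp add: power_divide)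
  finally show ?thesis by (simp add: hh)
 qed
 have cw: "c \<bullet> w = r^2 / 2" by (simp add: c_def inner_diff_left ew ww)
 define be where "be = q / (2 * h) - b / r^2"
 define al where "al = q / (2 * h) + b / r^2"
 have "al >= 0" using q h0 b0 by (simp add: al_def)
 have "be >= 0"
 proof -
  have "(2 * h * b)^2 <= (r^2 * q)^2" using ineq q by (simp add: power_mult_distrib power_mult[symmetric])
  then have "2 * h * b <= r\<^sup>2 * q" by (rule power2_le_imp_le) (use q in simp)
  then show ?thesis using h0 r0 by (simp add: be_def field_simps)
 qed
 have comb: "xi = al *R (- c) + be *R (w - c)"
 proof -
  have "al *R (- c) + be *R (w - c) = be *R w - (al + be) *R c" by (simp add: algebra_simps)
  also have "al + be = q / h" by (simp add: al_def be_def)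
  also have "(q / h) *R c = (q / (2 * h)) *R w - e" using q h0 by (simp add: c_def scaleR_diff_right)
  also have "be *R w - ((q / (2 * h)) *R w - e) = xi" by (simp add: be_def e_def algebra_simps)
  finally show ?thesis by simp
 qed
 have nc: "norm c = D" "norm (w - c) = D"
 proof -
  show "norm c = D" using cc D by (simp add: norm_eq_sqrt_inner)
  have "(w - c) \<bullet> (w - c) = D^2" by (simp add: inner_diff ww cc cw inner_commute[of w c])
  then show "norm (w - c) = D" using D by (simp add: norm_eq_sqrt_inner)
 qed
 have sig: "1 <= (al + be) * D"
 proof -
  have "1 = norm (al *R (- c) + be *R (w - c))" using comb xi by simp
  also have "\<dots> <= al * D + be * D"
   using norm_triangle_ineq[of "al *R (- c)" "be *R (w - c)"] nc \<open>al >= 0\<close> \<open>be >= 0\<close> by simp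
  finally show ?thesis by (simp add: algebra_simps)
 qed
 have "p + (c + D *R xi) \<in> K"
 proof (rule complete)
  fix y assume y: "y \<in> K"
  define v where "v = y - p - c"
  have "(norm (v + c))^2 <= D\<^sup>2" using diam[OF y p(1)] by (intro power_mono) (auto simp: v_def dist_norm)
  then have 1: "v \<bullet> v <= 2 * (v \<bullet> (- c))" unfolding power2_norm_eq_inner by (simp add: inner_add inner_commute cc)
  have "(norm (v - (w - c)))^2 <= D\<^sup>2" using diam[OF y z(1)] by (intro power_mono) (auto simp: v_def w_def dist_norm)
  then have 2: "v \<bullet> v <= 2 * (v \<bullet> (w - c))"
   unfolding power2_norm_eq_inner using nc(2) by (simp add: inner_diff inner_commute norm_eq_sqrt_inner real_sqrt_eq_iff cc ww cw)
  have "(al + be) * (v \<bullet> v) <= al * (2 * (v \<bullet> (- c))) + be * (2 * (v \<bullet> (w - c)))"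
   unfolding distrib_right using 1 2 \<open>al >= 0\<close> \<open>be >= 0\<close> by (intro add_mono mult_left_mono)
  also have "\<dots> = 2 * (v \<bullet> xi)" unfolding comb by (simp add: inner_add_right algebra_simps)
  finally have 3: "(al + be) * (v \<bullet> v) <= 2 * (v \<bullet> xi)" .
  have "v \<bullet> v <= ((al + be) * D) * (v \<bullet> v)" using mult_right_mono[OF sig, of "v \<bullet> v"] by simp
  also have "\<dots> <= D * (2 * (v \<bullet> xi))" using mult_left_mono[OF 3, of D] D by (simp add: mult_ac)
  finally have 4: "v \<bullet> v <= D * (2 * (v \<bullet> xi))" .
  have "(norm (v - D *R xi))^2 = v \<bullet> v - D * (2 * (v \<bullet> xi)) + D^2"
   unfolding power2_norm_eq_inner
   by (simp add: inner_diff_left inner_diff_right xi1 inner_commute[of xi v] power2_eq_square algebra_simps)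
  then have "(norm (v - D *R xi))^2 <= D\<^sup>2" using 4 by linarith
  then have "norm (v - D *R xi) <= D" by (rule power2_le_imp_le) (use D in simp)
  then show "dist y (p + (c + D *R xi)) <= D" by (simp add: v_def dist_norm algebra_simps)
 qed
 then have "xi \<bullet> (c + D *R xi) <= 0" using p(2) by (fastforce simp: inner_add_right)
 then have "(norm (c + D *R xi))^2 <= 0"
  unfolding power2_norm_eq_inner using D mult_left_mono[of "xi \<bullet> c + D" 0 "2 * D"]
  by (simp add: inner_add inner_commute xi1 cc power2_eq_square algebra_simps)
 then have "c = - D *R xi" by (simp add: add_eq_0_iff)
 then show False using nc(2) far by simp
qed

text \<open>A complete set is the intersection of the balls of radius \<open>D\<close> about its points, hence convex and compact.  A highest
 point \<open>p\<close> in direction \<open>xi\<close> and its opposite point \<open>p - D xi\<close> lie on the two supporting hyperplanes.\<close>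

lemma complete_constant_width:
 fixes K :: "'a::euclidean_space set"
 assumes D: "0 < D" and ne: "K ~= {}" and diam: "!!x y. x \<in> K ==> y \<in> K ==> dist x y <= D"
  and complete: "!!z. (!!x. x \<in> K ==> dist x z <= D) ==> z \<in> K"
 shows "constant_width_body K D"
proof -
 have K: "K = (\<Inter>x\<in>K. cball x D)" using diam complete by auto
 have conv: "convex K" by (subst K) (intro convex_INT convex_cball)
 have clos: "closed K" by (subst K) (intro closed_INT ballI closed_cball)
 have bnd: "bounded K" using diam unfolding bounded_def using ne by blast
 have comp: "compact K" using clos bnd by (simp add: compact_eq_bounded_closed)
 have top: "\<exists>p\<in>K. (\<forall>y\<in>K. xi \<bullet> y <= xi \<bullet> p)" for xi
  by (rule continuous_attains_sup[OF comp ne]) (intro continuous_intros)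
 have opp: "p - D *R xi \<in> K" if "norm xi = 1" "p \<in> K" "!!y. y \<in> K ==> xi \<bullet> y <= xi \<bullet> p" for xi p
  by (rule complete_opposite_point[OF D diam complete that])
 have int: "interior K ~= {}"
 proof
  assume "interior K = {}"
  then obtain a be where a: "a ~= 0" "K \<subseteq> {x. a \<bullet> x = be}" using empty_interior_subset_hyperplane[OF conv] by blast
  define xi where "xi = a /\<^sub>R norm a"
  have xi: "norm xi = 1" using a by (simp add: xi_def)
  obtain p where p: "p \<in> K" "!!y. y \<in> K ==> xi \<bullet> y <= xi \<bullet> p" using top by blast
  have "a \<bullet> p = be" "a \<bullet> (p - D *R xi) = be" using a p opp[OF xi p] by blast+
  then have "D * (a \<bullet> xi) = 0" by (simp add: inner_diff_right)
  moreover have "a \<bullet> xi = norm a" using a by (simp add: xi_def dot_square_norm power2_eq_square)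
  ultimately show False using D a by simp
 qed
 have "width K xi = D" if xi: "norm xi = 1" for xi
 proof -
  obtain p where p: "p \<in> K" "!!y. y \<in> K ==> xi \<bullet> y <= xi \<bullet> p" using top by blast
  define q where "q = p - D *R xi"
  have q: "q \<in> K" unfolding q_def by (rule opp[OF xi p])
  have xi1: "xi \<bullet> xi = 1" using xi by (simp add: norm_eq_1)
  have qp: "xi \<bullet> q = xi \<bullet> p - D" by (simp add: q_def inner_diff_right xi1)
  have low: "xi \<bullet> q <= xi \<bullet> y" if "y \<in> K" for y
  proof -
   have "xi \<bullet> (p - y) <= norm xi * norm (p - y)" by (rule norm_cauchy_schwarz)
   also have "\<dots> <= D" using diam[OF p(1) that] xi by (simp add: dist_norm)
   finally show ?thesis by (simp add: qp inner_diff_right)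
  qed
  have S1: "(SUP y\<in>K. xi \<bullet> y) = xi \<bullet> p" by (rule cSup_eq_maximum) (use p in auto)
  have S2: "(SUP y\<in>K. - xi \<bullet> y) = - xi \<bullet> q" by (rule cSup_eq_maximum) (use q low in auto)
  have "width K xi = dist p q"
   unfolding width_def supporting_hyperplane_def S1 S2
  proof (rule setdist_unique)
   fix x y assume xy: "x \<in> {x. xi \<bullet> x = xi \<bullet> p} & y \<in> {x. - xi \<bullet> x = - xi \<bullet> q}"
   have "D = xi \<bullet> (x - y)" using xy qp by (simp add: inner_diff_right)
   also have "\<dots> <= norm xi * norm (x - y)" by (rule norm_cauchy_schwarz)
   finally have "D <= norm (x - y)" using xi by simp
   moreover have "dist p q = D" using xi D by (simp add: q_def dist_norm)
   ultimately show "dist p q <= dist x y" by (simp add: dist_norm)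
  qed auto
  then show ?thesis using xi D by (simp add: q_def dist_norm)
 qed
 then show ?thesis using conv comp int by (simp add: constant_width_body_def)
qed

theorem constant_width_superset:
 fixes S :: "'a::euclidean_space set"
 assumes "0 < D" "!!x y. x \<in> S ==> y \<in> S ==> dist x y <= D"
 obtains K where "S \<subseteq> K" "constant_width_body K D" "!!x y. x \<in> K ==> y \<in> K ==> dist x y <= D"
proof -
 define S' where "S' = (if S = {} then {0} else S)"
 have S': "dist x y <= D" if "x \<in> S'" "y \<in> S'" for x y using assms that by (auto simp: S'_def split: if_splits)
 have "\<exists>K. S' \<subseteq> K & (\<forall>x\<in>K. \<forall>y\<in>K. dist x y <= D) & (\<forall>z. (\<forall>x\<in>K. dist x z <= D) --> z \<in> K)"
  using assms(1) S' by (intro diametrically_complete_superset) auto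
 then obtain K where K: "S' \<subseteq> K" "!!x y. x \<in> K ==> y \<in> K ==> dist x y <= D"
  "!!z. \<forall>x\<in>K. dist x z <= D ==> z \<in> K" by blast
 have "constant_width_body K D"
  by (rule complete_constant_width[OF assms(1) _ K(2)]) (use K assms(1) in \<open>auto simp: S'_def split: if_splits\<close>)
 moreover have "S \<subseteq> K" using K(1) by (auto simp: S'_def split: if_splits)
 ultimately show ?thesis using that K(2) by blast
qed

section \<open>Unique continuation from sets of positive measure\<close>

subsection \<open>Solutions are reproduced by the kernel\<close>

lemma pd_uminus: "f \<in> test UNIV ==> pd (%x. - f x) v x = - pd f v x"
 using frechet_derivative_at[OF has_derivative_minus[OF test_deriv]] unfolding pd_def by metis

lemma lap_reflect:
 assumes "rho \<in> test UNIV"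
 shows "lap (%y. rho (x - y)) y = lap rho (x - y)"
proof -
 have "pd (%y. rho (x - y)) i = (%y. - pd rho i (x - y))" for i by (rule ext) (rule pd_reflect[OF assms])
 then show ?thesis
  by (simp add: lap_def pd_uminus[OF reflect_test[OF test_pd[OF assms]]] pd_reflect[OF test_pd[OF assms]])
qed

lemma conv_test:
 fixes U :: "('a::euclidean_space, real) L2"
 assumes rho: "rho \<in> test UNIV" and U: "U \<in> vanish (- cball 0 B)"
 shows "conv rho (L2f U) \<in> test UNIV"
proof -
 have i: "integrable lborel (L2f U)" by (rule vanish_integrable[OF U bounded_cball])
 obtain R where R: "R > 0" "!!x. norm x >= R ==> rho x = 0" using test_outside_ball[OF rho] by blast
 show ?thesis
 proof (rule test_I[of _ "cball 0 (B + R)"])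
  show "smooth (conv rho (L2f U))" using smooth_conv[OF i rho] by blast
  fix x :: 'a assume x: "x ~: cball 0 (B + R)"
  have "AEL y. rho (x - y) *R L2f U y = 0"
   using U unfolding vanish_def mem_Collect_eq
  proof eventually_elim
   case (elim y)
   then show ?case using R(2)[of "x - y"] x norm_triangle_sub[of x y] by (cases "y \<in> cball 0 B") auto
  qed
  then show "conv rho (L2f U) x = 0" unfolding conv_def by (rule integral_eq_zero_AE)
 qed auto
qed

lemma lap_conv:
 fixes U :: "('a::euclidean_space, real) L2"
 assumes rho: "rho \<in> test UNIV" and i: "integrable lborel (L2f U)"
 shows "lap (conv rho (L2f U)) x = conv (lap rho) (L2f U) x"
proof -
 have "conv (lap rho) (L2f U) x = (\<Sum>i\<in>Basis. conv (pd (pd rho i) i) (L2f U) x)"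
  unfolding conv_def lap_def scaleR_sum_left
  by (rule Bochner_Integration.integral_sum) (rule conv_integrable[OF test_pd[OF test_pd[OF rho]] sqint_L2f])
 then show ?thesis by (simp add: lap_def pd_conv[OF rho i] pd_conv[OF test_pd[OF rho] i])
qed

lemma continuous_conv: "rho \<in> test UNIV ==> U \<in> vanish (- cball 0 B) ==> continuous_on S (conv rho (L2f U :: 'a::euclidean_space => real))"
 using conv_test test_cont by blast

lemma open_AE_empty:
 assumes V: "open V" and ae: "AEL x. x ~: V"
 shows "V = {}"
proof -
 have "emeasure lborel V = 0" using ae V by (subst (asm) AE_iff_measurable[of V]) auto
 then have "negligible V" using V by (simp add: negligible_iff_emeasure0)
 then show ?thesis using V open_not_negligible by blast
qed

lemma continuous_AE_eq:
 fixes f g :: "'a::euclidean_space => real"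
 assumes c: "continuous_on UNIV f" "continuous_on UNIV g" and S: "open S" and ae: "AEL x. x \<in> S --> f x = g x"
  and x: "x \<in> S"
 shows "f x = g x"
proof -
 define V where "V = S \<inter> {x. f x ~= g x}"
 have V: "open V" unfolding V_def using c S by (intro open_Int open_Collect_neq) auto
 have "AEL x. x ~: V" using ae by eventually_elim (simp add: V_def)
 from open_AE_empty[OF V this] show ?thesis using x by (auto simp: V_def)
qed

lemma moll_AE_subsequence:
 fixes U :: "('a::euclidean_space, real) L2"
 assumes p: "(U, G) \<in> H10 UNIV"
 shows "\<exists>eps rho. (\<forall>n. 0 < eps n & mollifier (eps n) (rho n)) & eps ---> 0 &
  (AEL x. (%n. conv (rho n) (L2f U) x) ---> L2f U x) & (%n. toL2 (conv (rho n) (L2f U))) ---> U"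
proof -
 define eps where "eps n = (1/64) ^ (n + 1) / (1 + norm G)" for n :: nat
 have g: "1 + norm G > 0" by (simp add: add_pos_nonneg)
 have e0: "eps n > 0" for n using g by (simp add: eps_def)
 have "\<forall>n. \<exists>rho :: 'a => real. mollifier (eps n) rho" using mollifier_exists[OF e0] by metis
 then obtain rho :: "nat => 'a => real" where rho: "!!n. mollifier (eps n) (rho n)" by metis
 define V where "V n = moll (rho n) U" for n
 have close: "norm (V n - U) <= (1/64) ^ (n + 1)" for n
 proof -
  have "norm (V n - U) <= eps n * norm G" unfolding V_def by (rule moll_close[OF rho p])
  also have "\<dots> = (1/64) ^ (n + 1) * (norm G / (1 + norm G))" by (simp add: eps_def)
  also have "\<dots> <= (1/64) ^ (n + 1) * 1" using g by (intro mult_left_mono) (simp_all add: divide_le_eq_1)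
  finally show ?thesis by simp
 qed
 have p8: "(%n. (1/64::real) ^ (n + 1)) ---> 0" using LIMSEQ_ignore_initial_segment[OF LIMSEQ_realpow_zero[of "1/64"], of 1] by simp
 have lim: "V ---> U" by (rule LIM_zero_cancel, rule Lim_null_comparison[OF _ p8]) (use close in auto)
 have "eps ---> 0" unfolding eps_def[abs_def] using tendsto_divide[OF p8 tendsto_const[of "1 + norm G"]] g by simp
 moreover have "AEL x. (%n. conv (rho n) (L2f U) x) ---> L2f U x"
 proof -
  \<comment> \<open>Interleaving with the limit \<open>U\<close> in norm makes \<open>U\<close> the only possible limit almost everywhere.\<close>
  define X where "X n = (if even n then V (n div 2) else U)" for n
  have "(norm (X (Suc n) - X n))^2 <= (1/8) ^ n" for n
  proof -
   have close2: "norm (V k - U) <= (1/8) ^ (2 * k) / 64" for k using close[of k] by (simp add: power_mult power2_eq_square)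
   have "norm (X (Suc n) - X n) <= (1/8) ^ n"
   proof (cases "even n")
    case True
    then obtain k where k: "n = 2 * k" by blast
    have "norm (U - V k) <= (1/8) ^ (2 * k)"
     using close2[of k] zero_le_power[of "1/8::real" "2 * k"] unfolding norm_minus_commute[of U] by linarith
    then show ?thesis by (simp add: X_def k)
   next
    case False
    then obtain k where k: "n = 2 * k + 1" using oddE by blast
    have "norm (V (k + 1) - U) <= (1/8) ^ (2 * k) / 64 / 64" using close2[of "k + 1"] by simp
    then have "norm (V (k + 1) - U) <= (1/8) ^ (2 * k) / 8" using zero_le_power[of "1/8::real" "2 * k"] by linarith
    then show ?thesis by (simp add: X_def k)
   qed
   moreover have "((1/8::real) ^ n)^2 <= (1/8) ^ n" by (simp add: power2_eq_square mult_left_le power_le_one)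
   ultimately show ?thesis using power_mono[OF _ norm_ge_zero[of "X (Suc n) - X n"]] order_trans by blast
  qed
  from L2_fast_Cauchy_AE[OF this] have 1: "AEL x. convergent (%n. L2f (X n) x)" .
  have "AEL x. \<forall>n. L2f (V n) x = conv (rho n) (L2f U) x"
   unfolding V_def moll_def AE_all_countable by (intro allI L2f_toL2 conv_L2(1)[OF rho sqint_L2f])
  with 1 show ?thesis
  proof eventually_elim
   case (elim x)
   then obtain l where l: "(%n. L2f (X n) x) ---> l" by (auto simp: convergent_def)
   have "strict_mono (%n::nat. 2 * n + 1)" "strict_mono (%n::nat. 2 * n)" by (auto simp: strict_mono_def)
   from this[THEN LIMSEQ_subseq_LIMSEQ[OF l]]
   have "(%n. L2f U x) ---> l" and e: "(%n. L2f (V n) x) ---> l" by (simp_all add: o_def X_def)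
   then have "l = L2f U x" using LIMSEQ_unique tendsto_const by blast
   then show ?case using e elim(2) by simp
  qed
 qed
 ultimately show ?thesis using e0 rho lim unfolding V_def moll_def by blast
qed

text \<open>Weak solutions of \<open>- \<Delta> U = mu\<^sup>2 U\<close> in \<open>Q\<close> that are given as compactly supported functions in \<open>H\<^sup>1\<close> of the whole space.\<close>

definition helmholtz_on :: "'a::euclidean_space set => real => ('a, real) L2 => bool" where
 "helmholtz_on Q mu U \<longleftrightarrow> (\<exists>G. (U, G) \<in> H10 UNIV) & (\<exists>B. U \<in> vanish (- cball 0 B)) &
   (\<forall>phi\<in>test Q. U \<bullet> toL2 (lap phi) = - (mu^2 * (U \<bullet> toL2 phi)))"

text \<open>The equation tested with \<open>y \<mapsto> rho (x - y)\<close>.\<close>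

lemma helmholtz_mollified:
 fixes U :: "('a::euclidean_space, real) L2"
 assumes U: "helmholtz_on Q mu U" and rho: "mollifier eps rho" and x: "cball x eps \<subseteq> Q"
 shows "lap (conv rho (L2f U)) x = - (mu^2 * conv rho (L2f U) x)"
proof -
 note r = mollifier_test[OF rho]
 obtain B where B: "U \<in> vanish (- cball 0 B)" using U by (auto simp: helmholtz_on_def)
 have i: "integrable lborel (L2f U)" by (rule vanish_integrable[OF B bounded_cball])
 have t: "(%y. rho (x - y)) \<in> test Q"
 proof (rule test_I[OF _ compact_cball x])
  show "smooth (%y. rho (x - y))" using test_smooth[OF reflect_test[OF r]] by blast
  show "rho (x - y) = 0" if "y ~: cball x eps" for y using rho that by (simp add: mollifier_def dist_norm)
 qed
 have "lap (conv rho (L2f U)) x = toL2 (%y. lap rho (x - y)) \<bullet> U"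
  unfolding lap_conv[OF r i] by (rule conv_inner[OF test_lap[OF r]])
 also have "(%y. lap rho (x - y)) = lap (%y. rho (x - y))" by (rule ext) (simp add: lap_reflect[OF r])
 finally show ?thesis using U t unfolding conv_inner[OF r] helmholtz_on_def by (simp add: inner_commute)
qed

text \<open>Mollified solutions are smooth solutions in slightly smaller balls, so the kernel reproduces them; pass to the limit.\<close>

lemma helmholtz_representation:
 fixes U :: "('a::euclidean_space, real) L2"
 assumes U: "helmholtz_on Q mu U" and kap: "helmholtz_kernel mu C kap" and r: "0 < r" "r <= 1"
  and sub: "!!x. x \<in> A ==> \<exists>R>r. ball x R \<subseteq> Q"
 shows "AEL x. x \<in> A --> L2f U x = conv (kap r) (L2f U) x"
proof -
 obtain G where G: "(U, G) \<in> H10 UNIV" using U by (auto simp: helmholtz_on_def)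
 obtain B where B: "U \<in> vanish (- cball 0 B)" using U by (auto simp: helmholtz_on_def)
 have kt: "kap r \<in> test UNIV" using kap r by (auto simp: helmholtz_kernel_def)
 obtain eps rho where rho: "!!n. 0 < eps n & mollifier (eps n) (rho n)" and e: "eps ---> 0"
  and ae: "AEL x. (%n. conv (rho n) (L2f U) x) ---> L2f U x"
  and lim: "(%n. toL2 (conv (rho n) (L2f U))) ---> U"
  using moll_AE_subsequence[OF G] by blast
 define f where "f n = conv (rho n) (L2f U)" for n
 have f: "f n \<in> test UNIV" for n unfolding f_def using rho by (intro conv_test[OF _ B]) (auto intro: mollifier_test)
 have "(%n. conv (kap r) (f n) x) ---> conv (kap r) (L2f U) x" for x
 proof -
  have "conv (kap r) (f n) x = toL2 (%y. kap r (x - y)) \<bullet> toL2 (f n)" for n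
   using conv_inner[OF kt, of "toL2 (f n)" x] by (simp add: conv_toL2[OF test_sqint[OF f] kt])
  then show ?thesis unfolding conv_inner[OF kt, of U x] f_def using lim by (auto intro!: tendsto_intros)
 qed
 moreover have "eventually (%n. conv (kap r) (f n) x = f n x) sequentially" if "x \<in> A" for x
 proof -
  obtain R where R: "R > r" "ball x R \<subseteq> Q" using sub \<open>x \<in> A\<close> by blast
  have "eventually (%n. eps n < (R - r) / 2) sequentially" using order_tendstoD(2)[OF e, of "(R - r) / 2"] R by simp
  then show ?thesis
  proof eventually_elim
   case (elim n)
   have "lap (f n) y = - (mu^2 * f n y)" if "y \<in> ball x ((R + r) / 2)" for y
    unfolding f_def
   proof (rule helmholtz_mollified[OF U])
    show "mollifier (eps n) (rho n)" using rho by blast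
    have "cball y (eps n) \<subseteq> ball x R"
    proof
     fix z assume "z \<in> cball y (eps n)"
     then have "dist y z < (R - r) / 2" "dist x y < (R + r) / 2" using elim that by auto
     then show "z \<in> ball x R" using dist_triangle[of x z y] by (simp add: field_simps)
    qed
    then show "cball y (eps n) \<subseteq> Q" using R by blast
   qed
   moreover have "r < (R + r) / 2" using R by simp
   ultimately show ?case using kap r f[of n] unfolding helmholtz_kernel_def by blast
  qed
 qed
 ultimately have cv: "(%n. f n x) ---> conv (kap r) (L2f U) x" if "x \<in> A" for x
  using Lim_transform_eventually[of _ "conv (kap r) (L2f U) x" sequentially "%n. f n x"] that by blast
 show ?thesis using ae 
 proof eventually_elim
  case (elim x)
  then show ?case using cv[of x] LIMSEQ_unique unfolding f_def by blast
 qed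
qed

text \<open>Test functions that the kernel reproduces wherever its support fits in the ball of radius \<open>S\<close> about \<open>z\<close>; near each point a solution
 agrees with one of them.\<close>

definition reproduced :: "(real => 'a::euclidean_space => real) => 'a => real => ('a => real) => bool" where
 "reproduced kap z S g \<longleftrightarrow> g \<in> test UNIV &
   (\<forall>x del. 0 < del & del <= 1 & dist z x + 2 * del < S --> conv (kap del) g x = g x)"

lemma conv_cong_ball:
 assumes kap: "!!z. del <= norm z ==> kap z = 0" "kap \<in> borel_measurable borel"
  and fg: "f \<in> borel_measurable borel" "g \<in> borel_measurable borel" "AEL y. y \<in> ball x del --> f y = g y"
 shows "conv kap f x = conv kap g x"
 unfolding conv_def
proof (rule integral_cong_AE)
 note [measurable] = kap(2) fg(1,2)
 show "(%y. kap (x - y) *R f y) \<in> borel_measurable lborel" "(%y. kap (x - y) *R g y) \<in> borel_measurable lborel" by measurable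
 show "AEL y. kap (x - y) *R f y = kap (x - y) *R g y"
  using fg(3) by eventually_elim (use kap(1) in \<open>force simp: dist_norm not_less\<close>)
qed

lemma helmholtz_local_representative:
 fixes U :: "('a::euclidean_space, real) L2"
 assumes U: "helmholtz_on Q mu U" and kap: "helmholtz_kernel mu C kap" and Q: "open Q" "z \<in> Q"
 shows "\<exists>S g. 0 < S & S <= 1 & reproduced kap z S g & (AEL x. x \<in> ball z S --> L2f U x = g x)"
proof -
 obtain e where e: "e > 0" "ball z e \<subseteq> Q" using Q openE by blast
 define S where "S = min 1 (e / 3)"
 have S: "S > 0" "S <= 1" "3 * S <= e" using e by (auto simp: S_def)
 obtain B where B: "U \<in> vanish (- cball 0 B)" using U by (auto simp: helmholtz_on_def)
 have kt: "kap r \<in> test UNIV" if "0 < r" "r <= 1" for r using kap that by (auto simp: helmholtz_kernel_def)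
 define g where "g = conv (kap S) (L2f U)"
 have g: "g \<in> test UNIV" unfolding g_def by (rule conv_test[OF kt B]) (use S in auto)
 have Ug: "AEL x. x \<in> ball z S --> L2f U x = g x"
  unfolding g_def
 proof (rule helmholtz_representation[OF U kap S(1,2)])
  fix x assume x: "x \<in> ball z S"
  have "ball x (2 * S) \<subseteq> ball z e" using x S(3) by (intro ball_subset_ball_iff[THEN iffD2]) (auto simp: dist_commute)
  then show "\<exists>R>S. ball x R \<subseteq> Q" using e S(1) by (intro exI[of _ "2 * S"]) auto
 qed
 have "conv (kap del) g x = g x" if del: "0 < del" "del <= 1" and x: "dist z x + 2 * del < S" for x del
 proof (rule continuous_AE_eq[of _ _ "{x. dist z x + 2 * del < S}"])
  show "continuous_on UNIV g" by (rule test_cont[OF g])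
  have sg: "conv (kap del) (L2f (toL2 g)) = conv (kap del) g" by (rule conv_toL2[OF test_sqint[OF g] kt[OF del]])
  have "\<exists>B. toL2 g \<in> vanish (- cball 0 B)"
  proof -
   obtain R where "R > 0" "!!x. norm x >= R ==> g x = 0" using test_outside_ball[OF g] by blast
   then show ?thesis by (intro exI[of _ R]) (auto simp: vanish_toL2[OF test_sqint[OF g]])
  qed
  then show "continuous_on UNIV (conv (kap del) g)" unfolding sg[symmetric] using continuous_conv[OF kt[OF del]] by blast
  show "open {x. dist z x + 2 * del < S}" by (intro open_Collect_less continuous_intros)
  have "AEL x. x \<in> {x. dist z x + 2 * del < S} --> L2f U x = conv (kap del) (L2f U) x"
  proof (rule helmholtz_representation[OF U kap del])
   fix x assume "x \<in> {x. dist z x + 2 * del < S}"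
   then have "ball x (2 * del) \<subseteq> ball z e" using S del by (intro ball_subset_ball_iff[THEN iffD2]) (auto simp: dist_commute)
   then show "\<exists>R>del. ball x R \<subseteq> Q" using e del by (intro exI[of _ "2 * del"]) auto
  qed
  with Ug show "AEL x. x \<in> {x. dist z x + 2 * del < S} --> conv (kap del) g x = g x"
  proof eventually_elim
   case (elim x)
   show ?case
   proof
    assume x: "x \<in> {x. dist z x + 2 * del < S}"
    have "conv (kap del) (L2f U) x = conv (kap del) g x"
    proof (rule conv_cong_ball[of del])
     show "!!z. del <= norm z ==> kap del z = 0" using kap del by (auto simp: helmholtz_kernel_def)
     have sub: "ball x del \<subseteq> ball z S" using x del by (intro ball_subset_ball_iff[THEN iffD2]) (auto simp: dist_commute)
     show "AEL y. y \<in> ball x del --> L2f U y = g y" using Ug by eventually_elim (use sub in blast)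
    qed (use test_meas[OF kt[OF del]] test_meas[OF g] in auto)
    moreover have "x \<in> ball z S" using x del by auto
    ultimately show "conv (kap del) g x = g x" using elim x by auto
   qed
  qed
 qed (use x in auto)
 then show ?thesis using S g Ug by (intro exI[of _ S] exI[of _ g]) (auto simp: reproduced_def)
qed

subsection \<open>Reproduced functions are analytic along lines\<close>

lemma conv_pd:
 assumes kap: "kap \<in> test UNIV" and g: "g \<in> test UNIV"
 shows "conv kap (pd g v) x = conv (pd kap v) g x"
proof -
 have "(LB y. g y * pd (%y. kap (x - y)) v y) = - (LB y. pd g v y * kap (x - y))"
  using integration_by_parts[OF reflect_test[OF kap]] test_smooth[OF g] by blast
 then show ?thesis unfolding pd_reflect[OF kap] by (simp add: conv_def mult.commute)
qed

text \<open>The derivative can be moved to the kernel, where it costs a factor of order \<open>1 / del\<close>.\<close>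

lemma reproduced_pd:
 assumes kap: "helmholtz_kernel mu C kap" and g: "reproduced kap z S g"
 shows "reproduced kap z S (pd g v)"
  and "0 < del ==> del <= 1 ==> dist z x + 2 * del < S ==> (!!y. y \<in> ball x del ==> \<bar>g y\<bar> <= M) ==> \<bar>pd g v x\<bar> <= C * norm v / del * M"
proof -
 have t: "g \<in> test UNIV" using g by (simp add: reproduced_def)
 have kt: "kap del \<in> test UNIV" if "0 < del" "del <= 1" for del using kap that by (auto simp: helmholtz_kernel_def)
 have eq: "pd g v x = conv (pd (kap del) v) g x" if del: "0 < del" "del <= 1" "dist z x + 2 * del < S" for del x
 proof -
  have "open {x. dist z x + 2 * del < S}" by (intro open_Collect_less continuous_intros)
  moreover have "g differentiable (at x)" using test_deriv[OF t] by (auto simp: differentiable_def)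
  moreover have "g y = conv (kap del) g y" if "y \<in> {x. dist z x + 2 * del < S}" for y using g del that by (auto simp: reproduced_def)
  ultimately have "frechet_derivative g (at x) = frechet_derivative (conv (kap del) g) (at x)"
   using frechet_derivative_transform_within_open[of g x "{x. dist z x + 2 * del < S}" "conv (kap del) g"] del by blast
  then have "pd g v x = pd (conv (kap del) g) v x" by (simp add: pd_def)
  then show ?thesis by (simp add: pd_conv[OF kt[OF del(1,2)] test_integrable[OF t]])
 qed
 show "reproduced kap z S (pd g v)"
  using test_pd[OF t] eq conv_pd[OF kt t] by (auto simp: reproduced_def)
 assume del: "0 < del" "del <= 1" "dist z x + 2 * del < S" and M: "!!y. y \<in> ball x del ==> \<bar>g y\<bar> <= M"
 note k = kt[OF del(1,2)] and kp = test_pd[OF kt[OF del(1,2)], of v]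
 have M0: "M >= 0" using M[of x] del(1) by auto
 have z: "pd (kap del) v w = 0" if "norm w > del" for w
  by (rule pd_zero_off[of "cball 0 del"]) (use that kap del in \<open>auto simp: helmholtz_kernel_def\<close>)
 have ae: "AEL y. norm (x - y) ~= del"
 proof -
  have "negligible (sphere x del)" by (rule negligible_sphere)
  then have "emeasure lborel (sphere x del) = 0" by (simp add: negligible_iff_emeasure0)
  then have "AEL y. y ~: sphere x del" by (intro AE_not_in) (auto simp: null_sets_def)
  then show ?thesis by eventually_elim (simp add: dist_norm)
 qed
 have int: "integrable lborel (%y. \<bar>pd (kap del) v (x - y)\<bar>)" by (intro integrable_abs test_integrable[OF reflect_test[OF kp]])
 have "\<bar>conv (pd (kap del) v) g x\<bar> <= (LB y. \<bar>pd (kap del) v (x - y) * g y\<bar>)"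
  unfolding conv_def real_scaleR_def by (rule integral_abs_bound)
 also have "\<dots> <= (LB y. M * \<bar>pd (kap del) v (x - y)\<bar>)"
 proof (rule integral_mono_AE)
  show "integrable lborel (%y. \<bar>pd (kap del) v (x - y) * g y\<bar>)"
   by (intro integrable_abs test_mult_integrable[OF kp] test_integrable[OF t])
  show "integrable lborel (%y. M * \<bar>pd (kap del) v (x - y)\<bar>)" by (rule integrable_mult_right[OF int])
  show "AEL y. \<bar>pd (kap del) v (x - y) * g y\<bar> <= M * \<bar>pd (kap del) v (x - y)\<bar>"
   using ae
  proof eventually_elim
   case (elim y)
   show ?case
   proof (cases "norm (x - y) < del")
    case True
    then have "\<bar>g y\<bar> <= M" using M by (simp add: dist_norm)
    then show ?thesis by (simp add: abs_mult mult.commute mult_right_mono)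
   next
    case False
    then have "pd (kap del) v (x - y) = 0" using elim by (intro z) simp
    then show ?thesis by simp
   qed
  qed
 qed
 also have "\<dots> = M * (LB y. \<bar>pd (kap del) v y\<bar>)"
  using integral_reflect_point[of "%y. \<bar>pd (kap del) v y\<bar>" x] test_meas[OF kp] by simp
 also have "\<dots> <= M * (C * norm v / del)"
  using kap del M0 by (intro mult_left_mono) (auto simp: helmholtz_kernel_def)
 finally show "\<bar>pd g v x\<bar> <= C * norm v / del * M" by (simp add: eq[OF del] mult.commute)
qed

lemma power_fact_le_exp: "real n ^ n / fact n <= exp (real n)"
proof -
 obtain t where "exp (real n) = (\<Sum>m<Suc n. real n ^ m / fact m) + exp t / fact (Suc n) * real n ^ Suc n"
  using Maclaurin_exp_le[of "real n" "Suc n"] by auto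
 moreover have "(\<Sum>m<n. real n ^ m / fact m) >= 0" by (intro sum_nonneg) auto
 moreover have "exp t / fact (Suc n) * real n ^ Suc n >= 0" by (intro mult_nonneg_nonneg divide_nonneg_nonneg) auto
 ultimately show ?thesis by simp
qed

text \<open>Estimate the \<open>n\<close>-th derivative along \<open>eta\<close> in \<open>n\<close> steps at scale \<open>S / (4 n)\<close>.  The resulting factor \<open>n ^ n\<close> is absorbed by
 the factorial, and the smallness of \<open>eta\<close> bounds the Taylor remainder by \<open>M / 2 ^ n\<close>.\<close>

lemma reproduced_power_series:
 fixes eta :: "'a::euclidean_space"
 assumes kap: "helmholtz_kernel mu C kap" and g: "reproduced kap z S g" and S: "0 < S" "S <= 1"
  and eta: "8 * exp 1 * (C + 1) * norm eta <= S" and x: "dist z x <= S / 4"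
 shows "\<exists>a. \<forall>t. \<bar>t\<bar> <= 1 --> (%n. a n * t ^ n) sums g (x + t *R eta)"
proof -
 define D where "D n = ((%f. pd f eta) ^^ n) g" for n
 have C: "C >= 0" using kap by (simp add: helmholtz_kernel_def)
 have D: "D 0 = g" "D (Suc n) = pd (D n) eta" for n by (simp_all add: D_def)
 have rep: "reproduced kap z S (D n)" for n by (induction n) (auto simp: D g intro: reproduced_pd(1)[OF kap])
 have t: "D n \<in> test UNIV" for n using rep[of n] by (simp add: reproduced_def)
 obtain M where M: "M >= 0" "!!x. \<bar>g x\<bar> <= M" using test_bounded[of g UNIV] g by (auto simp: reproduced_def)
 have bound: "\<bar>D k x\<bar> <= (C * norm eta / del) ^ k * M" if "0 < del" "del <= 1" "dist z x + 2 * real k * del < S" for del k x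
  using that(3)
 proof (induction k arbitrary: x)
  case 0
  then show ?case using M by (simp add: D)
 next
  case (Suc k)
  have "\<bar>pd (D k) eta x\<bar> <= C * norm eta / del * ((C * norm eta / del) ^ k * M)"
  proof (rule reproduced_pd(2)[OF kap rep that(1,2)])
   have "2 * real k * del >= 0" using that(1) by simp
   then show "dist z x + 2 * del < S" using Suc.prems by (simp add: algebra_simps)
   show "\<bar>D k y\<bar> <= (C * norm eta / del) ^ k * M" if "y \<in> ball x del" for y
    by (rule Suc.IH) (use that Suc.prems \<open>0 < del\<close> dist_triangle[of z y x] in \<open>simp add: algebra_simps\<close>)
  qed
  then show ?case by (simp add: D mult.assoc)
 qed
 have le1: "norm eta <= S / 8"
 proof -
  have "1 * norm eta <= exp 1 * (C + 1) * norm eta"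
   using mult_mono[of 1 "exp 1" 1 "C + 1"] C by (intro mult_right_mono) auto
  then show ?thesis using eta by simp
 qed
 have small: "\<bar>D n (x + s *R eta) / fact n\<bar> <= M * (1/2) ^ n" if s: "\<bar>s\<bar> <= 1" and n: "n > 0" for s n
 proof -
  define del where "del = S / (4 * real n)"
  have del: "0 < del" "2 * real n * del = S / 2" using S n by (auto simp: del_def)
  have del1: "del <= 1" using S n by (simp add: del_def divide_le_eq)
  have "dist z (x + s *R eta) <= dist z x + \<bar>s\<bar> * norm eta" using dist_triangle[of z "x + s *R eta" x] by (simp add: dist_norm)
  moreover have "\<bar>s\<bar> * norm eta <= 1 * norm eta" using s by (intro mult_right_mono) auto
  ultimately have "dist z (x + s *R eta) + 2 * real n * del < S" using le1 x del(2) S(1) by linarith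
  from bound[OF del(1) del1 this] have b: "\<bar>D n (x + s *R eta)\<bar> <= (C * norm eta / del) ^ n * M" .
  have "C * norm eta / del = real n * (4 * C * norm eta / S)" by (simp add: del_def)
  also have "\<dots> <= real n * (1 / (2 * exp 1))"
  proof (intro mult_left_mono)
   have "C * norm eta <= (C + 1) * norm eta" by (intro mult_right_mono) auto
   then have "exp 1 * (C * norm eta) <= exp 1 * ((C + 1) * norm eta)" by (intro mult_left_mono) auto
   moreover have "8 * (exp 1 * ((C + 1) * norm eta)) <= S" using eta by (simp only: mult.assoc)
   ultimately have "8 * (exp 1 * (C * norm eta)) <= S" by linarith
   then show "4 * C * norm eta / S <= 1 / (2 * exp 1)" using S(1) by (simp add: field_simps)
  qed simp
  finally have "(C * norm eta / del) ^ n <= (real n * (1 / (2 * exp 1))) ^ n"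
   using C del(1) by (intro power_mono) auto
  also have "\<dots> = real n ^ n * ((1/2) ^ n / exp (real n))"
   by (simp add: power_mult_distrib power_divide exp_of_nat_mult[of n 1, simplified])
  also have "\<dots> <= (exp (real n) * fact n) * ((1/2) ^ n / exp (real n))"
   using power_fact_le_exp[of n] by (intro mult_right_mono) (auto simp: divide_le_eq)
  also have "\<dots> = fact n * (1/2) ^ n" by simp
  finally have "(C * norm eta / del) ^ n * M <= fact n * (1/2) ^ n * M" using M(1) by (intro mult_right_mono)
  then have "\<bar>D n (x + s *R eta)\<bar> <= M * (1/2) ^ n * fact n" using b by (simp add: mult_ac)
  then show ?thesis by (simp add: divide_le_eq)
 qed
 define diff where "diff n s = D n (x + s *R eta)" for n s
 have der: "\<forall>m s. DERIV (diff m) s :> diff (Suc m) s"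
 proof (intro allI)
  fix m s
  have 1: "((%s. x + s *R eta) has_derivative (%h. h *R eta)) (at s)" by (auto intro!: derivative_eq_intros)
  have "((%s. D m (x + s *R eta)) has_derivative (%h. pd (D m) (h *R eta) (x + s *R eta))) (at s)"
   by (rule has_derivative_compose[OF 1 test_deriv[OF t]])
  moreover have "pd (D m) (h *R eta) (x + s *R eta) = diff (Suc m) s * h" for h
   using linear_scale[OF pd_linear[OF t[of m], of "x + s *R eta"], of h eta] by (simp add: diff_def D)
  ultimately show "DERIV (diff m) s :> diff (Suc m) s"
   by (simp add: has_field_derivative_def diff_def[abs_def])
 qed
 have "(%n. diff n 0 / fact n * t ^ n) sums g (x + t *R eta)" if t1: "\<bar>t\<bar> <= 1" for t
 proof -
  have "(%n. (\<Sum>m<n. diff m 0 / fact m * t ^ m)) ---> diff 0 t"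
  proof (rule LIM_zero_cancel, rule Lim_null_comparison)
   show "eventually (%n. norm ((\<Sum>m<n. diff m 0 / fact m * t ^ m) - diff 0 t) <= M * (1/2) ^ n) sequentially"
    using eventually_gt_at_top[of 0]
   proof eventually_elim
    case (elim n)
    obtain s where s: "\<bar>s\<bar> <= \<bar>t\<bar>" "diff 0 t = (\<Sum>m<n. diff m 0 / fact m * t ^ m) + diff n s / fact n * t ^ n"
     using Maclaurin_all_le[OF refl der, of t n] by blast
    have "\<bar>diff n s / fact n * t ^ n\<bar> <= \<bar>diff n s / fact n\<bar> * 1"
     unfolding abs_mult using t1 by (intro mult_left_mono) (auto simp: power_abs power_le_one)
    also have "\<dots> <= M * (1/2) ^ n" using small[OF _ elim] s(1) t1 by (simp add: diff_def)
    finally show ?case by (simp add: s(2))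
   qed
   show "(%n. M * (1/2) ^ n) ---> 0" by (intro tendsto_mult_right_zero LIMSEQ_realpow_zero) auto
  qed
  then show ?thesis by (simp add: sums_def diff_def D)
 qed
 then show ?thesis by (intro exI[of _ "%n. diff n 0 / fact n"]) blast
qed

lemma power_series_zero_accumulation:
 fixes a :: "nat => real"
 assumes s: "!!t. \<bar>t\<bar> <= 1 ==> (%n. a n * t ^ n) sums f t" and f0: "f 0 = 0"
  and z: "!!s. s > 0 ==> \<exists>t. 0 < \<bar>t\<bar> & \<bar>t\<bar> <= s & f t = 0"
 shows "f 1 = 0"
proof -
 have am: "a m = 0" if m: "m > 0" for m
 proof (rule ccontr)
  assume am: "a m ~= 0"
  obtain s where s: "0 < s" "!!z. z \<in> cball 0 s - {0} ==> f z ~= 0"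
   by (rule powser_0_nonzero[of 1 0 a f m]) (use s f0 am m that in auto)
  then show False using z[of s] by fastforce
 qed
 have "(%n. a n * 0 ^ n) sums a 0" by (rule powser_sums_zero)
 then have "a 0 = 0" using s[of 0] f0 sums_unique2 by fastforce
 then have "a m = 0" for m using am by (cases m) auto
 then show ?thesis using s[of 1] sums_unique2[OF _ sums_zero] by simp
qed

subsection \<open>The dichotomy for the zero set\<close>

text \<open>The points of \<open>E - h n\<close> outside \<open>E\<close> have measure tending to 0; by translation invariance so have the points of \<open>E\<close> outside
 \<open>E - h n\<close>.\<close>

lemma recurrence_AE:
 fixes E :: "'a::euclidean_space set"
 assumes E: "compact E" and h: "h ---> 0"
 shows "AEL x. x \<in> E --> (\<forall>N. \<exists>n\<ge>N. h n + x \<in> E)"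
proof -
 obtain H where H: "!!n::nat. norm (h n) <= H" using convergent_imp_Bseq[of h] h unfolding convergent_def Bseq_def by blast
 obtain R where R: "E \<subseteq> cball 0 R" using compact_imp_bounded[OF E] by (metis bounded_subset_ballD ball_subset_cball subset_trans)
 have cl: "closed E" by (rule compact_imp_closed[OF E])
 have [measurable]: "E \<in> sets borel" using cl by auto
 define e where "e = (indicator E :: 'a => real)"
 have [measurable]: "e \<in> borel_measurable borel" unfolding e_def by measurable
 have e01: "e x = 0 | e x = 1" for x by (auto simp: e_def indicator_def)
 have ie: "integrable lborel e" unfolding e_def using emeasure_compact_finite[OF E] by (intro integrable_real_indicator) auto
 have ish: "integrable lborel (%x. e (h n + x))" for n
  using integrable_dmap[OF ie, of "%_. 1" "h n"] by (simp add: dmap_const)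
 have ipr: "integrable lborel (%x. e x * e (h n + x))" for n
 proof (rule Bochner_Integration.integrable_bound[OF ie])
  show "(%x. e x * e (h n + x)) \<in> borel_measurable lborel" by measurable
  have "norm (e x * e (h n + x)) <= norm (e x)" for x using e01[of "h n + x"] by auto
  then show "AEL x. norm (e x * e (h n + x)) <= norm (e x)" by simp
 qed
 have "(%n. \<integral>x. e (h n + x) * (1 - e x) \<partial>lborel) ---> (\<integral>x. 0 \<partial>(lborel :: 'a measure))"
 proof (rule integral_dominated_convergence[where w = "indicator (cball 0 (R + H)) :: 'a => real"])
  show "integrable lborel (indicator (cball 0 (R + H)) :: 'a => real)"
   using emeasure_compact_finite[OF compact_cball[of "0::'a" "R + H"]] by (intro integrable_real_indicator) auto
  show "AEL x. norm (e (h n + x) * (1 - e x)) <= indicator (cball 0 (R + H)) x" for n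
  proof (rule AE_I2)
   fix x
   show "norm (e (h n + x) * (1 - e x)) <= indicator (cball 0 (R + H)) x"
   proof (cases "h n + x \<in> E")
    case True
    then have "norm (h n + x) <= R" using R by auto
    then have "norm x <= R + H" using norm_diff_ineq[of x "h n"] H[of n] by (simp add: add.commute)
    then show ?thesis using e01[of x] True by (auto simp: e_def)
   qed (simp add: e_def)
  qed
  show "AEL x. (%n. e (h n + x) * (1 - e x)) ---> 0"
  proof (rule AE_I2)
   fix x
   show "(%n. e (h n + x) * (1 - e x)) ---> 0"
   proof (cases "x \<in> E")
    case False
    have "(%n. h n + x) ---> 0 + x" by (intro tendsto_intros h)
    then have "eventually (%n. h n + x \<in> - E) sequentially"
     using False cl by (intro topological_tendstoD) (auto simp: open_Compl)
    then have "eventually (%n. e (h n + x) * (1 - e x) = 0) sequentially"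
     by eventually_elim (simp add: e_def)
    then show ?thesis by (rule tendsto_eventually)
   qed (simp add: e_def)
  qed
 qed auto
 moreover have "(LB x. e (h n + x) * (1 - e x)) = (LB x. e x * (1 - e (h n + x)))" for n
  using integral_shift[of e "h n"] ie ish[of n] ipr[of n] by (simp add: right_diff_distrib mult.commute[of "e (h n + _)"])
 ultimately have lim: "(%n. \<integral>x. e x * (1 - e (h n + x)) \<partial>lborel) ---> 0" by simp
 have "AEL x. ~ (x \<in> E & (\<forall>n\<ge>N. h n + x ~: E))" for N
 proof -
  define A where "A = {x \<in> space lborel. x \<in> E & (\<forall>n\<ge>N. h n + x ~: E)}"
  have [measurable]: "A \<in> sets borel" unfolding A_def by measurable
  have iA: "integrable lborel (indicator A :: 'a => real)"
   by (rule Bochner_Integration.integrable_bound[OF ie]) (auto simp: A_def e_def indicator_def)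
  have "(LB x. indicator A x) <= (0::real)"
  proof (rule LIMSEQ_le_const[OF lim], intro exI[of _ N] allI impI)
   fix n assume n: "N <= n"
   show "(LB x. indicator A x) <= (LB x. e x * (1 - e (h n + x)))"
   proof (rule integral_mono[OF iA])
    show "integrable lborel (%x. e x * (1 - e (h n + x)))" using ie ipr[of n] by (simp add: right_diff_distrib)
    show "indicator A x <= e x * (1 - e (h n + x))" for x
     using n e01[of x] e01[of "h n + x"] by (auto simp: A_def e_def indicator_def)
   qed
  qed
  moreover have "(LB x. indicator A x) >= (0::real)" by (rule Bochner_Integration.integral_nonneg) auto
  ultimately have "(LB x. indicator A x) = (0::real)" by (rule antisym)
  then have "AEL x. (indicator A x :: real) = 0"
   by (subst (asm) integral_nonneg_eq_0_iff_AE[OF iA]) auto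
  then show ?thesis by eventually_elim (auto simp: A_def indicator_def split: if_splits)
 qed
 then have "AEL x. \<forall>N. ~ (x \<in> E & (\<forall>n\<ge>N. h n + x ~: E))" unfolding AE_all_countable by blast
 then show ?thesis by eventually_elim blast
qed

text \<open>If the zero set \<open>E\<close> near \<open>z\<close> has positive measure, almost every \<open>x\<close> in it has zeros \<open>x + eta / (n + 1)\<close> accumulating at \<open>x\<close>.
 The representative is analytic along \<open>eta\<close>, so it also vanishes at \<open>x + eta\<close>.  By Fubini one \<open>x\<close> serves almost all small \<open>eta\<close>.\<close>

lemma helmholtz_zero_local:
 fixes U :: "('a::euclidean_space, real) L2"
 assumes U: "helmholtz_on Q mu U" and mu: "0 <= mu" and Q: "open Q" "z \<in> Q"
 shows "\<exists>tau>0. (AEL x. x \<in> ball z tau --> L2f U x ~= 0) | (AEL x. x \<in> ball z tau --> L2f U x = 0)"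
proof -
 obtain C and kap :: "real => 'a => real" where kap: "helmholtz_kernel mu C kap" using helmholtz_kernel_exists[OF mu] by blast
 have C: "C >= 0" using kap by (simp add: helmholtz_kernel_def)
 obtain S g where S: "0 < S" "S <= 1" and g: "reproduced kap z S g" and ug: "AEL x. x \<in> ball z S --> L2f U x = g x"
  using helmholtz_local_representative[OF U kap Q] by blast
 have t: "g \<in> test UNIV" using g by (simp add: reproduced_def)
 note [measurable] = test_meas[OF t]
 define c where "c = exp 1 * (C + 1)"
 have c1: "c >= 1" unfolding c_def using mult_mono[of 1 "exp 1" 1 "C + 1"] C by simp
 define tau where "tau = S / (16 * c)"
 have tau: "tau > 0" "16 * c * tau = S" using S c1 by (auto simp: tau_def)
 have tau4: "tau <= S / 4" using mult_right_mono[OF c1, of tau] tau by linarith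
 have sub: "ball z tau \<subseteq> ball z S" using tau4 S by auto
 define E where "E = cball z tau \<inter> {x. g x = 0}"
 have E: "compact E" unfolding E_def
  by (intro compact_Int_closed compact_cball closed_Collect_eq test_cont[OF t] continuous_intros)
 have [measurable]: "E \<in> sets borel" using compact_imp_closed[OF E] by auto
 show ?thesis
 proof (cases "AEL x. x ~: E")
  case True
  then have "AEL x. x \<in> ball z tau --> L2f U x ~= 0"
   using ug by eventually_elim (use sub in \<open>auto simp: E_def\<close>)
  then show ?thesis using tau by blast
 next
  case False
  have zero: "AEL x. x \<in> E & norm eta <= 2 * tau --> g (x + eta) = 0" for eta
  proof -
   have "(%n. (1 / real (Suc n)) *R eta) ---> 0 *R eta"
    by (intro tendsto_intros) (use LIMSEQ_inverse_real_of_nat in \<open>simp add: inverse_eq_divide\<close>)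
   then have "AEL x. x \<in> E --> (\<forall>N. \<exists>n\<ge>N. (1 / real (Suc n)) *R eta + x \<in> E)"
    by (intro recurrence_AE[OF E]) simp
   then show ?thesis
   proof eventually_elim
    case (elim x)
    show ?case
    proof
     assume a: "x \<in> E & norm eta <= 2 * tau"
     have "dist z x <= S / 4" using a tau4 by (auto simp: E_def)
     moreover have "8 * exp 1 * (C + 1) * norm eta <= S"
     proof -
      have "8 * c * norm eta <= 8 * c * (2 * tau)" using a c1 by (intro mult_left_mono) auto
      then have "8 * c * norm eta <= S" using tau(2) by linarith
      then show ?thesis by (simp only: c_def mult.assoc)
     qed
     ultimately obtain b where b: "!!t. \<bar>t\<bar> <= 1 ==> (%n. b n * t ^ n) sums g (x + t *R eta)"
      using reproduced_power_series[OF kap g S] by blast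
     have "g (x + 1 *R eta) = 0"
     proof (rule power_series_zero_accumulation[of b "%t. g (x + t *R eta)"])
      show "g (x + 0 *R eta) = 0" using a by (simp add: E_def)
      fix s :: real assume "s > 0"
      then obtain N where N: "1 / real (Suc N) < s" using nat_approx_posE by blast
      obtain n where n: "n >= N" "(1 / real (Suc n)) *R eta + x \<in> E" using elim a by blast
      have "1 / real (Suc n) <= 1 / real (Suc N)" using n(1) by (intro divide_left_mono) auto
      then show "\<exists>t. 0 < \<bar>t\<bar> & \<bar>t\<bar> <= s & g (x + t *R eta) = 0"
       using n(2) N by (intro exI[of _ "1 / real (Suc n)"]) (auto simp: E_def add.commute)
     qed (rule b)
     then show "g (x + eta) = 0" by simp
    qed
   qed
  qed
  have m: "{p \<in> space (lborel \<Otimes>\<^sub>M lborel). snd p \<in> E & norm (fst p) <= 2 * tau --> g (snd p + fst p) = 0} \<in> sets (lborel \<Otimes>\<^sub>M lborel)"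
   by measurable
  have "AE eta in lborel. AEL x. x \<in> E & norm eta <= 2 * tau --> g (x + eta) = 0" using zero by simp
  then have "AEL x. AE eta in lborel. x \<in> E & norm eta <= 2 * tau --> g (x + eta) = 0"
   using lborel_pair.AE_commute[OF m] by simp
  then have "\<exists>x\<in>E. AE eta in lborel. norm eta <= 2 * tau --> g (x + eta) = 0"
  proof (rule_tac ccontr)
   assume ae: "AEL x. AE eta in lborel. x \<in> E & norm eta <= 2 * tau --> g (x + eta) = 0"
    and no: "~ (\<exists>x\<in>E. AE eta in lborel. norm eta <= 2 * tau --> g (x + eta) = 0)"
   have "AEL x. x ~: E" using ae by eventually_elim (use no in auto)
   then show False using False by blast
  qed
  then obtain x where x: "x \<in> E" "AE eta in lborel. norm eta <= 2 * tau --> g (x + eta) = 0" by blast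
  have g0: "g y = 0" if y: "y \<in> ball z tau" for y
  proof -
   have "g (x + (y - x)) = 0"
   proof (rule continuous_AE_eq[of "%eta. g (x + eta)" "%_. 0" "ball 0 (2 * tau)"])
    show "continuous_on UNIV (%eta. g (x + eta))"
     by (rule continuous_on_compose2[OF test_cont[OF t]]) (auto intro!: continuous_intros)
    show "AE eta in lborel. eta \<in> ball 0 (2 * tau) --> g (x + eta) = 0" using x(2) by eventually_elim auto
    have "dist x y <= dist z x + dist z y" by (metis dist_commute dist_triangle)
    then show "y - x \<in> ball 0 (2 * tau)" using x(1) y by (auto simp: E_def dist_norm norm_minus_commute)
   qed auto
   then show ?thesis by simp
  qed
  have "AEL x. x \<in> ball z tau --> L2f U x = 0" using ug by eventually_elim (use sub g0 in auto)
  then show ?thesis using tau by blast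
 qed
qed

lemma AE_local:
 fixes Q :: "'a::euclidean_space set"
 assumes "!!z. z \<in> Q ==> \<exists>tau>0. AEL x. x \<in> ball z tau --> P x"
 shows "AEL x. x \<in> Q --> P x"
proof -
 obtain tau where tau: "!!z. z \<in> Q ==> tau z > 0 & (AEL x. x \<in> ball z (tau z) --> P x)"
  using bchoice[of Q "%z tau. tau > 0 & (AEL x. x \<in> ball z tau --> P x)"] assms by blast
 obtain F' where F: "F' \<subseteq> (%z. ball z (tau z)) ` Q" "countable F'" "\<Union>F' = \<Union>((%z. ball z (tau z)) ` Q)"
  by (rule Lindelof[of "(%z. ball z (tau z)) ` Q"]) auto
 have "AEL x. \<forall>B\<in>F'. x \<in> B --> P x" by (rule AE_ball_countable') (use F tau in auto)
 then show ?thesis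
 proof eventually_elim
  case (elim x)
  then show ?case using F(3) tau centre_in_ball by blast
 qed
qed

text \<open>The points around which the solution is almost everywhere nonzero, and those around which it is almost everywhere zero, form two
 disjoint open sets that cover \<open>Q\<close>.\<close>

lemma unique_continuation:
 fixes U :: "('a::euclidean_space, real) L2"
 assumes U: "helmholtz_on Q mu U" and mu: "0 <= mu" and Q: "open Q" "connected Q"
 shows "(AEL x. x \<in> Q --> L2f U x ~= 0) | (AEL x. x \<in> Q --> L2f U x = 0)"
proof -
 define A where "A P = {z\<in>Q. \<exists>tau>0. AEL x. x \<in> ball z tau --> P (L2f U x)}" for P
 have op: "open (A P)" for P unfolding open_contains_ball
 proof
  fix z assume z: "z \<in> A P"
  then obtain tau where t: "tau > 0" "AEL x. x \<in> ball z tau --> P (L2f U x)" by (auto simp: A_def)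
  obtain e where e: "e > 0" "ball z e \<subseteq> Q" using z Q(1) openE by (metis (no_types, lifting) A_def mem_Collect_eq)
  have "ball z (min e (tau / 2)) \<subseteq> A P"
  proof
   fix y assume y: "y \<in> ball z (min e (tau / 2))"
   then have "ball y (tau / 2) \<subseteq> ball z tau" by (intro ball_subset_ball_iff[THEN iffD2]) (auto simp: dist_commute)
   then have "AEL x. x \<in> ball y (tau / 2) --> P (L2f U x)" using t(2) by (auto elim!: eventually_mono)
   then show "y \<in> A P" unfolding A_def using y e t(1) by (auto intro!: exI[of _ "tau / 2"])
  qed
  then show "\<exists>e>0. ball z e \<subseteq> A P" using e t by (intro exI[of _ "min e (tau / 2)"]) auto
 qed
 have cov: "Q \<subseteq> A (%u. u ~= 0) \<union> A (%u. u = 0)"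
  using helmholtz_zero_local[OF U mu Q(1)] unfolding A_def by blast
 have "A (%u. u ~= 0) \<inter> A (%u. u = 0) = {}"
 proof (rule ccontr)
  assume "A (%u. u ~= 0) \<inter> A (%u. u = 0) ~= {}"
  then obtain z s t where "s > 0" "t > 0" "AEL x. x \<in> ball z s --> L2f U x ~= 0" "AEL x. x \<in> ball z t --> L2f U x = 0"
   unfolding A_def by blast
  then have "AEL x. x ~: ball z (min s t)" by (auto elim: eventually_elim2)
  from open_AE_empty[OF open_ball this] show False using \<open>s > 0\<close> \<open>t > 0\<close> by (simp add: ball_eq_empty)
 qed
 then have "A (%u. u ~= 0) \<inter> Q = {} | A (%u. u = 0) \<inter> Q = {}"
  using connectedD[OF Q(2) op op _ cov] by blast
 then have "Q \<subseteq> A (%u. u = 0) | Q \<subseteq> A (%u. u ~= 0)" using cov by blast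
 then show ?thesis using AE_local[of Q "%x. L2f U x ~= 0"] AE_local[of Q "%x. L2f U x = 0"] unfolding A_def by blast
qed

section \<open>Existence of minimizers\<close>

subsection \<open>Translations and reflections\<close>

text \<open>Used for \<open>c j = \<plusminus> 1\<close>, when \<open>dmap c t\<close> is an isometry; its linear part is diagonal, hence its own transpose.\<close>

definition motion :: "('a::euclidean_space => real) => 'a => ('a, real) L2 \<times> ('a, 'a) L2 => ('a, real) L2 \<times> ('a, 'a) L2" where
 "motion c t p = (pull c t (%v. v) (fst p), pull c t (dmap c 0) (snd p))"

context
 fixes c :: "'a::euclidean_space => real"
 assumes c: "!!j. j \<in> Basis ==> \<bar>c j\<bar> = 1"
begin

lemma motion_nonzero: "j \<in> Basis ==> c j ~= 0" using c[of j] by auto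

lemma motion_prod: "\<bar>\<Prod>j\<in>Basis. c j\<bar> = 1" using c by (simp add: abs_prod)

lemma motion_linear: "linear (motion c t)"
proof -
 have 1: "linear (pull c t (%v. v) :: ('a, real) L2 => _)" by (rule pull_linear[OF motion_nonzero linear_ident'])
 have 2: "linear (pull c t (dmap c 0) :: ('a, 'a) L2 => _)" by (rule pull_linear[OF motion_nonzero dmap_linear])
 show ?thesis unfolding motion_def
  by (rule linearI) (simp_all add: linear_add[OF 1] linear_add[OF 2] linear_scale[OF 1] linear_scale[OF 2])
qed

lemma motion_H10: "p \<in> H10 Om ==> motion c t p \<in> H10 (dmap c t -` Om)"
 using H10_pull[where c = c and t = t and U = "fst p" and G = "snd p", OF motion_nonzero] by (simp add: motion_def)

lemma motion_inner: "fst (motion c t p) \<bullet> fst (motion c t q) = fst p \<bullet> fst q"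
 using pull_inner[where c = c and t = t and U = "fst p" and V = "fst q", OF motion_nonzero] by (simp add: motion_def motion_prod)

lemma motion_norm: "norm (fst (motion c t p)) = norm (fst p)"
 by (simp add: norm_eq_sqrt_inner motion_inner)

lemma dmap_involution: "dmap c 0 (dmap c 0 v) = v"
proof (rule euclidean_eqI)
 fix j :: 'a assume j: "j \<in> Basis"
 then have "c j = 1 | c j = -1" using c[OF j] by linarith
 then show "dmap c 0 (dmap c 0 v) \<bullet> j = v \<bullet> j" using j by (auto simp: dmap_inner)
qed

lemma norm_dmap: "norm (dmap c 0 v) = norm v"
 by (simp add: norm_eq_sqrt_inner dmap_self_adjoint dmap_involution)

lemma motion_snd_le: "norm (snd (motion c t p)) <= norm (snd p)"
proof -
 have "\<bar>\<Prod>j\<in>Basis. c j\<bar> * (norm (pull c t (dmap c 0) (snd p)))^2 <= 1\<^sup>2 * (norm (snd p))^2"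
  by (rule pull_norm_le[OF motion_nonzero dmap_linear]) (simp_all add: norm_dmap)
 then have "(norm (snd (motion c t p)))^2 <= (norm (snd p))^2" by (simp add: motion_def motion_prod)
 then show ?thesis by (rule power2_le_imp_le) simp
qed

end

lemma eigenvalue_translate_le:
 assumes "dom Om" "1 <= h"
 shows "evD h ((+) t -` Om) <= evD h Om" and "dom ((+) t -` Om)"
proof -
 have im: "(+) t -` Om = (+) (- t) ` Om" by (auto simp: image_iff) (metis add_diff_cancel_left')
 show d: "dom ((+) t -` Om)" using assms open_translation[of Om "- t"] bounded_translation[of Om "- t"] unfolding im by simp
 obtain e where e: "!!i. e i \<in> H10 Om" "!!i j. fst (e i) \<bullet> fst (e j) = (if i = j then 1 else 0)" "!!c. (norm (fst (\<Sum>i<h. c i *R e i)))\<^sup>2 = (\<Sum>i<h. (c i)\<^sup>2)"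
  "!!c. (norm (snd (\<Sum>i<h. c i *R e i)))\<^sup>2 <= evD h Om * (norm (fst (\<Sum>i<h. c i *R e i)))^2"
  by (rule eigen_frame[OF assms]) (rule that)
 define T where "T = motion (%_::'a. 1) t"
 have s: "(\<Sum>i<h. c i *R T (e i)) = T (\<Sum>i<h. c i *R e i)" for c
  using motion_linear[of "%_. 1" t] unfolding T_def by (simp add: linear_scale linear_sum)
 have n: "norm (fst (T p)) = norm (fst p)" for p by (simp add: T_def motion_norm)
 show "evD h ((+) t -` Om) <= evD h Om"
 proof (rule eigenvalue_upper[OF d assms(2), of "%i. T (e i)"])
  show "T (e i) \<in> H10 ((+) t -` Om)" for i
   using motion_H10[OF _ e(1), of "%_. 1" t i] by (simp add: T_def dmap_const[of 1 t] vimage_def)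
  show "\<forall>i<h. c i = 0" if "fst (\<Sum>i<h. c i *R T (e i)) = 0" for c
  proof -
   have "norm (fst (T (\<Sum>i<h. c i *R e i))) = 0" using that unfolding s by simp
   then have "fst (\<Sum>i<h. c i *R e i) = 0" unfolding n by simp
   then show ?thesis by (rule orthonormal_independent[OF e(3)])
  qed
  have "norm (snd (T p)) <= norm (snd p)" for p unfolding T_def by (rule motion_snd_le) simp
  then show "(norm (snd (\<Sum>i<h. c i *R T (e i))))^2 <= evD h Om * (norm (fst (\<Sum>i<h. c i *R T (e i))))^2" for c
   unfolding s n by (rule order_trans[OF power_mono[OF _ norm_ge_zero] e(4)])
 qed
qed

subsection \<open>Admissible sets\<close>

lemma admissible_dom: "admissible D Om ==> dom Om"
 by (simp add: admissible_def)

lemma admissible_dist: "admissible D Om ==> x \<in> Om ==> y \<in> Om ==> dist x y <= D"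
 using diameter_bounded_bound[of Om x y] by (auto simp: admissible_def)

lemma admissibleI:
 assumes "open Om" "Om ~= {}" "!!x y. x \<in> Om ==> y \<in> Om ==> dist x y <= D"
 shows "admissible D Om"
proof -
 obtain x where x: "x \<in> Om" using assms(2) by blast
 have "bounded Om" using assms(3)[OF x] unfolding bounded_def by blast
 moreover have "diameter Om <= D" using assms(2,3) by (intro diameter_le) (auto simp: dist_norm)
 ultimately show ?thesis using assms by (simp add: admissible_def)
qed

lemma admissible_translate: "admissible D Om ==> admissible D ((+) t -` Om)"
proof (rule admissibleI)
 assume a: "admissible D Om"
 show "open ((+) t -` Om)" "(+) t -` Om ~= {}" using eigenvalue_translate_le(2)[OF admissible_dom[OF a], of 1 t] by auto
 show "dist x y <= D" if "x \<in> (+) t -` Om" "y \<in> (+) t -` Om" for x y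
  using admissible_dist[OF a, of "t + x" "t + y"] that by (simp add: dist_norm)
qed

lemma minimizer_iff:
 fixes Om :: "'a::euclidean_space set"
 shows "minimizer D h Om \<longleftrightarrow> admissible D Om & (\<forall>Om' :: 'a set. admissible D Om' --> evD h Om <= evD h Om')"
 unfolding minimizer_def is_arg_min_def by (auto simp: not_less)

lemma minimizer_translate:
 assumes m: "minimizer D h Om" and h: "1 <= h"
 shows "minimizer D h ((+) t -` Om)"
proof -
 have a: "admissible D Om" using m by (simp add: minimizer_iff)
 have "evD h ((+) t -` Om) <= evD h Om"
  by (intro eigenvalue_translate_le h admissible_dom[OF a])
 then show ?thesis using m admissible_translate by (force simp: minimizer_iff)
qed

lemma minimizer_superset:
 assumes m: "minimizer D h Om" and h: "1 <= h" and "admissible D Om'" "Om \<subseteq> Om'"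
 shows "minimizer D h Om'"
proof -
 have "evD h Om' <= evD h Om"
  using assms by (intro eigenvalue_mono) (auto simp: minimizer_iff dest: admissible_dom)
 then show ?thesis using m assms(3) by (force simp: minimizer_iff)
qed

lemma constant_width_interior_admissible:
 assumes "constant_width_body K D" "!!x y. x \<in> K ==> y \<in> K ==> dist x y <= D"
 shows "admissible D (interior K)"
 using assms interior_subset[of K] by (intro admissibleI) (auto simp: constant_width_body_def)

subsection \<open>A minimizing sequence converges\<close>

lemma common_subsequence:
 fixes X :: "nat => nat => ('a::euclidean_space, real) L2 \<times> ('a, 'a) L2"
 assumes X: "!!n i. X n i \<in> H10 UNIV" "!!n i. fst (X n i) \<in> vanish (- cball 0 R)" "!!n i. i < h ==> norm (X n i) <= B"
 shows "k <= h ==> \<exists>r u. strict_mono (r :: nat => nat) & (\<forall>i<k. (%n. fst (X (r n) i)) ---> u i)"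
proof (induction k)
 case 0
 show ?case by (auto intro!: exI[of _ id] simp: strict_mono_id)
next
 case (Suc k)
 then obtain r u where r: "strict_mono r" "!!i. i < k ==> (%n. fst (X (r n) i)) ---> u i" by auto
 obtain s v where s: "strict_mono (s :: nat => nat)" "(%n. fst (X (r (s n)) k)) ---> v"
  using rellich[of "%n. X (r n) k" R B] X Suc.prems by auto
 have "(%n. fst (X ((r \<circ> s) n) i)) ---> (u(k := v)) i" if "i < Suc k" for i
 proof (cases "i = k")
  case False
  then show ?thesis using LIMSEQ_subseq_LIMSEQ[OF r(2) s(1), of i] that by (simp add: o_def)
 qed (use s(2) in simp)
 then show ?case using strict_mono_o[OF r(1) s(1)] by blast
qed

lemma frequently_closed_limit:
 assumes "closed C" "X ---> u" "frequently (%n. X n \<in> C) sequentially"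
 shows "u \<in> C"
proof (rule ccontr)
 assume "u ~: C"
 then have "eventually (%n. X n \<in> - C) sequentially" using assms by (intro topological_tendstoD) (auto simp: open_Compl)
 then show False using assms(3) by (auto simp: frequently_def)
qed

text \<open>Two balls at distance more than \<open>D\<close> cannot both meet a set of diameter \<open>D\<close>, so one of them is missed infinitely
 often.  Hence the common essential support of limits of functions supported on sets of diameter \<open>D\<close> has diameter at most \<open>D\<close>.\<close>

lemma limit_support_diameter:
 fixes X :: "nat => nat => ('a::euclidean_space, real) L2"
 assumes Om: "!!n. admissible D (Om n)" and X: "!!n i. X n i \<in> vanish (- Om n)" and lim: "!!i. i < h ==> (%n. X n i) ---> u i"
 shows "\<exists>S. (\<forall>x\<in>S. \<forall>y\<in>S. dist x y <= D) & (\<forall>i<h. u i \<in> vanish (- S))"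
proof -
 define S where "S = {z. ~ (\<exists>tau>0. AEL x. x \<in> ball z tau --> (\<forall>i<h. L2f (u i) x = 0))}"
 have "dist z w <= D" if z: "z \<in> S" and w: "w \<in> S" for z w
 proof (rule ccontr)
  assume "~ dist z w <= D"
  define tau where "tau = (dist z w - D) / 2"
  have tau: "tau > 0" using \<open>~ dist z w <= D\<close> by (simp add: tau_def)
  have alt: "Om n \<inter> ball z tau = {} | Om n \<inter> ball w tau = {}" for n
  proof (rule ccontr)
   assume "~ ?thesis"
   then obtain x y where xy: "x \<in> Om n" "dist z x < tau" "y \<in> Om n" "dist w y < tau" by auto
   have "dist z w <= dist z x + dist x y + dist y w" by (metis add.commute add_left_mono dist_triangle order_trans)
   then show False using xy admissible_dist[OF Om xy(1,3)] by (simp add: tau_def dist_commute)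
  qed
  have no: "~ frequently (%n. Om n \<inter> ball v tau = {}) sequentially" if v: "v \<in> S" for v
  proof
   assume f: "frequently (%n. Om n \<inter> ball v tau = {}) sequentially"
   have "u i \<in> vanish (ball v tau)" if "i < h" for i
   proof (rule frequently_closed_limit[OF vanish_closed lim[OF that]])
    have van: "X n i \<in> vanish (ball v tau)" if "Om n \<inter> ball v tau = {}" for n
     using X[of n i] unfolding vanish_def mem_Collect_eq by eventually_elim (use that in auto)
    show "frequently (%n. X n i \<in> vanish (ball v tau)) sequentially" by (rule frequently_elim1[OF f van])
   qed simp
   then have "AEL x. \<forall>i\<in>{..<h}. x \<in> ball v tau --> L2f (u i) x = 0"
    by (intro AE_ball_countable') (auto simp: vanish_def)
   then have "AEL x. x \<in> ball v tau --> (\<forall>i<h. L2f (u i) x = 0)" by eventually_elim auto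
   then show False using v tau unfolding S_def by blast
  qed
  have "frequently (%n. Om n \<inter> ball z tau = {} | Om n \<inter> ball w tau = {}) sequentially" 
   by (rule eventually_frequently[OF sequentially_bot]) (simp only: alt eventually_True)
  then show False using no z w by (auto simp: frequently_disj_iff)
 qed
 moreover have "u i \<in> vanish (- S)" if "i < h" for i
 proof -
  have "AEL x. x \<in> - S --> (\<forall>i<h. L2f (u i) x = 0)" by (rule AE_local) (simp add: S_def)
  then show ?thesis unfolding vanish_def mem_Collect_eq by eventually_elim (use that in auto)
 qed
 ultimately show ?thesis by blast
qed

text \<open>The limit functions are carried by a body of constant width \<open>D\<close>, and weak lower semicontinuity of the energy on the
 span of the limits bounds the eigenvalue of that body by the infimum.\<close>

theorem minimizer_exists:
 assumes D: "0 < D" and h: "1 <= h"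
 shows "\<exists>Om :: 'a::euclidean_space set. minimizer D h Om"
proof -
 let ?ev = "evD h :: 'a set => real"
 define V where "V = ?ev ` {Om. admissible D Om & Om \<subseteq> cball 0 D}"
 define L where "L = Inf V"
 have ballD: "admissible D (ball (0::'a) (D / 2))"
 proof (rule admissibleI)
  show "dist x y <= D" if "x \<in> ball 0 (D / 2)" "y \<in> ball 0 (D / 2)" for x y :: 'a
   using that dist_triangle[of x y 0] by (simp add: dist_commute)
 qed (use D in auto)
 have V: "V ~= {}" unfolding V_def using ballD D by (auto intro!: exI[of _ "ball 0 (D / 2)"])
 have bd: "bdd_below V" unfolding V_def bdd_below_def using eigenvalue_nonneg[OF admissible_dom h] by blast
 have L0: "L >= 0" unfolding L_def using V eigenvalue_nonneg[OF admissible_dom h] by (intro cInf_greatest) (auto simp: V_def)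
 have low: "L <= ?ev Om" if a: "admissible D Om" for Om
 proof -
  obtain t where t: "t \<in> Om" using a by (auto simp: admissible_def)
  have "(+) t -` Om \<subseteq> cball 0 D"
   using admissible_dist[OF a t] by (auto simp: dist_norm) (metis add_diff_cancel_left' norm_minus_commute)
  then have "L <= ?ev ((+) t -` Om)" unfolding L_def V_def using admissible_translate[OF a] bd[unfolded V_def] by (intro cInf_lower) auto
  also have "\<dots> <= ?ev Om" by (rule eigenvalue_translate_le[OF admissible_dom[OF a] h])
  finally show ?thesis .
 qed
 have "\<exists>Om. admissible D Om & Om \<subseteq> cball 0 D & ?ev Om < L + inverse (real (Suc n))" for n
 proof -
  have "Inf V < L + inverse (real (Suc n))" by (simp add: L_def)
  then obtain v where "v \<in> V" "v < L + inverse (real (Suc n))" using cInf_lessD[OF V] by blast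
  then show ?thesis by (auto simp: V_def)
 qed
 then obtain Om :: "nat => 'a set" where Om: "!!n. admissible D (Om n)" "!!n. Om n \<subseteq> cball 0 D" "!!n. ?ev (Om n) < L + inverse (real (Suc n))"
  by metis
 note dm = admissible_dom[OF Om(1)]
 define P where "P n e \<longleftrightarrow> (\<forall>i. e i \<in> H10 (Om n)) & (\<forall>i j. fst (e i) \<bullet> fst (e j) = (if i = j then 1 else 0)) &
   (\<forall>c. (norm (snd (\<Sum>i<h. c i *R e i)))\<^sup>2 <= ?ev (Om n) * (\<Sum>i<h. (c i)\<^sup>2))" for n e
 have "\<forall>n. \<exists>e. P n e"
 proof
  fix n
  obtain e where "!!i. e i \<in> H10 (Om n)" "!!i j. fst (e i) \<bullet> fst (e j) = (if i = j then 1 else 0)" "!!c. (norm (fst (\<Sum>i<h. c i *R e i)))\<^sup>2 = (\<Sum>i<h. (c i)\<^sup>2)"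
   "!!c. (norm (snd (\<Sum>i<h. c i *R e i)))\<^sup>2 <= ?ev (Om n) * (norm (fst (\<Sum>i<h. c i *R e i)))^2"
   by (rule eigen_frame[OF dm[of n] h]) (rule that)
  then have "P n e" by (simp add: P_def)
  then show "\<exists>e. P n e" by blast
 qed
 from choice[OF this] obtain e where eP: "\<forall>n. P n (e n)" by blast
 have e: "e n i \<in> H10 (Om n)" "fst (e n i) \<bullet> fst (e n j) = (if i = j then 1 else 0)"
  "(norm (snd (\<Sum>i<h. c i *R e n i)))^2 <= ?ev (Om n) * (\<Sum>i<h. (c i)\<^sup>2)" for n i j c
  using eP unfolding P_def by blast+
 have eU: "e n i \<in> H10 UNIV" for n i using e(1) H10_mono[of "Om n" UNIV] by blast
 have ev: "fst (e n i) \<in> vanish (- Om n)" for n i by (rule H10_vanish(1)[OF _ e(1)]) (use dm in blast)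
 have ec: "fst (e n i) \<in> vanish (- cball 0 D)" for n i
  using ev[of n i] unfolding vanish_def mem_Collect_eq by eventually_elim (use Om(2)[of n] in auto)
 have snd: "(norm (snd (e n i)))^2 <= ?ev (Om n)" if i: "i < h" for n i
  using e(3)[where c = "%j. if j = i then 1 else 0" and n = n] i by (simp add: if_distrib[of "%x. x *R _"] if_distrib[of "%x. x\<^sup>2"] cong: if_cong)
 have bnd: "norm (e n i) <= sqrt (L + 2)" if i: "i < h" for n i
 proof -
  have "(norm (e n i))^2 = (norm (fst (e n i)))^2 + (norm (snd (e n i)))^2" by (cases "e n i") (simp add: norm_Pair)
  also have "(norm (fst (e n i)))^2 = 1" using e(2)[of n i i] by (simp add: power2_norm_eq_inner)
  also have "(norm (snd (e n i)))^2 <= L + 1"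
   using snd[OF i, of n] Om(3)[of n] inverse_le_1_iff[of "real (Suc n)"] by simp
  finally show ?thesis by (intro real_le_rsqrt) simp
 qed
 obtain r u where r: "strict_mono (r :: nat => nat)" "!!i. i < h ==> (%n. fst (e (r n) i)) ---> u i"
  using common_subsequence[of e D h "sqrt (L + 2)" h] eU ec bnd by blast
 define a where "a n = sqrt (L + inverse (real (Suc n)))" for n
 have a: "a ---> sqrt L"
  unfolding a_def[abs_def] by (rule tendsto_real_sqrt) (use tendsto_add[OF tendsto_const[of L] LIMSEQ_inverse_real_of_nat] in simp)
 have comb: "\<exists>G. ((\<Sum>i<h. c i *R u i), G) \<in> H10 UNIV & norm G <= sqrt L * sqrt (\<Sum>i<h. (c i)\<^sup>2)" for c
 proof (rule graph_weak_limit[OF subspace_imp_convex[OF H10_subspace] H10_closed])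
  show "(\<Sum>i<h. c i *R e (r n) i) \<in> H10 UNIV" for n by (intro subspace_sum subspace_scale H10_subspace eU)
  show "(%n. fst (\<Sum>i<h. c i *R e (r n) i)) ---> (\<Sum>i<h. c i *R u i)"
   unfolding fst_sum fst_scaleR using r(2) by (intro tendsto_sum tendsto_scaleR tendsto_const) simp
  show "norm (snd (\<Sum>i<h. c i *R e (r n) i)) <= (a \<circ> r) n * sqrt (\<Sum>i<h. (c i)\<^sup>2)" for n
  proof -
   have "(norm (snd (\<Sum>i<h. c i *R e (r n) i)))^2 <= ?ev (Om (r n)) * (\<Sum>i<h. (c i)\<^sup>2)" by (rule e(3))
   also have "\<dots> <= (L + inverse (real (Suc (r n)))) * (\<Sum>i<h. (c i)\<^sup>2)" using Om(3)[of "r n"] by (intro mult_right_mono sum_nonneg) auto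
   finally show ?thesis unfolding o_def a_def real_sqrt_mult[symmetric] by (rule real_le_rsqrt)
  qed
  show "(%n. (a \<circ> r) n * sqrt (\<Sum>i<h. (c i)\<^sup>2)) ---> sqrt L * sqrt (\<Sum>i<h. (c i)\<^sup>2)"
   by (intro tendsto_mult tendsto_const LIMSEQ_subseq_LIMSEQ[OF a r(1)])
 qed
 have "\<exists>G. (u i, G) \<in> H10 UNIV" if "i < h" for i
  using comb[of "%j. if j = i then 1 else 0"] that by (auto simp: if_distrib[of "%x. x *R _"] cong: if_cong)
 then obtain G where G: "!!i. i < h ==> (u i, G i) \<in> H10 UNIV" by metis
 have "\<exists>S. (\<forall>x\<in>S. \<forall>y\<in>S. dist x y <= D) & (\<forall>i<h. u i \<in> vanish (- S))"
  by (rule limit_support_diameter[of D "%n. Om (r n)" "%n i. fst (e (r n) i)"]) (fact Om(1) ev r(2))+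
 then obtain S where S: "!!x y. x \<in> S ==> y \<in> S ==> dist x y <= D" "!!i. i < h ==> u i \<in> vanish (- S)" by auto
 obtain K where K: "S \<subseteq> K" "constant_width_body K D" "!!x y. x \<in> K ==> y \<in> K ==> dist x y <= D"
  by (rule constant_width_superset[OF D, where S = S]) (erule S(1), assumption, rule that)
 have adm: "admissible D (interior K)" by (rule constant_width_interior_admissible[OF K(2,3)])
 have uo: "u i \<bullet> u j = (if i = j then 1 else 0)" if "i < h" "j < h" for i j
 proof (rule LIMSEQ_unique)
  show "(%n. fst (e (r n) i) \<bullet> fst (e (r n) j)) ---> u i \<bullet> u j" using r(2) that by (intro tendsto_intros)
  show "(%n. fst (e (r n) i) \<bullet> fst (e (r n) j)) ---> (if i = j then 1 else 0)" by (simp add: e(2))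
 qed
 have un: "(norm (\<Sum>i<h. c i *R u i))^2 = (\<Sum>i<h. (c i)\<^sup>2)" for c
  unfolding power2_norm_eq_inner inner_sum_left inner_sum_right
  by (simp add: uo power2_eq_square if_distrib[of "%x. _ * x"] cong: if_cong)
 define v where "v i = (if i < h then (u i, G i) else 0)" for i
 have vs: "(\<Sum>i<h. c i *R v i) = ((\<Sum>i<h. c i *R u i), (\<Sum>i<h. c i *R G i))" for c
  by (intro prod_eqI) (simp_all add: v_def fst_sum snd_sum)
 have "?ev (interior K) <= L"
 proof (rule eigenvalue_upper[OF admissible_dom[OF adm] h, of v])
  show vi: "v i \<in> H10 (interior K)" if "i < h" for i
  proof -
   have "u i \<in> vanish (- K)" using vanish_mono[of "- K" "- S"] S(2)[OF that] K(1) by auto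
   then show ?thesis using H10_convex[of K "u i" "G i"] K(2) G that by (simp add: v_def constant_width_body_def)
  qed
  show "\<forall>i<h. c i = 0" if "fst (\<Sum>i<h. c i *R v i) = 0" for c
   using un[of c] that unfolding vs by (simp add: sum_nonneg_eq_0_iff)
  show "(norm (snd (\<Sum>i<h. c i *R v i)))^2 <= L * (norm (fst (\<Sum>i<h. c i *R v i)))^2" for c
  proof -
   obtain G' where G': "((\<Sum>i<h. c i *R u i), G') \<in> H10 UNIV" "norm G' <= sqrt L * sqrt (\<Sum>i<h. (c i)\<^sup>2)" using comb[of c] by blast
   have "(\<Sum>i<h. c i *R v i) \<in> H10 UNIV" using G by (intro subspace_sum subspace_scale H10_subspace) (simp add: v_def)
   then have "(\<Sum>i<h. c i *R G i) = G'" unfolding vs by (rule gradient_unique'[OF _ G'(1)])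
   then have "(norm (snd (\<Sum>i<h. c i *R v i)))^2 <= (sqrt L * sqrt (\<Sum>i<h. (c i)\<^sup>2))^2"
    unfolding vs using G'(2) by (simp add: power_mono)
   also have "\<dots> = L * (\<Sum>i<h. (c i)\<^sup>2)" using L0 by (simp add: power_mult_distrib sum_nonneg)
   finally show ?thesis unfolding vs by (simp add: un)
  qed
 qed
 then show ?thesis using adm low unfolding minimizer_iff by (intro exI[of _ "interior K"]) (auto intro: order_trans)
qed

section \<open>Every minimizer fills a body of constant width\<close>

lemma eigenpair_helmholtz:
 assumes Q: "dom Q" and p: "eigenpair Q t p" and t: "0 <= t"
 shows "helmholtz_on Q (sqrt t) (fst p)"
proof -
 obtain U G where UG: "p = (U, G)" by (cases p)
 have H: "(U, G) \<in> H10 UNIV" using p H10_mono[of Q UNIV] by (auto simp: eigenpair_def UG)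
 obtain B where B: "Q \<subseteq> cball 0 B" using Q by (metis bounded_subset_ballD ball_subset_cball subset_trans)
 have "U \<in> vanish (- cball 0 B)"
  using vanish_mono[of "- cball 0 B" "- Q" U] H10_vanish(1)[of Q p] Q p B by (auto simp: eigenpair_def UG)
 moreover have "U \<bullet> toL2 (lap phi) = - ((sqrt t)^2 * (U \<bullet> toL2 phi))" if "phi \<in> test Q" for phi
 proof -
  have "G \<bullet> toL2 (grad phi) = t * (U \<bullet> toL2 phi)" using p gp_H10[OF that] by (fastforce simp: eigenpair_def UG)
  then show ?thesis using weak_laplacian[OF H that] t by simp
 qed
 ultimately show ?thesis using H by (auto simp: helmholtz_on_def UG)
qed

lemma eigenpair_nonzero_AE:
 assumes Q: "dom Q" "connected Q" and p: "eigenpair Q t p" "fst p ~= 0" and t: "0 <= t"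
 shows "AEL x. x \<in> Q --> L2f (fst p) x ~= 0"
proof -
 have "fst p \<in> vanish (- Q)" using H10_vanish(1)[of Q p] Q p by (simp add: eigenpair_def)
 then have v: "AEL x. x ~: Q --> L2f (fst p) x = 0" by (simp add: vanish_def)
 have "~ (AEL x. x \<in> Q --> L2f (fst p) x = 0)"
 proof
  assume "AEL x. x \<in> Q --> L2f (fst p) x = 0"
  with v have "AEL x. L2f (fst p) x = 0" by eventually_elim auto
  then have "fst p = 0" unfolding L2_eq_iff using L2f_zero by eventually_elim simp
  then show False using p(2) by simp
 qed
 then show ?thesis using unique_continuation[OF eigenpair_helmholtz[OF Q(1) p(1) t] _ _ Q(2)] Q(1) t by auto
qed

text \<open>\<open>Q\<close> has no larger eigenvalue than \<open>Om\<close>, nor a smaller one by minimality.  So some eigenfunction of \<open>Q\<close> vanishes outside \<open>Om\<close>, but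
 it is nonzero almost everywhere in \<open>Q\<close>.\<close>

lemma minimizer_fills:
 fixes Om :: "'a::euclidean_space set"
 assumes h: "1 <= h" and m: "minimizer D h Om" and Q: "admissible D Q" "connected Q" "Om \<subseteq> Q"
 shows "AEL x. x \<in> Q --> x \<in> Om"
proof -
 have a: "admissible D Om" and le: "evD h Om <= evD h Q" using m Q by (simp_all add: minimizer_iff)
 obtain p where p: "p \<in> H10 Om" "fst p ~= 0" "eigenpair Q (evD h Q) p"
  by (rule eigenvalue_equal_eigenpair[OF admissible_dom[OF a] admissible_dom[OF Q(1)] Q(3) h le]) (rule that)
 have "AEL x. x \<in> Q --> L2f (fst p) x ~= 0"
  by (rule eigenpair_nonzero_AE[OF admissible_dom[OF Q(1)] Q(2) p(3,2) eigenvalue_nonneg[OF admissible_dom[OF Q(1)] h]])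
 moreover have "AEL x. x ~: Om --> L2f (fst p) x = 0"
  using H10_vanish(1)[OF _ p(1)] a by (simp add: vanish_def admissible_def)
 ultimately show ?thesis by eventually_elim auto
qed

lemma AE_subset_closure:
 assumes "AEL x. x \<in> Q --> x \<in> Om" "open Q"
 shows "Q \<subseteq> closure Om"
proof -
 have "Q - closure Om = {}"
 proof (rule open_AE_empty)
  show "open (Q - closure Om)" using assms(2) by (intro open_Diff) auto
  show "AEL x. x ~: Q - closure Om" using assms(1) by eventually_elim (use closure_subset[of Om] in auto)
 qed
 then show ?thesis by auto
qed

text \<open>The interior of a completion \<open>K\<close> of \<open>Om\<close> is an admissible connected set containing \<open>Om\<close>, so \<open>Om\<close> fills it and \<open>K\<close> is the closure of \<open>Om\<close>.\<close>

theorem minimizer_structure: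
 fixes Om :: "'a::euclidean_space set"
 assumes D: "0 < D" and h: "1 <= h" and m: "minimizer D h Om"
 shows "Om \<subseteq> interior (closure Om) & constant_width_body (closure Om) D &
  (AEL x. x \<in> interior (closure Om) --> x \<in> Om) & minimizer D h (interior (closure Om))"
proof -
 have a: "admissible D Om" using m by (simp add: minimizer_iff)
 obtain K where K: "Om \<subseteq> K" "constant_width_body K D" "!!x y. x \<in> K ==> y \<in> K ==> dist x y <= D"
  by (rule constant_width_superset[OF D, where S = Om]) (erule admissible_dist[OF a], assumption, rule that)
 have adm: "admissible D (interior K)" by (rule constant_width_interior_admissible[OF K(2,3)])
 have cv: "convex K" "compact K" "interior K ~= {}" using K(2) by (auto simp: constant_width_body_def)
 have sub: "Om \<subseteq> interior K" using K(1) a by (intro interior_maximal) (auto simp: admissible_def)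
 have ae: "AEL x. x \<in> interior K --> x \<in> Om"
  by (rule minimizer_fills[OF h m adm _ sub]) (intro convex_connected convex_interior cv)
 have "closure (interior K) \<subseteq> closure Om" using AE_subset_closure[OF ae] by (intro closure_minimal) auto
 then have "K \<subseteq> closure Om" using convex_closure_interior[OF cv(1,3)] cv(2) by (simp add: compact_imp_closed closure_closed)
 moreover have "closure Om \<subseteq> K" using K(1) cv(2) by (intro closure_minimal compact_imp_closed)
 ultimately have "closure Om = K" by blast
 then show ?thesis using sub K(2) ae minimizer_superset[OF m h adm sub] by simp
qed

section \<open>Absolute values\<close>

lemma norm_toL2_mono:
 assumes "sqint f" "sqint g" "!!x. norm (f x) <= norm (g x)"
 shows "norm (toL2 f) <= norm (toL2 g)"
proof (rule power2_le_imp_le)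
 show "(norm (toL2 f))^2 <= (norm (toL2 g))^2"
  unfolding norm_toL2[OF assms(1)] norm_toL2[OF assms(2)]
  using assms by (intro integral_mono) (auto simp: sqint_def power_mono)
qed simp

lemma H10_eqI: "p \<in> H10 Om ==> q \<in> H10 Om' ==> fst p = fst q ==> p = q"
 using gradient_unique'[of "fst p" "snd p" Om "snd q" Om'] by (cases p; cases q) auto

text \<open>A smooth even approximation of \<open>\<bar>x\<bar>\<close> that is flat near 0 and has slope at most 1.\<close>

definition soft :: "real => real => real" where
 "soft eps s = (s - eps) * flat 1 ((s - eps) / eps)"

definition soft_abs :: "real => real => real" where
 "soft_abs eps x = soft eps x + soft eps (- x)"

lemma soft_zero: "eps > 0 ==> s <= eps ==> soft eps s = 0"
 by (simp add: soft_def flat_def divide_le_0_iff not_less zero_less_divide_iff)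

lemma soft_close:
 assumes "eps > 0" "s >= 0"
 shows "\<bar>soft eps s - s\<bar> <= 2 * eps"
proof (cases "s <= eps")
 case False
 define y where "y = (s - eps) / eps"
 have y: "y > 0" "s = eps * (y + 1)" using False assms by (simp_all add: y_def field_simps)
 have e: "exp (- 1 / y) <= 1" "1 - 1 / y <= exp (- 1 / y)" using y(1) exp_ge_add_one_self[of "- 1 / y"] by auto
 have "soft eps s = eps * y * exp (- 1 / y)" using y assms by (simp add: soft_def flat_def y_def[symmetric] algebra_simps)
 then have "s - soft eps s = eps * (1 + y * (1 - exp (- 1 / y)))" using y(2) by (simp add: algebra_simps)
 moreover have "y * (1 - exp (- 1 / y)) <= y * (1 / y)" using y(1) e(2) by (intro mult_left_mono) linarith+
 moreover have "0 <= y * (1 - exp (- 1 / y))" using y(1) e(1) by simp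
 ultimately have "s - soft eps s <= eps * 2" "0 <= s - soft eps s" using assms(1) y(1) by (auto intro!: mult_left_mono)
 then show ?thesis by simp
qed (use assms soft_zero in auto)

lemma soft_derivative:
 assumes "eps > 0"
 shows "\<exists>d. (soft eps has_field_derivative d) (at s) & 0 <= d & d <= 1 & (s <= eps --> d = 0)"
proof -
 define y where "y = (s - eps) / eps"
 have "((%s. (s - eps) / eps) has_field_derivative 1 / eps) (at s)" using assms by (auto intro!: derivative_eq_intros)
 from DERIV_chain2[OF flat_deriv[of 1] this]
 have "((%s. flat 1 ((s - eps) / eps)) has_field_derivative flat [:0, 0, 1:] y * (1 / eps)) (at s)"
  by (simp add: y_def)
 from DERIV_mult[OF DERIV_diff[OF DERIV_ident DERIV_const[of eps]] this]
 have "(soft eps has_field_derivative flat 1 y + y * flat [:0, 0, 1:] y) (at s)"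
  by (simp add: soft_def[abs_def] y_def[symmetric]) (simp add: y_def mult_ac)
 moreover have "0 <= flat 1 y + y * flat [:0, 0, 1:] y & flat 1 y + y * flat [:0, 0, 1:] y <= 1"
 proof (cases "y > 0")
  case True
  have "exp (- 1 / y) * (1 + 1 / y) <= exp (- 1 / y) * exp (1 / y)" by (intro mult_left_mono exp_ge_add_one_self) simp
  also have "\<dots> = 1" by (simp flip: exp_add)
  finally have "exp (- 1 / y) * (1 + 1 / y) <= 1" .
  moreover have "flat 1 y + y * flat [:0, 0, 1:] y = exp (- 1 / y) * (1 + 1 / y)"
   using True by (simp add: flat_def field_simps)
  ultimately show ?thesis using True by simp
 qed (simp add: flat_def)
 moreover have "s <= eps --> flat 1 y + y * flat [:0, 0, 1:] y = 0"
  using assms by (auto simp: flat_def y_def zero_less_divide_iff)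
 ultimately show ?thesis by blast
qed

lemma soft_abs_close: "eps > 0 ==> \<bar>soft_abs eps x - \<bar>x\<bar>\<bar> <= 2 * eps"
 using soft_close[of eps x] soft_close[of eps "- x"] soft_zero[of eps x] soft_zero[of eps "- x"]
 by (cases "x >= 0") (auto simp: soft_abs_def)

lemma soft_abs_zero: "eps > 0 ==> \<bar>x\<bar> <= eps ==> soft_abs eps x = 0"
 by (simp add: soft_abs_def soft_zero)

lemma soft_abs_derivative:
 assumes "eps > 0"
 shows "\<exists>d. (soft_abs eps has_field_derivative d) (at x) & \<bar>d\<bar> <= 1"
proof -
 obtain d e where d: "(soft eps has_field_derivative d) (at x)" "0 <= d" "d <= 1"
  and e: "(soft eps has_field_derivative e) (at (- x))" "0 <= e" "e <= 1"
  using soft_derivative[OF assms] by metis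
 have "((%x. soft eps (- x)) has_field_derivative e * - 1) (at x)"
  by (rule DERIV_chain2[of "soft eps" e uminus x "- 1"]) (use e(1) in \<open>auto intro!: derivative_eq_intros\<close>)
 from DERIV_add[OF d(1) this] show ?thesis
  unfolding soft_abs_def[abs_def] using d e by (intro exI[of _ "d + e * - 1"]) auto
qed

lemma smooth_soft_abs: "Ck k (soft_abs eps)"
proof -
 have L: "Ck k (%s. f (c + a * s))" if "Ck k f" for f :: "real => real" and c a
  using Ck_affine[OF bounded_linear_mult_right that] .
 have 1: "Ck k (soft eps)"
  using Ck_mult[OF Ck_diff[OF Ck_linear[OF bounded_linear_ident] Ck_const[of k eps]] L[OF smooth_flat[of k 1], of "- 1" "1 / eps"]]
  by (cases "eps = 0") (simp_all add: soft_def[abs_def] diff_divide_distrib flat_def)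
 show ?thesis unfolding soft_abs_def[abs_def] using Ck_add[OF 1 L[OF 1, of 0 "- 1"]] by simp
qed

text \<open>The factor \<open>s\<close> is a sign that changes only across \<open>Z\<close>, where the functions vanish; so
 \<open>s * soft_abs eps phi\<close> is again a test function, and passing to it does not increase the energy.\<close>

lemma signed_soft_test:
 fixes s :: "'a::euclidean_space => real"
 assumes phi: "phi \<in> test Om" and eps: "eps > 0" and s: "!!x. \<bar>s x\<bar> = 1"
  and loc: "!!x. x ~: Z ==> \<exists>U. open U & x \<in> U & (\<forall>y\<in>U. s y = s x)" and Z: "!!x. x \<in> Z ==> phi x = 0"
 shows "(%x. s x * soft_abs eps (phi x)) \<in> test Om"
  and "norm (grad (%x. s x * soft_abs eps (phi x)) x) <= norm (grad phi x)"
proof -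
 let ?f = "%x. s x * soft_abs eps (phi x)"
 have germ: "\<exists>U c. open U & x \<in> U & \<bar>c\<bar> = 1 & (\<forall>y\<in>U. ?f y = c * soft_abs eps (phi y))" for x
 proof (cases "x \<in> Z")
  case True
  have "open {y. \<bar>phi y\<bar> < eps}" by (intro open_Collect_less continuous_intros test_cont[OF phi])
  then show ?thesis using Z[OF True] eps s
   by (intro exI[of _ "{y. \<bar>phi y\<bar> < eps}"] exI[of _ 1]) (auto simp: soft_abs_zero)
 next
  case False
  then show ?thesis using loc[OF False] s by metis
 qed
 have sm: "Ck k (%y. c * soft_abs eps (phi y))" for k c
  by (intro Ck_scale Ck_compose[OF smooth_soft_abs] test_smooth[OF phi])
 obtain S where S: "compact S" "S \<subseteq> Om" "!!x. x ~: S ==> phi x = 0" using test_E[OF phi] by metis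
 show "?f \<in> test Om"
 proof (rule test_I[OF _ S(1,2)])
  show "smooth ?f" using germ sm by (intro allI Ck_local) metis
  show "?f x = 0" if "x ~: S" for x using S(3)[OF that] eps by (simp add: soft_abs_zero)
 qed
 show "norm (grad ?f x) <= norm (grad phi x)"
 proof -
  obtain U c where U: "open U" "x \<in> U" "\<bar>c\<bar> = 1" "!!y. y \<in> U ==> ?f y = c * soft_abs eps (phi y)" using germ by metis
  obtain d where d: "(soft_abs eps has_field_derivative d) (at (phi x))" "\<bar>d\<bar> <= 1" using soft_abs_derivative[OF eps] by blast
  have "((%y. c * soft_abs eps (phi y)) has_derivative (%v. c * (d * (grad phi x \<bullet> v)))) (at x)"
   using has_derivative_mult_right[OF has_derivative_compose[OF test_has_grad[OF phi] d(1)[unfolded has_field_derivative_def]], of c] .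
  then have "(?f has_derivative (%v. c * (d * (grad phi x \<bullet> v)))) (at x)"
   by (rule has_derivative_transform_within_open[OF _ U(1,2)]) (simp add: U(4))
  then have "grad ?f x = (c * d) *R grad phi x" by (intro grad_eqI) (simp add: mult.assoc)
  then show ?thesis using U(3) d(2) by (simp add: abs_mult mult_left_le_one_le)
 qed
qed

text \<open>The test functions \<open>s * soft_abs eps (phi n)\<close> converge in \<open>L\<^sup>2\<close> with energy at most that of \<open>phi n\<close>; apply \<open>graph_weak_limit\<close>.\<close>

lemma signed_abs_H10:
 fixes s :: "'a::euclidean_space => real"
 assumes phi: "!!n::nat. phi n \<in> test Om" and lim: "(%n. gp (phi n)) ---> (V, F)"
  and s: "!!x. \<bar>s x\<bar> = 1" and sm: "s \<in> borel_measurable borel"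
  and loc: "!!x. x ~: Z ==> \<exists>U. open U & x \<in> U & (\<forall>y\<in>U. s y = s x)" and Z: "!!n x. x \<in> Z ==> phi n x = 0"
 shows "\<exists>F'. (toL2 (%x. s x * \<bar>L2f V x\<bar>), F') \<in> H10 Om & norm F' <= norm F"
proof -
 note [measurable] = sm test_meas[OF phi]
 have sq: "sqint (%x. s x * \<bar>g x\<bar>)" if "sqint g" for g :: "'a => real"
  using that sqint_meas[OF that] by (intro sqint_bound[OF that]) (auto simp: abs_mult s)
 have "\<exists>eps>0. norm (toL2 (%x. s x * soft_abs eps (phi n x)) - toL2 (%x. s x * \<bar>phi n x\<bar>)) <= inverse (real (Suc n))" for n
 proof -
  obtain S where S: "compact S" "!!x. x ~: S ==> phi n x = 0" using test_E[OF phi] by metis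
  define I where "I = (%x. indicator S x :: real)"
  have "integrable lborel I" unfolding I_def using S(1) emeasure_compact_finite[OF S(1)]
   by (intro integrable_real_indicator) (auto simp: borel_compact)
  moreover have "(%x. (norm (I x))\<^sup>2) = I" by (auto simp: I_def indicator_def)
  ultimately have I: "sqint I" by (simp add: sqint_def)
  define eps where "eps = inverse (real (Suc n)) / (2 * (1 + norm (toL2 I)))"
  have p: "1 + norm (toL2 I) > 0" by (simp add: add_pos_nonneg)
  have eps: "eps > 0" using p by (simp add: eps_def)
  let ?a = "%x. s x * soft_abs eps (phi n x)" and ?b = "%x. s x * \<bar>phi n x\<bar>"
  have a: "sqint ?a" by (rule test_sqint[OF signed_soft_test(1)[OF phi eps s loc Z]])
  note b = sq[OF test_sqint[OF phi[of n]]]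
  have "norm (toL2 ?a - toL2 ?b) = norm (toL2 (%x. ?a x - ?b x))" by (simp only: toL2_diff[OF a b])
  also have "\<dots> <= norm (toL2 (%x. (2 * eps) *R I x))"
  proof (rule norm_toL2_mono[OF sqint_diff[OF a b] sqint_scale[OF I]])
   fix x
   have "\<bar>?a x - ?b x\<bar> = \<bar>s x\<bar> * \<bar>soft_abs eps (phi n x) - \<bar>phi n x\<bar>\<bar>" by (simp flip: abs_mult add: right_diff_distrib)
   then show "norm (?a x - ?b x) <= norm ((2 * eps) *R I x)"
    using soft_abs_close[OF eps, of "phi n x"] S(2)[of x] eps by (auto simp: s I_def indicator_def soft_abs_zero)
  qed
  also have "\<dots> = 2 * eps * norm (toL2 I)" using toL2_scale[OF I, of "2 * eps"] eps by (metis abs_of_pos mult_pos_pos norm_scaleR zero_less_numeral)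
  also have "\<dots> <= 2 * eps * (1 + norm (toL2 I))" using eps by (intro mult_left_mono) auto
  also have "\<dots> = inverse (real (Suc n))"
  proof -
   have "2 * (a / (2 * y)) * y = a" if "y > 0" for a y :: real using that by simp
   then show ?thesis using p unfolding eps_def by blast
  qed
  finally show ?thesis using eps by blast
 qed
 then obtain eps where eps: "!!n. eps n > 0"
  "!!n. norm (toL2 (%x. s x * soft_abs (eps n) (phi n x)) - toL2 (%x. s x * \<bar>phi n x\<bar>)) <= inverse (real (Suc n))" by metis
 define psi where "psi n x = s x * soft_abs (eps n) (phi n x)" for n x
 have psi: "psi n \<in> test Om" "norm (grad (psi n) x) <= norm (grad (phi n) x)" for n x
  unfolding psi_def[abs_def] by (rule signed_soft_test[OF phi eps(1) s loc Z]; assumption)+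
 define B where "B g = toL2 (%x. s x * \<bar>g x\<bar>)" for g
 have "norm (toL2 (psi n) - B (L2f V)) <= inverse (real (Suc n)) + norm (toL2 (phi n) - V)" for n
 proof -
  have "norm (B (phi n) - B (L2f V)) <= norm (toL2 (%x. phi n x - L2f V x))"
   unfolding B_def toL2_diff[OF sq[OF test_sqint[OF phi]] sq[OF sqint_L2f]]
  proof (rule norm_toL2_mono)
   fix x
   have "\<bar>s x * \<bar>phi n x\<bar> - s x * \<bar>L2f V x\<bar>\<bar> = \<bar>s x\<bar> * \<bar>\<bar>phi n x\<bar> - \<bar>L2f V x\<bar>\<bar>" by (simp flip: abs_mult add: right_diff_distrib)
   then show "norm (s x * \<bar>phi n x\<bar> - s x * \<bar>L2f V x\<bar>) <= norm (phi n x - L2f V x)" using abs_triangle_ineq3[of "phi n x" "L2f V x"] by (simp add: s)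
  qed (intro sqint_diff sq test_sqint[OF phi] sqint_L2f)+
  also have "toL2 (%x. phi n x - L2f V x) = toL2 (phi n) - V"
   using toL2_diff[OF test_sqint[OF phi] sqint_L2f, of n V] by simp
  finally have "norm (B (phi n) - B (L2f V)) <= norm (toL2 (phi n) - V)" .
  moreover have "norm (toL2 (psi n) - B (phi n)) <= inverse (real (Suc n))" using eps(2)[of n] by (simp add: B_def psi_def[abs_def])
  ultimately show ?thesis using norm_triangle_ineq[of "toL2 (psi n) - B (phi n)" "B (phi n) - B (L2f V)"] by simp
 qed
 note bd = this
 have l1: "(%n. toL2 (phi n)) ---> V" "(%n. toL2 (grad (phi n))) ---> F" using tendsto_fst[OF lim] tendsto_snd[OF lim] by simp_all
 have l2: "(%n. inverse (real (Suc n)) + norm (toL2 (phi n) - V)) ---> 0"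
  using tendsto_add[OF LIMSEQ_inverse_real_of_nat tendsto_norm[OF tendsto_diff[OF l1(1) tendsto_const[of V]]]] by simp
 have "(%n. toL2 (psi n)) ---> B (L2f V)"
  by (rule LIM_zero_cancel, rule Lim_null_comparison[OF always_eventually[OF allI[OF bd]] l2])
 moreover have "norm (toL2 (grad (psi n))) <= norm (toL2 (grad (phi n)))" for n
  by (rule norm_toL2_mono[OF grad_sqint[OF psi(1)] grad_sqint[OF phi] psi(2)])
 ultimately show ?thesis
  using graph_weak_limit[OF subspace_imp_convex[OF H10_subspace] H10_closed, of "%n. gp (psi n)" Om "B (L2f V)" "%n. norm (toL2 (grad (phi n)))" "norm F"]
   gp_H10[OF psi(1)] tendsto_norm[OF l1(2)] by (simp add: B_def)
qed

lemma abs_H10: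
 fixes V :: "('a::euclidean_space, real) L2"
 assumes "(V, F) \<in> H10 Om"
 shows "\<exists>F'. (toL2 (%x. \<bar>L2f V x\<bar>), F') \<in> H10 Om & norm F' <= norm F"
proof -
 obtain phi where "!!n. phi n \<in> test Om" "(%n::nat. gp (phi n)) ---> (V, F)" by (rule H10_approx[OF assms]) (rule that)
 then show ?thesis using signed_abs_H10[of phi Om V F "%_. 1" "{}"] by auto
qed

lemma sqint_abs: "sqint f ==> sqint (%x. \<bar>f x :: real\<bar>)"
 using sqint_meas[of f] by (rule_tac sqint_bound[of f]) auto

lemma norm_abs_L2: "norm (toL2 (%x. \<bar>L2f V x :: real\<bar>)) = norm V"
proof -
 have "(norm (toL2 (%x. \<bar>L2f V x :: real\<bar>)))^2 = (norm V)^2"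
  using norm_toL2[OF sqint_abs[OF sqint_L2f[of V]]] norm_L2f[of V] by simp
 then show ?thesis by (rule power_eq_imp_eq_base) auto
qed

text \<open>The energy of \<open>\<bar>u\<bar>\<close> is at most that of \<open>u\<close>, so \<open>\<bar>u\<bar>\<close> minimizes the Rayleigh quotient as well; unique continuation gives positivity.\<close>

lemma abs_first_eigenpair:
 assumes B: "dom B" "connected B" and p: "p \<in> H10 Om" "eigenpair B (evD 1 B) p" "fst p ~= 0"
  and sub: "Om \<subseteq> B"
 shows "\<exists>q\<in>H10 Om. eigenpair B (evD 1 B) q & norm (fst q) = norm (fst p) &
   (AEL x. 0 <= L2f (fst q) x) & (AEL x. x \<in> B --> 0 < L2f (fst q) x)"
proof -
 let ?l = "evD 1 B"
 obtain F' where F: "(toL2 (%x. \<bar>L2f (fst p) x\<bar>), F') \<in> H10 Om" "norm F' <= norm (snd p)"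
  using abs_H10[of "fst p" "snd p" Om] p(1) by auto
 define q where "q = (toL2 (%x. \<bar>L2f (fst p) x\<bar>), F')"
 have q: "q \<in> H10 Om" "q \<in> H10 B" using F(1) H10_mono[OF sub] by (auto simp: q_def)
 have n: "norm (fst q) = norm (fst p)" by (simp add: q_def norm_abs_L2)
 have "(norm (snd q))^2 <= (norm (snd p))^2" using F(2) by (simp add: q_def power_mono)
 then have e: "eigenpair B ?l q" using eigenpair_energy[OF p(2)] n by (intro first_eigenpairI[OF B(1) q(2)]) simp
 have q0: "fst q ~= 0" using n p(3) by auto
 have nn: "AEL x. 0 <= L2f (fst q) x"
  using L2f_toL2[OF sqint_abs[OF sqint_L2f[of "fst p"]]] by (auto simp: q_def elim: eventually_mono)
 moreover have "AEL x. x \<in> B --> L2f (fst q) x ~= 0"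
  using eigenpair_nonzero_AE[OF B e q0] eigenvalue_nonneg[of B 1] B(1) by simp
 ultimately have "AEL x. x \<in> B --> 0 < L2f (fst q) x" by eventually_elim auto
 then show ?thesis using q(1) e n nn by blast
qed

lemma positive_first_eigenpair:
 assumes "dom Om" "connected Om"
 shows "\<exists>p. eigenpair Om (evD 1 Om) p & (AEL x. 0 <= L2f (fst p) x) &
  (AEL x. x \<in> Om --> 0 < L2f (fst p) x)"
proof -
 obtain p where p: "p \<in> H10 Om" "fst p ~= 0" "eigenpair Om (evD 1 Om) p"
  by (rule eigenvalue_equal_eigenpair[OF assms(1,1) order_refl order_refl order_refl]) (rule that)
 then show ?thesis using abs_first_eigenpair[OF assms p(1,3,2) order_refl] by blast
qed

subsection \<open>First eigenfunctions that agree on an overlap\<close>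

lemma inner_vanish:
 fixes U V :: "('a::euclidean_space, real) L2"
 assumes "AEL x. L2f U x * L2f V x = 0"
 shows "U \<bullet> V = 0"
 unfolding inner_L2f by (rule integral_eq_zero_AE) (use assms in simp)

text \<open>On convex domains the function \<open>min u v\<close> is the restriction of \<open>u\<close> to the overlap.  Testing the
 equation of \<open>u\<close> with it shows that it is a first eigenfunction of both domains, so by unique continuation
 each domain is contained in the other.\<close>

lemma first_eigenpairs_overlap:
 fixes p q :: "('a::euclidean_space, real) L2 \<times> ('a, 'a) L2"
 assumes A: "dom A" "convex A" and B: "dom B" "convex B" and t: "evD 1 A = t" "evD 1 B = t"
  and p: "eigenpair A t p" "AEL x. 0 <= L2f (fst p) x" "AEL x. x \<in> A --> 0 < L2f (fst p) x"
  and q: "eigenpair B t q" "AEL x. 0 <= L2f (fst q) x"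
  and ne: "A \<inter> B ~= {}" and eq: "AEL x. x \<in> A \<inter> B --> L2f (fst p) x = L2f (fst q) x"
 shows "fst p = fst q"
proof -
 define U W where "U = fst p" and "W = fst q"
 have pU: "p \<in> H10 UNIV" "q \<in> H10 UNIV" using p q H10_mono[of A UNIV] H10_mono[of B UNIV] by (auto simp: eigenpair_def)
 have vU: "AEL x. x ~: A --> L2f U x = 0" and vW: "AEL x. x ~: B --> L2f W x = 0"
  using H10_vanish(1)[of A p] H10_vanish(1)[of B q] A B p(1) q(1) by (auto simp: eigenpair_def vanish_def U_def W_def)
 have "p - q \<in> H10 UNIV" by (intro subspace_diff H10_subspace pU)
 then have "(U - W, snd p - snd q) \<in> H10 UNIV" by (cases p; cases q) (simp add: U_def W_def)
 then obtain E where E: "(toL2 (%x. \<bar>L2f (U - W) x\<bar>), E) \<in> H10 UNIV" using abs_H10 by blast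
 define m where "m = (1/2) *R (p + q - (toL2 (%x. \<bar>L2f (U - W) x\<bar>), E))"
 have mU: "m \<in> H10 UNIV" unfolding m_def by (intro subspace_scale subspace_diff subspace_add H10_subspace pU E)
 have min: "AEL x. L2f (fst m) x = min (L2f U x) (L2f W x)"
 proof -
  have f: "fst m = (1/2) *R (U + W - toL2 (%x. \<bar>L2f (U - W) x\<bar>))" by (simp add: m_def U_def W_def)
  have mh: "min a b = (1/2) * (a + b - \<bar>a - b\<bar>)" for a b :: real by (simp add: min_def abs_if)
  show ?thesis unfolding f
   using L2f_scale[of "1/2" "U + W - toL2 (%x. \<bar>L2f (U - W) x\<bar>)"] L2f_diff[of "U + W" "toL2 (%x. \<bar>L2f (U - W) x\<bar>)"]
    L2f_add[of U W] L2f_toL2[OF sqint_abs[OF sqint_L2f[of "U - W"]]] L2f_diff[of U W]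
   by eventually_elim (simp only: mh real_scaleR_def)
 qed
 have m: "AEL x. L2f (fst m) x = (if x \<in> A \<inter> B then L2f U x else 0)"
  using min vU vW p(2) q(2) eq unfolding U_def[symmetric] W_def[symmetric] by eventually_elim auto
 have cv: "convex (A \<inter> B)" "open (A \<inter> B)" "bounded (A \<inter> B)" using A B by (auto intro: convex_Int bounded_Int)
 have int: "interior (closure (A \<inter> B)) = A \<inter> B" by (rule trans[OF convex_interior_closure[OF cv(1)] interior_open[OF cv(2)]])
 have "fst m \<in> vanish (- closure (A \<inter> B))"
  unfolding vanish_def mem_Collect_eq using m by eventually_elim (use closure_subset[of "A \<inter> B"] in auto)
 then have mAB: "m \<in> H10 (A \<inter> B)"
  using H10_convex[of "closure (A \<inter> B)" "fst m" "snd m"] mU cv ne by (simp add: int convex_closure)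
 have "H10 (A \<inter> B) \<subseteq> {r. snd r \<bullet> snd (m - p) = 0}"
 proof (rule H10_subset)
  show "closed {r :: ('a, real) L2 \<times> ('a, 'a) L2. snd r \<bullet> snd (m - p) = 0}" by (intro closed_Collect_eq continuous_intros)
  fix phi assume phi: "phi \<in> test (A \<inter> B)"
  have "(fst (m - p), snd (m - p)) \<in> H10 UNIV" using subspace_diff[OF H10_subspace mU pU(1)] by (simp only: prod.collapse)
  from weak_laplacian[OF this phi] have "snd (m - p) \<bullet> toL2 (grad phi) = - (fst (m - p) \<bullet> toL2 (lap phi))" .
  also have "fst (m - p) \<bullet> toL2 (lap phi) = 0"
  proof (rule inner_vanish)
   show "AEL x. L2f (fst (m - p)) x * L2f (toL2 (lap phi)) x = 0"
    using m L2f_diff[of "fst m" U] L2f_toL2[OF test_sqint[OF test_lap[OF phi]]] unfolding fst_diff U_def[symmetric]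
    by eventually_elim (auto simp: test_off[OF test_lap[OF phi]])
  qed
  finally show "gp phi \<in> {r. snd r \<bullet> snd (m - p) = 0}" by (simp add: inner_commute)
 qed
 then have "snd m \<bullet> snd m = snd p \<bullet> snd m" using mAB by (auto simp: inner_diff_right inner_commute)
 also have "\<dots> = t * (U \<bullet> fst m)" using p(1) mAB H10_mono[of "A \<inter> B" A] by (auto simp: eigenpair_def U_def)
 also have "U \<bullet> fst m = fst m \<bullet> fst m"
 proof -
  have "(U - fst m) \<bullet> fst m = 0" using m L2f_diff[of U "fst m"] by (intro inner_vanish, eventually_elim) auto
  then show ?thesis by (simp add: inner_diff_left)
 qed
 finally have en: "(norm (snd m))^2 = t * (norm (fst m))^2" by (simp add: power2_norm_eq_inner)
 have m0: "fst m ~= 0"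
 proof
  assume "fst m = 0"
  then have "AEL x. L2f (fst m) x = 0" using L2f_zero by simp
  with m p(3) have "AEL x. x ~: A \<inter> B" unfolding U_def[symmetric] by eventually_elim auto
  then show False using open_AE_empty[OF cv(2)] ne by blast
 qed
 have fill: "AEL x. x \<in> C --> x \<in> A \<inter> B" if C: "dom C" "convex C" "evD 1 C = t" "A \<inter> B \<subseteq> C" for C
 proof -
  have "eigenpair C t m" using first_eigenpairI[OF C(1), of m] mAB H10_mono[OF C(4)] C(3) en by auto
  moreover have "0 <= t" using eigenvalue_nonneg[OF C(1), of 1] C(3) by simp
  ultimately have "AEL x. x \<in> C --> L2f (fst m) x ~= 0"
   using eigenpair_nonzero_AE[OF C(1) convex_connected[OF C(2)] _ m0] by blast
  with m show ?thesis by eventually_elim (auto split: if_splits)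
 qed
 have "AEL x. L2f U x = L2f W x"
  using fill[OF A t(1)] fill[OF B t(2)] vU vW eq unfolding U_def[symmetric] W_def[symmetric] by auto
 then show ?thesis by (simp add: L2_eq_iff U_def W_def)
qed

section \<open>Polarization\<close>

text \<open>The reflection in the hyperplane \<open>x \<bullet> b = c\<close> orthogonal to a coordinate direction.\<close>

definition flip :: "'a::euclidean_space => real => 'a => 'a" where
 "flip b c x = x + (2 * (c - x \<bullet> b)) *R b"

abbreviation flip_sign :: "'a::euclidean_space => 'a => real" where
 "flip_sign b j \<equiv> (if j = b then - 1 else 1)"

abbreviation mirror :: "'a::euclidean_space => real => ('a, real) L2 \<times> ('a, 'a) L2 => ('a, real) L2 \<times> ('a, 'a) L2" where
 "mirror b c \<equiv> motion (flip_sign b) ((2 * c) *R b)"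

context
 fixes b :: "'a::euclidean_space" and c :: real
 assumes b: "b \<in> Basis"
begin

lemma flip_dmap: "dmap (flip_sign b) ((2 * c) *R b) = flip b c"
proof (rule ext, rule euclidean_eqI)
 fix x j :: 'a assume "j \<in> Basis"
 then show "dmap (flip_sign b) ((2 * c) *R b) x \<bullet> j = flip b c x \<bullet> j"
  using b by (simp add: dmap_inner flip_def inner_add_left inner_Basis algebra_simps)
qed

lemma flip_inner: "flip b c x \<bullet> b = 2 * c - x \<bullet> b"
 using b by (simp add: flip_def inner_add_left inner_Basis)

lemma flip_flip: "flip b c (flip b c x) = x"
proof -
 have "2 * (c - flip b c x \<bullet> b) = - (2 * (c - x \<bullet> b))" using flip_inner[of x] by simp
 then have "flip b c (flip b c x) = flip b c x + (- (2 * (c - x \<bullet> b))) *R b" unfolding flip_def[of b c "flip b c x"] by (simp only:)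
 also have "\<dots> = x" unfolding flip_def[of b c x] by (simp flip: scaleR_left_distrib)
 finally show ?thesis .
qed

lemma flip_fixed: "x \<bullet> b = c ==> flip b c x = x"
 by (simp add: flip_def)

lemma dist_flip_square: "(dist x (flip b c y))^2 = (dist x y)^2 + 4 * (c - x \<bullet> b) * (c - y \<bullet> b)"
proof -
 have "b \<bullet> b = 1" using b by (simp add: inner_Basis)
 then show ?thesis unfolding dist_norm power2_norm_eq_inner flip_def
  by (simp add: inner_add_left inner_add_right inner_diff_left inner_diff_right inner_commute[of b x] inner_commute[of b y] algebra_simps)
qed

lemma dist_flip_flip: "dist (flip b c x) (flip b c y) = dist x y"
proof -
 have "c - flip b c x \<bullet> b = - (c - x \<bullet> b)" using flip_inner[of x] by simp
 then have 1: "(dist (flip b c x) (flip b c y))^2 = (dist (flip b c x) y)^2 + 4 * (- (c - x \<bullet> b)) * (c - y \<bullet> b)"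
  by (simp only: dist_flip_square)
 have 2: "(dist (flip b c x) y)^2 = (dist x y)^2 + 4 * (c - y \<bullet> b) * (c - x \<bullet> b)"
  using dist_flip_square[of y x] by (simp only: dist_commute[of y])
 have "(dist (flip b c x) (flip b c y))^2 = (dist x y)^2" unfolding 1 2 by (simp add: algebra_simps)
 then show ?thesis by (rule power_eq_imp_eq_base) auto
qed

lemma dist_le_dist_flip: "0 <= (c - x \<bullet> b) * (c - y \<bullet> b) ==> dist x y <= dist x (flip b c y)"
proof (rule power2_le_imp_le)
 assume "0 <= (c - x \<bullet> b) * (c - y \<bullet> b)"
 then show "(dist x y)^2 <= (dist x (flip b c y))^2"
  using dist_flip_square[of x y] mult.assoc[of 4 "c - x \<bullet> b" "c - y \<bullet> b"] by linarith
qed simp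

lemma AE_off_hyperplane: "AEL x. x \<bullet> b ~= c"
proof -
 have "negligible {x. b \<bullet> x = c}" using b by (intro negligible_hyperplane) auto
 moreover have "{x. b \<bullet> x = c} \<in> sets borel" by simp
 ultimately have "{x. b \<bullet> x = c} \<in> null_sets lborel" by (simp add: negligible_iff_emeasure0 null_sets_def)
 from AE_not_in[OF this] show ?thesis by eventually_elim (simp add: inner_commute)
qed

lemma flip_sign_nonzero: "flip_sign b j ~= 0"
 by auto

lemma AE_flip: "AEL x. P x ==> AEL x. P (flip b c x)"
 using AE_dmap[where c = "flip_sign b" and t = "(2 * c) *R b" and P = P] by (simp add: flip_dmap)

lemma integral_flip:
 fixes f :: "'a => real"
 shows "f \<in> borel_measurable borel ==> (LB x. f (flip b c x)) = (LB x. f x)"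
 using integral_dmap[of f "flip_sign b" "(2 * c) *R b"] motion_prod[of "flip_sign b"] by (simp add: flip_dmap)

lemma mirror_L2f: "AEL x. L2f (fst (mirror b c p)) x = L2f (fst p) (flip b c x)"
 unfolding motion_def pull_def fst_conv flip_dmap[symmetric]
 by (rule L2f_toL2[OF sqint_pull[OF flip_sign_nonzero linear_ident' sqint_L2f]])

lemma mirror_linear: "linear (mirror b c)"
 by (rule motion_linear) auto

lemma mirror_H10: "p \<in> H10 Om ==> mirror b c p \<in> H10 (flip b c -` Om)"
 using motion_H10[of "flip_sign b" p Om "(2 * c) *R b"] by (simp add: flip_dmap)

lemma mirror_UNIV: "p \<in> H10 UNIV ==> mirror b c p \<in> H10 UNIV"
 using mirror_H10[of p UNIV] by simp

lemma mirror_mirror: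
 assumes "p \<in> H10 UNIV"
 shows "mirror b c (mirror b c p) = p"
proof (rule H10_eqI[OF mirror_UNIV[OF mirror_UNIV[OF assms]] assms])
 show "fst (mirror b c (mirror b c p)) = fst p"
  unfolding L2_eq_iff using mirror_L2f[of "mirror b c p"] AE_flip[OF mirror_L2f[of p]]
  by eventually_elim (simp add: flip_flip)
qed

lemma mirror_snd_le: "norm (snd (mirror b c p)) <= norm (snd p)"
 by (rule motion_snd_le) auto

lemma mirror_tendsto:
 assumes "X ---> p"
 shows "(%n. mirror b c (X n)) ---> mirror b c p"
 unfolding motion_def
 by (rule tendsto_Pair[OF bounded_linear.tendsto[OF pull_bounded_linear tendsto_fst[OF assms]]
    bounded_linear.tendsto[OF pull_bounded_linear tendsto_snd[OF assms]]])
   (auto simp: linear_ident' dmap_linear)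

lemma mirror_orthogonal:
 assumes "p \<in> H10 UNIV" "q \<in> H10 UNIV" "mirror b c p = p" "mirror b c q = - q"
 shows "fst p \<bullet> fst q = 0" "snd p \<bullet> snd q = 0"
proof -
 have "fst p \<bullet> fst q = fst p \<bullet> fst (- q)" using motion_inner[of "flip_sign b" "(2 * c) *R b" p q] assms(3,4) by simp
 then show "fst p \<bullet> fst q = 0" by simp
 have pm: "mirror b c (p + q) = p - q" "mirror b c (p - q) = p + q"
  using linear_add[OF mirror_linear, of p q] linear_diff[OF mirror_linear, of p q] assms(3,4) by simp_all
 have "norm (snd (p + q)) = norm (snd (p - q))"
  using mirror_snd_le[of "p + q"] mirror_snd_le[of "p - q"] unfolding pm by simp
 then have "(norm (snd p + snd q))^2 = (norm (snd p - snd q))^2" by simp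
 then show "snd p \<bullet> snd q = 0"
  unfolding power2_norm_eq_inner by (simp add: inner_add_left inner_add_right inner_diff_left inner_diff_right inner_commute)
qed

text \<open>The polarization of \<open>u\<close> moves the larger of the values at \<open>x\<close> and its mirror image to the side \<open>x \<bullet> b < c\<close>.
 It is half the sum of the even function \<open>u + u \<circ> \<sigma>\<close> and the odd function \<open>\<plusminus> \<bar>u - u \<circ> \<sigma>\<bar>\<close>; these are orthogonal, also in energy,
 and the second has the norm and at most the energy of \<open>u - u \<circ> \<sigma>\<close>.\<close>

lemma polarization:
 assumes p: "p \<in> H10 UNIV"
 shows "\<exists>w\<in>H10 UNIV. norm (fst w) = norm (fst p) & norm (snd w) <= norm (snd p) &
  (AEL x. L2f (fst w) x = (if x \<bullet> b < c then max (L2f (fst p) x) (L2f (fst p) (flip b c x))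
    else min (L2f (fst p) x) (L2f (fst p) (flip b c x))))"
proof -
 let ?R = "mirror b c"
 define s where "s x = (if x \<bullet> b < c then 1 else - 1 :: real)" for x
 have sm[measurable]: "s \<in> borel_measurable borel" unfolding s_def[abs_def] by measurable
 define S V where "S = p + ?R p" and "V = p - ?R p"
 have SV: "S \<in> H10 UNIV" "V \<in> H10 UNIV"
  unfolding S_def V_def using p mirror_UNIV[OF p] by (auto intro: subspace_add subspace_diff H10_subspace)
 have RS: "?R S = S" and RV: "?R V = - V" unfolding S_def V_def
  using linear_add[OF mirror_linear, of p "?R p"] linear_diff[OF mirror_linear, of p "?R p"] by (simp_all add: mirror_mirror[OF p] add.commute)
 obtain phi where phi: "!!n. phi n \<in> test UNIV" "(%n::nat. gp (phi n)) ---> p" by (rule H10_approx[OF p]) (rule that)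
 define psi where "psi n x = phi n x - phi n (flip b c x)" for n x
 have tf: "(%x. phi n (flip b c x)) \<in> test UNIV" for n
 proof -
  have inv: "dmap (flip_sign b) 0 (dmap (flip_sign b) 0 v) = v" for v :: 'a by (rule dmap_involution) auto
  have "(%x. phi n ((2 * c) *R b + dmap (flip_sign b) 0 x)) \<in> test UNIV"
   using test_affine(1)[OF phi(1) dmap_linear dmap_linear inv inv dmap_self_adjoint] by simp
  then show ?thesis by (simp only: dmap_shift[symmetric] flip_dmap)
 qed
 have psi: "psi n \<in> test UNIV" for n unfolding psi_def[abs_def] by (rule test_diff[OF phi(1) tf])
 have gppsi: "gp (psi n) = gp (phi n) - ?R (gp (phi n))" for n
 proof (rule H10_eqI[OF gp_H10[OF psi]])
  show "gp (phi n) - ?R (gp (phi n)) \<in> H10 UNIV" using gp_H10[OF phi(1)] mirror_UNIV by (intro subspace_diff H10_subspace) auto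
  have "pull (flip_sign b) ((2 * c) *R b) (%v. v) (toL2 (phi n)) = toL2 (%x. phi n (flip b c x))"
   using pull_toL2[OF flip_sign_nonzero linear_ident' test_sqint[OF phi(1)]] by (simp add: flip_dmap)
  then show "fst (gp (psi n)) = fst (gp (phi n) - ?R (gp (phi n)))"
   using toL2_diff[OF test_sqint[OF phi(1)] test_sqint[OF tf], of n n] by (simp add: motion_def psi_def[abs_def])
 qed
 have "(%n. gp (psi n)) ---> V" unfolding gppsi V_def by (intro tendsto_diff mirror_tendsto phi(2))
 then have lim: "(%n. gp (psi n)) ---> (fst V, snd V)" by simp
 have "\<exists>F'. (toL2 (%x. s x * \<bar>L2f (fst V) x\<bar>), F') \<in> H10 UNIV & norm F' <= norm (snd V)"
 proof (rule signed_abs_H10[OF psi lim, where Z = "{x. x \<bullet> b = c}"])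
  show "s \<in> borel_measurable borel" by (rule sm)
  show "psi n x = 0" if "x \<in> {x. x \<bullet> b = c}" for n x using that by (simp add: psi_def flip_fixed)
  fix x assume x: "x ~: {x. x \<bullet> b = c}"
  show "\<exists>U. open U & x \<in> U & (\<forall>y\<in>U. s y = s x)"
  proof (cases "x \<bullet> b < c")
   case True
   have "open {y. y \<bullet> b < c}" by (intro open_Collect_less continuous_intros)
   then show ?thesis using True by (intro exI[of _ "{y. y \<bullet> b < c}"]) (simp add: s_def)
  next
   case False
   have "open {y. c < y \<bullet> b}" by (intro open_Collect_less continuous_intros)
   then show ?thesis using False x by (intro exI[of _ "{y. c < y \<bullet> b}"]) (auto simp: s_def)
  qed
 qed (simp add: s_def)
 then obtain F' where F': "(toL2 (%x. s x * \<bar>L2f (fst V) x\<bar>), F') \<in> H10 UNIV" "norm F' <= norm (snd V)" by blast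
 have sq: "sqint (%x. s x * \<bar>L2f (fst V) x\<bar>)"
  by (rule sqint_bound[OF sqint_L2f[of "fst V"]]) (measurable, simp add: s_def)
 define Y where "Y = (toL2 (%x. s x * \<bar>L2f (fst V) x\<bar>), F')"
 have Y: "Y \<in> H10 UNIV" using F'(1) by (simp add: Y_def)
 have LY: "AEL x. L2f (fst Y) x = s x * \<bar>L2f (fst V) x\<bar>" unfolding Y_def fst_conv by (rule L2f_toL2[OF sq])
 have nY: "norm (fst Y) = norm (fst V)"
 proof -
  have "(norm (s x * \<bar>v\<bar>))^2 = (norm v)^2" for x and v :: real by (simp add: s_def)
  then have "(norm (fst Y))^2 = (norm (fst V))^2"
   unfolding Y_def fst_conv norm_toL2[OF sq] norm_L2f[of "fst V"] by (simp only:)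
  then show ?thesis by (rule power_eq_imp_eq_base) auto
 qed
 have LV: "AEL x. L2f (fst V) (flip b c x) = - L2f (fst V) x"
 proof -
  have "AEL x. L2f (fst (?R V)) x = - L2f (fst V) x"
   unfolding RV using L2f_scale[of "- 1" "fst V"] by simp
  with mirror_L2f[of V] show ?thesis by eventually_elim simp
 qed
 have RY: "?R Y = - Y"
 proof (rule H10_eqI[OF mirror_UNIV[OF Y]])
  show "- Y \<in> H10 UNIV" using subspace_neg[OF H10_subspace Y] .
  have "AEL x. L2f (fst (- Y)) x = - L2f (fst Y) x" using L2f_scale[of "- 1" "fst Y"] by simp
  then show "fst (?R Y) = fst (- Y)" unfolding L2_eq_iff
   using mirror_L2f[of Y] AE_flip[OF LY] LY LV AE_off_hyperplane
   by eventually_elim (auto simp: s_def flip_inner)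
 qed
 note orth = mirror_orthogonal[OF SV(1) Y RS RY] and orthV = mirror_orthogonal[OF SV RS RV]
 define w where "w = (1/2) *R (S + Y)"
 have pSV: "p = (1/2) *R (S + V)" by (simp add: S_def V_def scaleR_2[symmetric])
 have pyth: "(norm ((1/2) *R (x + y)))^2 = ((norm x)^2 + (norm y)^2) / 4" if "x \<bullet> y = 0" for x y :: "'v::real_inner"
  using norm_add_Pythagorean[of x y] that by (simp add: orthogonal_def power_divide)
 have h: "fst w = (1/2) *R (fst S + fst Y)" "snd w = (1/2) *R (snd S + snd Y)"
  "fst p = (1/2) *R (fst S + fst V)" "snd p = (1/2) *R (snd S + snd V)"
  using arg_cong[OF pSV, of fst] arg_cong[OF pSV, of snd] by (simp_all add: w_def)
 have "(norm (fst w))^2 = (norm (fst p))^2" unfolding h pyth[OF orth(1)] pyth[OF orthV(1)] nY ..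
 then have n1: "norm (fst w) = norm (fst p)" by (rule power_eq_imp_eq_base) auto
 have "(norm (snd w))^2 <= (norm (snd p))^2"
  unfolding h pyth[OF orth(2)] pyth[OF orthV(2)] using power_mono[OF F'(2) norm_ge_zero, of 2] by (simp add: Y_def)
 then have n2: "norm (snd w) <= norm (snd p)" by (rule power2_le_imp_le) simp
 have wH: "w \<in> H10 UNIV" unfolding w_def by (intro subspace_scale subspace_add H10_subspace SV Y)
 have mh: "max u v = (1/2) * ((u + v) + 1 * \<bar>u - v\<bar>)" "min u v = (1/2) * ((u + v) + (- 1) * \<bar>u - v\<bar>)" for u v :: real
  by (simp_all add: min_def max_def abs_if)
 have "AEL x. L2f (fst w) x = (1/2) * (L2f (fst S) x + L2f (fst Y) x)"
  using L2f_scale[of "1/2" "fst S + fst Y"] L2f_add[of "fst S" "fst Y"] by eventually_elim (simp add: w_def)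
 moreover have "AEL x. L2f (fst S) x = L2f (fst p) x + L2f (fst (?R p)) x" "AEL x. L2f (fst V) x = L2f (fst p) x - L2f (fst (?R p)) x"
  using L2f_add[of "fst p" "fst (?R p)"] L2f_diff[of "fst p" "fst (?R p)"] by (simp_all add: S_def V_def)
 ultimately have "AEL x. L2f (fst w) x = (if x \<bullet> b < c then max (L2f (fst p) x) (L2f (fst p) (flip b c x))
    else min (L2f (fst p) x) (L2f (fst p) (flip b c x)))"
  using LY mirror_L2f[of p]
 proof eventually_elim
  case (elim x)
  show ?case unfolding elim mh by (simp add: s_def elim)
 qed
 then show ?thesis using wH n1 n2 by blast
qed

text \<open>If \<open>x\<close> and \<open>y\<close> lie on the same side, they are no farther apart than \<open>x\<close> and the mirror image of \<open>y\<close>.\<close>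

lemma polarized_diameter:
 assumes d: "!!x y. x \<in> Om ==> y \<in> Om ==> dist x y <= D"
  and P: "P = {x. if x \<bullet> b < c then x \<in> Om | flip b c x \<in> Om else x \<in> Om & flip b c x \<in> Om}"
  and x: "x \<in> P" and y: "y \<in> P"
 shows "dist x y <= D"
proof -
 have m: "dist x y <= D" if "x \<in> Om" "flip b c y \<in> Om" "x \<bullet> b < c" "y \<bullet> b < c" for x y
  using dist_le_dist_flip[of x y] d[OF that(1,2)] that(3,4) by simp
 have f: "dist x y <= D" if "flip b c x \<in> Om" "flip b c y \<in> Om" for x y
  using d[OF that] by (simp add: dist_flip_flip)
 show ?thesis
  using x y d f m[of x y] m[of y x] unfolding P mem_Collect_eq by (auto simp: dist_commute split: if_splits)
qed

end

text \<open>Hyperplanes are null sets, so the signed mass depends continuously on \<open>c\<close>; it changes sign as the hyperplane crosses the support.\<close>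

lemma bisecting_hyperplane:
 fixes U :: "('a::euclidean_space, real) L2"
 assumes b: "b \<in> Basis" and U: "U \<in> vanish (- cball 0 R)"
 shows "\<exists>c. (LB x. sgn (c - x \<bullet> b) * (L2f U x)^2) = 0"
proof -
 define g where "g c = (LB x. sgn (c - x \<bullet> b) * (L2f U x)^2)" for c
 have i: "integrable lborel (%x. (L2f U x)\<^sup>2)" using sqint_L2f[of U] by (simp add: sqint_def)
 have U': "AEL x. x ~: cball 0 R --> L2f U x = 0" using U by (simp add: vanish_def)
 have "isCont g c" for c
 proof (rule continuous_at_sequentiallyI)
  fix C assume C: "C ---> c"
  show "(%n. g (C n)) ---> g c" unfolding g_def
  proof (rule integral_dominated_convergence[OF _ _ i])
   show "AEL x. (%n. sgn (C n - x \<bullet> b) * (L2f U x)^2) ---> sgn (c - x \<bullet> b) * (L2f U x)^2"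
    using AE_off_hyperplane[OF b, of c] by eventually_elim (auto intro!: tendsto_intros C)
   show "AEL x. norm (sgn (C n - x \<bullet> b) * (L2f U x)^2) <= (L2f U x)^2" for n
    by (rule AE_I2) (simp add: abs_mult abs_sgn_eq)
  qed measurable
 qed
 then have cont: "continuous_on {- (\<bar>R\<bar> + 1)..\<bar>R\<bar> + 1} g" by (simp add: continuous_at_imp_continuous_on)
 have le: "\<bar>x \<bullet> b\<bar> < \<bar>R\<bar> + 1" if "x \<in> cball 0 R" for x :: 'a using that Basis_le_norm[OF b, of x] by simp
 have "g (\<bar>R\<bar> + 1) >= 0" unfolding g_def
 proof (rule integral_nonneg_AE)
  show "AEL x. 0 <= sgn (\<bar>R\<bar> + 1 - x \<bullet> b) * (L2f U x)^2"
   using U' by eventually_elim (use le in \<open>force simp: sgn_if\<close>)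
 qed
 moreover have "- g (- (\<bar>R\<bar> + 1)) >= 0" unfolding g_def integral_minus[symmetric]
 proof (rule integral_nonneg_AE)
  show "AEL x. 0 <= - (sgn (- (\<bar>R\<bar> + 1) - x \<bullet> b) * (L2f U x)^2)"
   using U' by eventually_elim (use le in \<open>force simp: sgn_if\<close>)
 qed
 ultimately show ?thesis using IVT'[of g "- (\<bar>R\<bar> + 1)" 0 "\<bar>R\<bar> + 1"] cont unfolding g_def by auto
qed

section \<open>The first eigenvalue: minimizers are balls\<close>

lemma helmholtz_on_diff:
 fixes U V :: "('a::euclidean_space, real) L2"
 assumes U: "helmholtz_on Q mu U" and V: "helmholtz_on Q' mu V"
 shows "helmholtz_on (Q \<inter> Q') mu (U - V)"
proof -
 obtain G E where "(U, G) \<in> H10 UNIV" "(V, E) \<in> H10 UNIV" using U V by (auto simp: helmholtz_on_def)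
 then have "(U - V, G - E) \<in> H10 UNIV" using subspace_diff[OF H10_subspace] by fastforce
 moreover obtain B B' where B: "U \<in> vanish (- cball 0 B)" "V \<in> vanish (- cball 0 B')" using U V by (auto simp: helmholtz_on_def)
 then have "U - V \<in> vanish (- cball 0 (max B B'))"
  using L2f_diff[of U V] unfolding vanish_def mem_Collect_eq by eventually_elim auto
 moreover have "(U - V) \<bullet> toL2 (lap phi) = - (mu^2 * ((U - V) \<bullet> toL2 phi))" if "phi \<in> test (Q \<inter> Q')" for phi
 proof -
  have "phi \<in> test Q" "phi \<in> test Q'" using that test_mono[of "Q \<inter> Q'"] by blast+
  then show ?thesis using U V by (simp add: helmholtz_on_def inner_diff_left right_diff_distrib)
 qed
 ultimately show ?thesis by (auto simp: helmholtz_on_def)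
qed

text \<open>Minimality and the Rayleigh quotient of \<open>w\<close> squeeze the first eigenvalue of \<open>Q\<close>.\<close>

lemma competitor_eigenpair:
 fixes Om Q :: "'a::euclidean_space set"
 assumes m: "minimizer D 1 Om" and Q: "admissible D Q" and w: "w \<in> H10 Q" "fst w ~= 0"
  and le: "(norm (snd w))^2 <= evD 1 Om * (norm (fst w))^2"
 shows "evD 1 Q = evD 1 Om & eigenpair Q (evD 1 Om) w"
proof -
 have "evD 1 Q * (norm (fst w))^2 <= evD 1 Om * (norm (fst w))^2"
  using first_eigenvalue_upper[OF admissible_dom[OF Q] w(1)] le by linarith
 then have "evD 1 Q <= evD 1 Om" using w(2) by simp
 then have eq: "evD 1 Q = evD 1 Om" using m Q by (simp add: minimizer_iff antisym)
 then show ?thesis using first_eigenpairI[OF admissible_dom[OF Q] w(1)] le by simp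
qed

lemma convex_flip_vimage:
 assumes b: "b \<in> Basis" and "convex Om"
 shows "convex (flip b c -` Om)"
proof -
 have "flip b c x = (2 * c) *R b + dmap (flip_sign b) 0 x" for x
  unfolding flip_dmap[OF b, symmetric] by (rule dmap_shift)
 then have "flip b c -` Om = dmap (flip_sign b) 0 -` ((+) (- ((2 * c) *R b)) ` Om)"
  by (auto simp: image_iff) (metis add_diff_cancel_left' uminus_add_conv_diff)
 then show ?thesis using assms by (simp add: convex_linear_vimage dmap_linear convex_translation)
qed

lemma admissible_flip:
 assumes b: "b \<in> Basis" and a: "admissible D Om"
 shows "admissible D (flip b c -` Om)"
proof (rule admissibleI)
 have "continuous_on UNIV (flip b c)" unfolding flip_def[abs_def] by (intro continuous_intros)
 then show "open (flip b c -` Om)" using a by (simp add: admissible_def open_vimage)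
 obtain x where "x \<in> Om" using a by (auto simp: admissible_def)
 then have "flip b c x \<in> flip b c -` Om" by (simp add: flip_flip[OF b])
 then show "flip b c -` Om ~= {}" by blast
 show "dist x y <= D" if "x \<in> flip b c -` Om" "y \<in> flip b c -` Om" for x y
  using admissible_dist[OF a, of "flip b c x" "flip b c y"] that by (simp add: dist_flip_flip[OF b])
qed

text \<open>The reflection changes the sign of \<open>sgn (c - x \<bullet> b)\<close>, so by balance the signed difference of the squares of \<open>U\<close> and its mirror image
 has integral 0.  As it is of one sign, it vanishes.\<close>

lemma balanced_ordered_symmetric:
 fixes U :: "('a::euclidean_space, real) L2"
 assumes b: "b \<in> Basis" and c: "(LB x. sgn (c - x \<bullet> b) * (L2f U x)^2) = 0" and nn: "AEL x. 0 <= L2f U x"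
  and ord: "AEL x. 0 <= k * (sgn (c - x \<bullet> b) * (L2f U x - L2f U (flip b c x)))" and k: "k ~= 0"
 shows "AEL x. L2f U (flip b c x) = L2f U x"
proof -
 let ?s = "%x. sgn (c - x \<bullet> b)" and ?V = "%x. L2f U (flip b c x)"
 have [measurable]: "flip b c \<in> borel_measurable borel" unfolding flip_def[abs_def] by measurable
 have sq: "sqint (%x. ?V x)" 
  using sqint_pull[where c = "flip_sign b" and t = "(2 * c) *R b" and f = "L2f U", OF flip_sign_nonzero[OF b] linear_ident' sqint_L2f] by (simp add: flip_dmap[OF b])
 have si: "integrable lborel (%x. ?s x * (f x)^2)" if f: "sqint f" for f :: "'a => real"
 proof (rule Bochner_Integration.integrable_bound)
  show "integrable lborel (%x. (norm (f x))\<^sup>2)" using f by (simp add: sqint_def)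
  show "(%x. ?s x * (f x)^2) \<in> borel_measurable lborel" using sqint_meas[OF f] by measurable
 qed (auto simp: abs_mult abs_sgn_eq)
 have f: "?s (flip b c x) = - ?s x" for x by (simp add: flip_inner[OF b] sgn_minus[symmetric])
 have "(LB x. ?s (flip b c x) * (L2f U (flip b c x))^2) = (LB x. ?s x * (L2f U x)^2)"
  by (rule integral_flip[OF b]) measurable
 then have "(LB x. ?s x * (?V x)^2) = 0" using c by (simp add: f)
 then have z: "(LB x. k * (?s x * (L2f U x)^2 - ?s x * (?V x)^2)) = 0"
  using c by (simp add: Bochner_Integration.integral_diff[OF si[OF sqint_L2f] si[OF sq]])
 have i: "integrable lborel (%x. k * (?s x * (L2f U x)^2 - ?s x * (?V x)^2))"
  by (intro integrable_mult_right Bochner_Integration.integrable_diff si sqint_L2f sq)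
 have eq: "k * (?s x * (L2f U x)^2 - ?s x * (?V x)^2) = k * (?s x * (L2f U x - ?V x)) * (L2f U x + ?V x)" for x
  by (simp add: power2_eq_square algebra_simps)
 have "AEL x. 0 <= k * (?s x * (L2f U x)^2 - ?s x * (?V x)^2)"
  using ord nn AE_flip[where c = c, OF b nn] unfolding eq by eventually_elim simp
 then have "AEL x. k * (?s x * (L2f U x - ?V x)) * (L2f U x + ?V x) = 0"
  using integral_nonneg_eq_0_iff_AE[OF i] z unfolding eq by blast
 then show ?thesis using nn AE_flip[where c = c, OF b nn] AE_off_hyperplane[OF b, of c]
  by eventually_elim (use k in \<open>auto simp: sgn_if split: if_splits\<close>)
qed

text \<open>Let \<open>c\<close> halve the mass of the first eigenfunction \<open>u\<close>.  Its polarization \<open>w\<close> lives on another set \<open>Q\<close> of diameter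
 \<open>D\<close> and has no more energy, so \<open>Q\<close> is a minimizer with eigenfunction \<open>w\<close>.  Near the hyperplane \<open>w\<close> is the larger of \<open>u\<close>
 and its mirror image, and by unique continuation it is one of the two throughout; hence \<open>u\<close> and its mirror image are
 ordered on each side, and the balance of masses makes them equal.\<close>

lemma first_minimizer_symmetric:
 fixes Om :: "'a::euclidean_space set"
 assumes D: "0 < D" and m: "minimizer D 1 Om" and cv: "convex Om" and b: "b \<in> Basis"
 shows "\<exists>c. \<forall>x\<in>Om. flip b c x \<in> Om"
proof -
 define t where "t = evD 1 Om"
 have a: "admissible D Om" using m by (simp add: minimizer_iff)
 note dm = admissible_dom[OF a]
 have t0: "t >= 0" using eigenvalue_nonneg[OF dm, of 1] by (simp add: t_def)
 obtain p where p: "eigenpair Om t p" "AEL x. 0 <= L2f (fst p) x" "AEL x. x \<in> Om --> 0 < L2f (fst p) x"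
  using positive_first_eigenpair[OF dm convex_connected[OF cv]] unfolding t_def by blast
 define U where "U = fst p"
 note U = p(2,3)[folded U_def]
 have pH: "p \<in> H10 Om" "p \<in> H10 UNIV" using p(1) H10_mono[of Om UNIV] by (auto simp: eigenpair_def)
 have "U \<in> vanish (- Om)" using H10_vanish(1)[of Om p] pH dm by (simp add: U_def)
 then have vU: "AEL x. x ~: Om --> L2f U x = 0" by (simp add: vanish_def)
 have nz: "V ~= 0" if "AEL x. x \<in> A --> 0 < L2f V x" "open A" "A ~= {}" for V :: "('a, real) L2" and A
 proof
  assume "V = 0"
  then have "AEL x. L2f V x = 0" using L2f_zero by simp
  with that(1) have "AEL x. x ~: A" by eventually_elim auto
  then show False using open_AE_empty[OF that(2)] that(3) by blast
 qed
 have U0: "U ~= 0" using nz[OF U(2)] dm by blast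
 obtain R where R: "Om \<subseteq> cball 0 R" using dm by (metis bounded_subset_ballD ball_subset_cball subset_trans)
 have "U \<in> vanish (- cball 0 R)" using vanish_mono[of "- cball 0 R" "- Om" U] \<open>U \<in> vanish (- Om)\<close> R by blast
 then obtain c where c: "(LB x. sgn (c - x \<bullet> b) * (L2f U x)^2) = 0" using bisecting_hyperplane[OF b] by blast
 let ?f = "flip b c"
 define Om' where "Om' = ?f -` Om"
 define r where "r = mirror b c p"
 have a': "admissible D Om'" unfolding Om'_def by (rule admissible_flip[OF b a])
 note dm' = admissible_dom[OF a']
 have cv': "convex Om'" unfolding Om'_def by (rule convex_flip_vimage[OF b cv])
 have Lr: "AEL x. L2f (fst r) x = L2f U (?f x)" unfolding r_def U_def by (rule mirror_L2f[OF b])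
 have rH: "r \<in> H10 Om'" unfolding r_def Om'_def by (rule mirror_H10[OF b pH(1)])
 have r1: "AEL x. 0 <= L2f (fst r) x" using Lr AE_flip[where c = c, OF b U(1)] by eventually_elim simp
 have r2: "AEL x. x \<in> Om' --> 0 < L2f (fst r) x" using Lr AE_flip[where c = c, OF b U(2)] by eventually_elim (simp add: Om'_def)
 have en: "(norm (snd p))^2 = t * (norm U)^2" using eigenpair_energy[OF p(1)] by (simp add: U_def)
 have nr: "norm (fst r) = norm U" unfolding r_def U_def by (rule motion_norm) auto
 have "(norm (snd r))^2 <= (norm (snd p))^2" unfolding r_def by (rule power_mono[OF mirror_snd_le[OF b] norm_ge_zero])
 moreover have "fst r ~= 0" using nr U0 by auto
 ultimately have r: "evD 1 Om' = t" "eigenpair Om' t r"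
  using competitor_eigenpair[OF m a' rH] nr en unfolding t_def by auto
 obtain w where w: "w \<in> H10 UNIV" "norm (fst w) = norm U" "norm (snd w) <= norm (snd p)"
  and Lw: "AEL x. L2f (fst w) x = (if x \<bullet> b < c then max (L2f U x) (L2f U (?f x)) else min (L2f U x) (L2f U (?f x)))"
  using polarization[OF b pH(2), of c] unfolding U_def by blast
 define P where "P = {x. if x \<bullet> b < c then x \<in> Om | ?f x \<in> Om else x \<in> Om & ?f x \<in> Om}"
 have Pd: "dist x y <= D" if "x \<in> P" "y \<in> P" for x y by (rule polarized_diameter[OF b admissible_dist[OF a] P_def that])
 obtain K where K: "P \<subseteq> K" "constant_width_body K D" "!!x y. x \<in> K ==> y \<in> K ==> dist x y <= D"
  by (rule constant_width_superset[OF D, where S = P]) (erule Pd, assumption, rule that)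
 define Q where "Q = interior K"
 have aQ: "admissible D Q" unfolding Q_def by (rule constant_width_interior_admissible[OF K(2,3)])
 note dQ = admissible_dom[OF aQ]
 have cQ: "convex Q" using K(2) by (simp add: Q_def constant_width_body_def convex_interior)
 have w1: "AEL x. 0 <= L2f (fst w) x" using Lw U(1) AE_flip[where c = c, OF b U(1)] by eventually_elim auto
 have wP: "AEL x. x ~: P --> L2f (fst w) x = 0"
  using Lw U(1) AE_flip[where c = c, OF b U(1)] vU AE_flip[where c = c, OF b vU] by eventually_elim (auto simp: P_def)
 have "fst w \<in> vanish (- K)" unfolding vanish_def mem_Collect_eq using wP by eventually_elim (use K(1) in auto)
 then have wH: "w \<in> H10 Q" using H10_convex[of K "fst w" "snd w"] K(2) w(1) unfolding Q_def by (simp add: constant_width_body_def)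
 have vw: "AEL x. x ~: Q --> L2f (fst w) x = 0"
  using H10_vanish(1)[OF _ wH] dQ by (simp add: vanish_def)
 have "(norm (snd w))^2 <= t * (norm (fst w))^2" using power_mono[OF w(3) norm_ge_zero, of 2] w(2) en by simp
 moreover have "fst w ~= 0" using w(2) U0 by auto
 ultimately have wQ: "evD 1 Q = t" "eigenpair Q t w"
  using competitor_eigenpair[OF m aQ wH] unfolding t_def by auto
 \<comment> \<open>The overlap \<open>N\<close> of the two domains on the side \<open>x \<bullet> b < c\<close> is nonempty, and \<open>w\<close> is positive there.\<close>
 define N where "N = Om \<inter> Om' \<inter> {x. x \<bullet> b < c}"
 have oN: "open N" unfolding N_def using dm dm' by (intro open_Int open_Collect_less continuous_intros) auto
 have "\<exists>x\<in>Om. b \<bullet> x = c"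
 proof (rule ccontr)
  assume no: "~ ?thesis"
  have "(\<forall>x\<in>Om. b \<bullet> x < c) | (\<forall>x\<in>Om. c < b \<bullet> x)"
   using connected_ivt_hyperplane[OF convex_connected[OF cv], of _ _ b c] no by (metis linorder_le_less_linear)
  then have "(\<forall>x\<in>Om. sgn (c - x \<bullet> b) = 1) | (\<forall>x\<in>Om. sgn (c - x \<bullet> b) = - 1)"
   by (elim disjE) (auto simp: inner_commute)
  then obtain k :: real where k: "k = 1 | k = - 1" "!!x. x \<in> Om ==> sgn (c - x \<bullet> b) = k" by metis
  have "(LB x. sgn (c - x \<bullet> b) * (L2f U x)^2) = (LB x. k * (norm (L2f U x))^2)"
  proof (rule integral_cong_AE)
   show "AEL x. sgn (c - x \<bullet> b) * (L2f U x)^2 = k * (norm (L2f U x))^2"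
    using vU by eventually_elim (use k(2) in auto)
  qed measurable
  then have "k * (norm U)^2 = 0" using c by (simp add: norm_L2f)
  then show False using k(1) U0 by auto
 qed
 then obtain x where x: "x \<in> Om" "x \<bullet> b = c" by (auto simp: inner_commute)
 then have "x \<in> Om \<inter> Om'" by (simp add: Om'_def flip_fixed[OF b])
 then obtain e where e: "e > 0" "ball x e \<subseteq> Om \<inter> Om'" using dm dm' openE[of "Om \<inter> Om'" x] by blast
 have "x - (e / 2) *R b \<in> N"
  using e b x(2) by (auto simp: N_def inner_diff_left inner_Basis dist_norm intro!: subsetD[OF e(2)])
 then have Nne: "~ (AEL x. x ~: N)" using open_AE_empty[OF oN] by blast
 have NQ: "AEL x. x \<in> N --> x \<in> Q"
  using Lw U(2) vw by eventually_elim (auto simp: N_def max_def split: if_splits)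
 have ne: "Om \<inter> Q ~= {}" "Om' \<inter> Q ~= {}"
 proof -
  show "Om \<inter> Q ~= {}"
  proof
   assume "Om \<inter> Q = {}"
   with NQ have "AEL x. x ~: N" by (auto simp: N_def elim!: eventually_mono)
   then show False using Nne by blast
  qed
  show "Om' \<inter> Q ~= {}"
  proof
   assume "Om' \<inter> Q = {}"
   with NQ have "AEL x. x ~: N" by (auto simp: N_def elim!: eventually_mono)
   then show False using Nne by blast
  qed
 qed
 have dich: "(AEL x. x \<in> A \<inter> Q --> L2f (V - fst w) x ~= 0) | (AEL x. x \<in> A \<inter> Q --> L2f (V - fst w) x = 0)"
  if "dom A" "convex A" "helmholtz_on A (sqrt t) V" for A and V :: "('a, real) L2"
  using that cQ dQ t0 by (intro unique_continuation[OF helmholtz_on_diff[OF that(3) eigenpair_helmholtz[OF dQ wQ(2) t0]]] convex_connected convex_Int open_Int) auto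
 consider "AEL x. x \<in> Om \<inter> Q --> L2f (U - fst w) x = 0" | "AEL x. x \<in> Om' \<inter> Q --> L2f (fst r - fst w) x = 0"
 proof -
  have False if n: "AEL x. x \<in> Om \<inter> Q --> L2f (U - fst w) x ~= 0" "AEL x. x \<in> Om' \<inter> Q --> L2f (fst r - fst w) x ~= 0"
  proof -
   have "AEL x. x ~: N"
    using n L2f_diff[of U "fst w"] L2f_diff[of "fst r" "fst w"] NQ Lr Lw
    by eventually_elim (auto simp: N_def max_def split: if_splits)
   then show False using Nne by blast
  qed
  then show ?thesis
   using dich[OF dm cv eigenpair_helmholtz[OF dm p(1) t0, folded U_def]] dich[OF dm' cv' eigenpair_helmholtz[OF dm' r(2) t0]] that by blast
 qed
 then have sym: "AEL x. L2f U (?f x) = L2f U x"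
 proof cases
  case 1
  with L2f_diff[of U "fst w"] have "AEL x. x \<in> Om \<inter> Q --> L2f (fst p) x = L2f (fst w) x"
   by eventually_elim (simp add: U_def)
  from first_eigenpairs_overlap[OF dm cv dQ cQ t_def[symmetric] wQ(1) p wQ(2) w1 ne(1) this] have "fst w = U" by (simp add: U_def)
  then have "AEL x. 0 <= 1 * (sgn (c - x \<bullet> b) * (L2f U x - L2f U (?f x)))"
   using Lw AE_off_hyperplane[OF b, of c] by (auto simp: sgn_if max_def min_def elim!: eventually_elim2 split: if_splits)
  then show ?thesis by (rule balanced_ordered_symmetric[OF b c U(1)]) simp
 next
  case 2
  with L2f_diff[of "fst r" "fst w"] have "AEL x. x \<in> Om' \<inter> Q --> L2f (fst r) x = L2f (fst w) x"
   by eventually_elim simp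
  from first_eigenpairs_overlap[OF dm' cv' dQ cQ r(1) wQ(1) r(2) r1 r2 wQ(2) w1 ne(2) this] have "fst r = fst w" .
  then have "AEL x. L2f (fst w) x = L2f U (?f x)" using Lr by simp
  then have "AEL x. 0 <= (- 1) * (sgn (c - x \<bullet> b) * (L2f U x - L2f U (?f x)))"
   using Lw AE_off_hyperplane[OF b, of c]
   by eventually_elim (auto simp: sgn_if max_def min_def split: if_splits)
  then show ?thesis by (rule balanced_ordered_symmetric[OF b c U(1)]) simp
 qed
 have "AEL x. x \<in> Om --> x \<in> Om'"
  using sym U(2) AE_flip[where c = c, OF b vU] by eventually_elim (auto simp: Om'_def)
 then have "Om \<subseteq> closure Om'" using AE_subset_closure dm by blast
 then have "Om \<subseteq> interior (closure Om')" using dm by (simp add: interior_maximal)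
 then have "Om \<subseteq> Om'" using convex_interior_closure[OF cv'] dm' by (simp add: interior_open)
 then show ?thesis unfolding Om'_def by blast
qed

text \<open>The symmetries in all coordinate directions compose to the point reflection in \<open>z\<close>.  So every \<open>x\<close> has distance at most \<open>D / 2\<close> from \<open>z\<close>,
 and by \<open>minimizer_fills\<close> the ball about \<open>z\<close> is filled.\<close>

theorem first_minimizer_ball:
 fixes Om :: "'a::euclidean_space set"
 assumes D: "0 < D" and m: "minimizer D 1 Om" and cv: "convex Om"
 shows "\<exists>a. Om = ball a (D / 2)"
proof -
 have a: "admissible D Om" using m by (simp add: minimizer_iff)
 obtain c where c: "!!b x. b \<in> Basis ==> x \<in> Om ==> flip b (c b) x \<in> Om"
  using first_minimizer_symmetric[OF D m cv] by metis
 define z :: 'a where "z = (\<Sum>b\<in>Basis. c b *R b)"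
 have flips: "x + (\<Sum>b\<in>B. (2 * (c b - x \<bullet> b)) *R b) \<in> Om" if "finite B" "B \<subseteq> Basis" "x \<in> Om" for B x
  using that
 proof (induction B rule: finite_induct)
  case (insert d B)
  let ?y = "x + (\<Sum>b\<in>B. (2 * (c b - x \<bullet> b)) *R b)"
  have "(\<Sum>b\<in>B. (2 * (c b - x \<bullet> b)) *R b) \<bullet> d = 0"
   unfolding inner_sum_left
  proof (rule sum.neutral, rule ballI)
   fix e assume "e \<in> B"
   then have "e \<in> Basis" "d \<in> Basis" "e ~= d" using insert by auto
   then show "((2 * (c e - x \<bullet> e)) *R e) \<bullet> d = 0" by (simp add: inner_not_same_Basis)
  qed
  then have "?y \<bullet> d = x \<bullet> d" by (simp add: inner_add_left)
  moreover have "flip d (c d) ?y \<in> Om" using insert c by auto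
  ultimately show ?case using insert by (simp add: flip_def add_ac)
 qed simp
 have "x \<in> cball z (D / 2)" if x: "x \<in> Om" for x
 proof -
  have "(\<Sum>b\<in>Basis. (2 * (c b - x \<bullet> b)) *R b) = 2 *R z - 2 *R x"
  proof -
   have "(\<Sum>b\<in>Basis. (2 * (c b - x \<bullet> b)) *R b) = 2 *R z - 2 *R (\<Sum>b\<in>Basis. (x \<bullet> b) *R b)"
    by (simp add: z_def scaleR_sum_right sum_subtractf scaleR_left_diff_distrib right_diff_distrib)
   then show ?thesis by (simp only: euclidean_representation)
  qed
  then have "2 *R z - x \<in> Om" using flips[OF finite_Basis order_refl x] by (simp add: scaleR_2)
  then have "dist x (2 *R z - x) <= D" using admissible_dist[OF a x] by blast
  moreover have "x - (2 *R z - x) = 2 *R (x - z)" by (simp add: scaleR_2 algebra_simps)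
  ultimately show ?thesis by (simp add: dist_norm norm_minus_commute)
 qed
 then have "Om \<subseteq> cball z (D / 2)" by blast
 then have sub: "Om \<subseteq> ball z (D / 2)" using interior_maximal[of Om "cball z (D / 2)"] a by (simp add: admissible_def)
 have aB: "admissible D (ball z (D / 2))"
 proof (rule admissibleI)
  show "dist x y <= D" if "x \<in> ball z (D / 2)" "y \<in> ball z (D / 2)" for x y
   using that dist_triangle[of x y z] by (simp add: dist_commute)
 qed (use D in auto)
 have "ball z (D / 2) \<subseteq> closure Om"
  by (rule AE_subset_closure[OF minimizer_fills[OF order_refl m aB _ sub]]) auto
 then have "ball z (D / 2) \<subseteq> interior (closure Om)" by (simp add: interior_maximal)
 then show ?thesis using sub convex_interior_closure[OF cv] a by (intro exI[of _ z]) (auto simp: admissible_def interior_open)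
qed

section \<open>Sets omitted by a minimizer have zero capacity\<close>

lemma grad_mult:
 assumes eta: "eta \<in> test UNIV" and phi: "phi \<in> test UNIV"
 shows "grad (%x. eta x * phi x) x = phi x *R grad eta x + eta x *R grad phi x"
 using has_derivative_mult[OF test_has_grad[OF eta] test_has_grad[OF phi], of x]
 by (intro grad_eqI) (simp add: inner_add_left mult.commute add.commute)

lemma norm_gp_mult:
 fixes eta :: "'a::euclidean_space => real"
 assumes eta: "eta \<in> test UNIV" "!!x. \<bar>eta x\<bar> <= 1"
 shows "\<exists>M>0. \<forall>phi\<in>test UNIV. norm (gp (%x. eta x * phi x)) <= M * norm (gp phi)"
proof -
 obtain K where K: "K >= 0" "!!x. norm (grad eta x) <= K" using grad_bounded[OF eta(1)] by blast
 have "norm (gp (%x. eta x * phi x)) <= (2 + K) * norm (gp phi)" if phi: "phi \<in> test UNIV" for phi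
 proof -
  note [measurable] = test_meas[OF eta(1)] test_meas[OF phi] sqint_meas[OF grad_sqint[OF eta(1)]] sqint_meas[OF grad_sqint[OF phi]]
  note s = test_sqint[OF phi] grad_sqint[OF phi]
  have t: "(%x. eta x * phi x) \<in> test UNIV" using test_mult[OF phi] test_smooth[OF eta(1)] by blast
  have b1: "norm (phi x *R grad eta x) <= norm (K *R phi x)" for x
   using mult_left_mono[OF K(2)[of x] abs_ge_zero[of "phi x"]] K(1) by (simp add: abs_mult mult.commute)
  have b2: "norm (eta x *R grad phi x) <= norm (grad phi x)" for x using eta(2)[of x] by (simp add: mult_left_le_one_le)
  have s1: "sqint (%x. phi x *R grad eta x)" by (rule sqint_bound[OF sqint_scale[OF s(1), of K] _ b1]) measurable
  have s2: "sqint (%x. eta x *R grad phi x)" by (rule sqint_bound[OF s(2) _ b2]) measurable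
  have "norm (toL2 (grad (%x. eta x * phi x))) <= norm (toL2 (%x. phi x *R grad eta x)) + norm (toL2 (%x. eta x *R grad phi x))"
   unfolding grad_mult[OF eta(1) phi] toL2_add[OF s1 s2, symmetric] by (rule norm_triangle_ineq)
  also have "\<dots> <= norm (toL2 (%x. K *R phi x)) + norm (toL2 (grad phi))"
   by (intro add_mono norm_toL2_mono s1 s2 s sqint_scale b1 b2)
  also have "norm (toL2 (%x. K *R phi x)) = K * norm (toL2 phi)" using toL2_scale[OF s(1), of K] K(1) by (metis abs_of_nonneg norm_scaleR)
  finally have "norm (toL2 (grad (%x. eta x * phi x))) <= K * norm (toL2 phi) + norm (toL2 (grad phi))" .
  moreover have "norm (toL2 (%x. eta x * phi x)) <= norm (toL2 phi)"
   by (rule norm_toL2_mono[OF test_sqint[OF t] s(1)]) (use eta(2) in \<open>simp add: abs_mult mult_left_le_one_le\<close>)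
  moreover have "norm (gp (%x. eta x * phi x)) <= norm (toL2 (%x. eta x * phi x)) + norm (toL2 (grad (%x. eta x * phi x)))"
   by (rule norm_Pair_le)
  moreover have "norm (toL2 phi) <= norm (gp phi)" "norm (toL2 (grad phi)) <= norm (gp phi)" by (rule norm_fst_le norm_snd_le)+
  moreover have "K * norm (toL2 phi) <= K * norm (gp phi)" using norm_fst_le K(1) by (intro mult_left_mono) auto
  ultimately show ?thesis by (simp add: algebra_simps)
 qed
 then show ?thesis using K(1) by (intro exI[of _ "2 + K"]) auto
qed

lemma gp_diff:
 assumes "f \<in> test UNIV" "g \<in> test UNIV"
 shows "gp (%x. f x - g x) = gp f - gp g"
 using assms by (intro H10_eqI[where Om = UNIV and Om' = UNIV] gp_H10 test_diff subspace_diff H10_subspace) (simp_all add: toL2_diff test_sqint)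

text \<open>Cutting off preserves convergence in \<open>H\<^sup>1\<close>, and the limit is identified through its function part alone,
 since that determines the gradient.\<close>

lemma cutoff_tendsto:
 fixes U :: "('a::euclidean_space, real) L2"
 assumes eta: "eta \<in> test UNIV" "!!x. \<bar>eta x\<bar> <= 1" and phi: "!!n::nat. phi n \<in> test UNIV"
  and lim: "(%n. gp (phi n)) ---> (U, G)" and g: "g \<in> test UNIV" and eq: "AEL x. eta x * g x = eta x * L2f U x"
 shows "(%n. gp (%x. eta x * phi n x)) ---> gp (%x. eta x * g x)"
proof -
 have t: "(%x. eta x * f x) \<in> test UNIV" if "f \<in> test UNIV" for f
  using test_mult[OF that] test_smooth[OF eta(1)] by blast
 note [measurable] = test_meas[OF eta(1)]
 obtain M where M: "M > 0" "!!f. f \<in> test UNIV ==> norm (gp (%x. eta x * f x)) <= M * norm (gp f)"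
  using norm_gp_mult[OF eta] by blast
 have "Cauchy (%n. gp (%x. eta x * phi n x))"
 proof (rule CauchyI)
  fix e :: real assume e: "0 < e"
  obtain N where N: "!!m n. N <= m ==> N <= n ==> norm (gp (phi m) - gp (phi n)) < e / M"
   using CauchyD[OF LIMSEQ_imp_Cauchy[OF lim], of "e / M"] e M(1) by auto
  have "norm (gp (%x. eta x * phi m x) - gp (%x. eta x * phi n x)) < e" if "N <= m" "N <= n" for m n
  proof -
   have "gp (%x. eta x * phi m x) - gp (%x. eta x * phi n x) = gp (%x. eta x * (phi m x - phi n x))"
    unfolding gp_diff[OF t[OF phi] t[OF phi], symmetric] right_diff_distrib ..
   then have "norm (gp (%x. eta x * phi m x) - gp (%x. eta x * phi n x)) <= M * norm (gp (phi m) - gp (phi n))"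
    using M(2)[OF test_diff[OF phi phi], of m n] by (simp add: gp_diff[OF phi phi])
   also have "\<dots> < M * (e / M)" using N[OF that] M(1) by (intro mult_strict_left_mono)
   finally show ?thesis using M(1) by simp
  qed
  then show "\<exists>N. \<forall>m\<ge>N. \<forall>n\<ge>N. norm (gp (%x. eta x * phi m x) - gp (%x. eta x * phi n x)) < e" by blast
 qed
 then obtain l where l: "(%n. gp (%x. eta x * phi n x)) ---> l" using Cauchy_convergent unfolding convergent_def by blast
 have lH: "l \<in> H10 UNIV" by (rule closed_sequentially[OF H10_closed gp_H10[OF t[OF phi]] l])
 have sU: "sqint (%x. eta x * L2f U x)"
  by (rule sqint_bound[OF sqint_L2f[of U]]) (measurable, use eta(2) in \<open>simp add: abs_mult mult_left_le_one_le\<close>)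
 have "toL2 (%x. eta x * g x) = toL2 (%x. eta x * L2f U x)" by (rule toL2_eqI[OF test_sqint[OF t[OF g]] sU eq])
 moreover have "(%n. toL2 (%x. eta x * phi n x)) ---> toL2 (%x. eta x * L2f U x)"
 proof (rule LIM_zero_cancel, rule Lim_null_comparison[OF always_eventually])
  have l1: "(%n. toL2 (phi n)) ---> U" using tendsto_fst[OF lim] by simp
  show "(%n. norm (toL2 (phi n) - U)) ---> 0" using tendsto_norm[OF tendsto_diff[OF l1 tendsto_const[of U]]] by simp
  show "\<forall>n. norm (toL2 (%x. eta x * phi n x) - toL2 (%x. eta x * L2f U x)) <= norm (toL2 (phi n) - U)"
  proof
   fix n
   have "norm (toL2 (%x. eta x * phi n x - eta x * L2f U x)) <= norm (toL2 (%x. phi n x - L2f U x))"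
    using eta(2) by (intro norm_toL2_mono sqint_diff test_sqint[OF t[OF phi]] sU test_sqint[OF phi] sqint_L2f)
     (simp add: abs_mult mult_left_le_one_le right_diff_distrib[symmetric])
   then show "norm (toL2 (%x. eta x * phi n x) - toL2 (%x. eta x * L2f U x)) <= norm (toL2 (phi n) - U)"
    using toL2_diff[OF test_sqint[OF t[OF phi]] sU, of n] toL2_diff[OF test_sqint[OF phi] sqint_L2f, of n U] by simp
  qed
 qed
 ultimately have "(%n. toL2 (%x. eta x * phi n x)) ---> toL2 (%x. eta x * g x)" by simp
 moreover have "(%n. toL2 (%x. eta x * phi n x)) ---> fst l" using tendsto_fst[OF l] by simp
 ultimately have "fst l = fst (gp (%x. eta x * g x))" using LIMSEQ_unique by simp
 then have "l = gp (%x. eta x * g x)" by (rule H10_eqI[OF lH gp_H10[OF t[OF g]]])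
 then show ?thesis using l by simp
qed

text \<open>A positive eigenfunction \<open>u\<close> of \<open>B\<close> that lies in \<open>H\<^sup>1\<^sub>0(Om)\<close> is a limit of test functions \<open>phi\<close> vanishing on \<open>B - Om\<close>,
 while its smooth representative is bounded below on compact subsets.  So the differences \<open>u - phi\<close>, cut off and rescaled,
 are at least 1 there and tend to 0 in \<open>H\<^sup>1\<close>.\<close>

lemma zero_capacity_complement:
 fixes q :: "('a::euclidean_space, real) L2 \<times> ('a, 'a) L2"
 assumes B: "dom B" and t: "0 <= t" and q: "q \<in> H10 Om" "eigenpair B t q"
  and nn: "AEL x. 0 <= L2f (fst q) x" and pos: "AEL x. x \<in> B --> 0 < L2f (fst q) x"
 shows "zero_capacity (B - Om)"
 unfolding zero_capacity_def
proof (intro allI impI)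
 fix K :: "'a set" and eps :: real
 assume K: "compact K & K \<subseteq> B - Om" and eps: "eps > 0"
 define U where "U = fst q"
 note U = eigenpair_helmholtz[OF B q(2) t, folded U_def]
 obtain R where Rv: "U \<in> vanish (- cball 0 R)" using U by (auto simp: helmholtz_on_def)
 obtain C and kap :: "real => 'a => real" where kap: "helmholtz_kernel (sqrt t) C kap" using helmholtz_kernel_exists[of "sqrt t"] t by auto
 obtain e where e: "e > 0" "(\<Union>x\<in>K. cball x e) \<subseteq> B" using compact_subset_open_imp_cball_epsilon_subset[of K B] K B by blast
 define r where "r = min 1 (e / 3)"
 have r: "0 < r" "r <= 1" "3 * r <= e" using e(1) by (auto simp: r_def)
 have kr: "kap r \<in> test UNIV" "!!z. kap r z >= 0" "!!z. norm z < r ==> kap r z > 0" using kap r by (auto simp: helmholtz_kernel_def)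
 define V where "V = (\<Union>x\<in>K. ball x r)"
 define g where "g = conv (kap r) (L2f U)"
 have g: "g \<in> test UNIV" unfolding g_def by (rule conv_test[OF kr(1) Rv])
 have Ug: "AEL x. x \<in> V --> L2f U x = g x" unfolding g_def
 proof (rule helmholtz_representation[OF U kap r(1,2)])
  fix x assume "x \<in> V"
  then obtain k where k: "k \<in> K" "dist k x < r" by (auto simp: V_def)
  then have "ball x (2 * r) \<subseteq> ball k e" using r by (intro ball_subset_ball_iff[THEN iffD2]) (auto simp: dist_commute)
  then have "ball x (2 * r) \<subseteq> B" using e(2) k(1) ball_subset_cball by blast
  then show "\<exists>R>r. ball x R \<subseteq> B" using r(1) by (intro exI[of _ "2 * r"]) auto
 qed
 have gpos: "g x > 0" if x: "x \<in> K" for x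
 proof -
  have nn': "AEL y. 0 <= kap r (x - y) *R L2f U y" using nn by eventually_elim (simp add: U_def kr(2))
  have "g x ~= 0"
  proof
   assume "g x = 0"
   then have "AEL y. kap r (x - y) *R L2f U y = 0"
    using integral_nonneg_eq_0_iff_AE[OF conv_integrable[OF kr(1) sqint_L2f] nn'] by (simp add: g_def conv_def)
   with pos have "AEL y. y ~: ball x r"
   proof eventually_elim
    case (elim y)
    have "y \<in> B" if "y \<in> ball x r" using that x e(2) r(1,3) by (intro subsetD[OF e(2)] UN_I[OF x]) auto
    then show ?case using elim kr(3)[of "x - y"] by (auto simp: U_def dist_norm)
   qed
   then have "ball x r = {}" by (intro open_AE_empty) auto
   then show False using r(1) by simp
  qed
  moreover have "g x >= 0" unfolding g_def conv_def by (rule integral_nonneg_AE[OF nn'])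
  ultimately show ?thesis by simp
 qed
 obtain c where c: "c > 0" "!!x. x \<in> K ==> c <= g x"
 proof (cases "K = {}")
  case False
  then obtain x where "x \<in> K" "\<forall>y\<in>K. g x <= g y" using continuous_attains_inf[of K g] K test_cont[OF g] by blast
  then show ?thesis using that[of "g x"] gpos by blast
 qed (use that[of 1] in auto)
 have "open V" "K \<subseteq> V" using r(1) by (auto simp: V_def)
 then obtain eta where eta: "eta \<in> test V" "!!x. x \<in> K ==> eta x = 1" "!!x. 0 <= eta x & eta x <= 1"
  using cutoff_exists[of K V] K by metis
 have etaU: "eta \<in> test UNIV" "!!x. \<bar>eta x\<bar> <= 1" using eta(1,3) test_mono[of V UNIV] by auto
 obtain phi where phi: "!!n. phi n \<in> test Om" "(%n::nat. gp (phi n)) ---> q" by (rule H10_approx[OF q(1)]) (rule that)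
 have phiU: "phi n \<in> test UNIV" for n using phi(1) test_mono[of Om UNIV] by blast
 have "(%n. gp (%x. eta x * phi n x)) ---> gp (%x. eta x * g x)"
 proof (rule cutoff_tendsto[OF etaU phiU _ g])
  show "(%n. gp (phi n)) ---> (U, snd q)" using phi(2) by (simp add: U_def)
  show "AEL x. eta x * g x = eta x * L2f U x"
   using Ug by eventually_elim (use test_off[OF eta(1)] in force)
 qed
 from tendsto_norm[OF tendsto_diff[OF tendsto_const[of "gp (%x. eta x * g x)"] this]]
 have "(%n. norm (gp (%x. eta x * g x) - gp (%x. eta x * phi n x))) ---> 0" by simp
 moreover have "0 < c * sqrt eps" using c(1) eps by simp
 ultimately have "eventually (%n. norm (gp (%x. eta x * g x) - gp (%x. eta x * phi n x)) < c * sqrt eps) sequentially"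
  by (intro order_tendstoD(2)) auto
 then obtain n where n: "norm (gp (%x. eta x * g x) - gp (%x. eta x * phi n x)) < c * sqrt eps"
  using eventually_happens'[OF sequentially_bot] by blast
 define f where "f x = eta x * (g x - phi n x)" for x
 have m: "(%x. eta x * h x) \<in> test UNIV" if "h \<in> test UNIV" for h
  using test_mult[OF that] test_smooth[OF etaU(1)] by blast
 have f: "f \<in> test UNIV" unfolding f_def[abs_def] by (rule m[OF test_diff[OF g phiU]])
 have "gp f = gp (%x. eta x * g x) - gp (%x. eta x * phi n x)"
  unfolding gp_diff[OF m[OF g] m[OF phiU], symmetric] f_def right_diff_distrib ..
 then have nf: "norm (gp f) < c * sqrt eps" using n by simp
 define v where "v x = (1 / c) * f x" for x
 have v: "v \<in> test UNIV" unfolding v_def[abs_def] by (rule test_scale[OF f])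
 have "gp v = (1 / c) *R gp f"
  by (rule H10_eqI[OF gp_H10[OF v] subspace_scale[OF H10_subspace gp_H10[OF f]]])
   (use toL2_scale[OF test_sqint[OF f], of "1 / c"] in \<open>simp add: v_def[abs_def]\<close>)
 then have "norm (gp v) = norm (gp f) / c" using c(1) by (simp only: norm_scaleR) simp
 then have "norm (gp v) < sqrt eps" using nf c(1) by (simp only: pos_divide_less_eq mult.commute[of _ c])
 then have "(norm (gp v))^2 < eps" using power_strict_mono[of "norm (gp v)" "sqrt eps" 2] eps by simp
 moreover have "(norm (gp v))^2 = (LB x. (v x)\<^sup>2) + (LB x. (norm (grad v x))\<^sup>2)"
  using norm_toL2[OF test_sqint[OF v]] norm_toL2[OF grad_sqint[OF v]] by (simp add: norm_Pair)
 moreover have "(LINT x|lebesgue. (v x)\<^sup>2) = (LB x. (v x)\<^sup>2)" "(LINT x|lebesgue. (norm (grad v x))\<^sup>2) = (LB x. (norm (grad v x))\<^sup>2)"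
  using test_meas[OF v] sqint_meas[OF grad_sqint[OF v]] by (auto intro!: integral_completion)
 moreover have "1 <= v x" if x: "x \<in> K" for x
 proof -
  have "phi n x = 0" using test_off[OF phi(1)] x K by blast
  then show ?thesis using eta(2)[OF x] c(2)[OF x] c(1) by (simp add: v_def f_def le_divide_eq)
 qed
 ultimately show "\<exists>phi\<in>test UNIV. (\<forall>x\<in>K. 1 <= phi x) & (LINT x|lebesgue. (phi x)\<^sup>2) + (LINT x|lebesgue. (norm (grad phi x))\<^sup>2) < eps"
  using v by (intro bexI[of _ v]) auto
qed

section \<open>Minimizers under the diameter constraint\<close>

lemma minimizer_negligible:
 fixes Om :: "'a::euclidean_space set"
 assumes D: "0 < D" and h: "1 <= h" and m: "minimizer D h Om"
 shows "negligible (closure Om - Om)"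
proof -
 note s = minimizer_structure[OF D h m]
 have o: "open Om" using m by (simp add: minimizer_iff admissible_def)
 have "interior (closure Om) - Om \<in> sets lborel" using o by auto
 moreover have "AEL x. x ~: interior (closure Om) - Om" using s by (auto elim!: eventually_mono)
 ultimately have "emeasure lborel (interior (closure Om) - Om) = 0" by (subst (asm) AE_iff_measurable[of "interior (closure Om) - Om"]) auto
 then have "negligible (interior (closure Om) - Om)" using o by (simp add: negligible_iff_emeasure0)
 moreover have "negligible (frontier (closure Om))" using s by (intro negligible_convex_frontier) (simp add: constant_width_body_def)
 ultimately have "negligible ((interior (closure Om) - Om) \<union> frontier (closure Om))" by (rule negligible_Un)
 then show ?thesis by (rule negligible_subset) (auto simp: frontier_def)
qed

lemma first_minimizer_interior_ball:
 fixes Om :: "'a::euclidean_space set"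
 assumes D: "0 < D" and m: "minimizer D 1 Om"
 shows "\<exists>a. interior (closure Om) = ball a (D / 2)"
 using minimizer_structure[OF D order_refl m]
 by (intro first_minimizer_ball[OF D]) (auto simp: constant_width_body_def convex_interior)

text \<open>The minimizer that exists determines a minimizing ball, and a translation moves it anywhere.\<close>

lemma ball_minimizer:
 assumes D: "0 < D"
 shows "minimizer D 1 (ball (a :: 'a::euclidean_space) (D / 2))"
proof -
 obtain Om :: "'a set" where m: "minimizer D 1 Om" using minimizer_exists[OF D order_refl] by blast
 obtain z where z: "interior (closure Om) = ball z (D / 2)" using first_minimizer_interior_ball[OF D m] by blast
 have "minimizer D 1 (ball z (D / 2))" using minimizer_structure[OF D order_refl m] z by simp
 from minimizer_translate[OF this order_refl, of "z - a"] have "minimizer D 1 ((+) (z - a) -` ball z (D / 2))" .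
 moreover have "(+) (z - a) -` ball z (D / 2) = ball a (D / 2)" by (auto simp: dist_norm algebra_simps)
 ultimately show ?thesis by simp
qed

lemma first_minimizer_capacity:
 fixes Om :: "'a::euclidean_space set"
 assumes D: "0 < D" and m: "minimizer D 1 Om"
 shows "\<exists>a. Om \<subseteq> ball a (D / 2) & zero_capacity (ball a (D / 2) - Om)"
proof -
 obtain a where a: "interior (closure Om) = ball a (D / 2)" using first_minimizer_interior_ball[OF D m] by blast
 let ?B = "ball a (D / 2)"
 have sub: "Om \<subseteq> ?B" and mB: "minimizer D 1 ?B" using minimizer_structure[OF D order_refl m] a by auto
 have d: "dom Om" "dom ?B" and le: "evD 1 Om <= evD 1 ?B"
  using m mB admissible_dom unfolding minimizer_iff by blast+
 obtain p where p: "p \<in> H10 Om" "fst p ~= 0" "eigenpair ?B (evD 1 ?B) p"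
  by (rule eigenvalue_equal_eigenpair[OF d sub order_refl le]) (rule that)
 obtain q where q: "q \<in> H10 Om" "eigenpair ?B (evD 1 ?B) q"
  "AEL x. 0 <= L2f (fst q) x" "AEL x. x \<in> ?B --> 0 < L2f (fst q) x"
  using abs_first_eigenpair[OF d(2) _ p(1,3,2) sub] by auto
 have "zero_capacity (?B - Om)"
  by (rule zero_capacity_complement[OF d(2) eigenvalue_nonneg[OF d(2) order_refl] q])
 then show ?thesis using sub by blast
qed

theorem theorem2p1:
 fixes D\<^sub>0 :: real and h :: nat
 assumes "0 < D\<^sub>0" and "1 \<le> h"
 shows "(\<exists>\<Omega> :: 'a::euclidean_space set. minimizer D\<^sub>0 h \<Omega>) \<and>
  (\<forall>\<Omega> :: 'a set. minimizer D\<^sub>0 h \<Omega> \<longrightarrow>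
    constant_width_body (closure \<Omega>) D\<^sub>0 \<and>
    negligible (closure \<Omega> - \<Omega>) \<and>
    minimizer D\<^sub>0 h (interior (closure \<Omega>))) \<and>
  (h = 1 \<longrightarrow>
    (\<forall>a :: 'a. minimizer D\<^sub>0 h (ball a (D\<^sub>0 / 2))) \<and>
    (\<forall>\<Omega> :: 'a set. minimizer D\<^sub>0 h \<Omega> \<longrightarrow>
     (\<exists>a. \<Omega> \<subseteq> ball a (D\<^sub>0 / 2) \<and> zero_capacity (ball a (D\<^sub>0 / 2) - \<Omega>))))"
proof (intro conjI allI impI)
 show "\<exists>\<Omega> :: 'a set. minimizer D\<^sub>0 h \<Omega>" by (rule minimizer_exists[OF assms])
next
 fix \<Omega> :: "'a set" assume m: "minimizer D\<^sub>0 h \<Omega>"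
 show "constant_width_body (closure \<Omega>) D\<^sub>0" "minimizer D\<^sub>0 h (interior (closure \<Omega>))"
  using minimizer_structure[OF assms m] by blast+
 show "negligible (closure \<Omega> - \<Omega>)" by (rule minimizer_negligible[OF assms m])
next
 fix a :: 'a assume "h = 1"
 then show "minimizer D\<^sub>0 h (ball a (D\<^sub>0 / 2))" using ball_minimizer[OF assms(1)] by simp
next
 fix \<Omega> :: "'a set" assume "h = 1" "minimizer D\<^sub>0 h \<Omega>"
 then show "\<exists>a. \<Omega> \<subseteq> ball a (D\<^sub>0 / 2) \<and> zero_capacity (ball a (D\<^sub>0 / 2) - \<Omega>)"
  using first_minimizer_capacity[OF assms(1)] by simp
qed

end
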